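(* Let $\mathbf{L}$ be a symmetric Markov operator on a state space $(E,\mathcal{F})$ with invariant and reversible probability measure $\boldsymbol{\mu}$ and carr\'e-du-champ operator $\boldsymbol{\Gamma}$, satisfying assumptions (a), (b), (c) of the context, with eigenvalues $0=\lambda_0<\lambda_1<\lambda_2<\cdots$ of $-\mathbf{L}$. Let $p,m\ge1$ be integers. Then there exists a constant $C^{(\lambda)}_{p,m}>0$ such that for every $X\in\operatorname{Ker}(\mathbf{L}+\lambda_p\mathbf{Id})$ with $\mathbb{E}[X^2]=1$, $$ d_{\mathrm{TV}}(\boldsymbol{\mu}_X,\boldsymbol{\gamma}^{(\lambda)}_{X,m})\le C^{(\lambda)}_{p,m}\bigl(\operatorname{Var}\boldsymbol{\Gamma}(X)\bigr)^{\frac{m+1}{2}}, $$ where $\boldsymbol{\mu}_X$ is the law of $X$ under $\boldsymbol{\mu}$, and $\boldsymbol{\gamma}^{(\lambda)}_{X,m}$ is the signed measure on $\mathbb{R}$ with Lebesgue density $$x\mapsto\frac{e^{-x^2/2}}{\sqrt{2\pi}}\left(1+\sum_{k=3}^{\tilde r_{\lambda,m}+1}\frac{\mathbb{E}[H_k(X)]}{k!}H_k(x)\right),\qquad \tilde r_{\lambda,m}=\left\lfloor\frac{\lambda_{(2p-1)m}}{\lambda_p}\right\rfloor+2m-1 .$$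
   Context: $\mathbb{E}$ and $\operatorname{Var}$ are taken with respect to $\boldsymbol{\mu}$. $H_k(x)=(-1)^k e^{x^2/2}\frac{d^k}{dx^k}e^{-x^2/2}$ are the Hermite polynomials. The carr\'e-du-champ operator is $\boldsymbol{\Gamma}(X,Y)=\frac12(\mathbf{L}(XY)-X\mathbf{L}Y-Y\mathbf{L}X)$ for $X,Y$ in a suitable domain of functions on $E$, and $\boldsymbol{\Gamma}(X)=\boldsymbol{\Gamma}(X,X)$; one has $\int\boldsymbol{\Gamma}(X,Y)d\boldsymbol{\mu}=-\int X\mathbf{L}Y\,d\boldsymbol{\mu}=-\int Y\mathbf{L}X\,d\boldsymbol{\mu}$. $\mathscr{C}^2_{\mathrm{pol}}(\mathbb{R})$ denotes the $C^2$ functions on $\mathbb{R}$ which together with their first two derivatives have at most polynomial growth. Assumptions: (a) for every $\phi\in\mathscr{C}^2_{\mathrm{pol}}(\mathbb{R})$ and $X\in\operatorname{Dom}\mathbf{L}$, $\phi(X)\in\operatorname{Dom}\mathbf{L}$ and $\mathbf{L}\phi(X)=\phi''(X)\boldsymbol{\Gamma}(X,X)+\phi'(X)\mathbf{L}X$. (b) $-\mathbf{L}$ is diagonalisable on $L^2(\boldsymbol{\mu})$ with discrete spectrum $0=\lambda_0<\lambda_1<\lambda_2<\cdots$, so $L^2(\boldsymbol{\mu})=\bigoplus_{k\ge0}\operatorname{Ker}(\mathbf{L}+\lambda_k\mathbf{Id})$. (c) for any eigenfunctions $X,Y$ of $-\mathbf{L}$ with eigenvalues $\lambda_p,\lambda_q$,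 $XY\in\bigoplus_{k=0}^{p+q}\operatorname{Ker}(\mathbf{L}+\lambda_k\mathbf{Id})$. For finite signed measures $\mu,\nu$ on $\mathbb{R}$, $d_{\mathrm{TV}}(\mu,\nu)=\frac12\sup\{|\int h\,d\mu-\int h\,d\nu| : h:\mathbb{R}\to\mathbb{R}\text{ continuous},\ \|h\|_\infty\le1\}$. *)

theory Defs
  imports "HOL-Probability.Probability"
begin

text \<open>Elements of \<open>L\<^sup>2(M)\<close> are handled through representatives, and identities between them are
  stated almost everywhere.\<close>

definition L2 :: "'a measure \<Rightarrow> ('a \<Rightarrow> real) set" where
  "L2 M = {f \<in> borel_measurable M. integrable M (\<lambda>x. (f x)\<^sup>2)}"

definition L2_tendsto ::
  "'a measure \<Rightarrow> ('i \<Rightarrow> 'a \<Rightarrow> real) \<Rightarrow> ('a \<Rightarrow> real) \<Rightarrow> 'i filter \<Rightarrow> bool" where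
  "L2_tendsto M f g F \<longleftrightarrow> ((\<lambda>i. \<integral>x. (f i x - g x)\<^sup>2 \<partial>M) \<longlongrightarrow> 0) F"


locale symmetric_markov_semigroup = prob_space M for M :: "'a measure" +
  fixes P :: "real \<Rightarrow> ('a \<Rightarrow> real) \<Rightarrow> 'a \<Rightarrow> real"
  assumes maps_L2: "\<And>t f. t \<ge> 0 \<Longrightarrow> f \<in> L2 M \<Longrightarrow> P t f \<in> L2 M"
    and linear: "\<And>t f g a b. t \<ge> 0 \<Longrightarrow> f \<in> L2 M \<Longrightarrow> g \<in> L2 M \<Longrightarrow>
      AE x in M. P t (\<lambda>y. a * f y + b * g y) x = a * P t f x + b * P t g x"
    and positive: "\<And>t f. t \<ge> 0 \<Longrightarrow> f \<in> L2 M \<Longrightarrow> AE x in M. 0 \<le> f x \<Longrightarrow> AE x in M. 0 \<le> P t f x"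
    and unit: "\<And>t. t \<ge> 0 \<Longrightarrow> AE x in M. P t (\<lambda>_. 1) x = 1"
    and zero: "\<And>f. f \<in> L2 M \<Longrightarrow> AE x in M. P 0 f x = f x"
    and semigroup: "\<And>s t f. s \<ge> 0 \<Longrightarrow> t \<ge> 0 \<Longrightarrow> f \<in> L2 M \<Longrightarrow>
      AE x in M. P (s + t) f x = P s (P t f) x"
    and strongly_continuous: "\<And>f. f \<in> L2 M \<Longrightarrow> L2_tendsto M (\<lambda>t. P t f) f (at_right 0)"
    and invariant: "\<And>t f. t \<ge> 0 \<Longrightarrow> f \<in> L2 M \<Longrightarrow> (\<integral>x. P t f x \<partial>M) = (\<integral>x. f x \<partial>M)"
    and reversible: "\<And>t f g. t \<ge> 0 \<Longrightarrow> f \<in> L2 M \<Longrightarrow> g \<in> L2 M \<Longrightarrow>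
      (\<integral>x. f x * P t g x \<partial>M) = (\<integral>x. P t f x * g x \<partial>M)"

text \<open>\<open>D\<close> stands for \<open>Dom L\<close>, a space of functions on which \<open>L\<close> is the generator of the semigroup.
  It need not be the whole \<open>L\<^sup>2\<close>-domain of the generator: that one is in general not stable under
  composition with functions of polynomial growth, as \<open>diffusion_property\<close> below requires.
  Linearity and symmetry of \<open>L\<close> and its compatibility with almost everywhere equality follow from
  those of the semigroup.\<close>

definition symmetric_markov_operator ::
  "'a measure \<Rightarrow> ('a \<Rightarrow> real) set \<Rightarrow> (('a \<Rightarrow> real) \<Rightarrow> 'a \<Rightarrow> real) \<Rightarrow> bool" where
  "symmetric_markov_operator M D L \<longleftrightarrow>
     D \<subseteq> L2 M \<and>
     (\<forall>f\<in>D. \<forall>g\<in>D. \<forall>a b. (\<lambda>x. a * f x + b * g x) \<in> D) \<and>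
     (\<forall>f\<in>D. \<forall>g\<in>borel_measurable M. (AE x in M. f x = g x) \<longrightarrow> g \<in> D) \<and>
     (\<forall>f\<in>D. L f \<in> L2 M) \<and>
     (\<exists>P. symmetric_markov_semigroup M P \<and>
        (\<forall>f\<in>D. L2_tendsto M (\<lambda>t x. (P t f x - f x) / t) (L f) (at_right 0)))"

definition carre_du_champ ::
  "(('a \<Rightarrow> real) \<Rightarrow> 'a \<Rightarrow> real) \<Rightarrow> ('a \<Rightarrow> real) \<Rightarrow> ('a \<Rightarrow> real) \<Rightarrow> 'a \<Rightarrow> real" where
  "carre_du_champ L X Y = (\<lambda>x. (L (\<lambda>y. X y * Y y) x - X x * L Y x - Y x * L X x) / 2)"

definition polynomial_growth :: "(real \<Rightarrow> real) \<Rightarrow> bool" where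
  "polynomial_growth f \<longleftrightarrow> (\<exists>C n. \<forall>x. \<bar>f x\<bar> \<le> C * (1 + \<bar>x\<bar>) ^ n)"

definition C2_pol :: "(real \<Rightarrow> real) set" where
  "C2_pol = {\<phi>. (\<forall>x. \<phi> differentiable at x) \<and> (\<forall>x. deriv \<phi> differentiable at x) \<and>
     continuous_on UNIV (deriv (deriv \<phi>)) \<and>
     polynomial_growth \<phi> \<and> polynomial_growth (deriv \<phi>) \<and> polynomial_growth (deriv (deriv \<phi>))}"

definition diffusion_property ::
  "'a measure \<Rightarrow> ('a \<Rightarrow> real) set \<Rightarrow> (('a \<Rightarrow> real) \<Rightarrow> 'a \<Rightarrow> real) \<Rightarrow> bool" where
  "diffusion_property M D L \<longleftrightarrow> (\<forall>\<phi>\<in>C2_pol. \<forall>X\<in>D.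
     (\<lambda>x. \<phi> (X x)) \<in> D \<and>
     (AE x in M. L (\<lambda>y. \<phi> (X y)) x =
        deriv (deriv \<phi>) (X x) * carre_du_champ L X X x + deriv \<phi> (X x) * L X x))"

definition ker_shift ::
  "'a measure \<Rightarrow> ('a \<Rightarrow> real) set \<Rightarrow> (('a \<Rightarrow> real) \<Rightarrow> 'a \<Rightarrow> real) \<Rightarrow> real \<Rightarrow> ('a \<Rightarrow> real) set" where
  "ker_shift M D L c = {X \<in> D. AE x in M. L X x + c * X x = 0}"

text \<open>The \<open>lam k\<close> being the points of a discrete spectrum, they are actual eigenvalues and have no
  finite accumulation point. The direct sum is a Hilbert sum; the summands are orthogonal because
  \<open>L\<close> is symmetric and the eigenvalues are distinct.\<close>

definition diagonalisable ::
  "'a measure \<Rightarrow> ('a \<Rightarrow> real) set \<Rightarrow> (('a \<Rightarrow> real) \<Rightarrow> 'a \<Rightarrow> real) \<Rightarrow> (nat \<Rightarrow> real) \<Rightarrow> bool" where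
  "diagonalisable M D L lam \<longleftrightarrow>
     lam 0 = 0 \<and> strict_mono lam \<and> filterlim lam at_top sequentially \<and>
     (\<forall>k. \<exists>X \<in> ker_shift M D L (lam k). \<not> (AE x in M. X x = 0)) \<and>
     (\<forall>f \<in> L2 M. \<exists>g. (\<forall>k. g k \<in> ker_shift M D L (lam k)) \<and>
        L2_tendsto M (\<lambda>n x. \<Sum>k<n. g k x) f sequentially)"

definition product_stable ::
  "'a measure \<Rightarrow> ('a \<Rightarrow> real) set \<Rightarrow> (('a \<Rightarrow> real) \<Rightarrow> 'a \<Rightarrow> real) \<Rightarrow> (nat \<Rightarrow> real) \<Rightarrow> bool" where
  "product_stable M D L lam \<longleftrightarrow>
     (\<forall>p q. \<forall>X \<in> ker_shift M D L (lam p). \<forall>Y \<in> ker_shift M D L (lam q).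
        \<exists>g. (\<forall>k. g k \<in> ker_shift M D L (lam k)) \<and>
          (AE x in M. X x * Y x = (\<Sum>k\<le>p+q. g k x)))"


text \<open>A finite signed measure on the line is given by a pair of finite Borel measures and stands for
  their difference.\<close>

type_synonym signed_measure = "real measure \<times> real measure"

definition signed_integral :: "signed_measure \<Rightarrow> (real \<Rightarrow> real) \<Rightarrow> real" where
  "signed_integral \<nu> h = (\<integral>x. h x \<partial>(fst \<nu>)) - (\<integral>x. h x \<partial>(snd \<nu>))"

definition signed_of_measure :: "real measure \<Rightarrow> signed_measure" where
  "signed_of_measure \<mu> = (\<mu>, null_measure borel)"

text \<open>As \<open>ennreal\<close> truncates at 0, the components are the positive and the negative part.\<close>

definition signed_density :: "(real \<Rightarrow> real) \<Rightarrow> signed_measure" where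
  "signed_density g =
     (density lborel (\<lambda>x. ennreal (g x)), density lborel (\<lambda>x. ennreal (- g x)))"

definition d_TV :: "signed_measure \<Rightarrow> signed_measure \<Rightarrow> real" where
  "d_TV \<mu> \<nu> = 1 / 2 *
     (SUP h \<in> {h :: real \<Rightarrow> real. continuous_on UNIV h \<and> (\<forall>x. \<bar>h x\<bar> \<le> 1)}.
        \<bar>signed_integral \<mu> h - signed_integral \<nu> h\<bar>)"


definition hermite :: "nat \<Rightarrow> real \<Rightarrow> real" where
  "hermite k x = (-1) ^ k * exp (x\<^sup>2 / 2) * (deriv ^^ k) (\<lambda>t. exp (- t\<^sup>2 / 2)) x"

definition r_tilde :: "(nat \<Rightarrow> real) \<Rightarrow> nat \<Rightarrow> nat \<Rightarrow> nat" where
  "r_tilde lam p m = nat \<lfloor>lam ((2 * p - 1) * m) / lam p\<rfloor> + 2 * m - 1"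

definition edgeworth_measure ::
  "'a measure \<Rightarrow> (nat \<Rightarrow> real) \<Rightarrow> nat \<Rightarrow> nat \<Rightarrow> ('a \<Rightarrow> real) \<Rightarrow> signed_measure" where
  "edgeworth_measure M lam p m X = signed_density (\<lambda>x. exp (- x\<^sup>2 / 2) / sqrt (2 * pi) *
     (1 + (\<Sum>k = 3..r_tilde lam p m + 1. (\<integral>y. hermite k (X y) \<partial>M) / fact k * hermite k x)))"

end

theory Submission
  imports Defs
begin

text \<open>Put \<open>W = \<Gamma> X X / lam p - 1\<close>, so that \<open>Var (\<Gamma> X X) = (lam p * \<parallel>W\<parallel>)\<^sup>2\<close>. If \<open>Z\<close> is an eigenfunction for \<open>lam k\<close> and
  \<open>\<psi>'' - x \<psi>' + (lam k / lam p) \<psi> = g\<close>, then the symmetry of \<open>L\<close> and the diffusion property give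
  \<open>\<integral> g(X) Z = - \<integral> \<psi>''(X) W Z\<close>. For \<open>g\<close> orthogonal, with respect to the Gaussian measure, to the polynomials of
  degree less than \<open>r > lam k / lam p\<close>, the equation has a solution with \<open>\<psi>''\<close> orthogonal to those of degree less than
  \<open>r - 2\<close>. Starting from \<open>Z = 1\<close> and a test function minus its Hermite expansion, \<open>m + 1\<close> such steps
  produce the factor \<open>\<parallel>W\<parallel> ^ (m + 1)\<close>. They require that \<open>W ^ j\<close>, \<open>j \<le> m\<close>, has no components beyond index
  \<open>(2 p - 1) j\<close>, which holds if \<open>lam (2 p) = 2 lam p\<close>, since the top component of \<open>W\<close> carries the coefficient
  \<open>1 - lam (2 p) / (2 lam p)\<close>. Otherwise \<open>\<parallel>W\<parallel>\<close> is bounded away from 0 and nothing has to be gained: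
  a sequence \<open>X\<^sub>n\<close> with \<open>\<parallel>W\<parallel>\<close> tending to 0 is asymptotically Gaussian and decouples from every eigenfunction, which
  forces every \<open>lam p + lam q\<close> to be an eigenvalue of index at most \<open>p + q\<close>, and then \<open>lam (p + q) = lam p + lam q\<close>.\<close>

section \<open>Square integrable functions and functions with all moments\<close>

text \<open>Product stability bounds the indices of the components of a product but relates no two
  eigenvalues, so \<open>lam (2 * p) = 2 * lam p\<close> is not given. The dichotomy supplies it
  exactly when it matters. Its source is the identity (lam p + lam q + L)(X Y) = 2 \<Gamma>(X, Y):
  if \<Gamma>(X, X) is nearly constant, Cauchy-Schwarz gives \<Gamma>(X, Y) the size of the root of
  \<Gamma>(Y, Y), whereas X Y is larger by one order in X; so the operator on the left cannot be
  invertible on the components of X Y. Sizes are read off from the growth in j of moments against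
  X^(2j). The number of Hermite terms is an orthogonality budget. Step j, counted from 0, needs an
  order above \<open>lam ((2 * p - 1) * j) / lam p\<close>, and every step costs two orders, so the
  initial order must exceed \<open>lam ((2 * p - 1) * m) / lam p + 2 * m\<close>. Subtracting the
  Hermite terms up to degree \<open>r_tilde lam p m + 1\<close> gives the order
  \<open>r_tilde lam p m + 2\<close>, which is just enough. All constants must be uniform in X.
  Uniformity rests on the boundedness in L2 of products of finite spectral sums, which comes from a
  Baire category argument.\<close>

definition l2 :: "'a measure \<Rightarrow> ('a \<Rightarrow> real) \<Rightarrow> real" where
  "l2 M f = sqrt (\<integral>x. (f x)\<^sup>2 \<partial>M)"

lemma l2_nonneg [simp]: "0 \<le> l2 M f"
  by (simp add: l2_def)

lemma l2_sq: "(l2 M f)\<^sup>2 = (\<integral>x. (f x)\<^sup>2 \<partial>M)"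
  by (simp add: l2_def)

lemma l2_cong_AE:
  assumes "AE x in M. f x = g x" "f \<in> borel_measurable M" "g \<in> borel_measurable M"
  shows "l2 M f = l2 M g"
  unfolding l2_def
  by (intro arg_cong[where f = sqrt] integral_cong_AE) (use assms in auto)

lemma L2_measurable [measurable_dest]: "f \<in> L2 M \<Longrightarrow> f \<in> borel_measurable M"
  by (simp add: L2_def)

lemma L2_integrable_sq: "f \<in> L2 M \<Longrightarrow> integrable M (\<lambda>x. (f x)\<^sup>2)"
  by (simp add: L2_def)

lemma L2_mult_integrable:
  assumes "f \<in> L2 M" "g \<in> L2 M"
  shows "integrable M (\<lambda>x. f x * g x)"
proof (rule Bochner_Integration.integrable_bound)
  show "integrable M (\<lambda>x. (f x)\<^sup>2 + (g x)\<^sup>2)"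
    using assms by (auto simp: L2_def)
  show "AE x in M. norm (f x * g x) \<le> norm ((f x)\<^sup>2 + (g x)\<^sup>2)"
  proof (rule AE_I2)
    fix x
    have "2 * \<bar>f x * g x\<bar> \<le> (f x)\<^sup>2 + (g x)\<^sup>2"
      using sum_squares_bound[of "\<bar>f x\<bar>" "\<bar>g x\<bar>"] by (simp add: abs_mult)
    then show "norm (f x * g x) \<le> norm ((f x)\<^sup>2 + (g x)\<^sup>2)"
      by simp
  qed
qed (use assms in measurable)

lemma L2_lincomb:
  assumes "f \<in> L2 M" "g \<in> L2 M"
  shows "(\<lambda>x. a * f x + b * g x) \<in> L2 M"
proof -
  have "integrable M (\<lambda>x. a\<^sup>2 * (f x)\<^sup>2 + (2 * a * b) * (f x * g x) + b\<^sup>2 * (g x)\<^sup>2)"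
    using L2_mult_integrable[OF assms] L2_integrable_sq[OF assms(1)] L2_integrable_sq[OF assms(2)]
    by (intro Bochner_Integration.integrable_add integrable_mult_right)
  moreover have "(\<lambda>x. (a * f x + b * g x)\<^sup>2) = (\<lambda>x. a\<^sup>2 * (f x)\<^sup>2 + (2 * a * b) * (f x * g x) + b\<^sup>2 * (g x)\<^sup>2)"
    by (auto simp: power2_eq_square algebra_simps)
  moreover have "(\<lambda>x. a * f x + b * g x) \<in> borel_measurable M"
    using assms by measurable
  ultimately show ?thesis
    by (simp add: L2_def)
qed

lemma L2_add: "f \<in> L2 M \<Longrightarrow> g \<in> L2 M \<Longrightarrow> (\<lambda>x. f x + g x) \<in> L2 M"
  using L2_lincomb[of f M g 1 1] by simp

lemma L2_diff: "f \<in> L2 M \<Longrightarrow> g \<in> L2 M \<Longrightarrow> (\<lambda>x. f x - g x) \<in> L2 M"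
  using L2_lincomb[of f M g 1 "-1"] by simp

lemma L2_zero [simp]: "(\<lambda>x. 0) \<in> L2 M"
  by (simp add: L2_def)

lemma L2_sum: "(\<And>i. i \<in> I \<Longrightarrow> f i \<in> L2 M) \<Longrightarrow> (\<lambda>x. \<Sum>i\<in>I. f i x) \<in> L2 M"
  by (induction I rule: infinite_finite_induct) (auto intro: L2_add)

lemma l2_0_iff:
  assumes "f \<in> L2 M"
  shows "l2 M f = 0 \<longleftrightarrow> (AE x in M. f x = 0)"
proof -
  have "l2 M f = 0 \<longleftrightarrow> (\<integral>x. (f x)\<^sup>2 \<partial>M) = 0"
    by (simp add: l2_def)
  also have "\<dots> \<longleftrightarrow> (AE x in M. (f x)\<^sup>2 = 0)"
    by (rule integral_nonneg_eq_0_iff_AE) (use assms in \<open>auto simp: L2_def\<close>)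
  finally show ?thesis by simp
qed

lemma Cauchy_Schwarz_L2:
  assumes "f \<in> L2 M" "g \<in> L2 M"
  shows "\<bar>\<integral>x. f x * g x \<partial>M\<bar> \<le> l2 M f * l2 M g"
proof -
  let ?A = "\<integral>x. (f x)\<^sup>2 \<partial>M" and ?B = "\<integral>x. (g x)\<^sup>2 \<partial>M" and ?C = "\<integral>x. f x * g x \<partial>M"
  have q: "0 \<le> a\<^sup>2 * ?A + 2 * a * b * ?C + b\<^sup>2 * ?B" for a b
  proof -
    have "0 \<le> (\<integral>x. (a * f x + b * g x)\<^sup>2 \<partial>M)"
      by simp
    also have "\<dots> = (\<integral>x. a\<^sup>2 * (f x)\<^sup>2 + (2 * a * b) * (f x * g x) + b\<^sup>2 * (g x)\<^sup>2 \<partial>M)"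
      by (intro Bochner_Integration.integral_cong) (auto simp: power2_eq_square algebra_simps)
    also have "\<dots> = a\<^sup>2 * ?A + (2 * a * b) * ?C + b\<^sup>2 * ?B"
      using L2_mult_integrable[OF assms] L2_integrable_sq[OF assms(1)] L2_integrable_sq[OF assms(2)]
      by simp
    finally show ?thesis .
  qed
  have A: "0 \<le> ?A" and B: "0 \<le> ?B" by auto
  have "?C\<^sup>2 \<le> ?A * ?B"
  proof (cases "?B = 0")
    case True
    have "?C = 0"
    proof (rule ccontr)
      assume C: "?C \<noteq> 0"
      \<comment> \<open>With \<open>?B = 0\<close> the form is affine in its second coefficient,
        which is chosen to give the value -1.\<close>
      have "0 \<le> 1\<^sup>2 * ?A + 2 * 1 * (-(?A + 1) / (2 * ?C)) * ?C + (-(?A + 1) / (2 * ?C))\<^sup>2 * ?B"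
        by (rule q)
      also have "\<dots> = ?A - (?A + 1)"
        using C True by (simp add: field_simps)
      finally show False by simp
    qed
    then show ?thesis using True by simp
  next
    case False
    have "0 \<le> ?B\<^sup>2 * ?A + 2 * ?B * (- ?C) * ?C + (- ?C)\<^sup>2 * ?B"
      by (rule q)
    also have "\<dots> = ?B * (?A * ?B - ?C\<^sup>2)"
      by (simp add: power2_eq_square algebra_simps)
    finally show ?thesis
      using False B by (simp add: zero_le_mult_iff)
  qed
  then have "sqrt (?C\<^sup>2) \<le> sqrt (?A * ?B)"
    by (rule real_sqrt_le_mono)
  then show ?thesis
    by (simp add: l2_def real_sqrt_mult)
qed

lemma l2_triangle:
  assumes "f \<in> L2 M" "g \<in> L2 M"
  shows "l2 M (\<lambda>x. f x + g x) \<le> l2 M f + l2 M g"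
proof (rule power2_le_imp_le)
  have "(l2 M (\<lambda>x. f x + g x))\<^sup>2 = (\<integral>x. (f x)\<^sup>2 + 2 * (f x * g x) + (g x)\<^sup>2 \<partial>M)"
    unfolding l2_sq by (intro Bochner_Integration.integral_cong) (auto simp: power2_eq_square algebra_simps)
  also have "\<dots> = (l2 M f)\<^sup>2 + 2 * (\<integral>x. f x * g x \<partial>M) + (l2 M g)\<^sup>2"
    using L2_mult_integrable[OF assms] L2_integrable_sq[OF assms(1)] L2_integrable_sq[OF assms(2)]
    by (simp add: l2_sq)
  also have "\<dots> \<le> (l2 M f + l2 M g)\<^sup>2"
    using Cauchy_Schwarz_L2[OF assms] by (simp add: power2_sum)
  finally show "(l2 M (\<lambda>x. f x + g x))\<^sup>2 \<le> (l2 M f + l2 M g)\<^sup>2" .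
qed simp

lemma l2_cmult: "l2 M (\<lambda>x. c * f x) = \<bar>c\<bar> * l2 M f"
  by (simp add: l2_def power_mult_distrib real_sqrt_mult)

lemma l2_minus_commute: "l2 M (\<lambda>x. f x - g x) = l2 M (\<lambda>x. g x - f x)"
  by (simp add: l2_def power2_commute)

lemma l2_sum:
  assumes "\<And>i. i \<in> I \<Longrightarrow> f i \<in> L2 M"
  shows "l2 M (\<lambda>x. \<Sum>i\<in>I. f i x) \<le> (\<Sum>i\<in>I. l2 M (f i))"
  using assms
proof (induction I rule: infinite_finite_induct)
  case (insert i I)
  have "l2 M (\<lambda>x. f i x + (\<Sum>j\<in>I. f j x)) \<le> l2 M (f i) + l2 M (\<lambda>x. \<Sum>j\<in>I. f j x)"
    using insert by (intro l2_triangle L2_sum) auto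
  also have "\<dots> \<le> l2 M (f i) + (\<Sum>j\<in>I. l2 M (f j))"
    using insert by auto
  finally show ?case
    using insert by simp
qed (auto simp: l2_def)

lemma L2_tendsto_iff: "L2_tendsto M f g F \<longleftrightarrow> ((\<lambda>i. l2 M (\<lambda>x. f i x - g x)) \<longlongrightarrow> 0) F"
proof
  assume "L2_tendsto M f g F"
  then have "((\<lambda>i. sqrt (\<integral>x. (f i x - g x)\<^sup>2 \<partial>M)) \<longlongrightarrow> sqrt 0) F"
    unfolding L2_tendsto_def by (intro tendsto_real_sqrt)
  then show "((\<lambda>i. l2 M (\<lambda>x. f i x - g x)) \<longlongrightarrow> 0) F"
    by (simp add: l2_def)
next
  assume "((\<lambda>i. l2 M (\<lambda>x. f i x - g x)) \<longlongrightarrow> 0) F"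
  then have "((\<lambda>i. (l2 M (\<lambda>x. f i x - g x))\<^sup>2) \<longlongrightarrow> 0\<^sup>2) F"
    by (intro tendsto_power)
  then show "L2_tendsto M f g F"
    by (simp add: L2_tendsto_def l2_sq)
qed

text \<open>The eventual form serves the difference quotients of the semigroup, which are known to
  lie in L2 only for positive times.\<close>

lemma L2_tendsto_inner_eventually:
  assumes "L2_tendsto M f g F" "\<forall>\<^sub>F i in F. f i \<in> L2 M" "g \<in> L2 M" "h \<in> L2 M"
  shows "((\<lambda>i. \<integral>x. f i x * h x \<partial>M) \<longlongrightarrow> (\<integral>x. g x * h x \<partial>M)) F"
proof -
  have "((\<lambda>i. l2 M (\<lambda>x. f i x - g x) * l2 M h) \<longlongrightarrow> 0 * l2 M h) F"
    using assms(1) unfolding L2_tendsto_iff by (intro tendsto_mult tendsto_const)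
  then have lim: "((\<lambda>i. l2 M (\<lambda>x. f i x - g x) * l2 M h) \<longlongrightarrow> 0) F"
    by simp
  have "((\<lambda>i. (\<integral>x. f i x * h x \<partial>M) - (\<integral>x. g x * h x \<partial>M)) \<longlongrightarrow> 0) F"
  proof (rule Lim_null_comparison[OF _ lim], use assms(2) in eventually_elim)
    fix i
    assume fi: "f i \<in> L2 M"
    have "(\<integral>x. f i x * h x \<partial>M) - (\<integral>x. g x * h x \<partial>M) = (\<integral>x. (f i x - g x) * h x \<partial>M)"
      using assms fi by (simp add: L2_mult_integrable left_diff_distrib)
    then show "norm ((\<integral>x. f i x * h x \<partial>M) - (\<integral>x. g x * h x \<partial>M)) \<le> l2 M (\<lambda>x. f i x - g x) * l2 M h"
      using Cauchy_Schwarz_L2[OF L2_diff[OF fi assms(3)] assms(4)] by simp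
  qed
  then show ?thesis
    using Lim_null by blast
qed

lemma L2_tendsto_inner:
  assumes "L2_tendsto M f g F" "\<And>i. f i \<in> L2 M" "g \<in> L2 M" "h \<in> L2 M"
  shows "((\<lambda>i. \<integral>x. f i x * h x \<partial>M) \<longlongrightarrow> (\<integral>x. g x * h x \<partial>M)) F"
  using assms by (intro L2_tendsto_inner_eventually always_eventually) auto

section \<open>Functions with finite moments of all orders\<close>

definition all_moments :: "'a measure \<Rightarrow> ('a \<Rightarrow> real) set" where
  "all_moments M = {f \<in> borel_measurable M. \<forall>n. integrable M (\<lambda>x. \<bar>f x\<bar> ^ n)}"

lemma all_moments_measurable [measurable_dest]: "f \<in> all_moments M \<Longrightarrow> f \<in> borel_measurable M"
  by (simp add: all_moments_def)

lemma all_moments_integrable: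
  assumes "f \<in> all_moments M"
  shows "integrable M f"
proof -
  have "integrable M (\<lambda>x. \<bar>f x\<bar> ^ 1)"
    using assms unfolding all_moments_def by blast
  then show ?thesis
    using assms by (simp add: integrable_abs_iff all_moments_def)
qed

lemma all_moments_bound:
  assumes "g \<in> all_moments M" "f \<in> borel_measurable M" "AE x in M. \<bar>f x\<bar> \<le> \<bar>g x\<bar>"
  shows "f \<in> all_moments M"
proof -
  have "integrable M (\<lambda>x. \<bar>f x\<bar> ^ n)" for n
  proof (rule Bochner_Integration.integrable_bound)
    show "integrable M (\<lambda>x. \<bar>g x\<bar> ^ n)"
      using assms by (simp add: all_moments_def)
    show "AE x in M. norm (\<bar>f x\<bar> ^ n) \<le> norm (\<bar>g x\<bar> ^ n)"
      using assms(3) by eventually_elim (auto intro!: power_mono)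
  qed (use assms(2) in measurable)
  then show ?thesis
    using assms(2) by (simp add: all_moments_def)
qed

lemma all_moments_mult:
  assumes "f \<in> all_moments M" "g \<in> all_moments M"
  shows "(\<lambda>x. f x * g x) \<in> all_moments M"
proof -
  have "integrable M (\<lambda>x. \<bar>f x * g x\<bar> ^ n)" for n
  proof (rule Bochner_Integration.integrable_bound)
    show "integrable M (\<lambda>x. \<bar>f x\<bar> ^ (n * 2) + \<bar>g x\<bar> ^ (n * 2))"
      using assms by (auto simp: all_moments_def)
    show "AE x in M. norm (\<bar>f x * g x\<bar> ^ n) \<le> norm (\<bar>f x\<bar> ^ (n * 2) + \<bar>g x\<bar> ^ (n * 2))"
    proof (rule AE_I2)
      fix x
      have "2 * (\<bar>f x\<bar> ^ n) * (\<bar>g x\<bar> ^ n) \<le> (\<bar>f x\<bar> ^ n)\<^sup>2 + (\<bar>g x\<bar> ^ n)\<^sup>2"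
        by (rule sum_squares_bound)
      moreover have "0 \<le> (\<bar>f x\<bar> ^ n) * (\<bar>g x\<bar> ^ n)" by simp
      ultimately have "(\<bar>f x\<bar> ^ n) * (\<bar>g x\<bar> ^ n) \<le> (\<bar>f x\<bar> ^ n)\<^sup>2 + (\<bar>g x\<bar> ^ n)\<^sup>2" by linarith
      then show "norm (\<bar>f x * g x\<bar> ^ n) \<le> norm (\<bar>f x\<bar> ^ (n * 2) + \<bar>g x\<bar> ^ (n * 2))"
        by (simp add: abs_mult power_mult power_mult_distrib)
    qed
  qed (use assms in measurable)
  moreover have "(\<lambda>x. f x * g x) \<in> borel_measurable M"
    using assms by measurable
  ultimately show ?thesis
    by (simp add: all_moments_def)
qed

lemma all_moments_add:
  assumes "f \<in> all_moments M" "g \<in> all_moments M"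
  shows "(\<lambda>x. f x + g x) \<in> all_moments M"
proof -
  have "integrable M (\<lambda>x. \<bar>f x + g x\<bar> ^ n)" for n
  proof (rule Bochner_Integration.integrable_bound)
    show "integrable M (\<lambda>x. 2 ^ n * (\<bar>f x\<bar> ^ n + \<bar>g x\<bar> ^ n))"
      using assms by (auto simp: all_moments_def)
    show "AE x in M. norm (\<bar>f x + g x\<bar> ^ n) \<le> norm (2 ^ n * (\<bar>f x\<bar> ^ n + \<bar>g x\<bar> ^ n))"
    proof (rule AE_I2)
      fix x
      have "\<bar>f x + g x\<bar> ^ n \<le> (2 * max \<bar>f x\<bar> \<bar>g x\<bar>) ^ n"
        by (intro power_mono) auto
      also have "\<dots> = 2 ^ n * (max \<bar>f x\<bar> \<bar>g x\<bar>) ^ n"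
        by (simp add: power_mult_distrib)
      also have "\<dots> \<le> 2 ^ n * (\<bar>f x\<bar> ^ n + \<bar>g x\<bar> ^ n)"
        by (intro mult_left_mono) (auto simp: max_def)
      finally show "norm (\<bar>f x + g x\<bar> ^ n) \<le> norm (2 ^ n * (\<bar>f x\<bar> ^ n + \<bar>g x\<bar> ^ n))"
        by simp
    qed
  qed (use assms in measurable)
  moreover have "(\<lambda>x. f x + g x) \<in> borel_measurable M"
    using assms by measurable
  ultimately show ?thesis
    by (simp add: all_moments_def)
qed

lemma all_moments_abs: "f \<in> all_moments M \<Longrightarrow> (\<lambda>x. \<bar>f x\<bar>) \<in> all_moments M"
  by (rule all_moments_bound[where g = f]) auto

lemma (in prob_space) all_moments_const: "(\<lambda>x. c) \<in> all_moments M"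
  by (simp add: all_moments_def)

lemma (in prob_space) all_moments_cmult:
  "f \<in> all_moments M \<Longrightarrow> (\<lambda>x. c * f x) \<in> all_moments M"
  by (intro all_moments_mult all_moments_const)

lemma (in prob_space) all_moments_diff:
  assumes "f \<in> all_moments M" "g \<in> all_moments M"
  shows "(\<lambda>x. f x - g x) \<in> all_moments M"
  using all_moments_add[OF assms(1) all_moments_cmult[OF assms(2), of "-1"]] by simp

lemma (in prob_space) all_moments_divide:
  "f \<in> all_moments M \<Longrightarrow> (\<lambda>x. f x / c) \<in> all_moments M"
  using all_moments_cmult[of f "1 / c"] by simp

lemma (in prob_space) all_moments_power:
  "f \<in> all_moments M \<Longrightarrow> (\<lambda>x. f x ^ n) \<in> all_moments M"
  by (induction n) (auto intro: all_moments_mult all_moments_const)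

lemma (in prob_space) all_moments_sum:
  "(\<And>i. i \<in> I \<Longrightarrow> f i \<in> all_moments M) \<Longrightarrow> (\<lambda>x. \<Sum>i\<in>I. f i x) \<in> all_moments M"
  by (induction I rule: infinite_finite_induct) (auto intro: all_moments_add all_moments_const)

lemma (in prob_space) all_moments_L2: "f \<in> all_moments M \<Longrightarrow> f \<in> L2 M"
  using all_moments_integrable[OF all_moments_power[of f 2]] by (simp add: L2_def all_moments_def)

lemmas (in prob_space) all_moments_intros =
  all_moments_const all_moments_add all_moments_diff all_moments_mult all_moments_cmult
  all_moments_power all_moments_sum all_moments_abs all_moments_divide

lemma (in prob_space) all_moments_growth:
  assumes "f \<in> all_moments M" "\<phi> \<in> borel_measurable borel" "polynomial_growth \<phi>"
  shows "(\<lambda>x. \<phi> (f x)) \<in> all_moments M"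
proof -
  obtain C n where C: "\<And>x. \<bar>\<phi> x\<bar> \<le> C * (1 + \<bar>x\<bar>) ^ n"
    using assms(3) unfolding polynomial_growth_def by blast
  show ?thesis
  proof (rule all_moments_bound[where g = "\<lambda>x. C * (1 + \<bar>f x\<bar>) ^ n"])
    show "(\<lambda>x. C * (1 + \<bar>f x\<bar>) ^ n) \<in> all_moments M"
      using assms by (intro all_moments_intros)
    show "(\<lambda>x. \<phi> (f x)) \<in> borel_measurable M"
      using assms by measurable
    show "AE x in M. \<bar>\<phi> (f x)\<bar> \<le> \<bar>C * (1 + \<bar>f x\<bar>) ^ n\<bar>"
      using C by (auto intro: order_trans[OF _ abs_ge_self])
  qed
qed

section \<open>Diffusion operators with discrete spectrum\<close>

lemma polynomial_growth_bound:
  assumes "polynomial_growth g" "\<And>x. \<bar>f x\<bar> \<le> \<bar>g x\<bar>"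
  shows "polynomial_growth f"
  using assms unfolding polynomial_growth_def by (meson order_trans)

text \<open>Two growth bounds can be added only after both are brought to a common exponent; hence
  the nonnegative constant and the freedom to enlarge the exponent.\<close>

lemma polynomial_growth_normalise:
  assumes "polynomial_growth f"
  obtains C n where "C \<ge> 0" "\<And>x m. m \<ge> n \<Longrightarrow> \<bar>f x\<bar> \<le> C * (1 + \<bar>x\<bar>) ^ m"
proof -
  obtain C n where C: "\<And>x. \<bar>f x\<bar> \<le> C * (1 + \<bar>x\<bar>) ^ n"
    using assms unfolding polynomial_growth_def by blast
  have "\<bar>f x\<bar> \<le> \<bar>C\<bar> * (1 + \<bar>x\<bar>) ^ m" if "m \<ge> n" for x m
  proof -
    have "\<bar>f x\<bar> \<le> \<bar>C\<bar> * (1 + \<bar>x\<bar>) ^ n"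
      using C[of x] by (rule order_trans) (intro mult_right_mono, auto)
    also have "\<dots> \<le> \<bar>C\<bar> * (1 + \<bar>x\<bar>) ^ m"
      using that by (intro mult_left_mono power_increasing) auto
    finally show ?thesis .
  qed
  then show ?thesis by (intro that[of "\<bar>C\<bar>" n]) auto
qed

lemma polynomial_growth_const: "polynomial_growth (\<lambda>x. c)"
  unfolding polynomial_growth_def by (rule exI[of _ "\<bar>c\<bar>"], rule exI[of _ 0]) simp

lemma polynomial_growth_ident: "polynomial_growth (\<lambda>x. x)"
  unfolding polynomial_growth_def by (rule exI[of _ 1], rule exI[of _ 1]) simp

lemma polynomial_growth_add:
  assumes "polynomial_growth f" "polynomial_growth g"
  shows "polynomial_growth (\<lambda>x. f x + g x)"
proof -
  obtain C n where C: "C \<ge> 0" "\<And>x m. m \<ge> n \<Longrightarrow> \<bar>f x\<bar> \<le> C * (1 + \<bar>x\<bar>) ^ m"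
    using polynomial_growth_normalise[OF assms(1)] by metis
  obtain C' n' where C': "C' \<ge> 0" "\<And>x m. m \<ge> n' \<Longrightarrow> \<bar>g x\<bar> \<le> C' * (1 + \<bar>x\<bar>) ^ m"
    using polynomial_growth_normalise[OF assms(2)] by metis
  have "\<bar>f x + g x\<bar> \<le> (C + C') * (1 + \<bar>x\<bar>) ^ (max n n')" for x
    using C(2)[of "max n n'" x] C'(2)[of "max n n'" x] abs_triangle_ineq[of "f x" "g x"]
    by (simp add: distrib_right)
  then show ?thesis
    unfolding polynomial_growth_def by blast
qed

lemma polynomial_growth_mult:
  assumes "polynomial_growth f" "polynomial_growth g"
  shows "polynomial_growth (\<lambda>x. f x * g x)"
proof -
  obtain C n where C: "C \<ge> 0" "\<And>x m. m \<ge> n \<Longrightarrow> \<bar>f x\<bar> \<le> C * (1 + \<bar>x\<bar>) ^ m"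
    using polynomial_growth_normalise[OF assms(1)] by metis
  obtain C' n' where C': "C' \<ge> 0" "\<And>x m. m \<ge> n' \<Longrightarrow> \<bar>g x\<bar> \<le> C' * (1 + \<bar>x\<bar>) ^ m"
    using polynomial_growth_normalise[OF assms(2)] by metis
  have "\<bar>f x * g x\<bar> \<le> (C * C') * (1 + \<bar>x\<bar>) ^ (n + n')" for x
  proof -
    have "\<bar>f x\<bar> * \<bar>g x\<bar> \<le> (C * (1 + \<bar>x\<bar>) ^ n) * (C' * (1 + \<bar>x\<bar>) ^ n')"
      using C(1) C(2)[of n x] C'(2)[of n' x] by (intro mult_mono) auto
    then show ?thesis by (simp add: abs_mult power_add mult_ac)
  qed
  then show ?thesis
    unfolding polynomial_growth_def by blast
qed

lemma polynomial_growth_power: "polynomial_growth f \<Longrightarrow> polynomial_growth (\<lambda>x. f x ^ n)"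
  by (induction n) (auto intro: polynomial_growth_mult polynomial_growth_const)

lemma polynomial_growth_diff:
  "polynomial_growth f \<Longrightarrow> polynomial_growth g \<Longrightarrow> polynomial_growth (\<lambda>x. f x - g x)"
  using polynomial_growth_add[of f "\<lambda>x. (-1) * g x"]
    polynomial_growth_mult[OF polynomial_growth_const[of "-1"], of g] by simp

lemma polynomial_growth_sum:
  "(\<And>i. i \<in> I \<Longrightarrow> polynomial_growth (f i)) \<Longrightarrow> polynomial_growth (\<lambda>x. \<Sum>i\<in>I. f i x)"
  by (induction I rule: infinite_finite_induct)
    (auto intro: polynomial_growth_add polynomial_growth_const)

lemmas polynomial_growth_intros =
  polynomial_growth_const polynomial_growth_ident polynomial_growth_add polynomial_growth_diff
  polynomial_growth_mult polynomial_growth_power polynomial_growth_sum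

lemma C2_polI:
  assumes "\<And>x. (f has_real_derivative f1 x) (at x)" "\<And>x. (f1 has_real_derivative f2 x) (at x)"
    and "continuous_on UNIV f2"
    and "polynomial_growth f" "polynomial_growth f1" "polynomial_growth f2"
  shows "f \<in> C2_pol" "deriv f = f1" "deriv (deriv f) = f2"
proof -
  show 1: "deriv f = f1"
    using assms(1) by (auto intro!: ext DERIV_imp_deriv)
  show 2: "deriv (deriv f) = f2"
    unfolding 1 using assms(2) by (auto intro!: ext DERIV_imp_deriv)
  show "f \<in> C2_pol"
    using assms(1,2) 1
    by (auto simp: C2_pol_def real_differentiable_def 2[unfolded 1] assms(3-6))
qed

lemma C2_pol_power: "(\<lambda>x. x ^ n) \<in> C2_pol"
  and deriv_power: "deriv (\<lambda>x::real. x ^ n) = (\<lambda>x. real n * x ^ (n - 1))"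
  and deriv2_power: "deriv (deriv (\<lambda>x::real. x ^ n)) = (\<lambda>x. real n * (real (n - 1) * x ^ (n - 2)))"
proof -
  have n: "n - Suc 0 - Suc 0 = n - 2" by simp
  have 1: "((\<lambda>x::real. x ^ n) has_real_derivative real n * x ^ (n - 1)) (at x)" for x
    by (auto intro!: derivative_eq_intros)
  have 2: "((\<lambda>x::real. real n * x ^ (n - 1)) has_real_derivative real n * (real (n - 1) * x ^ (n - 2))) (at x)" for x
    by (auto intro!: derivative_eq_intros simp: numeral_2_eq_2)
  note * = C2_polI[OF 1 2]
  show "(\<lambda>x. x ^ n) \<in> C2_pol" "deriv (\<lambda>x::real. x ^ n) = (\<lambda>x. real n * x ^ (n - 1))"
    "deriv (deriv (\<lambda>x::real. x ^ n)) = (\<lambda>x. real n * (real (n - 1) * x ^ (n - 2)))"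
    by (intro *; intro polynomial_growth_intros continuous_intros)+
qed

text \<open>What the proof uses of the generator. The semigroup survives only in the symmetry of
  \<open>L\<close> and in \<open>L_square\<close>, the positivity of \<open>\<Gamma>\<close> in a
  form that can be stated before products are known to lie in \<open>D\<close>.\<close>

locale markov_diffusion = prob_space M for M :: "'a measure" +
  fixes D :: "('a \<Rightarrow> real) set" and L :: "('a \<Rightarrow> real) \<Rightarrow> 'a \<Rightarrow> real" and lam :: "nat \<Rightarrow> real"
  assumes D_L2: "D \<subseteq> L2 M"
    and D_lincomb: "\<And>f g a b. f \<in> D \<Longrightarrow> g \<in> D \<Longrightarrow> (\<lambda>x. a * f x + b * g x) \<in> D"
    and D_cong_AE: "\<And>f g. f \<in> D \<Longrightarrow> g \<in> borel_measurable M \<Longrightarrow> AE x in M. f x = g x \<Longrightarrow> g \<in> D"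
    and L_L2: "\<And>f. f \<in> D \<Longrightarrow> L f \<in> L2 M"
    and L_symmetric: "\<And>f g. f \<in> D \<Longrightarrow> g \<in> D \<Longrightarrow> (\<integral>x. f x * L g x \<partial>M) = (\<integral>x. L f x * g x \<partial>M)"
    and L_square: "\<And>f. f \<in> D \<Longrightarrow> (\<lambda>x. (f x)\<^sup>2) \<in> D \<Longrightarrow> AE x in M. 0 \<le> L (\<lambda>y. (f y)\<^sup>2) x - 2 * f x * L f x"
    and diffusion: "diffusion_property M D L"
    and diagonal: "diagonalisable M D L lam"
    and product_stable: "product_stable M D L lam"
begin

abbreviation "\<Gamma> \<equiv> carre_du_champ L"

abbreviation E :: "nat \<Rightarrow> ('a \<Rightarrow> real) set" where "E k \<equiv> ker_shift M D L (lam k)"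

lemma D_measurable [measurable_dest]: "f \<in> D \<Longrightarrow> f \<in> borel_measurable M"
  using D_L2 L2_measurable by blast

lemma L_measurable [measurable]: "f \<in> D \<Longrightarrow> L f \<in> borel_measurable M"
  using L_L2 L2_measurable by blast

lemma E_D: "X \<in> E k \<Longrightarrow> X \<in> D"
  by (simp add: ker_shift_def)

lemma D_add: "f \<in> D \<Longrightarrow> g \<in> D \<Longrightarrow> (\<lambda>x. f x + g x) \<in> D"
  using D_lincomb[of f g 1 1] by simp

lemma D_diff: "f \<in> D \<Longrightarrow> g \<in> D \<Longrightarrow> (\<lambda>x. f x - g x) \<in> D"
  using D_lincomb[of f g 1 "-1"] by simp

lemma D_cmult: "f \<in> D \<Longrightarrow> (\<lambda>x. c * f x) \<in> D"
  using D_lincomb[of f f c 0] by simp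

lemma D_compose: "\<phi> \<in> C2_pol \<Longrightarrow> X \<in> D \<Longrightarrow> (\<lambda>x. \<phi> (X x)) \<in> D"
  using diffusion unfolding diffusion_property_def by blast

lemma L_compose: "\<phi> \<in> C2_pol \<Longrightarrow> X \<in> D \<Longrightarrow> AE x in M. L (\<lambda>y. \<phi> (X y)) x =
        deriv (deriv \<phi>) (X x) * \<Gamma> X X x + deriv \<phi> (X x) * L X x"
  using diffusion unfolding diffusion_property_def by blast

lemma D_power: "X \<in> D \<Longrightarrow> (\<lambda>x. X x ^ n) \<in> D"
  by (rule D_compose[OF C2_pol_power])

text \<open>Polarisation reduces a product to squares, and the diffusion property for x^2 keeps
  squares in \<open>D\<close>.\<close>

lemma D_mult:
  assumes "X \<in> D" "Y \<in> D"
  shows "(\<lambda>x. X x * Y x) \<in> D"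
proof -
  have "(\<lambda>x. (1/4) * (X x + Y x)\<^sup>2 + (-1/4) * (X x - Y x)\<^sup>2) \<in> D"
    using assms by (intro D_lincomb D_power D_add D_diff)
  moreover have "(\<lambda>x. (1/4) * (X x + Y x)\<^sup>2 + (-1/4) * (X x - Y x)\<^sup>2) = (\<lambda>x. X x * Y x)"
    by (auto simp: power2_eq_square field_simps)
  ultimately show ?thesis by simp
qed

lemma D_nonempty: "\<exists>X. X \<in> D"
  using diagonal unfolding diagonalisable_def by (meson E_D)

lemma D_const: "(\<lambda>x. c) \<in> D"
proof -
  obtain X where "X \<in> D" using D_nonempty by blast
  then have "(\<lambda>x. c * (X x ^ 0)) \<in> D" by (intro D_cmult D_power)
  then show ?thesis by simp
qed

lemma D_zero: "(\<lambda>x. 0) \<in> D"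
  by (rule D_const)

lemma D_sum: "(\<And>i. i \<in> I \<Longrightarrow> f i \<in> D) \<Longrightarrow> (\<lambda>x. \<Sum>i\<in>I. f i x) \<in> D"
  by (induction I rule: infinite_finite_induct) (auto intro: D_add D_zero)

text \<open>\<open>D\<close> lies in L2 and is stable under powers, so every power of
  \<open>X\<close> is square integrable.\<close>

lemma D_all_moments:
  assumes "X \<in> D"
  shows "X \<in> all_moments M"
proof -
  have "integrable M (\<lambda>x. \<bar>X x\<bar> ^ n)" for n
  proof (rule Bochner_Integration.integrable_bound)
    have "(\<lambda>x. X x ^ n) \<in> L2 M" using D_power[OF assms] D_L2 by blast
    then show "integrable M (\<lambda>x. 1 + (X x ^ n)\<^sup>2)"
      by (intro Bochner_Integration.integrable_add integrable_const L2_integrable_sq)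
    show "AE x in M. norm (\<bar>X x\<bar> ^ n) \<le> norm (1 + (X x ^ n)\<^sup>2)"
    proof (rule AE_I2)
      fix x
      have "2 * (\<bar>X x\<bar> ^ n) \<le> 1 + (\<bar>X x\<bar> ^ n)\<^sup>2"
        using sum_squares_bound[of 1 "\<bar>X x\<bar> ^ n"] by simp
      moreover have "0 \<le> \<bar>X x\<bar> ^ n" by simp
      ultimately have "\<bar>X x\<bar> ^ n \<le> 1 + (\<bar>X x\<bar> ^ n)\<^sup>2" by linarith
      then show "norm (\<bar>X x\<bar> ^ n) \<le> norm (1 + (X x ^ n)\<^sup>2)"
        by (simp flip: power_abs)
    qed
  qed (use assms in measurable)
  then show ?thesis
    using assms by (auto simp: all_moments_def)
qed

lemma D_integrable: "f \<in> D \<Longrightarrow> integrable M f"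
  by (intro all_moments_integrable D_all_moments)

lemma D_L2': "f \<in> D \<Longrightarrow> f \<in> L2 M"
  using D_L2 by blast

text \<open>The partial sums of the eigenfunction expansion of \<open>w\<close> lie in
  \<open>D\<close> and tend to \<open>w\<close>, so \<open>w\<close> is orthogonal to
  itself.\<close>

lemma L2_null_if_orthogonal_to_D:
  assumes "w \<in> L2 M" "\<And>u. u \<in> D \<Longrightarrow> (\<integral>x. w x * u x \<partial>M) = 0"
  shows "AE x in M. w x = 0"
proof -
  obtain g where g: "\<And>k. g k \<in> E k" "L2_tendsto M (\<lambda>n x. \<Sum>k<n. g k x) w sequentially"
    using diagonal assms(1) unfolding diagonalisable_def by meson
  have gD: "(\<lambda>x. \<Sum>k<n. g k x) \<in> D" for n
    using g(1) by (intro D_sum E_D) auto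
  have "(\<lambda>n. \<integral>x. (\<Sum>k<n. g k x) * w x \<partial>M) \<longlonglongrightarrow> (\<integral>x. w x * w x \<partial>M)"
    by (rule L2_tendsto_inner[OF g(2)]) (use assms gD D_L2 in auto)
  moreover have "(\<integral>x. (\<Sum>k<n. g k x) * w x \<partial>M) = 0" for n
    using assms(2)[OF gD[of n]] by (simp add: mult.commute)
  ultimately have "(\<integral>x. w x * w x \<partial>M) = 0"
    by (simp add: LIMSEQ_const_iff)
  then have "l2 M w = 0"
    by (simp add: l2_def power2_eq_square)
  then show ?thesis using l2_0_iff[OF assms(1)] by simp
qed

text \<open>The criterion behind the linearity of \<open>L\<close> and its compatibility with a.e.
  equality: tested by \<open>D\<close>, an expression in \<open>L\<close> can be rewritten by moving
  \<open>L\<close> onto the test function.\<close>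

lemma L2_eq_if_tested_by_D:
  assumes "v \<in> L2 M" "w \<in> L2 M" "\<And>u. u \<in> D \<Longrightarrow> (\<integral>x. v x * u x \<partial>M) = (\<integral>x. w x * u x \<partial>M)"
  shows "AE x in M. v x = w x"
proof -
  have "AE x in M. v x - w x = 0"
  proof (rule L2_null_if_orthogonal_to_D[OF L2_diff[OF assms(1,2)]])
    fix u assume u: "u \<in> D"
    have "integrable M (\<lambda>x. v x * u x)" "integrable M (\<lambda>x. w x * u x)"
      using u D_L2 assms by (auto intro!: L2_mult_integrable)
    then show "(\<integral>x. (v x - w x) * u x \<partial>M) = 0"
      using assms(3)[OF u] by (simp add: left_diff_distrib)
  qed
  then show ?thesis by eventually_elim simp
qed

lemma L_cong_AE:
  assumes "f \<in> D" "g \<in> D" "AE x in M. f x = g x"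
  shows "AE x in M. L f x = L g x"
proof (rule L2_eq_if_tested_by_D)
  fix u assume u: "u \<in> D"
  have "(\<integral>x. L f x * u x \<partial>M) = (\<integral>x. f x * L u x \<partial>M)"
    using L_symmetric[OF assms(1) u] by simp
  also have "\<dots> = (\<integral>x. g x * L u x \<partial>M)"
    by (rule integral_cong_AE) (use assms u in \<open>auto\<close>)
  also have "\<dots> = (\<integral>x. L g x * u x \<partial>M)"
    using L_symmetric[OF assms(2) u] by simp
  finally show "(\<integral>x. L f x * u x \<partial>M) = (\<integral>x. L g x * u x \<partial>M)" .
qed (use assms L_L2 in auto)

lemma L_lincomb:
  assumes "f \<in> D" "g \<in> D"
  shows "AE x in M. L (\<lambda>y. a * f y + b * g y) x = a * L f x + b * L g x"
proof (rule L2_eq_if_tested_by_D)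
  fix u assume u: "u \<in> D"
  have i: "integrable M (\<lambda>x. f x * L u x)" "integrable M (\<lambda>x. g x * L u x)"
    "integrable M (\<lambda>x. L f x * u x)" "integrable M (\<lambda>x. L g x * u x)"
    using assms u D_L2 L_L2 by (auto intro!: L2_mult_integrable)
  have "(\<integral>x. L (\<lambda>y. a * f y + b * g y) x * u x \<partial>M) = (\<integral>x. (a * f x + b * g x) * L u x \<partial>M)"
    using L_symmetric[OF D_lincomb[OF assms] u] by simp
  also have "\<dots> = (\<integral>x. a * (f x * L u x) + b * (g x * L u x) \<partial>M)"
    by (simp add: algebra_simps)
  also have "\<dots> = a * (\<integral>x. L f x * u x \<partial>M) + b * (\<integral>x. L g x * u x \<partial>M)"
    using i L_symmetric[OF assms(1) u] L_symmetric[OF assms(2) u] by simp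
  also have "\<dots> = (\<integral>x. a * (L f x * u x) + b * (L g x * u x) \<partial>M)"
    using i by simp
  also have "\<dots> = (\<integral>x. (a * L f x + b * L g x) * u x \<partial>M)"
    by (simp add: algebra_simps)
  finally show "(\<integral>x. L (\<lambda>y. a * f y + b * g y) x * u x \<partial>M) = (\<integral>x. (a * L f x + b * L g x) * u x \<partial>M)" .
qed (intro L_L2 D_lincomb L2_lincomb assms)+

text \<open>The diffusion property for a constant test function has a vanishing right-hand
  side.\<close>

lemma L_const: "AE x in M. L (\<lambda>x. c) x = 0"
proof -
  obtain X where X: "X \<in> D" using D_nonempty by blast
  have *: "((\<lambda>x. c) has_real_derivative 0) (at x)" "((\<lambda>x. 0::real) has_real_derivative 0) (at x)" for x
    by (auto intro!: derivative_eq_intros)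
  note d = C2_polI[OF * continuous_on_const polynomial_growth_const polynomial_growth_const
      polynomial_growth_const]
  show ?thesis
    using L_compose[OF d(1) X] unfolding d by simp
qed

lemma L_add: "f \<in> D \<Longrightarrow> g \<in> D \<Longrightarrow> AE x in M. L (\<lambda>y. f y + g y) x = L f x + L g x"
  using L_lincomb[of f g 1 1] by simp

lemma L_sum:
  assumes "\<And>i. i \<in> I \<Longrightarrow> f i \<in> D"
  shows "AE x in M. L (\<lambda>y. \<Sum>i\<in>I. f i y) x = (\<Sum>i\<in>I. L (f i) x)"
  using assms
proof (induction I rule: infinite_finite_induct)
  case (insert i I)
  then have "AE x in M. L (\<lambda>y. f i y + (\<Sum>i\<in>I. f i y)) x = L (f i) x + L (\<lambda>y. \<Sum>i\<in>I. f i y) x"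
    by (intro L_add D_sum) auto
  moreover have "AE x in M. L (\<lambda>y. \<Sum>i\<in>I. f i y) x = (\<Sum>i\<in>I. L (f i) x)"
    using insert by auto
  ultimately have "AE x in M. L (\<lambda>y. f i y + (\<Sum>i\<in>I. f i y)) x = L (f i) x + (\<Sum>i\<in>I. L (f i) x)"
    by eventually_elim simp
  then show ?case using insert by simp
qed (auto intro: L_const)

lemma L_integral: "f \<in> D \<Longrightarrow> (\<integral>x. L f x \<partial>M) = 0"
proof -
  assume f: "f \<in> D"
  have "(\<integral>x. L f x * 1 \<partial>M) = (\<integral>x. f x * L (\<lambda>x. 1) x \<partial>M)"
    using L_symmetric[OF f D_const[of 1]] by simp
  also have "\<dots> = (\<integral>x. 0 \<partial>M)"
    by (rule integral_cong_AE) (use f D_const L_const[of 1] in \<open>auto\<close>)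
  finally show ?thesis by simp
qed

section \<open>The carre du champ\<close>

lemma \<Gamma>_measurable [measurable]:
  assumes "X \<in> D" "Y \<in> D"
  shows "\<Gamma> X Y \<in> borel_measurable M"
proof -
  have [measurable]: "L (\<lambda>y. X y * Y y) \<in> borel_measurable M" "L X \<in> borel_measurable M"
    "L Y \<in> borel_measurable M" "X \<in> borel_measurable M" "Y \<in> borel_measurable M"
    using assms D_mult[OF assms] L_measurable D_measurable by blast+
  show ?thesis unfolding carre_du_champ_def by measurable
qed

lemma \<Gamma>_nonneg: "X \<in> D \<Longrightarrow> AE x in M. 0 \<le> \<Gamma> X X x"
  using L_square[OF _ D_power[of X 2]] by (auto simp: carre_du_champ_def power2_eq_square)

lemma \<Gamma>_lincomb:
  assumes "X \<in> D" "Y \<in> D"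
  shows "AE x in M. \<Gamma> (\<lambda>y. X y + c * Y y) (\<lambda>y. X y + c * Y y) x =
    \<Gamma> X X x + 2 * c * \<Gamma> X Y x + c\<^sup>2 * \<Gamma> Y Y x"
proof -
  let ?XX = "\<lambda>y. X y * X y" and ?XY = "\<lambda>y. X y * Y y" and ?YY = "\<lambda>y. Y y * Y y"
  have D: "?XX \<in> D" "?XY \<in> D" "?YY \<in> D"
    using assms by (auto intro: D_mult)
  have e: "(\<lambda>y. (X y + c * Y y) * (X y + c * Y y)) = (\<lambda>y. 1 * (1 * ?XX y + (2 * c) * ?XY y) + c\<^sup>2 * ?YY y)"
    by (auto simp: algebra_simps power2_eq_square)
  have "AE x in M. L (\<lambda>y. (X y + c * Y y) * (X y + c * Y y)) x =
      1 * L (\<lambda>y. 1 * ?XX y + (2 * c) * ?XY y) x + c\<^sup>2 * L ?YY x"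
    unfolding e by (intro L_lincomb D_lincomb D)
  moreover have "AE x in M. L (\<lambda>y. 1 * ?XX y + (2 * c) * ?XY y) x = 1 * L ?XX x + (2 * c) * L ?XY x"
    by (intro L_lincomb D)
  moreover have "AE x in M. L (\<lambda>y. 1 * X y + c * Y y) x = 1 * L X x + c * L Y x"
    using assms by (intro L_lincomb)
  ultimately show ?thesis
    unfolding carre_du_champ_def
    by eventually_elim (simp add: field_simps power2_eq_square)
qed

text \<open>Only rational \<open>c\<close> are assumed, because the inequality will come from a.e.
  statements; continuity supplies the other values of \<open>c\<close>.\<close>

lemma discriminant_nonpos:
  assumes "\<And>c. c \<in> \<rat> \<Longrightarrow> 0 \<le> a + 2 * c * b + c\<^sup>2 * (d::real)"
  shows "b\<^sup>2 \<le> a * d"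
proof -
  have q: "0 \<le> a + 2 * c * b + c\<^sup>2 * d" for c
  proof -
    obtain r where r: "\<And>n. r n \<in> \<rat>" "r \<longlonglongrightarrow> c"
      using Rats_closure_real closure_sequential by (metis UNIV_I)
    have "(\<lambda>n. a + 2 * r n * b + (r n)\<^sup>2 * d) \<longlonglongrightarrow> a + 2 * c * b + c\<^sup>2 * d"
      by (intro tendsto_intros r(2))
    then show ?thesis
      by (rule LIMSEQ_le_const) (use assms r(1) in auto)
  qed
  show ?thesis
  proof (cases "d = 0")
    case True
    have "b = 0"
    proof (rule ccontr)
      assume "b \<noteq> 0"
      then show False using q[of "- (a + 1) / (2 * b)"] True by (simp add: field_simps)
    qed
    then show ?thesis using True by simp
  next
    case False
    have d0: "d > 0"
    proof (rule ccontr)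
      assume "\<not> d > 0"
      with False have d: "d < 0" by simp
      \<comment> \<open>Large enough for the negative term c^2 d to outweigh the other two: with
        this choice \<open>c * (- d)\<close> equals - d + |a| + 2 |b|.\<close>
      define c where "c = 1 + (\<bar>a\<bar> + 2 * \<bar>b\<bar>) / (- d)"
      have c1: "c \<ge> 1" using d by (simp add: c_def field_simps)
      have "c * (- d) = - d + \<bar>a\<bar> + 2 * \<bar>b\<bar>" using d by (simp add: c_def field_simps)
      then have "c * (c * (- d)) = c * (- d + \<bar>a\<bar> + 2 * \<bar>b\<bar>)" by simp
      then have "a + 2 * c * b + c\<^sup>2 * d = a + 2 * c * b - c * (- d + \<bar>a\<bar> + 2 * \<bar>b\<bar>)"
        by (simp add: power2_eq_square algebra_simps)
      also have "\<dots> = (a - c * \<bar>a\<bar>) + 2 * c * (b - \<bar>b\<bar>) + c * d"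
        by (simp add: algebra_simps)
      also have "\<dots> < 0"
      proof -
        have "a - c * \<bar>a\<bar> \<le> 0" using c1 mult_right_mono[of 1 c "\<bar>a\<bar>"] by auto
        moreover have "2 * c * (b - \<bar>b\<bar>) \<le> 0" using c1 by (intro mult_nonneg_nonpos) auto
        moreover have "c * d < 0" using c1 d by (intro mult_pos_neg) auto
        ultimately show ?thesis by linarith
      qed
      finally show False using q[of c] by simp
    qed
    have "0 \<le> d * (a + 2 * (- b / d) * b + (- b / d)\<^sup>2 * d)"
      using q[of "- b / d"] d0 by simp
    also have "\<dots> = a * d - b\<^sup>2"
      using d0 by (simp add: field_simps power2_eq_square)
    finally show ?thesis by simp
  qed
qed

text \<open>\<open>\<Gamma>\<close> at X + c Y is nonnegative off a null set that depends on c; for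
  the countably many rational c one null set serves all.\<close>

lemma \<Gamma>_Cauchy_Schwarz:
  assumes "X \<in> D" "Y \<in> D"
  shows "AE x in M. (\<Gamma> X Y x)\<^sup>2 \<le> \<Gamma> X X x * \<Gamma> Y Y x"
proof -
  have "AE x in M. 0 \<le> \<Gamma> X X x + 2 * c * \<Gamma> X Y x + c\<^sup>2 * \<Gamma> Y Y x" for c
    using \<Gamma>_lincomb[OF assms, of c] \<Gamma>_nonneg[OF D_add[OF assms(1) D_cmult[OF assms(2), of c]]]
    by eventually_elim simp
  then have "AE x in M. \<forall>c\<in>\<rat>. 0 \<le> \<Gamma> X X x + 2 * c * \<Gamma> X Y x + c\<^sup>2 * \<Gamma> Y Y x"
    by (subst AE_ball_countable[OF countable_rat]) auto
  then show ?thesis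
    by eventually_elim (auto intro: discriminant_nonpos)
qed

section \<open>Eigenspaces and finite spectral sums\<close>

lemma E_eigen: "X \<in> E k \<Longrightarrow> AE x in M. L X x = - lam k * X x"
  unfolding ker_shift_def by (auto elim!: eventually_mono simp: algebra_simps)

lemma E_I: "X \<in> D \<Longrightarrow> AE x in M. L X x = - lam k * X x \<Longrightarrow> X \<in> E k"
  unfolding ker_shift_def by (auto elim!: eventually_mono)

lemma E_lincomb:
  assumes "f \<in> E k" "g \<in> E k"
  shows "(\<lambda>x. a * f x + b * g x) \<in> E k"
proof (rule E_I)
  show "(\<lambda>x. a * f x + b * g x) \<in> D"
    using assms by (intro D_lincomb E_D)
  show "AE x in M. L (\<lambda>y. a * f y + b * g y) x = - lam k * (a * f x + b * g x)"
    using L_lincomb[OF assms[THEN E_D], of a b] E_eigen[OF assms(1)] E_eigen[OF assms(2)]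
    by eventually_elim (simp add: algebra_simps)
qed

lemma E_cmult: "f \<in> E k \<Longrightarrow> (\<lambda>x. c * f x) \<in> E k"
  using E_lincomb[of f k f c 0] by simp

lemma E_zero: "(\<lambda>x. 0) \<in> E k"
  by (rule E_I[OF D_zero]) (use L_const[of 0] in simp)

lemma lam_0: "lam 0 = 0" and lam_strict_mono: "strict_mono lam"
  using diagonal unfolding diagonalisable_def by auto

lemma lam_nonneg: "0 \<le> lam k"
  using lam_0 lam_strict_mono by (metis le0 strict_mono_less_eq)

lemma lam_mono: "i \<le> j \<Longrightarrow> lam i \<le> lam j"
  using lam_strict_mono strict_mono_less_eq by blast

lemma lam_pos: "k \<ge> 1 \<Longrightarrow> 0 < lam k"
  using lam_0 lam_strict_mono strict_monoD[of lam 0 k] by auto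

lemma E_const: "(\<lambda>x. c) \<in> E 0"
  by (rule E_I[OF D_const]) (use L_const[of c] lam_0 in simp)

lemma E_nontrivial: "\<exists>X \<in> E k. l2 M X > 0"
proof -
  obtain X where X: "X \<in> E k" "\<not> (AE x in M. X x = 0)"
    using diagonal unfolding diagonalisable_def by blast
  then have "l2 M X \<noteq> 0"
    using l2_0_iff[OF D_L2'[OF E_D[OF X(1)]]] by simp
  then show ?thesis
    using X(1) l2_nonneg[of M X] by (metis order_le_less)
qed

lemma E_orthogonal:
  assumes "f \<in> E j" "g \<in> E k" "j \<noteq> k"
  shows "(\<integral>x. f x * g x \<partial>M) = 0"
proof -
  have fg: "f \<in> D" "g \<in> D" using assms by (auto intro: E_D)
  have "- lam k * (\<integral>x. f x * g x \<partial>M) = (\<integral>x. f x * L g x \<partial>M)"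
    unfolding integral_mult_right_zero[symmetric]
    by (rule integral_cong_AE) (use fg E_eigen[OF assms(2)] in auto)
  also have "\<dots> = (\<integral>x. L f x * g x \<partial>M)"
    by (rule L_symmetric[OF fg])
  also have "\<dots> = - lam j * (\<integral>x. f x * g x \<partial>M)"
    unfolding integral_mult_right_zero[symmetric]
    by (rule integral_cong_AE) (use fg E_eigen[OF assms(1)] in auto)
  finally have "(lam k - lam j) * (\<integral>x. f x * g x \<partial>M) = 0"
    by (simp add: algebra_simps)
  moreover have "lam k \<noteq> lam j"
    using assms(3) strict_mono_eq[OF lam_strict_mono] by auto
  ultimately show ?thesis by simp
qed

text \<open>The analogue of the sum of the Wiener chaoses of order at most \<open>N\<close>, up to
  null sets. Products add the index bounds, and \<open>L\<close> preserves them; this is the form in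
  which product stability enters all later arguments.\<close>

definition A :: "nat \<Rightarrow> ('a \<Rightarrow> real) set" where
  "A N = {F \<in> borel_measurable M. \<exists>g. (\<forall>k. g k \<in> E k) \<and> (AE x in M. F x = (\<Sum>k\<le>N. g k x))}"

lemma A_I: "F \<in> borel_measurable M \<Longrightarrow> (\<And>k. g k \<in> E k) \<Longrightarrow> AE x in M. F x = (\<Sum>k\<le>N. g k x) \<Longrightarrow> F \<in> A N"
  unfolding A_def by blast

lemma A_E:
  assumes "F \<in> A N"
  obtains g where "\<And>k. g k \<in> E k" "AE x in M. F x = (\<Sum>k\<le>N. g k x)"
  using assms unfolding A_def by blast

lemma A_measurable [measurable_dest]: "F \<in> A N \<Longrightarrow> F \<in> borel_measurable M"
  by (simp add: A_def)

lemma A_D: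
  assumes "F \<in> A N"
  shows "F \<in> D"
proof -
  obtain g where g: "\<And>k. g k \<in> E k" "AE x in M. F x = (\<Sum>k\<le>N. g k x)"
    using A_E[OF assms] by blast
  have "(\<lambda>x. \<Sum>k\<le>N. g k x) \<in> D"
    using g by (intro D_sum E_D) auto
  then show ?thesis
    by (rule D_cong_AE) (use assms g in \<open>auto elim: eventually_mono\<close>)
qed

lemma A_all_moments: "F \<in> A N \<Longrightarrow> F \<in> all_moments M"
  by (intro D_all_moments A_D)

lemma A_cong_AE:
  assumes "F \<in> A N" "G \<in> borel_measurable M" "AE x in M. G x = F x"
  shows "G \<in> A N"
proof -
  obtain g where g: "\<And>k. g k \<in> E k" "AE x in M. F x = (\<Sum>k\<le>N. g k x)"
    using A_E[OF assms(1)] by blast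
  show ?thesis
    by (rule A_I[OF assms(2) g(1)]) (use assms(3) g(2) in eventually_elim, simp)
qed

lemma A_lincomb:
  assumes "F \<in> A N" "G \<in> A N"
  shows "(\<lambda>x. a * F x + b * G x) \<in> A N"
proof -
  obtain f where f: "\<And>k. f k \<in> E k" "AE x in M. F x = (\<Sum>k\<le>N. f k x)"
    using A_E[OF assms(1)] by blast
  obtain g where g: "\<And>k. g k \<in> E k" "AE x in M. G x = (\<Sum>k\<le>N. g k x)"
    using A_E[OF assms(2)] by blast
  show ?thesis
  proof (rule A_I[where g = "\<lambda>k x. a * f k x + b * g k x"])
    show "(\<lambda>x. a * F x + b * G x) \<in> borel_measurable M"
      using assms by measurable
    show "AE x in M. a * F x + b * G x = (\<Sum>k\<le>N. a * f k x + b * g k x)"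
      using f(2) g(2) by eventually_elim (simp add: sum.distrib sum_distrib_left)
  qed (use f g E_lincomb in blast)
qed

lemma A_cmult: "F \<in> A N \<Longrightarrow> (\<lambda>x. c * F x) \<in> A N"
  using A_lincomb[of F N F c 0] by simp

lemma A_add: "F \<in> A N \<Longrightarrow> G \<in> A N \<Longrightarrow> (\<lambda>x. F x + G x) \<in> A N"
  using A_lincomb[of F N G 1 1] by simp

lemma A_diff: "F \<in> A N \<Longrightarrow> G \<in> A N \<Longrightarrow> (\<lambda>x. F x - G x) \<in> A N"
  using A_lincomb[of F N G 1 "-1"] by simp

lemma A_mono:
  assumes "F \<in> A N" "N \<le> N'"
  shows "F \<in> A N'"
proof -
  obtain g where g: "\<And>k. g k \<in> E k" "AE x in M. F x = (\<Sum>k\<le>N. g k x)"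
    using A_E[OF assms(1)] by blast
  show ?thesis
  proof (rule A_I[where g = "\<lambda>k. if k \<le> N then g k else (\<lambda>x. 0)"])
    have "(\<Sum>k\<le>N'. (if k \<le> N then g k else (\<lambda>x. 0)) x) = (\<Sum>k\<le>N. g k x)" for x
      using assms(2) by (intro sum.mono_neutral_cong_right) auto
    then show "AE x in M. F x = (\<Sum>k\<le>N'. (if k \<le> N then g k else (\<lambda>x. 0)) x)"
      using g(2) by simp
  qed (use assms g E_zero in auto)
qed

lemma E_A:
  assumes "F \<in> E k" "k \<le> N"
  shows "F \<in> A N"
proof (rule A_I[where g = "\<lambda>j. if j = k then F else (\<lambda>x. 0)"])
  have "(\<Sum>j\<le>N. (if j = k then F else (\<lambda>x. 0)) x) = F x" for x
    using assms(2) by (subst if_distribR) simp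
  then show "AE x in M. F x = (\<Sum>j\<le>N. (if j = k then F else (\<lambda>x. 0)) x)"
    by simp
qed (use assms E_D D_measurable E_zero in auto)

lemma A_const: "(\<lambda>x. c) \<in> A N"
  by (rule E_A[OF E_const]) simp

lemma A_sum: "(\<And>i. i \<in> I \<Longrightarrow> f i \<in> A N) \<Longrightarrow> (\<lambda>x. \<Sum>i\<in>I. f i x) \<in> A N"
  by (induction I rule: infinite_finite_induct) (auto intro: A_add A_const)

lemma E_mult:
  assumes "X \<in> E p" "Y \<in> E q"
  shows "(\<lambda>x. X x * Y x) \<in> A (p + q)"
proof -
  obtain g where "\<And>k. g k \<in> E k" "AE x in M. X x * Y x = (\<Sum>k\<le>p+q. g k x)"
    using product_stable assms unfolding product_stable_def by meson
  then show ?thesis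
    by (intro A_I[of _ g]) (use assms[THEN E_D] in measurable)
qed

lemma A_mult:
  assumes "F \<in> A N" "G \<in> A N'"
  shows "(\<lambda>x. F x * G x) \<in> A (N + N')"
proof -
  obtain f where f: "\<And>k. f k \<in> E k" "AE x in M. F x = (\<Sum>k\<le>N. f k x)"
    using A_E[OF assms(1)] by blast
  obtain g where g: "\<And>k. g k \<in> E k" "AE x in M. G x = (\<Sum>k\<le>N'. g k x)"
    using A_E[OF assms(2)] by blast
  have "(\<lambda>x. \<Sum>i\<le>N. \<Sum>j\<le>N'. f i x * g j x) \<in> A (N + N')"
    by (intro A_sum, rule A_mono[OF E_mult[OF f(1) g(1)]]) auto
  then show ?thesis
  proof (rule A_cong_AE)
    show "AE x in M. F x * G x = (\<Sum>i\<le>N. \<Sum>j\<le>N'. f i x * g j x)"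
      using f(2) g(2) by eventually_elim (simp add: sum_product)
  qed (use assms in measurable)
qed

lemma A_power: "F \<in> A N \<Longrightarrow> (\<lambda>x. F x ^ n) \<in> A (n * N)"
  by (induction n) (auto intro: A_const A_mult)

lemma L_eigen_sum:
  assumes "F \<in> D" "\<And>k. g k \<in> E k" "AE x in M. F x = (\<Sum>k\<le>N. g k x)"
  shows "AE x in M. L F x = - (\<Sum>k\<le>N. lam k * g k x)"
proof -
  have gD: "\<And>k. g k \<in> D" using assms(2) E_D by blast
  have "AE x in M. L F x = L (\<lambda>x. \<Sum>k\<le>N. g k x) x"
    using assms gD by (intro L_cong_AE D_sum) auto
  moreover have "AE x in M. L (\<lambda>x. \<Sum>k\<le>N. g k x) x = (\<Sum>k\<le>N. L (g k) x)"
    using gD by (intro L_sum)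
  moreover have "AE x in M. \<forall>k. L (g k) x = - lam k * g k x"
    using E_eigen[OF assms(2)] by (simp add: AE_all_countable)
  ultimately show ?thesis
    by eventually_elim (simp add: sum_negf)
qed

lemma A_L:
  assumes "F \<in> A N"
  shows "L F \<in> A N"
proof -
  obtain g where g: "\<And>k. g k \<in> E k" "AE x in M. F x = (\<Sum>k\<le>N. g k x)"
    using A_E[OF assms] by blast
  show ?thesis
  proof (rule A_I[where g = "\<lambda>k x. - lam k * g k x"])
    show "AE x in M. L F x = (\<Sum>k\<le>N. - lam k * g k x)"
      using L_eigen_sum[OF A_D[OF assms] g] by eventually_elim (simp add: sum_negf)
  qed (rule L_measurable[OF A_D[OF assms]], rule E_cmult[OF g(1)])
qed

lemma A_\<Gamma>:
  assumes "F \<in> A N" "G \<in> A N'"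
  shows "\<Gamma> F G \<in> A (N + N')"
proof -
  have "(\<lambda>x. (1/2) * (L (\<lambda>y. F y * G y) x + (-1) * (F x * L G x) + (-1) * (L F x * G x))) \<in> A (N + N')"
    using assms by (intro A_cmult A_add A_L A_mult)
  moreover have "(\<lambda>x. (1/2) * (L (\<lambda>y. F y * G y) x + (-1) * (F x * L G x) + (-1) * (L F x * G x))) = \<Gamma> F G"
    by (auto simp: carre_du_champ_def)
  ultimately show ?thesis by simp
qed

lemma integral_eigen_sum_square:
  assumes "\<And>k. g k \<in> E k"
  shows "(\<integral>x. (\<Sum>k\<in>I. g k x) * g j x \<partial>M) = (if finite I \<and> j \<in> I then (l2 M (g j))\<^sup>2 else 0)"
proof (cases "finite I")
  case True
  have gD: "\<And>k. g k \<in> D" using assms E_D by blast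
  have "(\<integral>x. (\<Sum>k\<in>I. g k x) * g j x \<partial>M) = (\<Sum>k\<in>I. \<integral>x. g k x * g j x \<partial>M)"
    unfolding sum_distrib_right
    by (rule Bochner_Integration.integral_sum) (intro D_integrable D_mult gD)
  also have "\<dots> = (\<Sum>k\<in>I. if k = j then (l2 M (g j))\<^sup>2 else 0)"
    using E_orthogonal[OF assms assms] by (intro sum.cong) (auto simp: l2_sq simp flip: power2_eq_square)
  also have "\<dots> = (if finite I \<and> j \<in> I then (l2 M (g j))\<^sup>2 else 0)"
    using True by simp
  finally show ?thesis .
qed auto

text \<open>Pairing \<open>F\<close> with \<open>g j\<close> leaves the squared norm of
  \<open>g j\<close> by orthogonality. Components of a bounded sequence thus stay bounded.\<close>

lemma l2_component_le:
  assumes "F \<in> D" "\<And>k. g k \<in> E k" "AE x in M. F x = (\<Sum>k\<le>N. g k x)" "j \<le> N"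
  shows "l2 M (g j) \<le> l2 M F"
proof (cases "l2 M (g j) = 0")
  case False
  have gD: "\<And>k. g k \<in> D" using assms E_D by blast
  have "(l2 M (g j))\<^sup>2 = (\<integral>x. (\<Sum>k\<le>N. g k x) * g j x \<partial>M)"
    using integral_eigen_sum_square[OF assms(2), of "{..N}" j] assms(4) by simp
  also have "\<dots> = (\<integral>x. F x * g j x \<partial>M)"
    by (rule integral_cong_AE) (use assms gD in auto)
  also have "\<dots> \<le> l2 M F * l2 M (g j)"
    using Cauchy_Schwarz_L2[OF D_L2'[OF assms(1)] D_L2'[OF gD]] by (simp add: abs_le_iff)
  finally show ?thesis
    using False l2_nonneg[of M "g j"] by (simp add: power2_eq_square)
qed simp

text \<open>The components of \<open>x\<close> beyond \<open>N\<close> are limits of the vanishing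
  ones of \<open>xs n\<close>, so the expansion of \<open>x\<close> stops at \<open>N\<close>.
  Closedness makes \<open>A N\<close> complete, as the category argument for the fourth moments
  requires.\<close>

lemma A_closed:
  assumes "x \<in> L2 M" "\<And>n. xs n \<in> A N" "L2_tendsto M xs x sequentially"
  shows "x \<in> A N"
proof -
  obtain g where g: "\<And>k. g k \<in> E k" "L2_tendsto M (\<lambda>n x. \<Sum>k<n. g k x) x sequentially"
    using diagonal assms(1) unfolding diagonalisable_def by meson
  have gD: "\<And>k. g k \<in> D" using g E_D by blast
  have xsL2: "\<And>n. xs n \<in> L2 M" using assms(2) A_D D_L2' by blast
  have z: "AE y in M. g k y = 0" if k: "k > N" for k
  proof -
    have 1: "(\<lambda>n. \<integral>y. xs n y * g k y \<partial>M) \<longlonglongrightarrow> (\<integral>y. x y * g k y \<partial>M)"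
      by (rule L2_tendsto_inner[OF assms(3) xsL2 assms(1) D_L2'[OF gD]])
    have "(\<integral>y. xs n y * g k y \<partial>M) = 0" for n
    proof -
      obtain h where h: "\<And>k. h k \<in> E k" "AE y in M. xs n y = (\<Sum>i\<le>N. h i y)"
        using A_E[OF assms(2)] by blast
      \<comment> \<open>Joins the components of \<open>xs n\<close> and the function
        \<open>g k\<close>, whose index lies outside the range of summation, into one family, to
        which the orthogonality lemma applies with value 0.\<close>
      define h' where "h' = (\<lambda>i. if i = k then g k else h i)"
      have h': "\<And>i. h' i \<in> E i" using h g by (auto simp: h'_def)
      have e: "(\<Sum>i\<le>N. h i y) = (\<Sum>i\<le>N. h' i y)" for y
        using k by (intro sum.cong) (auto simp: h'_def)
      have h'k: "h' k = g k" by (simp add: h'_def)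
      have m: "(\<lambda>y. xs n y * g k y) \<in> borel_measurable M"
        "(\<lambda>y. (\<Sum>i\<le>N. h' i y) * h' k y) \<in> borel_measurable M"
        using assms(2) gD E_D[OF h'] by measurable
      have "(\<integral>y. xs n y * g k y \<partial>M) = (\<integral>y. (\<Sum>i\<le>N. h' i y) * h' k y \<partial>M)"
      proof (rule integral_cong_AE[OF m])
        show "AE y in M. xs n y * g k y = (\<Sum>i\<le>N. h' i y) * h' k y"
          using h(2) by eventually_elim (simp add: e h'k)
      qed
      also have "\<dots> = 0"
        using integral_eigen_sum_square[OF h', of "{..N}" k] k by simp
      finally show ?thesis .
    qed
    with 1 have x0: "(\<integral>y. x y * g k y \<partial>M) = 0"
      by (simp add: LIMSEQ_const_iff)
    have 2: "(\<lambda>n. \<integral>y. (\<Sum>k<n. g k y) * g k y \<partial>M) \<longlonglongrightarrow> (\<integral>y. x y * g k y \<partial>M)"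
      by (rule L2_tendsto_inner[OF g(2) _ assms(1) D_L2'[OF gD]])
        (intro D_L2' D_sum gD)
    have "(\<lambda>n. (l2 M (g k))\<^sup>2) \<longlonglongrightarrow> (\<integral>y. x y * g k y \<partial>M)"
    proof (rule Lim_transform_eventually[OF 2])
      show "\<forall>\<^sub>F n in sequentially. (\<integral>y. (\<Sum>k<n. g k y) * g k y \<partial>M) = (l2 M (g k))\<^sup>2"
        using eventually_gt_at_top[of k]
        by eventually_elim (simp add: integral_eigen_sum_square[OF g(1)])
    qed
    then have "l2 M (g k) = 0"
      using x0 by (simp add: LIMSEQ_const_iff)
    then show ?thesis
      using l2_0_iff[OF D_L2'[OF gD]] by blast
  qed
  have "(\<lambda>n. l2 M (\<lambda>y. (\<Sum>k\<le>N. g k y) - x y)) \<longlonglongrightarrow> 0"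
  proof (rule Lim_transform_eventually[OF g(2)[unfolded L2_tendsto_iff]])
    show "\<forall>\<^sub>F n in sequentially. l2 M (\<lambda>y. (\<Sum>k<n. g k y) - x y) = l2 M (\<lambda>y. (\<Sum>k\<le>N. g k y) - x y)"
      using eventually_gt_at_top[of N]
    proof eventually_elim
      case (elim n)
      have "AE y in M. \<forall>k\<in>{N<..}. g k y = 0"
        using z by (subst AE_ball_countable) auto
      then have "AE y in M. (\<Sum>k<n. g k y) - x y = (\<Sum>k\<le>N. g k y) - x y"
      proof eventually_elim
        fix y assume "\<forall>k\<in>{N<..}. g k y = 0"
        then have "(\<Sum>k<n. g k y) = (\<Sum>k\<le>N. g k y)"
          using elim by (intro sum.mono_neutral_right) auto
        then show "(\<Sum>k<n. g k y) - x y = (\<Sum>k\<le>N. g k y) - x y" by simp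
      qed
      then show ?case
        by (rule l2_cong_AE) (use assms(1) gD in auto)
    qed
  qed
  then have "l2 M (\<lambda>y. (\<Sum>k\<le>N. g k y) - x y) = 0"
    by (simp add: LIMSEQ_const_iff)
  then have "AE y in M. (\<Sum>k\<le>N. g k y) - x y = 0"
    by (subst (asm) l2_0_iff) (intro L2_diff D_L2' D_sum gD assms)+
  then show ?thesis
    by (intro A_I[OF _ g(1)]) (use assms(1) in \<open>auto simp: L2_def elim: eventually_mono\<close>)
qed

end

section \<open>From the semigroup to the generator\<close>

lemma all_rat_square_nonneg:
  assumes "\<And>c. c \<in> \<rat> \<Longrightarrow> 0 \<le> a - 2 * c * b + c\<^sup>2"
  shows "0 \<le> a - 2 * y * b + (y::real)\<^sup>2"
proof -
  obtain r where r: "\<And>n. r n \<in> \<rat>" "r \<longlonglongrightarrow> y"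
    using Rats_closure_real closure_sequential by (metis UNIV_I)
  have "(\<lambda>n. a - 2 * r n * b + (r n)\<^sup>2) \<longlonglongrightarrow> a - 2 * y * b + y\<^sup>2"
    by (intro tendsto_intros r(2))
  then show ?thesis
    by (rule LIMSEQ_le_const) (use assms r(1) in auto)
qed

context symmetric_markov_semigroup
begin

lemma L2_const: "(\<lambda>x. c) \<in> L2 M"
  by (simp add: L2_def)

text \<open>\<open>P t\<close> of (f - c)^2 is nonnegative for each constant c. Off one null set
  this holds for all rational c, hence for all real c, and then c may be the value of
  \<open>f\<close> at the point itself.\<close>

lemma semigroup_square:
  assumes t: "t \<ge> 0" and f: "f \<in> L2 M" and f2: "(\<lambda>x. (f x)\<^sup>2) \<in> L2 M"
  shows "AE x in M. 0 \<le> P t (\<lambda>y. (f y)\<^sup>2) x - 2 * f x * P t f x + (f x)\<^sup>2"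
proof -
  have "AE x in M. 0 \<le> P t (\<lambda>y. (f y)\<^sup>2) x - 2 * c * P t f x + c\<^sup>2" for c
  proof -
    have g: "(\<lambda>x. 1 * (f x)\<^sup>2 + (- 2 * c) * f x) \<in> L2 M"
      by (rule L2_lincomb[OF f2 f])
    have gc: "(\<lambda>x. 1 * (1 * (f x)\<^sup>2 + (- 2 * c) * f x) + c\<^sup>2 * 1) \<in> L2 M"
      by (rule L2_lincomb[OF g L2_const])
    have "AE x in M. 0 \<le> P t (\<lambda>x. 1 * (1 * (f x)\<^sup>2 + (- 2 * c) * f x) + c\<^sup>2 * 1) x"
    proof (rule positive[OF t gc], rule AE_I2)
      fix x
      have "1 * (1 * (f x)\<^sup>2 + (- 2 * c) * f x) + c\<^sup>2 * 1 = (f x - c)\<^sup>2"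
        by (simp add: power2_diff algebra_simps)
      then show "0 \<le> 1 * (1 * (f x)\<^sup>2 + (- 2 * c) * f x) + c\<^sup>2 * 1"
        by simp
    qed
    with linear[OF t g L2_const, of 1 "c\<^sup>2" 1] linear[OF t f2 f, of 1 "- 2 * c"] unit[OF t]
    show ?thesis
      by eventually_elim simp
  qed
  then have "AE x in M. \<forall>c\<in>\<rat>. 0 \<le> P t (\<lambda>y. (f y)\<^sup>2) x - 2 * c * P t f x + c\<^sup>2"
    by (subst AE_ball_countable[OF countable_rat]) auto
  then show ?thesis
    by eventually_elim (auto intro: all_rat_square_nonneg)
qed

lemma difference_quotient_L2: "t > 0 \<Longrightarrow> f \<in> L2 M \<Longrightarrow> (\<lambda>x. (P t f x - f x) / t) \<in> L2 M"
  using L2_lincomb[OF maps_L2, of t f f "1/t" "-1/t"] by (simp add: diff_divide_distrib)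

lemma generator_inner:
  assumes "L2_tendsto M (\<lambda>t x. (P t f x - f x) / t) Lf (at_right 0)" "f \<in> L2 M" "Lf \<in> L2 M" "g \<in> L2 M"
  shows "((\<lambda>t. \<integral>x. (P t f x - f x) / t * g x \<partial>M) \<longlongrightarrow> (\<integral>x. Lf x * g x \<partial>M)) (at_right 0)"
proof (rule L2_tendsto_inner_eventually[OF assms(1) _ assms(3,4)])
  show "\<forall>\<^sub>F t in at_right 0. (\<lambda>x. (P t f x - f x) / t) \<in> L2 M"
    unfolding eventually_at_right_field using assms(2)
    by (intro exI[of _ 1]) (auto intro: difference_quotient_L2)
qed

text \<open>Reversibility makes the pairings with the difference quotients agree for each t > 0; the
  limit t to 0 keeps this.\<close>

lemma generator_symmetric:
  assumes f: "L2_tendsto M (\<lambda>t x. (P t f x - f x) / t) Lf (at_right 0)" "f \<in> L2 M" "Lf \<in> L2 M"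
    and g: "L2_tendsto M (\<lambda>t x. (P t g x - g x) / t) Lg (at_right 0)" "g \<in> L2 M" "Lg \<in> L2 M"
  shows "(\<integral>x. f x * Lg x \<partial>M) = (\<integral>x. Lf x * g x \<partial>M)"
proof -
  have 1: "((\<lambda>t. \<integral>x. (P t f x - f x) / t * g x \<partial>M) \<longlongrightarrow> (\<integral>x. Lf x * g x \<partial>M)) (at_right 0)"
    by (rule generator_inner[OF f g(2)])
  have 2: "((\<lambda>t. \<integral>x. (P t g x - g x) / t * f x \<partial>M) \<longlongrightarrow> (\<integral>x. Lg x * f x \<partial>M)) (at_right 0)"
    by (rule generator_inner[OF g f(2)])
  have "\<forall>\<^sub>F t in at_right 0. (\<integral>x. (P t f x - f x) / t * g x \<partial>M) = (\<integral>x. (P t g x - g x) / t * f x \<partial>M)"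
    unfolding eventually_at_right_field
  proof (intro exI[of _ 1] conjI allI impI)
    fix t :: real assume t: "0 < t"
    have i: "integrable M (\<lambda>x. P t f x * g x)" "integrable M (\<lambda>x. P t g x * f x)"
      "integrable M (\<lambda>x. f x * g x)"
      using t f(2) g(2) by (auto intro!: L2_mult_integrable maps_L2)
    have "(\<integral>x. (P t f x - f x) / t * g x \<partial>M) = (\<integral>x. (P t f x * g x - f x * g x) / t \<partial>M)"
      by (simp add: left_diff_distrib)
    also have "\<dots> = ((\<integral>x. P t f x * g x \<partial>M) - (\<integral>x. f x * g x \<partial>M)) / t"
      using i by simp
    also have "(\<integral>x. P t f x * g x \<partial>M) = (\<integral>x. P t g x * f x \<partial>M)"
      using reversible[of t f g] t f(2) g(2) by (simp add: mult.commute)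
    also have "((\<integral>x. P t g x * f x \<partial>M) - (\<integral>x. f x * g x \<partial>M)) / t = (\<integral>x. (P t g x * f x - f x * g x) / t \<partial>M)"
      using i by simp
    also have "\<dots> = (\<integral>x. (P t g x - g x) / t * f x \<partial>M)"
      by (simp add: algebra_simps)
    finally show "(\<integral>x. (P t f x - f x) / t * g x \<partial>M) = (\<integral>x. (P t g x - g x) / t * f x \<partial>M)" .
  qed auto
  then have "((\<lambda>t. \<integral>x. (P t g x - g x) / t * f x \<partial>M) \<longlongrightarrow> (\<integral>x. Lf x * g x \<partial>M)) (at_right 0)"
    by (rule Lim_transform_eventually[OF 1])
  then have "(\<integral>x. Lf x * g x \<partial>M) = (\<integral>x. Lg x * f x \<partial>M)"
    using 2 by (intro tendsto_unique[of "at_right (0::real)"]) auto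
  then show ?thesis by (simp add: mult.commute)
qed

text \<open>The difference quotients obtained from \<open>semigroup_square\<close> are nonnegative,
  but they contain the product of \<open>f\<close> with a quotient, which need not converge in L2.
  The limit is therefore taken after testing against the indicator of the set where the claim
  fails.\<close>

lemma generator_square:
  assumes f: "L2_tendsto M (\<lambda>t x. (P t f x - f x) / t) Lf (at_right 0)" "f \<in> L2 M" "Lf \<in> L2 M"
    and g: "L2_tendsto M (\<lambda>t x. (P t (\<lambda>x. (f x)\<^sup>2) x - (f x)\<^sup>2) / t) Lg (at_right 0)"
      "(\<lambda>x. (f x)\<^sup>2) \<in> L2 M" "Lg \<in> L2 M"
  shows "AE x in M. 0 \<le> Lg x - 2 * f x * Lf x"
proof -
  have [measurable]: "f \<in> borel_measurable M" "Lf \<in> borel_measurable M" "Lg \<in> borel_measurable M"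
    using f g L2_measurable by blast+
  define w where "w = (\<lambda>x. Lg x - 2 * f x * Lf x)"
  \<comment> \<open>A bounded weight: 2 f \<eta> is still in L2 and can be paired with the quotients
    of \<open>f\<close>.\<close>
  define \<eta> where "\<eta> = (indicator {x \<in> space M. w x < 0} :: 'a \<Rightarrow> real)"
  have [measurable]: "w \<in> borel_measurable M" "\<eta> \<in> borel_measurable M"
    unfolding w_def \<eta>_def by measurable
  have \<eta>01: "\<eta> x = 0 \<or> \<eta> x = 1" for x
    by (auto simp: \<eta>_def indicator_def)
  have \<eta>L2: "\<eta> \<in> L2 M"
  proof -
    have "integrable M (\<lambda>x. (\<eta> x)\<^sup>2)"
    proof (rule Bochner_Integration.integrable_bound[OF integrable_const[of "1::real"]])
      show "AE x in M. norm ((\<eta> x)\<^sup>2) \<le> norm (1::real)"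
      proof (rule AE_I2)
        fix x show "norm ((\<eta> x)\<^sup>2) \<le> norm (1::real)"
          using \<eta>01[of x] by auto
      qed
    qed measurable
    then show ?thesis by (simp add: L2_def)
  qed
  have f\<eta>L2: "(\<lambda>x. 2 * f x * \<eta> x) \<in> L2 M"
  proof -
    have "integrable M (\<lambda>x. (2 * f x * \<eta> x)\<^sup>2)"
    proof (rule Bochner_Integration.integrable_bound)
      show "integrable M (\<lambda>x. 4 * (f x)\<^sup>2)" using f(2) by (simp add: L2_def)
      show "AE x in M. norm ((2 * f x * \<eta> x)\<^sup>2) \<le> norm (4 * (f x)\<^sup>2)"
      proof (rule AE_I2)
        fix x show "norm ((2 * f x * \<eta> x)\<^sup>2) \<le> norm (4 * (f x)\<^sup>2)"
          using \<eta>01[of x] by (auto simp: power_mult_distrib)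
      qed
    qed measurable
    then show ?thesis by (simp add: L2_def)
  qed
  have 1: "((\<lambda>t. \<integral>x. (P t f x - f x) / t * (2 * f x * \<eta> x) \<partial>M) \<longlongrightarrow> (\<integral>x. Lf x * (2 * f x * \<eta> x) \<partial>M)) (at_right 0)"
    by (rule generator_inner[OF f f\<eta>L2])
  have 2: "((\<lambda>t. \<integral>x. (P t (\<lambda>x. (f x)\<^sup>2) x - (f x)\<^sup>2) / t * \<eta> x \<partial>M) \<longlongrightarrow> (\<integral>x. Lg x * \<eta> x \<partial>M)) (at_right 0)"
    by (rule generator_inner[OF g \<eta>L2])
  have "0 \<le> (\<integral>x. Lg x * \<eta> x \<partial>M) - (\<integral>x. Lf x * (2 * f x * \<eta> x) \<partial>M)"
  proof (rule tendsto_lowerbound[OF tendsto_diff[OF 2 1]])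
    show "\<forall>\<^sub>F t in at_right 0. 0 \<le> (\<integral>x. (P t (\<lambda>x. (f x)\<^sup>2) x - (f x)\<^sup>2) / t * \<eta> x \<partial>M) -
        (\<integral>x. (P t f x - f x) / t * (2 * f x * \<eta> x) \<partial>M)"
      unfolding eventually_at_right_field
    proof (intro exI[of _ 1] conjI allI impI)
      fix t :: real assume t: "0 < t"
      have "(\<integral>x. (P t (\<lambda>x. (f x)\<^sup>2) x - (f x)\<^sup>2) / t * \<eta> x \<partial>M) -
        (\<integral>x. (P t f x - f x) / t * (2 * f x * \<eta> x) \<partial>M) =
        (\<integral>x. (P t (\<lambda>x. (f x)\<^sup>2) x - (f x)\<^sup>2) / t * \<eta> x - (P t f x - f x) / t * (2 * f x * \<eta> x) \<partial>M)"
        using t f g \<eta>L2 f\<eta>L2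
        by (intro Bochner_Integration.integral_diff[symmetric] L2_mult_integrable difference_quotient_L2) auto
      also have "0 \<le> \<dots>"
      proof (rule integral_nonneg_AE)
        show "AE x in M. 0 \<le> (P t (\<lambda>x. (f x)\<^sup>2) x - (f x)\<^sup>2) / t * \<eta> x - (P t f x - f x) / t * (2 * f x * \<eta> x)"
          using semigroup_square[OF less_imp_le[OF t] f(2) g(2)]
        proof eventually_elim
          case (elim x)
          have "(P t (\<lambda>x. (f x)\<^sup>2) x - (f x)\<^sup>2) / t * \<eta> x - (P t f x - f x) / t * (2 * f x * \<eta> x) =
            \<eta> x / t * (P t (\<lambda>y. (f y)\<^sup>2) x - 2 * f x * P t f x + (f x)\<^sup>2)"
            using t by (simp add: field_simps power2_eq_square)
          moreover have "0 \<le> \<eta> x / t" using t \<eta>01[of x] by auto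
          ultimately show ?case using elim by (simp only: mult_nonneg_nonneg)
        qed
      qed
      finally show "0 \<le> (\<integral>x. (P t (\<lambda>x. (f x)\<^sup>2) x - (f x)\<^sup>2) / t * \<eta> x \<partial>M) -
        (\<integral>x. (P t f x - f x) / t * (2 * f x * \<eta> x) \<partial>M)" .
    qed auto
  qed simp
  also have "(\<integral>x. Lg x * \<eta> x \<partial>M) - (\<integral>x. Lf x * (2 * f x * \<eta> x) \<partial>M) = (\<integral>x. w x * \<eta> x \<partial>M)"
    by (subst Bochner_Integration.integral_diff[symmetric])
      (use f g \<eta>L2 f\<eta>L2 in \<open>auto intro!: L2_mult_integrable simp: w_def algebra_simps\<close>)
  finally have w0: "0 \<le> (\<integral>x. w x * \<eta> x \<partial>M)" .
  have wi: "integrable M (\<lambda>x. - (w x * \<eta> x))"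
  proof -
    have "integrable M (\<lambda>x. Lf x * (2 * f x * \<eta> x) - Lg x * \<eta> x)"
      using f g \<eta>L2 f\<eta>L2 by (intro Bochner_Integration.integrable_diff L2_mult_integrable)
    then show ?thesis by (simp add: w_def algebra_simps)
  qed
  have wn: "AE x in M. 0 \<le> - (w x * \<eta> x)"
    by (intro AE_I2) (auto simp: \<eta>_def indicator_def)
  have "(\<integral>x. - (w x * \<eta> x) \<partial>M) = 0"
    using w0 integral_nonneg_AE[OF wn] by simp
  then have "AE x in M. - (w x * \<eta> x) = 0"
    using integral_nonneg_eq_0_iff_AE[OF wi wn] by simp
  moreover have "AE x in M. x \<in> space M" by simp
  ultimately show ?thesis
    by eventually_elim (auto simp: \<eta>_def indicator_def w_def split: if_splits)
qed

end

lemma markov_diffusionI: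
  assumes "symmetric_markov_operator M D L" "diffusion_property M D L" "diagonalisable M D L lam"
    "product_stable M D L lam"
  shows "markov_diffusion M D L lam"
proof -
  obtain P where P: "symmetric_markov_semigroup M P"
    and gen: "\<And>f. f \<in> D \<Longrightarrow> L2_tendsto M (\<lambda>t x. (P t f x - f x) / t) (L f) (at_right 0)"
    using assms(1) unfolding symmetric_markov_operator_def by blast
  interpret symmetric_markov_semigroup M P by fact
  have D: "D \<subseteq> L2 M" "\<And>f. f \<in> D \<Longrightarrow> L f \<in> L2 M"
    using assms(1) unfolding symmetric_markov_operator_def by blast+
  show ?thesis
  proof
    fix f g assume "f \<in> D" "g \<in> D"
    then show "(\<integral>x. f x * L g x \<partial>M) = (\<integral>x. L f x * g x \<partial>M)"
      using D by (intro generator_symmetric gen) auto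
  next
    fix f assume "f \<in> D" "(\<lambda>x. (f x)\<^sup>2) \<in> D"
    then show "AE x in M. 0 \<le> L (\<lambda>y. (f y)\<^sup>2) x - 2 * f x * L f x"
      using D by (intro generator_square gen) auto
  qed (use assms in \<open>auto simp: symmetric_markov_operator_def\<close>)
qed

section \<open>Hypercontractivity\<close>

lemma (in prob_space) l2_const: "l2 M (\<lambda>x. c) = \<bar>c\<bar>"
  by (simp add: l2_def prob_space)

lemma (in prob_space) integral_abs_le_l2:
  assumes "f \<in> L2 M"
  shows "integrable M (\<lambda>x. \<bar>f x\<bar>)" "(\<integral>x. \<bar>f x\<bar> \<partial>M) \<le> l2 M f"
proof -
  have one: "(\<lambda>x. 1) \<in> L2 M" by (simp add: L2_def)
  have a: "(\<lambda>x. \<bar>f x\<bar>) \<in> L2 M" using assms by (auto simp: L2_def)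
  show "integrable M (\<lambda>x. \<bar>f x\<bar>)" using L2_mult_integrable[OF a one] by simp
  have "l2 M (\<lambda>x. \<bar>f x\<bar>) = l2 M f" by (simp add: l2_def)
  then show "(\<integral>x. \<bar>f x\<bar> \<partial>M) \<le> l2 M f"
    using Cauchy_Schwarz_L2[OF a one] by (simp add: l2_const)
qed

text \<open>The increments are summable in L1, so the sum of their absolute values is finite almost
  everywhere.\<close>

lemma (in prob_space) L2_AE_convergent:
  assumes xs: "\<And>n. xs n \<in> L2 M" and step: "\<And>n. l2 M (\<lambda>y. xs (Suc n) y - xs n y) \<le> (1/2) ^ n"
  shows "AE y in M. convergent (\<lambda>n. xs n y)"
proof -
  define d where "d n y = \<bar>xs (Suc n) y - xs n y\<bar>" for n y
  have dm [measurable]: "d n \<in> borel_measurable M" for n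
    unfolding d_def using xs[THEN L2_measurable] by measurable
  have "(\<integral>\<^sup>+y. ennreal (d n y) \<partial>M) \<le> ennreal ((1/2) ^ n)" for n
  proof -
    note * = integral_abs_le_l2[OF L2_diff[OF xs[of "Suc n"] xs[of n]], folded d_def]
    have "(\<integral>\<^sup>+y. ennreal (d n y) \<partial>M) = ennreal (\<integral>y. d n y \<partial>M)"
      using * by (intro nn_integral_eq_integral) (auto simp: d_def)
    also have "\<dots> \<le> ennreal ((1/2) ^ n)"
      using *(2) step[of n] by (intro ennreal_leI) linarith
    finally show ?thesis .
  qed
  then have "(\<Sum>n. \<integral>\<^sup>+y. ennreal (d n y) \<partial>M) \<le> (\<Sum>n. ennreal ((1/2) ^ n))"
    by (intro suminf_le) auto
  also have "\<dots> = ennreal (\<Sum>n. (1/2) ^ n)"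
    by (intro suminf_ennreal2) (auto intro!: summable_geometric)
  finally have "(\<integral>\<^sup>+y. (\<Sum>n. ennreal (d n y)) \<partial>M) \<noteq> \<infinity>"
    by (subst nn_integral_suminf) (auto simp: top_unique)
  then have "AE y in M. (\<Sum>n. ennreal (d n y)) \<noteq> \<infinity>"
    by (intro nn_integral_PInf_AE) auto
  then show ?thesis
  proof eventually_elim
    case (elim y)
    have "summable (\<lambda>n. d n y)"
      using elim by (intro summable_suminf_not_top) (auto simp: d_def)
    then have "summable (\<lambda>n. xs (Suc n) y - xs n y)"
      unfolding d_def by (rule summable_rabs_cancel)
    then have "convergent (\<lambda>n. \<Sum>i<n. xs (Suc i) y - xs i y)"
      by (simp add: summable_iff_convergent)
    moreover have "(\<Sum>i<n. xs (Suc i) y - xs i y) = xs n y - xs 0 y" for n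
      by (rule sum_lessThan_telescope)
    ultimately have "convergent (\<lambda>n. (xs n y - xs 0 y) + xs 0 y)"
      by (intro convergent_add convergent_const) simp
    then show ?case by simp
  qed
qed

text \<open>Fatou's lemma carries the rate over to the limit. The rate is part of the conclusion
  because the limit will have to lie in each of a sequence of nested balls.\<close>

lemma (in prob_space) L2_complete:
  assumes xs: "\<And>n. xs n \<in> L2 M" and r: "\<And>n. r n \<le> (1/2) ^ n"
    and cauchy: "\<And>m n. n \<le> m \<Longrightarrow> l2 M (\<lambda>y. xs m y - xs n y) \<le> r n"
  obtains x where "x \<in> L2 M" "\<And>n. l2 M (\<lambda>y. x y - xs n y) \<le> r n"
proof -
  have [measurable]: "xs n \<in> borel_measurable M" for n
    using xs L2_measurable by blast
  have r0: "0 \<le> r n" for n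
    using cauchy[of n n] l2_nonneg[of M "\<lambda>y. xs n y - xs n y"] by linarith
  have conv: "AE y in M. convergent (\<lambda>n. xs n y)"
  proof (rule L2_AE_convergent[OF xs])
    show "l2 M (\<lambda>y. xs (Suc n) y - xs n y) \<le> (1/2) ^ n" for n
      using cauchy[of n "Suc n"] r[of n] by simp
  qed
  define x where "x y = lim (\<lambda>n. xs n y)" for y
  have [measurable]: "x \<in> borel_measurable M"
    unfolding x_def by measurable
  have bound: "(\<integral>\<^sup>+y. ennreal ((x y - xs n y)\<^sup>2) \<partial>M) \<le> ennreal ((r n)\<^sup>2)" for n
  proof -
    have "AE y in M. ennreal ((x y - xs n y)\<^sup>2) = liminf (\<lambda>m. ennreal ((xs m y - xs n y)\<^sup>2))"
      using conv
    proof eventually_elim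
      case (elim y)
      have "(\<lambda>m. xs m y) \<longlonglongrightarrow> x y"
        using elim unfolding x_def by (simp add: convergent_LIMSEQ_iff)
      then have "(\<lambda>m. ennreal ((xs m y - xs n y)\<^sup>2)) \<longlonglongrightarrow> ennreal ((x y - xs n y)\<^sup>2)"
        by (intro tendsto_intros tendsto_ennrealI)
      then show ?case
        by (intro lim_imp_Liminf[symmetric]) auto
    qed
    then have "(\<integral>\<^sup>+y. ennreal ((x y - xs n y)\<^sup>2) \<partial>M) = (\<integral>\<^sup>+y. liminf (\<lambda>m. ennreal ((xs m y - xs n y)\<^sup>2)) \<partial>M)"
      by (rule nn_integral_cong_AE)
    also have "\<dots> \<le> liminf (\<lambda>m. \<integral>\<^sup>+y. ennreal ((xs m y - xs n y)\<^sup>2) \<partial>M)"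
      by (rule nn_integral_liminf) measurable
    also have "\<dots> \<le> ennreal ((r n)\<^sup>2)"
    proof (rule Liminf_le)
      show "\<forall>\<^sub>F m in sequentially. (\<integral>\<^sup>+y. ennreal ((xs m y - xs n y)\<^sup>2) \<partial>M) \<le> ennreal ((r n)\<^sup>2)"
        using eventually_ge_at_top[of n]
      proof eventually_elim
        case (elim m)
        have "(\<integral>\<^sup>+y. ennreal ((xs m y - xs n y)\<^sup>2) \<partial>M) = ennreal ((l2 M (\<lambda>y. xs m y - xs n y))\<^sup>2)"
          unfolding l2_sq by (rule nn_integral_eq_integral[OF L2_integrable_sq[OF L2_diff[OF xs xs]]]) auto
        also have "\<dots> \<le> ennreal ((r n)\<^sup>2)"
          using cauchy[OF elim] by (intro ennreal_leI power_mono) auto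
        finally show ?case .
      qed
    qed auto
    finally show ?thesis .
  qed
  have int: "integrable M (\<lambda>y. (x y - xs n y)\<^sup>2)" for n
    by (rule integrableI_bounded) (use bound[of n] in \<open>auto simp: top_unique less_top intro: le_less_trans\<close>)
  have dL2: "(\<lambda>y. x y - xs n y) \<in> L2 M" for n
    using int by (simp add: L2_def)
  have "x \<in> L2 M"
    using L2_add[OF dL2[of 0] xs[of 0]] by simp
  moreover have "l2 M (\<lambda>y. x y - xs n y) \<le> r n" for n
  proof -
    have "ennreal (\<integral>y. (x y - xs n y)\<^sup>2 \<partial>M) \<le> ennreal ((r n)\<^sup>2)"
      using bound[of n] nn_integral_eq_integral[OF int[of n]] by simp
    then have "(l2 M (\<lambda>y. x y - xs n y))\<^sup>2 \<le> (r n)\<^sup>2"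
      by (simp add: l2_sq)
    then show ?thesis
      using r0[of n] by (rule power2_le_imp_le)
  qed
  ultimately show ?thesis using that by blast
qed

section \<open>Fourth moments of finite spectral sums\<close>

definition clip :: "real \<Rightarrow> real \<Rightarrow> real" where
  "clip R t = max (- R) (min R t)"

lemma clip_measurable [measurable]: "clip R \<in> borel_measurable borel"
  unfolding clip_def by measurable

lemma clip_fourth_le: "R \<ge> 0 \<Longrightarrow> (clip R t) ^ 4 \<le> t ^ 4"
proof -
  assume "R \<ge> 0"
  then have "\<bar>clip R t\<bar> \<le> \<bar>t\<bar>" by (auto simp: clip_def)
  then have "\<bar>clip R t\<bar> ^ 4 \<le> \<bar>t\<bar> ^ 4" by (rule power_mono) simp
  then show ?thesis by simp
qed

lemma clip_fourth_Lipschitz: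
  assumes "R \<ge> 0"
  shows "(clip R a) ^ 4 - (clip R b) ^ 4 \<le> 4 * R ^ 3 * \<bar>a - b\<bar>"
proof -
  let ?a = "clip R a" and ?b = "clip R b"
  have ab: "\<bar>?a\<bar> \<le> R" "\<bar>?b\<bar> \<le> R"
    using assms by (auto simp: clip_def)
  have ab': "\<bar>?a - ?b\<bar> \<le> \<bar>a - b\<bar>"
    using assms unfolding clip_def max_def min_def by (simp split: if_split)
  have "?a ^ 4 - ?b ^ 4 = (?a - ?b) * ((?a + ?b) * (?a\<^sup>2 + ?b\<^sup>2))"
    by (simp add: power4_eq_xxxx power2_eq_square algebra_simps)
  also have "\<dots> \<le> \<bar>?a - ?b\<bar> * (\<bar>?a + ?b\<bar> * (?a\<^sup>2 + ?b\<^sup>2))"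
    by (rule order_trans[OF abs_ge_self]) (simp only: abs_mult abs_of_nonneg[OF sum_power2_ge_zero] order_refl)
  also have "\<dots> \<le> \<bar>a - b\<bar> * ((2 * R) * (R\<^sup>2 + R\<^sup>2))"
  proof (intro mult_mono add_mono)
    show "?a\<^sup>2 \<le> R\<^sup>2" "?b\<^sup>2 \<le> R\<^sup>2" using ab assms by (auto simp: abs_le_square_iff[symmetric])
  qed (use ab ab' assms in auto)
  also have "\<dots> = 4 * R ^ 3 * \<bar>a - b\<bar>"
    by (simp add: power2_eq_square power3_eq_cube)
  finally show ?thesis .
qed

context prob_space
begin

lemma clip_fourth_integrable:
  assumes "f \<in> borel_measurable M" "R \<ge> 0"
  shows "integrable M (\<lambda>x. (clip R (f x)) ^ 4)"
proof (rule Bochner_Integration.integrable_bound[OF integrable_const[of "R ^ 4"]])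
  show "AE x in M. norm (clip R (f x) ^ 4) \<le> norm (R ^ 4)"
  proof (rule AE_I2)
    fix x
    have "\<bar>clip R (f x)\<bar> \<le> R" using assms(2) by (auto simp: clip_def)
    then have "\<bar>clip R (f x)\<bar> ^ 4 \<le> R ^ 4" by (rule power_mono) simp
    then show "norm (clip R (f x) ^ 4) \<le> norm (R ^ 4)" by simp
  qed
qed (use assms in measurable)

text \<open>The fourth moment need not be continuous in L2, but it is the limit from below of the
  moments of the truncations, which are Lipschitz. It is thus lower semicontinuous, and the set
  where it exceeds \<open>K\<close> is open.\<close>

lemma fourth_moment_L2_open:
  assumes x: "x \<in> all_moments M" and K: "(\<integral>y. x y ^ 4 \<partial>M) > K"
  obtains \<delta> where "\<delta> > 0"
    "\<And>z. z \<in> all_moments M \<Longrightarrow> l2 M (\<lambda>y. z y - x y) \<le> \<delta> \<Longrightarrow> (\<integral>y. z y ^ 4 \<partial>M) > K"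
proof -
  have x4: "integrable M (\<lambda>y. x y ^ 4)"
    using x by (intro all_moments_integrable all_moments_intros)
  have "(\<lambda>n. \<integral>y. (clip (real n) (x y)) ^ 4 \<partial>M) \<longlonglongrightarrow> (\<integral>y. x y ^ 4 \<partial>M)"
  proof (rule integral_dominated_convergence[where w = "\<lambda>y. x y ^ 4"])
    show "AE y in M. (\<lambda>n. clip (real n) (x y) ^ 4) \<longlonglongrightarrow> x y ^ 4"
    proof (rule AE_I2, rule tendsto_eventually)
      fix y
      show "\<forall>\<^sub>F n in sequentially. clip (real n) (x y) ^ 4 = x y ^ 4"
        using eventually_ge_at_top[of "nat \<lceil>\<bar>x y\<bar>\<rceil>"]
      proof eventually_elim
        case (elim n)
        then have "\<bar>x y\<bar> \<le> real n" by linarith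
        then have "clip (real n) (x y) = x y" by (auto simp: clip_def)
        then show ?case by simp
      qed
    qed
    show "AE y in M. norm (clip (real n) (x y) ^ 4) \<le> x y ^ 4" for n
      using clip_fourth_le[of "real n"] by auto
  qed (use x x4 in measurable)
  then have "\<forall>\<^sub>F n in sequentially. (\<integral>y. (clip (real n) (x y)) ^ 4 \<partial>M) > K"
    using K order_tendstoD(1) by blast
  then have "\<forall>\<^sub>F n in sequentially. n > 0 \<and> (\<integral>y. (clip (real n) (x y)) ^ 4 \<partial>M) > K"
    using eventually_gt_at_top[of 0] by eventually_elim auto
  then obtain n where n: "n > 0" "(\<integral>y. (clip (real n) (x y)) ^ 4 \<partial>M) > K"
    using eventually_happens'[OF sequentially_bot] by blast
  define I where "I = (\<integral>y. (clip (real n) (x y)) ^ 4 \<partial>M)"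
  \<comment> \<open>The truncated moment has Lipschitz constant 4 n^3, so a distance of at most
    \<delta> costs half of the excess \<open>I - K\<close>.\<close>
  define \<delta> where "\<delta> = (I - K) / (8 * real n ^ 3)"
  have \<delta>: "\<delta> > 0" using n by (simp add: \<delta>_def I_def)
  have \<delta>8: "4 * real n ^ 3 * \<delta> = (I - K) / 2" using n(1) by (simp add: \<delta>_def)
  show ?thesis
  proof (rule that[OF \<delta>])
    fix z assume z: "z \<in> all_moments M" and d: "l2 M (\<lambda>y. z y - x y) \<le> \<delta>"
    have zx: "(\<lambda>y. x y - z y) \<in> L2 M"
      using x z by (intro L2_diff all_moments_L2)
    have ci: "integrable M (\<lambda>y. (clip (real n) (x y)) ^ 4)" "integrable M (\<lambda>y. (clip (real n) (z y)) ^ 4)"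
      using x z by (auto intro!: clip_fourth_integrable)
    have "I - (\<integral>y. (clip (real n) (z y)) ^ 4 \<partial>M) = (\<integral>y. (clip (real n) (x y)) ^ 4 - (clip (real n) (z y)) ^ 4 \<partial>M)"
      unfolding I_def using ci by simp
    also have "\<dots> \<le> (\<integral>y. 4 * real n ^ 3 * \<bar>x y - z y\<bar> \<partial>M)"
      using ci integral_abs_le_l2[OF zx] clip_fourth_Lipschitz[of "real n"]
      by (intro integral_mono) auto
    also have "\<dots> = 4 * real n ^ 3 * (\<integral>y. \<bar>x y - z y\<bar> \<partial>M)"
      by simp
    also have "\<dots> \<le> 4 * real n ^ 3 * \<delta>"
      using integral_abs_le_l2(2)[OF zx] d l2_minus_commute[of M x z] by (intro mult_left_mono) auto
    finally have "(\<integral>y. (clip (real n) (z y)) ^ 4 \<partial>M) \<ge> I - (I - K) / 2"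
      unfolding \<delta>8 by linarith
    also have "(\<integral>y. (clip (real n) (z y)) ^ 4 \<partial>M) \<le> (\<integral>y. z y ^ 4 \<partial>M)"
      using ci all_moments_integrable[OF all_moments_power[OF z, of 4]] clip_fourth_le[of "real n"]
      by (intro integral_mono) auto
    finally show "(\<integral>y. z y ^ 4 \<partial>M) > K"
      using n(2) by (simp add: I_def field_simps)
  qed
qed

end

context markov_diffusion
begin

text \<open>The density half of the category argument: every ball contains a smaller one on which
  the fourth moment exceeds \<open>K\<close>. Unboundedness on the unit sphere provides F, and one
  of x + c F and x - c F is the new centre, because their fourth powers add up to at least 2 (c
  F)^4.\<close>

lemma fourth_moment_step:
  assumes unb: "\<And>K. \<exists>F\<in>A N. l2 M F = 1 \<and> (\<integral>y. F y ^ 4 \<partial>M) > K"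
    and x: "x \<in> A N" "r > 0"
  obtains x' r' where "x' \<in> A N" "r' > 0" "r' \<le> r / 2" "l2 M (\<lambda>y. x' y - x y) \<le> r / 2"
    "\<And>z. z \<in> A N \<Longrightarrow> l2 M (\<lambda>y. z y - x' y) \<le> r' \<Longrightarrow> (\<integral>y. z y ^ 4 \<partial>M) > K"
proof -
  obtain F where F: "F \<in> A N" "l2 M F = 1" "(\<integral>y. F y ^ 4 \<partial>M) > K / (r / 2) ^ 4"
    using unb by blast
  have key: "\<exists>s. \<bar>s\<bar> = r / 2 \<and> (\<integral>y. (x y + s * F y) ^ 4 \<partial>M) > K"
  proof (rule ccontr)
    assume c: "\<not> ?thesis"
    let ?c = "r / 2"
    have am: "x \<in> all_moments M" "F \<in> all_moments M" using x F A_all_moments by auto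
    have i: "integrable M (\<lambda>y. (x y + s * F y) ^ 4)" for s
      using am by (intro all_moments_integrable all_moments_intros)
    have "(\<integral>y. (x y + s * F y) ^ 4 \<partial>M) \<le> K" if "\<bar>s\<bar> = ?c" for s
      using c that by (meson not_less)
    from this[of ?c] this[of "- ?c"]
    have "(\<integral>y. (x y + ?c * F y) ^ 4 \<partial>M) \<le> K" "(\<integral>y. (x y + (- ?c) * F y) ^ 4 \<partial>M) \<le> K"
      using x(2) by auto
    then have "(\<integral>y. (x y + ?c * F y) ^ 4 + (x y + (- ?c) * F y) ^ 4 \<partial>M) \<le> 2 * K"
      by (subst Bochner_Integration.integral_add[OF i i]) simp
    moreover have "(\<integral>y. 2 * (?c * F y) ^ 4 \<partial>M) \<le> (\<integral>y. (x y + ?c * F y) ^ 4 + (x y + (- ?c) * F y) ^ 4 \<partial>M)"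
    proof (rule integral_mono)
      show "integrable M (\<lambda>y. 2 * (?c * F y) ^ 4)"
        using am by (intro all_moments_integrable all_moments_intros)
      show "integrable M (\<lambda>y. (x y + ?c * F y) ^ 4 + (x y + (- ?c) * F y) ^ 4)"
        by (intro Bochner_Integration.integrable_add i)
      fix y
      have "(a + b) ^ 4 + (a + - b) ^ 4 = 2 * a ^ 4 + 12 * (a * b)\<^sup>2 + 2 * b ^ 4" for a b :: real
        by (simp add: power4_eq_xxxx power2_eq_square algebra_simps)
      moreover have "0 \<le> 2 * a ^ 4 + 12 * (a * b)\<^sup>2" for a b :: real by simp
      ultimately show "2 * (?c * F y) ^ 4 \<le> (x y + ?c * F y) ^ 4 + (x y + (- ?c) * F y) ^ 4"
        by (smt (verit) mult_minus_left)
    qed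
    ultimately have "(\<integral>y. 2 * (?c * F y) ^ 4 \<partial>M) \<le> 2 * K" by linarith
    then have "?c ^ 4 * (\<integral>y. F y ^ 4 \<partial>M) \<le> K"
      unfolding power_mult_distrib by simp
    then show False
      using F(3) x(2) by (simp add: field_simps)
  qed
  then obtain s where s: "\<bar>s\<bar> = r / 2" "(\<integral>y. (x y + s * F y) ^ 4 \<partial>M) > K" by blast
  let ?x = "\<lambda>y. x y + s * F y"
  have xA: "?x \<in> A N" using x F by (intro A_add A_cmult)
  obtain \<delta> where \<delta>: "\<delta> > 0"
    "\<And>z. z \<in> all_moments M \<Longrightarrow> l2 M (\<lambda>y. z y - ?x y) \<le> \<delta> \<Longrightarrow> (\<integral>y. z y ^ 4 \<partial>M) > K"
    using fourth_moment_L2_open[OF A_all_moments[OF xA] s(2)] by metis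
  show ?thesis
  proof (rule that[of ?x "min \<delta> (r / 2)"])
    show "l2 M (\<lambda>y. ?x y - x y) \<le> r / 2"
      using s F(2) by (simp add: l2_cmult)
  qed (use xA \<delta> x A_all_moments in auto)
qed

text \<open>An inclusion of the closed subspace \<open>A N\<close> of \<open>L\<^sup>2\<close> into \<open>L\<^sup>4\<close> is automatically bounded;
  this takes the place of the hypercontractivity of the semigroup.\<close>

lemma hypercontractive_fourth_moment:
  "\<exists>C\<ge>0. \<forall>F\<in>A N. (\<integral>y. F y ^ 4 \<partial>M) \<le> C * (l2 M F) ^ 4"
proof (rule ccontr)
  assume c: "\<not> ?thesis"
  have unb: "\<exists>F\<in>A N. l2 M F = 1 \<and> (\<integral>y. F y ^ 4 \<partial>M) > K" for K
  proof -
    obtain F where F: "F \<in> A N" "(\<integral>y. F y ^ 4 \<partial>M) > \<bar>K\<bar> * (l2 M F) ^ 4"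
      using c by (meson abs_ge_zero not_le)
    have "l2 M F \<noteq> 0"
    proof
      assume "l2 M F = 0"
      then have "AE y in M. F y = 0" using l2_0_iff[OF D_L2'[OF A_D[OF F(1)]]] by simp
      then have "(\<integral>y. F y ^ 4 \<partial>M) = (\<integral>y. 0 \<partial>M)"
        using F(1) by (intro integral_cong_AE) auto
      with F(2) \<open>l2 M F = 0\<close> show False by simp
    qed
    then have l: "l2 M F > 0" using l2_nonneg[of M F] by linarith
    show ?thesis
    proof (intro bexI[of _ "\<lambda>y. (1 / l2 M F) * F y"] conjI)
      show "l2 M (\<lambda>y. 1 / l2 M F * F y) = 1"
        unfolding l2_cmult using l by simp
      have "(\<integral>y. (1 / l2 M F * F y) ^ 4 \<partial>M) = (\<integral>y. F y ^ 4 \<partial>M) / (l2 M F) ^ 4"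
        by (simp add: power_divide)
      also have "\<dots> > \<bar>K\<bar>"
        using F(2) l by (simp add: field_simps)
      finally show "K < (\<integral>y. (1 / l2 M F * F y) ^ 4 \<partial>M)" by linarith
    qed (intro A_cmult F(1))
  qed
  \<comment> \<open>A state is a ball, given by centre and radius; in the n-th ball all elements of
    \<open>A N\<close> have fourth moment above n. At n = 0 nothing is asked of the moments, so the
    construction may start with the unit ball around 0.\<close>
  define P where "P n s \<longleftrightarrow> fst s \<in> A N \<and> snd s > 0 \<and> snd s \<le> (1/2) ^ n \<and>
      (n > 0 \<longrightarrow> (\<forall>z\<in>A N. l2 M (\<lambda>y. z y - fst s y) \<le> snd s \<longrightarrow> (\<integral>y. z y ^ 4 \<partial>M) > real n))"
    for n :: nat and s :: "('a \<Rightarrow> real) \<times> real"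
  define Q where "Q n s t \<longleftrightarrow> snd t \<le> snd s / 2 \<and> l2 M (\<lambda>y. fst t y - fst s y) \<le> snd s / 2"
    for n :: nat and s t :: "('a \<Rightarrow> real) \<times> real"
  have "\<exists>f. \<forall>n. P n (f n) \<and> Q n (f n) (f (Suc n))"
  proof (rule dependent_nat_choice)
    have "P 0 ((\<lambda>y. 0), 1)" by (auto simp: P_def A_const)
    then show "\<exists>s. P 0 s" ..
    fix s n assume s: "P n s"
    obtain x' r' where "x' \<in> A N" "r' > 0" "r' \<le> snd s / 2" "l2 M (\<lambda>y. x' y - fst s y) \<le> snd s / 2"
      "\<And>z. z \<in> A N \<Longrightarrow> l2 M (\<lambda>y. z y - x' y) \<le> r' \<Longrightarrow> (\<integral>y. z y ^ 4 \<partial>M) > real (Suc n)"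
      by (rule fourth_moment_step[OF unb, of "fst s" "snd s" "real (Suc n)"])
        (use s in \<open>auto simp: P_def\<close>)
    then have "P (Suc n) (x', r') \<and> Q n s (x', r')"
      using s by (auto simp: P_def Q_def)
    then show "\<exists>t. P (Suc n) t \<and> Q n s t" ..
  qed
  then obtain f where f: "\<And>n. P n (f n)" "\<And>n. Q n (f n) (f (Suc n))" by blast
  define xs where "xs n = fst (f n)" for n
  define r where "r n = snd (f n)" for n
  have xsA: "xs n \<in> A N" and r0: "r n > 0" "r n \<le> (1/2) ^ n" for n
    using f(1)[of n] by (auto simp: P_def xs_def r_def)
  have big: "z \<in> A N \<Longrightarrow> l2 M (\<lambda>y. z y - xs n y) \<le> r n \<Longrightarrow> n > 0 \<Longrightarrow> (\<integral>y. z y ^ 4 \<partial>M) > real n" for n z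
    using f(1)[of n] by (auto simp: P_def xs_def r_def)
  have step: "r (Suc n) \<le> r n / 2" "l2 M (\<lambda>y. xs (Suc n) y - xs n y) \<le> r n / 2" for n
    using f(2)[of n] by (auto simp: Q_def xs_def r_def)
  have xsL2: "xs n \<in> L2 M" for n using xsA A_D D_L2' by blast
  \<comment> \<open>The radii at least halve, so the increments telescope and the limit stays in
    every one of the balls; its fourth moment would exceed every n.\<close>
  have cauchy: "l2 M (\<lambda>y. xs m y - xs n y) \<le> r n - r m" if "n \<le> m" for m n
    using that
  proof (induction m rule: dec_induct)
    case base
    show ?case by (simp add: l2_def)
  next
    case (step m)
    have "l2 M (\<lambda>y. (xs (Suc m) y - xs m y) + (xs m y - xs n y)) \<le>
        l2 M (\<lambda>y. xs (Suc m) y - xs m y) + l2 M (\<lambda>y. xs m y - xs n y)"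
      by (intro l2_triangle L2_diff xsL2)
    also have "\<dots> \<le> r m / 2 + (r n - r m)"
      using step \<open>\<And>n. l2 M (\<lambda>y. xs (Suc n) y - xs n y) \<le> r n / 2\<close> by (intro add_mono) auto
    also have "\<dots> \<le> r n - r (Suc m)"
      using \<open>\<And>n. r (Suc n) \<le> r n / 2\<close>[of m] by simp
    finally show ?case by simp
  qed
  obtain x where x: "x \<in> L2 M" "\<And>n. l2 M (\<lambda>y. x y - xs n y) \<le> r n"
  proof (rule L2_complete[of xs r])
    show "l2 M (\<lambda>y. xs m y - xs n y) \<le> r n" if "n \<le> m" for m n
      using cauchy[OF that] r0(1)[of m] by simp
  qed (use xsL2 r0 in auto)
  have "x \<in> A N"
  proof (rule A_closed[OF x(1) xsA])
    show "L2_tendsto M xs x sequentially"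
      unfolding L2_tendsto_iff
    proof (rule Lim_null_comparison)
      show "(\<lambda>n. (1/2::real) ^ n) \<longlonglongrightarrow> 0" by (rule LIMSEQ_power_zero) simp
      show "\<forall>\<^sub>F n in sequentially. norm (l2 M (\<lambda>y. xs n y - x y)) \<le> (1/2) ^ n"
      proof (intro always_eventually allI)
        fix n show "norm (l2 M (\<lambda>y. xs n y - x y)) \<le> (1/2) ^ n"
          using x(2)[of n] r0(2)[of n] l2_minus_commute[of M x "xs n"] by simp
      qed
    qed
  qed
  moreover obtain n where "real n > max 1 (\<integral>y. x y ^ 4 \<partial>M)"
    using reals_Archimedean2 by blast
  ultimately show False
    using big[of x n] x(2)[of n] by fastforce
qed

text \<open>Cauchy-Schwarz for F^2 and G^2 reduces the product to the fourth moments of the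
  factors.\<close>

lemma hypercontractive_mult:
  "\<exists>C\<ge>0. \<forall>F\<in>A N. \<forall>G\<in>A N'. l2 M (\<lambda>x. F x * G x) \<le> C * l2 M F * l2 M G"
proof -
  obtain C1 where C1: "C1 \<ge> 0" "\<And>F. F \<in> A N \<Longrightarrow> (\<integral>y. F y ^ 4 \<partial>M) \<le> C1 * (l2 M F) ^ 4"
    using hypercontractive_fourth_moment by meson
  obtain C2 where C2: "C2 \<ge> 0" "\<And>F. F \<in> A N' \<Longrightarrow> (\<integral>y. F y ^ 4 \<partial>M) \<le> C2 * (l2 M F) ^ 4"
    using hypercontractive_fourth_moment by meson
  have sq: "l2 M (\<lambda>x. (F x)\<^sup>2) \<le> sqrt C * (l2 M F)\<^sup>2" if "(\<integral>y. F y ^ 4 \<partial>M) \<le> C * (l2 M F) ^ 4" for F C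
  proof -
    have "l2 M (\<lambda>x. (F x)\<^sup>2) = sqrt (\<integral>y. F y ^ 4 \<partial>M)"
      by (simp add: l2_def flip: power_mult)
    also have "\<dots> \<le> sqrt (C * (l2 M F) ^ 4)"
      using that by (rule real_sqrt_le_mono)
    also have "\<dots> = sqrt C * (l2 M F)\<^sup>2"
      by (simp add: real_sqrt_mult power4_eq_xxxx power2_eq_square)
    finally show ?thesis .
  qed
  show ?thesis
  proof (intro exI[of _ "sqrt (sqrt C1 * sqrt C2)"] conjI ballI)
    fix F G assume F: "F \<in> A N" and G: "G \<in> A N'"
    have "(l2 M (\<lambda>x. F x * G x))\<^sup>2 = (\<integral>x. (F x)\<^sup>2 * (G x)\<^sup>2 \<partial>M)"
      by (simp add: l2_sq power_mult_distrib)
    also have "\<dots> \<le> l2 M (\<lambda>x. (F x)\<^sup>2) * l2 M (\<lambda>x. (G x)\<^sup>2)"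
      using Cauchy_Schwarz_L2[of "\<lambda>x. (F x)\<^sup>2" M "\<lambda>x. (G x)\<^sup>2"] F G
      by (simp add: abs_le_iff D_L2' D_power A_D)
    also have "\<dots> \<le> (sqrt C1 * (l2 M F)\<^sup>2) * (sqrt C2 * (l2 M G)\<^sup>2)"
      using C1 C2 F G by (intro mult_mono sq) auto
    also have "\<dots> = (sqrt (sqrt C1 * sqrt C2) * l2 M F * l2 M G)\<^sup>2"
      using C1 C2 by (simp add: power_mult_distrib)
    finally show "l2 M (\<lambda>x. F x * G x) \<le> sqrt (sqrt C1 * sqrt C2) * l2 M F * l2 M G"
      by (rule power2_le_imp_le) (use C1 C2 in auto)
  qed (use C1 C2 in auto)
qed

lemma hypercontractive_power:
  "\<exists>C\<ge>0. \<forall>F\<in>A N. l2 M (\<lambda>x. F x ^ n) \<le> C * (l2 M F) ^ n"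
proof (induction n)
  case 0
  then show ?case by (auto simp: l2_const intro!: exI[of _ 1])
next
  case (Suc n)
  then obtain C where C: "C \<ge> 0" "\<And>F. F \<in> A N \<Longrightarrow> l2 M (\<lambda>x. F x ^ n) \<le> C * (l2 M F) ^ n"
    by blast
  obtain C' where C': "C' \<ge> 0"
    "\<And>F G. F \<in> A N \<Longrightarrow> G \<in> A (n * N) \<Longrightarrow> l2 M (\<lambda>x. F x * G x) \<le> C' * l2 M F * l2 M G"
    using hypercontractive_mult by meson
  show ?case
  proof (intro exI[of _ "C' * C"] conjI ballI)
    fix F assume F: "F \<in> A N"
    have "l2 M (\<lambda>x. F x * F x ^ n) \<le> C' * l2 M F * l2 M (\<lambda>x. F x ^ n)"
      using F by (intro C' A_power)
    also have "\<dots> \<le> C' * l2 M F * (C * (l2 M F) ^ n)"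
      using F C C' by (intro mult_left_mono) auto
    finally show "l2 M (\<lambda>x. F x ^ Suc n) \<le> C' * C * (l2 M F) ^ Suc n"
      by (simp add: mult_ac)
  qed (use C C' in auto)
qed

end

section \<open>Gaussian measure and the Stein equation\<close>

abbreviation gauss :: "real measure" where
  "gauss \<equiv> density lborel (\<lambda>x. ennreal (std_normal_density x))"

lemma prob_space_gauss: "prob_space gauss"
  by (rule prob_space_normal_density) simp

interpretation gauss: prob_space gauss
  by (rule prob_space_gauss)

lemma integral_gauss:
  fixes f :: "real \<Rightarrow> real"
  assumes "f \<in> borel_measurable borel"
  shows "(\<integral>x. f x \<partial>gauss) = (\<integral>x. std_normal_density x * f x \<partial>lborel)"
  using assms by (subst integral_density) auto

lemma integrable_gauss:
  fixes f :: "real \<Rightarrow> real"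
  assumes "f \<in> borel_measurable borel"
  shows "integrable gauss f \<longleftrightarrow> integrable lborel (\<lambda>x. std_normal_density x * f x)"
  using assms by (subst integrable_density) auto

lemma all_moments_gauss_ident: "(\<lambda>x. x) \<in> all_moments gauss"
  using integrable_std_normal_moment_abs by (auto simp: all_moments_def integrable_gauss)

lemma all_moments_gauss:
  assumes "f \<in> borel_measurable borel" "polynomial_growth f"
  shows "f \<in> all_moments gauss"
  by (rule gauss.all_moments_growth[OF all_moments_gauss_ident assms])

lemma integrable_gauss_growth:
  "f \<in> borel_measurable borel \<Longrightarrow> polynomial_growth f \<Longrightarrow> integrable gauss f"
  by (intro all_moments_integrable all_moments_gauss)

lemma polynomial_growthI: "(\<And>x. \<bar>f x\<bar> \<le> B * (1 + \<bar>x\<bar>) ^ s) \<Longrightarrow> polynomial_growth f"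
  unfolding polynomial_growth_def by blast

lemma DERIV_std_normal_density:
  "(std_normal_density has_real_derivative - x * std_normal_density x) (at x)"
proof -
  have "((\<lambda>x. (1 / sqrt (2 * pi)) * exp (- x\<^sup>2 / 2)) has_real_derivative
      (1 / sqrt (2 * pi)) * (exp (- x\<^sup>2 / 2) * (- x))) (at x)"
    by (rule derivative_eq_intros refl | simp)+
  then show ?thesis unfolding std_normal_density_def[abs_def] by (simp add: mult_ac)
qed

lemma continuous_std_normal_density: "continuous_on S std_normal_density"
  by (meson DERIV_std_normal_density DERIV_isCont continuous_at_imp_continuous_on)

lemma growth_times_density_tendsto_0:
  assumes "polynomial_growth G" "\<And>n. \<bar>u n\<bar> = real n"
  shows "(\<lambda>n. G (u n) * std_normal_density (u n)) \<longlonglongrightarrow> 0"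
proof -
  obtain C m where C: "\<And>x. \<bar>G x\<bar> \<le> C * (1 + \<bar>x\<bar>) ^ m"
    using assms(1) unfolding polynomial_growth_def by blast
  \<comment> \<open>From (n - 1)^2 \<ge> 0 one gets - n^2 / 2 \<le> 3/2 - (1 + n), so the density is
    dominated by an exponential.\<close>
  let ?K = "C * exp (3/2)"
  have C0: "C \<ge> 0" using C[of 0] by simp
  have 1: "((\<lambda>x::real. x ^ m / exp x) \<longlongrightarrow> 0) at_top"
    by (rule tendsto_power_div_exp_0)
  have 2: "filterlim (\<lambda>n. 1 + real n) at_top sequentially"
    by (intro filterlim_tendsto_add_at_top[OF tendsto_const] filterlim_real_sequentially)
  have lim: "(\<lambda>n. ?K * ((1 + real n) ^ m / exp (1 + real n))) \<longlonglongrightarrow> 0"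
    using tendsto_mult_left[OF filterlim_compose[OF 1 2], of ?K] by simp
  show ?thesis
  proof (rule Lim_null_comparison[OF _ lim], intro always_eventually allI)
    fix n
    have "std_normal_density (u n) \<le> exp (- (u n)\<^sup>2 / 2)"
      unfolding std_normal_density_def using pi_ge_two by (simp add: field_simps)
    also have "\<dots> \<le> exp (3/2 - (1 + real n))"
    proof -
      have "(u n)\<^sup>2 = (real n)\<^sup>2" using assms(2)[of n] by (metis power2_abs)
      moreover have "0 \<le> (real n - 1)\<^sup>2" by simp
      ultimately show ?thesis by (simp add: power2_diff)
    qed
    finally have d: "std_normal_density (u n) \<le> exp (3/2) / exp (1 + real n)"
      unfolding exp_diff .
    have "norm (G (u n) * std_normal_density (u n)) = \<bar>G (u n)\<bar> * std_normal_density (u n)"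
      by (simp add: abs_mult)
    also have "\<dots> \<le> (C * (1 + real n) ^ m) * (exp (3/2) / exp (1 + real n))"
      using C[of "u n"] d C0 assms(2)[of n] by (intro mult_mono) auto
    finally show "norm (G (u n) * std_normal_density (u n)) \<le> ?K * ((1 + real n) ^ m / exp (1 + real n))"
      by (simp add: mult_ac)
  qed
qed

lemma continuous_borel: "continuous_on UNIV f \<Longrightarrow> f \<in> borel_measurable borel"
  for f :: "real \<Rightarrow> real"
  by (rule borel_measurable_continuous_onI)

lemma DERIV_continuous: "(\<And>x. (f has_real_derivative f' x) (at x)) \<Longrightarrow> continuous_on S f"
  by (meson DERIV_isCont continuous_at_imp_continuous_on)

text \<open>G times the density has derivative G' - x G times the density, and polynomial growth
  makes the boundary terms at n and - n vanish in the limit.\<close>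

lemma gauss_integration_by_parts:
  assumes G: "\<And>x. (G has_real_derivative G' x) (at x)" and G': "continuous_on UNIV G'"
    and pg: "polynomial_growth G" "polynomial_growth G'"
  shows "(\<integral>x. G' x \<partial>gauss) = (\<integral>x. x * G x \<partial>gauss)"
proof -
  let ?d = std_normal_density
  let ?H = "\<lambda>x. G x * ?d x" and ?h = "\<lambda>x. (G' x - x * G x) * ?d x"
  have [measurable]: "G \<in> borel_measurable borel" "G' \<in> borel_measurable borel"
    using G' DERIV_continuous[OF G] by (auto intro: continuous_borel)
  have int: "integrable gauss G'" "integrable gauss (\<lambda>x. x * G x)"
    by (intro integrable_gauss_growth polynomial_growth_intros pg; measurable)+
  then have "integrable gauss (\<lambda>x. G' x - x * G x)"
    by (rule Bochner_Integration.integrable_diff)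
  then have inth: "integrable lborel ?h"
    by (subst (asm) integrable_gauss) (auto simp: mult.commute)
  have Hh: "(?H has_real_derivative ?h x) (at x)" for x
    by (rule derivative_eq_intros G DERIV_std_normal_density refl)+ (simp add: algebra_simps)
  have ch: "isCont ?h x" for x
    using G' DERIV_isCont[OF G] DERIV_isCont[OF DERIV_std_normal_density]
    by (intro continuous_intros) (auto simp: continuous_on_eq_continuous_at)
  have FTC: "(\<integral>x. ?h x * indicator {- real n..real n} x \<partial>lborel) = ?H (real n) - ?H (- real n)" for n
    by (intro integral_FTC_Icc_real Hh ch) simp
  have "(\<lambda>n. \<integral>x. ?h x * indicator {- real n..real n} x \<partial>lborel) \<longlonglongrightarrow> (\<integral>x. ?h x \<partial>lborel)"
  proof (rule integral_dominated_convergence[where w = "\<lambda>x. \<bar>?h x\<bar>"])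
    show "integrable lborel (\<lambda>x. \<bar>?h x\<bar>)" using inth by (rule integrable_abs)
    show "AE x in lborel. (\<lambda>n. ?h x * indicator {- real n..real n} x) \<longlonglongrightarrow> ?h x"
    proof (rule AE_I2, rule tendsto_eventually)
      fix x :: real
      show "\<forall>\<^sub>F n in sequentially. ?h x * indicator {- real n..real n} x = ?h x"
        using eventually_ge_at_top[of "nat \<lceil>\<bar>x\<bar>\<rceil>"]
      proof eventually_elim
        case (elim n)
        then have "\<bar>x\<bar> \<le> real n" by linarith
        then show ?case by (auto simp: indicator_def)
      qed
    qed
  qed (auto simp: indicator_def)
  moreover have "(\<lambda>n. ?H (real n) - ?H (- real n)) \<longlonglongrightarrow> 0 - 0"
    by (intro tendsto_diff growth_times_density_tendsto_0 pg) auto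
  ultimately have "(\<integral>x. ?h x \<partial>lborel) = 0"
    unfolding FTC using LIMSEQ_unique by fastforce
  moreover have "(\<integral>x. ?h x \<partial>lborel) = (\<integral>x. G' x - x * G x \<partial>gauss)"
    by (subst integral_gauss) (auto simp: mult.commute)
  ultimately show ?thesis
    using int by simp
qed

text \<open>After the shift t = x + u the density d factors as sqrt(2 pi) d(x) d(u) exp(- x u), and
  the exponential is at most 1 where x u \<ge> 0. The tail integral therefore carries the factor
  d(x), by which the Stein antiderivative is divided.\<close>

lemma gauss_tail_bound:
  assumes g: "g \<in> borel_measurable borel" "\<And>x. \<bar>g x\<bar> \<le> B * (1 + \<bar>x\<bar>) ^ s"
    and S: "S \<in> sets borel" "\<And>u. u \<in> S \<Longrightarrow> x * u \<ge> 0"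
  shows "\<bar>\<integral>t. indicator S (t - x) * (g t * std_normal_density t) \<partial>lborel\<bar> \<le>
    (sqrt (2 * pi) * (\<integral>u. (1 + \<bar>u\<bar>) ^ s \<partial>gauss)) * B * (1 + \<bar>x\<bar>) ^ s * std_normal_density x"
proof -
  let ?d = std_normal_density
  note [measurable] = g(1) S(1)
  have B: "B \<ge> 0" using g(2)[of 0] by simp
  have d: "?d (x + u) \<le> sqrt (2 * pi) * ?d x * ?d u" if "x * u \<ge> 0" for u
  proof -
    have "?d (x + u) = sqrt (2 * pi) * ?d x * ?d u * exp (- (x * u))"
    proof -
      have "- (x + u)\<^sup>2 / 2 = (- x\<^sup>2 / 2) + (- u\<^sup>2 / 2) + (- (x * u))"
        by (simp add: power2_sum field_simps)
      then have e: "exp (- (x + u)\<^sup>2 / 2) = exp (- x\<^sup>2 / 2) * exp (- u\<^sup>2 / 2) * exp (- (x * u))"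
        by (simp only: exp_add)
      have *: "(1 / c) * (a * b * e) = c * ((1 / c) * a) * ((1 / c) * b) * e" if "c > 0" for a b c e :: real
        using that by simp
      show ?thesis unfolding std_normal_density_def e by (rule *) simp
    qed
    also have "\<dots> \<le> sqrt (2 * pi) * ?d x * ?d u * 1"
      using that by (intro mult_left_mono) auto
    finally show ?thesis by simp
  qed
  have ui: "integrable lborel (\<lambda>u. ?d u * (1 + \<bar>u\<bar>) ^ s)"
  proof -
    have "(\<lambda>u. (1 + \<bar>u\<bar>) ^ s) \<in> all_moments gauss"
      by (intro gauss.all_moments_intros all_moments_gauss_ident)
    then have "integrable gauss (\<lambda>u. (1 + \<bar>u\<bar>) ^ s)" by (rule all_moments_integrable)
    then show ?thesis by (subst (asm) integrable_gauss) auto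
  qed
  let ?K = "sqrt (2 * pi) * B * (1 + \<bar>x\<bar>) ^ s * ?d x"
  have bd: "norm (indicator S u * (g (x + u) * ?d (x + u))) \<le> ?K * (?d u * (1 + \<bar>u\<bar>) ^ s)" for u
  proof (cases "u \<in> S")
    case True
    have "\<bar>g (x + u)\<bar> \<le> B * (1 + \<bar>x + u\<bar>) ^ s" by (rule g)
    also have "\<dots> \<le> B * ((1 + \<bar>x\<bar>) * (1 + \<bar>u\<bar>)) ^ s"
    proof (intro mult_left_mono power_mono)
      have "1 + \<bar>x + u\<bar> \<le> 1 + \<bar>x\<bar> + \<bar>u\<bar> + \<bar>x\<bar> * \<bar>u\<bar>" using abs_triangle_ineq[of x u] mult_nonneg_nonneg[of "\<bar>x\<bar>" "\<bar>u\<bar>"] by linarith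
      then show "1 + \<bar>x + u\<bar> \<le> (1 + \<bar>x\<bar>) * (1 + \<bar>u\<bar>)" by (simp add: algebra_simps)
    qed (use B in auto)
    finally have 1: "\<bar>g (x + u)\<bar> \<le> B * ((1 + \<bar>x\<bar>) * (1 + \<bar>u\<bar>)) ^ s" .
    have "\<bar>g (x + u)\<bar> * ?d (x + u) \<le> (B * ((1 + \<bar>x\<bar>) * (1 + \<bar>u\<bar>)) ^ s) * (sqrt (2 * pi) * ?d x * ?d u)"
      by (rule mult_mono[OF 1 d[OF S(2)[OF True]]]) (use B in auto)
    then show ?thesis using True by (simp add: abs_mult power_mult_distrib mult_ac)
  qed (use B in auto)
  have 1: "(\<integral>t. indicator S (t - x) * (g t * ?d t) \<partial>lborel) = (\<integral>u. indicator S u * (g (x + u) * ?d (x + u)) \<partial>lborel)"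
    by (subst lborel_integral_real_affine[where c = 1 and t = x]) auto
  have 2: "\<bar>\<integral>u. indicator S u * (g (x + u) * ?d (x + u)) \<partial>lborel\<bar> \<le> (\<integral>u. ?K * (?d u * (1 + \<bar>u\<bar>) ^ s) \<partial>lborel)"
  proof -
    have "\<bar>\<integral>u. indicator S u * (g (x + u) * ?d (x + u)) \<partial>lborel\<bar> \<le> (\<integral>u. norm (indicator S u * (g (x + u) * ?d (x + u))) \<partial>lborel)"
      using integral_norm_bound[of lborel "\<lambda>u. indicator S u * (g (x + u) * ?d (x + u))"] by simp
    also have "\<dots> \<le> (\<integral>u. ?K * (?d u * (1 + \<bar>u\<bar>) ^ s) \<partial>lborel)"
    proof (rule integral_mono)
      show i: "integrable lborel (\<lambda>u. ?K * (?d u * (1 + \<bar>u\<bar>) ^ s))" using ui by simp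
      show "integrable lborel (\<lambda>u. norm (indicator S u * (g (x + u) * ?d (x + u))))"
      proof (rule Bochner_Integration.integrable_bound[OF i])
        show "AE u in lborel. norm (norm (indicator S u * (g (x + u) * ?d (x + u)))) \<le> norm (?K * (?d u * (1 + \<bar>u\<bar>) ^ s))"
        proof (rule AE_I2)
          fix u
          show "norm (norm (indicator S u * (g (x + u) * ?d (x + u)))) \<le> norm (?K * (?d u * (1 + \<bar>u\<bar>) ^ s))"
            unfolding real_norm_def abs_idempotent
            by (rule order_trans[OF bd[of u, unfolded real_norm_def] abs_ge_self])
        qed
      qed measurable
    qed (rule bd)
    finally show ?thesis .
  qed
  have 3: "(\<integral>u. ?K * (?d u * (1 + \<bar>u\<bar>) ^ s) \<partial>lborel) = ?K * (\<integral>u. (1 + \<bar>u\<bar>) ^ s \<partial>gauss)"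
    by (subst integral_gauss) auto
  show ?thesis
    unfolding 1 by (rule order_trans[OF 2]) (unfold 3, simp only: mult_ac order_refl)
qed

text \<open>f(x) is minus the integral of g times the density up to x, divided by the density at x.
  The division is harmless only for a tail that points away from 0; for x > 0 the vanishing mean of
  g replaces the lower tail by the upper one. The constant depends on the exponent \<open>s\<close>
  alone.\<close>

lemma stein_antiderivative:
  "\<exists>K\<ge>0. \<forall>g B. continuous_on UNIV g \<longrightarrow> (\<forall>x. \<bar>g x\<bar> \<le> B * (1 + \<bar>x\<bar>) ^ s) \<longrightarrow> (\<integral>x. g x \<partial>gauss) = 0 \<longrightarrow>
    (\<exists>f. (\<forall>x. (f has_real_derivative (x * f x - g x)) (at x)) \<and> (\<forall>x. \<bar>f x\<bar> \<le> K * B * (1 + \<bar>x\<bar>) ^ s))"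
proof -
  let ?d = std_normal_density
  let ?K = "sqrt (2 * pi) * (\<integral>u. (1 + \<bar>u\<bar>) ^ s \<partial>gauss)"
  have K0: "?K \<ge> 0" by simp
  have "\<exists>f. (\<forall>x. (f has_real_derivative (x * f x - g x)) (at x)) \<and> (\<forall>x. \<bar>f x\<bar> \<le> ?K * B * (1 + \<bar>x\<bar>) ^ s)"
    if cg: "continuous_on UNIV g" and gB': "\<forall>x. \<bar>g x\<bar> \<le> B * (1 + \<bar>x\<bar>) ^ s" and g0: "(\<integral>x. g x \<partial>gauss) = 0"
    for g :: "real \<Rightarrow> real" and B
  proof -
  note gB = gB'[rule_format]
  have [measurable]: "g \<in> borel_measurable borel" by (rule continuous_borel[OF cg])
  let ?h = "\<lambda>t. g t * ?d t"
  have gi: "integrable lborel ?h"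
    using integrable_gauss_growth[OF _ polynomial_growthI[OF gB]] by (simp add: integrable_gauss mult.commute)
  have g0': "(\<integral>t. ?h t \<partial>lborel) = 0"
    using g0 by (simp add: integral_gauss mult.commute)
  have hi: "integrable lborel (\<lambda>t. indicator A t * ?h t)" if "A \<in> sets borel" for A
    by (rule Bochner_Integration.integrable_bound[OF gi]) (use that in \<open>auto simp: indicator_def\<close>)
  define I where "I x = (\<integral>t. indicator {..x} t * ?h t \<partial>lborel)" for x
  have ch: "continuous_on T ?h" for T
    by (intro continuous_intros continuous_std_normal_density continuous_on_subset[OF cg]) auto
  have dI: "(I has_real_derivative ?h x) (at x)" for x
  proof -
    let ?a = "x - 1" and ?b = "x + 1"
    \<comment> \<open>Splitting off a fixed initial part reduces I near x to an integral over a
      compact interval, where the fundamental theorem applies.\<close>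
    have Ieq: "I y = I ?a + integral {?a..y} ?h" if "y \<in> {?a..?b}" for y
    proof -
      have 1: "I y = (\<integral>t. indicator {..?a} t * ?h t + indicator {?a<..y} t * ?h t \<partial>lborel)"
        unfolding I_def using that by (intro Bochner_Integration.integral_cong) (auto simp: indicator_def)
      have 2: "(\<integral>t. indicator {..?a} t * ?h t + indicator {?a<..y} t * ?h t \<partial>lborel) =
          I ?a + (\<integral>t. indicator {?a<..y} t * ?h t \<partial>lborel)"
        unfolding I_def by (intro Bochner_Integration.integral_add hi) auto
      have 3: "(\<integral>t. indicator {?a<..y} t * ?h t \<partial>lborel) = (\<integral>t. indicator {?a..y} t * ?h t \<partial>lborel)"
      proof (rule integral_cong_AE)
        show "AE t in lborel. indicator {?a<..y} t * ?h t = indicator {?a..y} t * ?h t"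
          using AE_lborel_singleton[of ?a] by eventually_elim (auto simp: indicator_def)
      qed measurable
      have "set_integrable lborel {?a..y} ?h"
        unfolding set_integrable_def real_scaleR_def by (rule hi) simp
      then have 4: "(\<integral>t. indicator {?a..y} t * ?h t \<partial>lborel) = integral {?a..y} ?h"
        unfolding set_lebesgue_integral_def[of lborel "{?a..y}" ?h, unfolded real_scaleR_def, symmetric]
        by (rule set_borel_integral_eq_integral(2))
      show ?thesis unfolding 1 2 3 4 ..
    qed
    have "((\<lambda>y. integral {?a..y} ?h) has_real_derivative ?h x) (at x within {?a..?b})"
      by (rule integral_has_real_derivative[OF ch]) auto
    from DERIV_add[OF DERIV_const[of "I ?a"] this]
    have "((\<lambda>y. I ?a + integral {?a..y} ?h) has_real_derivative ?h x) (at x within {?a..?b})"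
      by simp
    then have "(I has_real_derivative ?h x) (at x within {?a..?b})"
      by (rule has_field_derivative_transform_within[where d = 1]) (simp_all only: Ieq zero_less_one, simp_all)
    moreover have "at x within {?a..?b} = at x"
      by (rule at_within_Icc_at) auto
    ultimately show ?thesis by (simp only:)
  qed
  have dpos: "?d x > 0" for x by (simp add: normal_density_pos)
  define f where "f x = - I x / ?d x" for x
  have df: "(f has_real_derivative (x * f x - g x)) (at x)" for x
  proof -
    have "(f has_real_derivative ((- ?h x) * ?d x - (- I x) * (- x * ?d x)) / (?d x * ?d x)) (at x)"
      unfolding f_def[abs_def]
      by (intro DERIV_divide DERIV_minus dI DERIV_std_normal_density) (use dpos[of x] in simp)
    moreover have "((- (a * d)) * d - (- b) * (- x * d)) / (d * d) = x * (- b / d) - a" if "d > 0" for a b d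
      using that by (simp add: field_simps)
    note this[OF dpos[of x], of "g x" "I x", folded f_def]
    ultimately show ?thesis by simp
  qed
  have bI: "\<bar>I x\<bar> \<le> ?K * B * (1 + \<bar>x\<bar>) ^ s * ?d x" for x
  proof (cases "x \<le> 0")
    case True
    have "I x = (\<integral>t. indicator {..0} (t - x) * ?h t \<partial>lborel)"
      unfolding I_def by (intro Bochner_Integration.integral_cong) (auto simp: indicator_def)
    moreover have "\<bar>\<integral>t. indicator {..0} (t - x) * ?h t \<partial>lborel\<bar> \<le> ?K * B * (1 + \<bar>x\<bar>) ^ s * ?d x"
      by (rule gauss_tail_bound) (use gB True in \<open>auto intro: mult_nonpos_nonpos\<close>)
    ultimately show ?thesis by simp
  next
    case False
    have "(\<integral>t. ?h t \<partial>lborel) = (\<integral>t. indicator {..x} t * ?h t + indicator {x<..} t * ?h t \<partial>lborel)"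
      by (intro Bochner_Integration.integral_cong) (auto simp: indicator_def)
    then have 1: "0 = (\<integral>t. indicator {..x} t * ?h t + indicator {x<..} t * ?h t \<partial>lborel)"
      unfolding g0' .
    have 2: "(\<integral>t. indicator {..x} t * ?h t + indicator {x<..} t * ?h t \<partial>lborel) =
        I x + (\<integral>t. indicator {x<..} t * ?h t \<partial>lborel)"
      unfolding I_def by (intro Bochner_Integration.integral_add hi) auto
    have 3: "(\<integral>t. indicator {x<..} t * ?h t \<partial>lborel) = (\<integral>t. indicator {0<..} (t - x) * ?h t \<partial>lborel)"
      by (intro Bochner_Integration.integral_cong) (auto simp: indicator_def)
    have "I x = - (\<integral>t. indicator {0<..} (t - x) * ?h t \<partial>lborel)"
      using 1 unfolding 2 3 by linarith
    moreover have "\<bar>\<integral>t. indicator {0<..} (t - x) * ?h t \<partial>lborel\<bar> \<le> ?K * B * (1 + \<bar>x\<bar>) ^ s * ?d x"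
      by (rule gauss_tail_bound) (use gB False in auto)
    ultimately show ?thesis by simp
  qed
  have "\<bar>f x\<bar> \<le> ?K * B * (1 + \<bar>x\<bar>) ^ s" for x
    using bI[of x] dpos[of x] by (simp add: f_def abs_div pos_divide_le_eq)
  then show "\<exists>f. (\<forall>x. (f has_real_derivative (x * f x - g x)) (at x)) \<and> (\<forall>x. \<bar>f x\<bar> \<le> ?K * B * (1 + \<bar>x\<bar>) ^ s)"
    using df by blast
  qed
  with K0 show ?thesis by blast
qed

section \<open>The Ornstein-Uhlenbeck resolvent\<close>

text \<open>By the mean value theorem the difference quotients within distance 1 of \<open>a\<close>
  are bounded by \<open>W\<close>, so dominated convergence applies along sequences tending to
  \<open>a\<close>.\<close>

lemma DERIV_integral_dominated:
  fixes f f' :: "real \<Rightarrow> 'b \<Rightarrow> real"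
  assumes f: "\<And>x. integrable M (f x)" and f': "\<And>x. f' x \<in> borel_measurable M"
    and d: "\<And>x w. ((\<lambda>x. f x w) has_real_derivative f' x w) (at x)"
    and W: "integrable M W" "\<And>x w. \<bar>x - a\<bar> \<le> 1 \<Longrightarrow> \<bar>f' x w\<bar> \<le> W w"
  shows "((\<lambda>x. \<integral>w. f x w \<partial>M) has_real_derivative (\<integral>w. f' a w \<partial>M)) (at a)"
  unfolding has_field_derivative_iff
proof (subst tendsto_at_iff_sequentially, intro allI impI)
  fix u :: "nat \<Rightarrow> real" assume u: "\<forall>i. u i \<in> UNIV - {a}" "u \<longlonglongrightarrow> a"
  let ?q = "\<lambda>x w. (f x w - f a w) / (x - a)"
  have q: "(\<integral>w. ?q x w \<partial>M) = ((\<integral>w. f x w \<partial>M) - (\<integral>w. f a w \<partial>M)) / (x - a)" for x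
    using f by simp
  have ev: "\<forall>\<^sub>F n in sequentially. \<bar>u n - a\<bar> \<le> 1"
    using u(2) unfolding lim_sequentially dist_real_def eventually_sequentially
    by (metis less_imp_le zero_less_one)
  \<comment> \<open>Replaces the finitely many terms outside the unit ball, so that the domination
    holds for every n; the substitute \<open>a + 1\<close> differs from \<open>a\<close>.\<close>
  define v where "v n = (if \<bar>u n - a\<bar> \<le> 1 then u n else a + 1)" for n
  have va: "v n \<noteq> a" "\<bar>v n - a\<bar> \<le> 1" for n
    using u(1) by (auto simp: v_def)
  have vu: "\<forall>\<^sub>F n in sequentially. v n = u n"
    using ev by eventually_elim (simp add: v_def)
  have vlim: "v \<longlonglongrightarrow> a"
    by (rule Lim_transform_eventually[OF u(2)]) (use vu in eventually_elim, simp)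
  have "(\<lambda>n. \<integral>w. ?q (v n) w \<partial>M) \<longlonglongrightarrow> (\<integral>w. f' a w \<partial>M)"
  proof (rule integral_dominated_convergence[where w = W])
    show "AE w in M. (\<lambda>n. ?q (v n) w) \<longlonglongrightarrow> f' a w"
    proof (rule AE_I2)
      fix w
      have "((\<lambda>x. ?q x w) \<longlongrightarrow> f' a w) (at a)"
        using d[where x = a and w = w] unfolding has_field_derivative_iff .
      then show "(\<lambda>n. ?q (v n) w) \<longlonglongrightarrow> f' a w"
        unfolding tendsto_at_iff_sequentially using va(1) vlim by (auto simp: comp_def)
    qed
    show "AE w in M. norm (?q (v n) w) \<le> W w" for n
    proof (rule AE_I2)
      fix w
      have lip: "norm (f (v n) w - f a w) \<le> W w * norm (v n - a)"
      proof (rule field_differentiable_bound[where S = "cball a 1" and f' = "\<lambda>x. f' x w"])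
        show "((\<lambda>x. f x w) has_field_derivative f' x w) (at x within cball a 1)" for x
          using d by (rule has_field_derivative_at_within)
        show "norm (f' x w) \<le> W w" if "x \<in> cball a 1" for x
          using W(2)[of x w] that by (simp add: dist_real_def abs_minus_commute)
      qed (use va(2)[of n] in \<open>auto simp: dist_real_def abs_minus_commute\<close>)
      then show "norm (?q (v n) w) \<le> W w"
        using va(1)[of n] by (simp add: abs_div pos_divide_le_eq)
    qed
    show "(\<lambda>w. ?q (v n) w) \<in> borel_measurable M" for n
      using f[of "v n"] f[of a] by measurable
  qed (use f' W in auto)
  then have "(\<lambda>n. \<integral>w. ?q (u n) w \<partial>M) \<longlonglongrightarrow> (\<integral>w. f' a w \<partial>M)"
    by (rule Lim_transform_eventually) (use vu in eventually_elim, simp)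
  then show "((\<lambda>y. ((\<integral>w. f y w \<partial>M) - (\<integral>w. f a w \<partial>M)) / (y - a)) \<circ> u) \<longlonglongrightarrow> (\<integral>w. f' a w \<partial>M)"
    unfolding q comp_def .
qed

section \<open>Mehler's formula with an angle as time\<close>

lemma sigma_finite_gauss: "sigma_finite_measure gauss"
  using prob_space_gauss by (simp add: prob_space_imp_sigma_finite)

interpretation lg: pair_sigma_finite "lborel :: real measure" gauss
  by (simp add: pair_sigma_finite_def sigma_finite_lborel sigma_finite_gauss)

abbreviation lgm :: "(real \<times> real) measure" where "lgm \<equiv> lborel \<Otimes>\<^sub>M gauss"

lemma integrable_product_lg:
  fixes k h :: "real \<Rightarrow> real"
  assumes "integrable lborel k" "integrable gauss h"
  shows "integrable lgm (\<lambda>w. k (fst w) * h (snd w))"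
proof -
  have [measurable]: "k \<in> borel_measurable borel" "h \<in> borel_measurable borel"
    using assms borel_measurable_integrable by fastforce+
  have "integrable lgm (\<lambda>(t, y). k t * h y)"
  proof (rule lg.Fubini_integrable)
    show "integrable lborel (\<lambda>x. \<integral>y. norm (case (x, y) of (t, y) \<Rightarrow> k t * h y) \<partial>gauss)"
      using assms(1) by (simp add: abs_mult)
  qed (use assms in auto)
  then show ?thesis by (simp only: case_prod_unfold)
qed

text \<open>Mehler's formula after the substitution exp(- s) = sin t: the argument exp(- s) x +
  sqrt(1 - exp(- 2 s)) y becomes smooth in t, and infinite time becomes the end point t = 0.\<close>

definition rot :: "real \<Rightarrow> real \<times> real \<Rightarrow> real" where
  "rot x w = x * sin (fst w) + snd w * cos (fst w)"

lemma rot_measurable [measurable]: "(\<lambda>w. rot x w) \<in> borel_measurable lgm"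
  unfolding rot_def by measurable

text \<open>The product form separates x from the integration variable, so a growth bound in x comes
  out of the integral.\<close>

lemma rot_bound: "1 + \<bar>rot x w\<bar> \<le> (1 + \<bar>x\<bar>) * (1 + \<bar>snd w\<bar>)"
proof -
  have "\<bar>rot x w\<bar> \<le> \<bar>x * sin (fst w)\<bar> + \<bar>snd w * cos (fst w)\<bar>"
    unfolding rot_def by (rule abs_triangle_ineq)
  also have "\<dots> \<le> \<bar>x\<bar> * 1 + \<bar>snd w\<bar> * 1"
    unfolding abs_mult by (intro add_mono mult_left_mono) auto
  also have "\<dots> \<le> \<bar>x\<bar> + \<bar>snd w\<bar> + \<bar>x\<bar> * \<bar>snd w\<bar>"
    by simp
  finally show ?thesis by (simp add: algebra_simps)
qed

lemma rot_growth:
  assumes "\<And>x. \<bar>g x\<bar> \<le> B * (1 + \<bar>x\<bar>) ^ s"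
  shows "\<bar>g (rot x w)\<bar> \<le> B * (1 + \<bar>x\<bar>) ^ s * (1 + \<bar>snd w\<bar>) ^ s"
proof -
  have B: "B \<ge> 0" using assms[of 0] by simp
  have "\<bar>g (rot x w)\<bar> \<le> B * (1 + \<bar>rot x w\<bar>) ^ s" by (rule assms)
  also have "\<dots> \<le> B * ((1 + \<bar>x\<bar>) * (1 + \<bar>snd w\<bar>)) ^ s"
    using B rot_bound by (intro mult_left_mono power_mono) auto
  finally show ?thesis by (simp add: power_mult_distrib mult_ac)
qed

definition bmoment :: "nat \<Rightarrow> real" where "bmoment s = (\<integral>y. (1 + \<bar>y\<bar>) ^ s \<partial>gauss)"

lemma bmoment_integrable: "integrable gauss (\<lambda>y. (1 + \<bar>y\<bar>) ^ s)"
  by (intro all_moments_integrable gauss.all_moments_intros all_moments_gauss_ident)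

context
  fixes k :: "real \<Rightarrow> real"
  assumes k: "integrable lborel k"
begin

lemma k_measurable: "k \<in> borel_measurable borel"
  using k borel_measurable_integrable by fastforce

lemma rot_dominated: "integrable lgm (\<lambda>w. \<bar>k (fst w)\<bar> * (1 + \<bar>snd w\<bar>) ^ s)"
  by (rule integrable_product_lg[OF integrable_abs[OF k] bmoment_integrable])

lemma rot_dominated_integral: "(\<integral>w. \<bar>k (fst w)\<bar> * (1 + \<bar>snd w\<bar>) ^ s \<partial>lgm) = (\<integral>t. \<bar>k t\<bar> \<partial>lborel) * bmoment s"
proof -
  have "(\<integral>w. \<bar>k (fst w)\<bar> * (1 + \<bar>snd w\<bar>) ^ s \<partial>lgm) = (\<integral>t. (\<integral>y. \<bar>k t\<bar> * (1 + \<bar>y\<bar>) ^ s \<partial>gauss) \<partial>lborel)"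
    using lg.integral_fst'[OF rot_dominated[of s]] by simp
  then show ?thesis by (simp add: bmoment_def)
qed

lemma rot_integrable:
  assumes "g \<in> borel_measurable borel" "\<And>x. \<bar>g x\<bar> \<le> B * (1 + \<bar>x\<bar>) ^ s"
  shows "integrable lgm (\<lambda>w. k (fst w) * g (rot x w))"
    and "\<bar>\<integral>w. k (fst w) * g (rot x w) \<partial>lgm\<bar> \<le> ((\<integral>t. \<bar>k t\<bar> \<partial>lborel) * bmoment s) * B * (1 + \<bar>x\<bar>) ^ s"
proof -
  note [measurable] = assms(1) k_measurable
  let ?c = "B * (1 + \<bar>x\<bar>) ^ s"
  have i: "integrable lgm (\<lambda>w. ?c * (\<bar>k (fst w)\<bar> * (1 + \<bar>snd w\<bar>) ^ s))"
    by (intro integrable_mult_right rot_dominated)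
  have bd: "\<bar>k (fst w) * g (rot x w)\<bar> \<le> ?c * (\<bar>k (fst w)\<bar> * (1 + \<bar>snd w\<bar>) ^ s)" for w
    using mult_left_mono[OF rot_growth[OF assms(2), of x w], of "\<bar>k (fst w)\<bar>"]
    by (simp add: abs_mult mult_ac)
  show int: "integrable lgm (\<lambda>w. k (fst w) * g (rot x w))"
  proof (rule Bochner_Integration.integrable_bound[OF i])
    show "AE w in lgm. norm (k (fst w) * g (rot x w)) \<le> norm (?c * (\<bar>k (fst w)\<bar> * (1 + \<bar>snd w\<bar>) ^ s))"
    proof (rule AE_I2)
      fix w
      show "norm (k (fst w) * g (rot x w)) \<le> norm (?c * (\<bar>k (fst w)\<bar> * (1 + \<bar>snd w\<bar>) ^ s))"
        unfolding real_norm_def by (rule order_trans[OF bd abs_ge_self])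
    qed
  qed measurable
  have "\<bar>\<integral>w. k (fst w) * g (rot x w) \<partial>lgm\<bar> \<le> (\<integral>w. \<bar>k (fst w) * g (rot x w)\<bar> \<partial>lgm)"
    by (rule integral_abs_bound)
  also have "\<dots> \<le> (\<integral>w. ?c * (\<bar>k (fst w)\<bar> * (1 + \<bar>snd w\<bar>) ^ s) \<partial>lgm)"
    by (intro integral_mono integrable_abs int i bd)
  also have "\<dots> = ?c * ((\<integral>t. \<bar>k t\<bar> \<partial>lborel) * bmoment s)"
    by (simp add: rot_dominated_integral)
  finally show "\<bar>\<integral>w. k (fst w) * g (rot x w) \<partial>lgm\<bar> \<le> ((\<integral>t. \<bar>k t\<bar> \<partial>lborel) * bmoment s) * B * (1 + \<bar>x\<bar>) ^ s"
    by (simp add: mult_ac)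
qed

lemma rot_DERIV:
  assumes g: "\<And>x. (g has_real_derivative g' x) (at x)" "g' \<in> borel_measurable borel"
    and b: "polynomial_growth g" "polynomial_growth g'"
  shows "((\<lambda>x. \<integral>w. k (fst w) * g (rot x w) \<partial>lgm) has_real_derivative
    (\<integral>w. k (fst w) * (sin (fst w) * g' (rot x w)) \<partial>lgm)) (at x)"
proof -
  obtain B s where B: "\<And>x. \<bar>g x\<bar> \<le> B * (1 + \<bar>x\<bar>) ^ s" using b(1) unfolding polynomial_growth_def by blast
  obtain B' s' where B': "\<And>x. \<bar>g' x\<bar> \<le> B' * (1 + \<bar>x\<bar>) ^ s'" using b(2) unfolding polynomial_growth_def by blast
  have B0: "B' \<ge> 0" using B'[of 0] by simp
  have [measurable]: "g \<in> borel_measurable borel" using DERIV_continuous[OF g(1)] by (rule continuous_borel)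
  note [measurable] = g(2) k_measurable
  \<comment> \<open>Valid for all points y within distance 1 of x, where 1 + |y| \<le> 2 +
    |x|.\<close>
  let ?W = "\<lambda>w. B' * (2 + \<bar>x\<bar>) ^ s' * (\<bar>k (fst w)\<bar> * (1 + \<bar>snd w\<bar>) ^ s')"
  show ?thesis
  proof (rule DERIV_integral_dominated[where W = ?W])
    show "integrable lgm (\<lambda>w. k (fst w) * g (rot x w))" for x
      by (rule rot_integrable[OF _ B]) measurable
    show "integrable lgm ?W" by (intro integrable_mult_right rot_dominated)
    show "((\<lambda>x. k (fst w) * g (rot x w)) has_real_derivative k (fst w) * (sin (fst w) * g' (rot x w))) (at x)" for x w
    proof -
      have "((\<lambda>x. rot x w) has_real_derivative sin (fst w)) (at x)"
        unfolding rot_def by (auto intro!: derivative_eq_intros)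
      from DERIV_cmult[OF DERIV_chain2[OF g(1) this], of "k (fst w)"]
      show ?thesis by (simp add: mult_ac)
    qed
    fix y w assume y: "\<bar>y - x\<bar> \<le> 1"
    have "\<bar>k (fst w) * (sin (fst w) * g' (rot y w))\<bar> \<le> \<bar>k (fst w)\<bar> * (1 * \<bar>g' (rot y w)\<bar>)"
      unfolding abs_mult by (intro mult_left_mono mult_right_mono) auto
    also have "\<dots> \<le> \<bar>k (fst w)\<bar> * (B' * (1 + \<bar>y\<bar>) ^ s' * (1 + \<bar>snd w\<bar>) ^ s')"
      using rot_growth[OF B'] by (intro mult_left_mono) auto
    also have "\<dots> \<le> \<bar>k (fst w)\<bar> * (B' * (2 + \<bar>x\<bar>) ^ s' * (1 + \<bar>snd w\<bar>) ^ s')"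
      using y B0 by (intro mult_left_mono mult_right_mono power_mono) auto
    finally show "\<bar>k (fst w) * (sin (fst w) * g' (rot y w))\<bar> \<le> ?W w"
      by (simp add: mult_ac)
  qed measurable
qed

end

lemma integrable_Icc_bounded:
  fixes k :: "real \<Rightarrow> real"
  assumes "k \<in> borel_measurable borel" "\<And>t. t \<in> {a<..<b} \<Longrightarrow> \<bar>k t\<bar> \<le> C"
  shows "integrable lborel (\<lambda>t. indicator {a<..<b} t * k t)"
proof (rule Bochner_Integration.integrable_bound[where f = "\<lambda>t. \<bar>C\<bar> * indicator {a..b} t"])
  show "integrable lborel (\<lambda>t. \<bar>C\<bar> * indicator {a..b} t)"
    by (intro integrable_mult_right integrable_real_indicator) (auto simp: emeasure_lborel_Icc_eq)
  show "AE t in lborel. norm (indicator {a<..<b} t * k t) \<le> norm (\<bar>C\<bar> * indicator {a..b} t)"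
  proof (rule AE_I2)
    fix t
    show "norm (indicator {a<..<b} t * k t) \<le> norm (\<bar>C\<bar> * indicator {a..b} t)"
      using assms(2)[of t] by (auto simp: indicator_def)
  qed
  note [measurable] = assms(1)
  show "(\<lambda>t. indicator {a<..<b} t * k t) \<in> borel_measurable lborel" by measurable
qed

text \<open>For b < 1 the weight is unbounded near 0. It is nonnegative with antiderivative sin^b /
  b, which has finite limits at both ends.\<close>

lemma mehler_weight_integrable:
  assumes "b > 0"
  shows "integrable lborel (\<lambda>t. indicator {0<..<pi/2} t * (sin t powr (b - 1) * cos t))"
proof -
  have "set_integrable lborel (einterval (ereal 0) (ereal (pi/2))) (\<lambda>t. sin t powr (b - 1) * cos t)"
  proof (rule interval_integral_FTC_nonneg(1)[where F = "\<lambda>t. sin t powr b / b" and A = 0 and B = "1 / b"])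
    fix t assume "ereal 0 < ereal t" "ereal t < ereal (pi/2)"
    then have t: "0 < t" "t < pi/2" by auto
    have s: "sin t > 0" using t by (intro sin_gt_zero) auto
    have c: "cos t > 0" using t by (intro cos_gt_zero) auto
    show "((\<lambda>t. sin t powr b / b) has_real_derivative sin t powr (b - 1) * cos t) (at t)"
      using s assms by (auto intro!: derivative_eq_intros simp: powr_diff field_simps)
    show "isCont (\<lambda>t. sin t powr (b - 1) * cos t) t"
      using s by (intro continuous_intros) auto
  next
    show "AE t in lborel. ereal 0 < ereal t \<longrightarrow> ereal t < ereal (pi/2) \<longrightarrow> 0 \<le> sin t powr (b - 1) * cos t"
      by (intro AE_I2 impI mult_nonneg_nonneg) (auto intro!: cos_ge_zero)
  next
    have "((\<lambda>t. sin t powr b / b) \<longlongrightarrow> 0 / b) (at_right 0)"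
    proof (intro tendsto_divide tendsto_const tendsto_zero_powrI)
      have "(sin \<longlongrightarrow> sin 0) (at_right (0::real))" by (intro tendsto_intros)
      then show "(sin \<longlongrightarrow> (0::real)) (at_right 0)" by simp
      show "\<forall>\<^sub>F x in at_right (0::real). 0 \<le> sin x"
        unfolding eventually_at_right_field
        by (intro exI[of _ 1]) (use pi_gt3 in \<open>auto intro!: sin_ge_zero\<close>)
    qed (use assms in auto)
    then have "((\<lambda>t. sin t powr b / b) \<longlongrightarrow> 0) (at_right 0)" by simp
    then show "(((\<lambda>t. sin t powr b / b) \<circ> real_of_ereal) \<longlongrightarrow> 0) (at_right (ereal 0))"
      by (simp only: ereal_tendsto_simps1)
    have "isCont (\<lambda>t. sin t powr b / b) (pi/2)"
      using assms by (intro continuous_intros) auto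
    then have "((\<lambda>t. sin t powr b / b) \<longlongrightarrow> 1 / b) (at_left (pi/2))"
      using assms by (auto simp: isCont_def intro: tendsto_mono[OF at_le])
    then show "(((\<lambda>t. sin t powr b / b) \<circ> real_of_ereal) \<longlongrightarrow> 1 / b) (at_left (ereal (pi/2)))"
      by (simp only: ereal_tendsto_simps1)
  qed simp
  then show ?thesis
    by (simp add: set_integrable_def)
qed

text \<open>w is minus the integral over s > 0 of exp(- b s) P_s F, with P_s the Ornstein-Uhlenbeck
  semigroup; it converges because b > 0. One differentiation under the integral involves F' only, so
  F'' enters no bound. The equation follows from Gaussian integration by parts in y and an exact
  derivative in t.\<close>

lemma mehler_resolvent:
  assumes b: "b > 0"
  shows "\<exists>K\<ge>0. \<forall>F F1 F2 B. (\<forall>x. (F has_real_derivative F1 x) (at x)) \<longrightarrow> (\<forall>x. (F1 has_real_derivative F2 x) (at x)) \<longrightarrow>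
      continuous_on UNIV F2 \<longrightarrow> polynomial_growth F2 \<longrightarrow>
      (\<forall>x. \<bar>F x\<bar> \<le> B * (1 + \<bar>x\<bar>) ^ s) \<longrightarrow> (\<forall>x. \<bar>F1 x\<bar> \<le> B * (1 + \<bar>x\<bar>) ^ s) \<longrightarrow>
      (\<exists>w w1. (\<forall>x. (w has_real_derivative w1 x) (at x)) \<and>
        (\<forall>x. (w1 has_real_derivative F x + x * w1 x + b * w x) (at x)) \<and>
        (\<forall>x. \<bar>w x\<bar> \<le> K * B * (1 + \<bar>x\<bar>) ^ s) \<and> (\<forall>x. \<bar>w1 x\<bar> \<le> K * B * (1 + \<bar>x\<bar>) ^ s))"
proof -
  define J where "J = {0<..<pi/2::real}"
  \<comment> \<open>With exp(- s) = sin t, exp(- b s) ds becomes sin^(b-1) t cos t dt.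
    \<open>k1\<close> has the further factor sin t from a differentiation in x; \<open>k2\<close> is
    what remains once the integration by parts in y has used up a factor cos t.\<close>
  define k where "k t = indicator J t * (sin t powr (b - 1) * cos t)" for t :: real
  define k1 where "k1 t = indicator J t * (sin t powr b * cos t)" for t :: real
  define k2 where "k2 t = indicator J t * (sin t powr (b + 1))" for t :: real
  have pos: "sin t > 0" "cos t > 0" if "t \<in> J" for t
    using that by (auto simp: J_def intro!: sin_gt_zero cos_gt_zero)
  have ki: "integrable lborel k"
    unfolding k_def J_def by (rule mehler_weight_integrable[OF b])
  have pw: "\<bar>sin t powr c\<bar> \<le> 1" if "t \<in> J" "c \<ge> 0" for t c
    using pos(1)[OF that(1)] powr_mono2[of c "sin t" 1] that(2) by simp
  have k1i: "integrable lborel k1"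
    unfolding k1_def J_def
  proof (rule integrable_Icc_bounded[where C = 1])
    show "\<bar>sin t powr b * cos t\<bar> \<le> 1" if "t \<in> {0<..<pi/2}" for t
      using mult_mono[OF pw[of t b] abs_cos_le_one[of t]] that b by (simp add: J_def abs_mult)
  qed measurable
  have k2i: "integrable lborel k2"
    unfolding k2_def J_def
    by (rule integrable_Icc_bounded[where C = 1]) (use pw b in \<open>auto simp: J_def\<close>)
  have k1k: "k1 t = k t * sin t" for t
    using pos[of t] by (auto simp: k_def k1_def indicator_def powr_diff)
  have k2k: "k1 t * sin t = k2 t * cos t" for t
    using pos[of t] by (auto simp: k2_def k1_def indicator_def powr_add)
  let ?K = "(\<integral>t. \<bar>k t\<bar> \<partial>lborel) * bmoment s + (\<integral>t. \<bar>k1 t\<bar> \<partial>lborel) * bmoment s"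
  have bm: "bmoment s \<ge> 0" unfolding bmoment_def by simp
  then have K0: "0 \<le> (\<integral>t. \<bar>k t\<bar> \<partial>lborel) * bmoment s" "0 \<le> (\<integral>t. \<bar>k1 t\<bar> \<partial>lborel) * bmoment s"
    by (auto intro!: mult_nonneg_nonneg)
  show ?thesis
  proof (intro exI[of _ ?K] conjI allI impI)
    show "0 \<le> ?K" using K0 by linarith
    fix F F1 F2 :: "real \<Rightarrow> real" and B
    assume FF: "\<forall>x. (F has_real_derivative F1 x) (at x)" "\<forall>x. (F1 has_real_derivative F2 x) (at x)"
      and F2: "continuous_on UNIV F2" "polynomial_growth F2"
      and FFB: "\<forall>x. \<bar>F x\<bar> \<le> B * (1 + \<bar>x\<bar>) ^ s" "\<forall>x. \<bar>F1 x\<bar> \<le> B * (1 + \<bar>x\<bar>) ^ s"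
    note F = FF(1)[rule_format] and F1 = FF(2)[rule_format] and FB = FFB(1)[rule_format] and F1B = FFB(2)[rule_format]
    have B0: "B \<ge> 0" using FB[of 0] by simp
    obtain B2 s2 where F2B: "\<And>x. \<bar>F2 x\<bar> \<le> B2 * (1 + \<bar>x\<bar>) ^ s2" using F2(2) unfolding polynomial_growth_def by blast
    have [measurable]: "F \<in> borel_measurable borel" "F1 \<in> borel_measurable borel" "F2 \<in> borel_measurable borel"
      using F2(1) DERIV_continuous[OF F] DERIV_continuous[OF F1] by (auto intro: continuous_borel)
    have [measurable]: "k \<in> borel_measurable borel" "k1 \<in> borel_measurable borel" "k2 \<in> borel_measurable borel"
      using ki k1i k2i borel_measurable_integrable by fastforce+
    have pgF: "polynomial_growth F" "polynomial_growth F1"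
      using FB F1B by (auto intro: polynomial_growthI)
    define w where "w x = - (\<integral>v. k (fst v) * F (rot x v) \<partial>lgm)" for x
    define w1 where "w1 x = - (\<integral>v. k1 (fst v) * F1 (rot x v) \<partial>lgm)" for x
    define w2 where "w2 x = - (\<integral>v. k1 (fst v) * (sin (fst v) * F2 (rot x v)) \<partial>lgm)" for x
    have dw: "(w has_real_derivative w1 x) (at x)" for x
      using DERIV_minus[OF rot_DERIV[OF ki F _ pgF, of x]]
      unfolding w_def[abs_def] w1_def k1k by (simp add: mult.assoc)
    have dw1: "(w1 has_real_derivative w2 x) (at x)" for x
      using DERIV_minus[OF rot_DERIV[OF k1i F1 _ pgF(2) F2(2), of x]]
      unfolding w1_def[abs_def] w2_def by simp
    have ode: "w2 x = F x + x * w1 x + b * w x" for x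
    proof -
      have i0: "integrable lgm (\<lambda>v. k (fst v) * F (rot x v))"
        by (rule rot_integrable[OF ki _ FB]) measurable
      have i1: "integrable lgm (\<lambda>v. k1 (fst v) * F1 (rot x v))"
        by (rule rot_integrable[OF k1i _ F1B]) measurable
      have i2: "integrable lgm (\<lambda>v. k2 (fst v) * (snd v * F1 (rot x v)))"
      proof (rule Bochner_Integration.integrable_bound)
        show "integrable lgm (\<lambda>v. (B * (1 + \<bar>x\<bar>) ^ s) * (\<bar>k2 (fst v)\<bar> * (1 + \<bar>snd v\<bar>) ^ (s + 1)))"
          by (intro integrable_mult_right rot_dominated[OF k2i])
        show "AE v in lgm. norm (k2 (fst v) * (snd v * F1 (rot x v))) \<le>
            norm ((B * (1 + \<bar>x\<bar>) ^ s) * (\<bar>k2 (fst v)\<bar> * (1 + \<bar>snd v\<bar>) ^ (s + 1)))"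
        proof (rule AE_I2)
          fix v
          have "\<bar>snd v\<bar> * \<bar>F1 (rot x v)\<bar> \<le> (1 + \<bar>snd v\<bar>) * (B * (1 + \<bar>x\<bar>) ^ s * (1 + \<bar>snd v\<bar>) ^ s)"
            by (rule mult_mono[OF _ rot_growth[OF F1B]]) auto
          then have "\<bar>k2 (fst v)\<bar> * (\<bar>snd v\<bar> * \<bar>F1 (rot x v)\<bar>) \<le>
            \<bar>k2 (fst v)\<bar> * ((1 + \<bar>snd v\<bar>) * (B * (1 + \<bar>x\<bar>) ^ s * (1 + \<bar>snd v\<bar>) ^ s))"
            by (rule mult_left_mono) simp
          then show "norm (k2 (fst v) * (snd v * F1 (rot x v))) \<le>
            norm ((B * (1 + \<bar>x\<bar>) ^ s) * (\<bar>k2 (fst v)\<bar> * (1 + \<bar>snd v\<bar>) ^ (s + 1)))"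
            using B0 by (simp add: abs_mult mult_ac)
        qed
      qed measurable
      have i3: "integrable lgm (\<lambda>v. k1 (fst v) * (sin (fst v) * F2 (rot x v)))"
      proof (rule Bochner_Integration.integrable_bound)
        show "integrable lgm (\<lambda>v. k1 (fst v) * F2 (rot x v))"
          by (rule rot_integrable[OF k1i _ F2B]) measurable
        show "AE v in lgm. norm (k1 (fst v) * (sin (fst v) * F2 (rot x v))) \<le> norm (k1 (fst v) * F2 (rot x v))"
          by (intro AE_I2) (auto simp: abs_mult intro!: mult_left_mono mult_left_le_one_le)
      qed measurable
      have ibp: "(\<integral>v. k1 (fst v) * (sin (fst v) * F2 (rot x v)) \<partial>lgm) =
          (\<integral>v. k2 (fst v) * (snd v * F1 (rot x v)) \<partial>lgm)"
      proof -
        have "(\<integral>y. k1 t * (sin t * F2 (rot x (t, y))) \<partial>gauss) = (\<integral>y. k2 t * (y * F1 (rot x (t, y))) \<partial>gauss)" for t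
        proof -
          have 1: "((\<lambda>y. F1 (rot x (t, y))) has_real_derivative cos t * F2 (rot x (t, y))) (at y)" for y
          proof -
            have "((\<lambda>y. rot x (t, y)) has_real_derivative cos t) (at y)"
              unfolding rot_def by (auto intro!: derivative_eq_intros)
            from DERIV_chain2[OF F1 this] show ?thesis by (simp add: mult.commute)
          qed
          have cr: "continuous_on UNIV (\<lambda>y. rot x (t, y))"
            unfolding rot_def by (auto intro!: continuous_intros)
          have 2: "continuous_on UNIV (\<lambda>y. cos t * F2 (rot x (t, y)))"
            by (intro continuous_intros continuous_on_compose2[OF F2(1) cr]) auto
          have 3: "polynomial_growth (\<lambda>y. F1 (rot x (t, y)))"
            by (rule polynomial_growthI[where B = "B * (1 + \<bar>x\<bar>) ^ s" and s = s])
              (use rot_growth[OF F1B, of x] in \<open>auto\<close>)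
          have 4: "polynomial_growth (\<lambda>y. F2 (rot x (t, y)))"
            by (rule polynomial_growthI[where B = "B2 * (1 + \<bar>x\<bar>) ^ s2" and s = s2])
              (use rot_growth[OF F2B, of x] in \<open>auto\<close>)
          have "(\<integral>y. k1 t * (sin t * F2 (rot x (t, y))) \<partial>gauss) = k2 t * (\<integral>y. cos t * F2 (rot x (t, y)) \<partial>gauss)"
            using k2k[of t] by (simp flip: mult.assoc)
          also have "\<dots> = k2 t * (\<integral>y. y * F1 (rot x (t, y)) \<partial>gauss)"
            by (subst gauss_integration_by_parts[OF 1 2 3]) (intro polynomial_growth_intros 4 refl)+
          finally show ?thesis by simp
        qed
        then have "(\<integral>t. (\<integral>y. k1 t * (sin t * F2 (rot x (t, y))) \<partial>gauss) \<partial>lborel) =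
            (\<integral>t. (\<integral>y. k2 t * (y * F1 (rot x (t, y))) \<partial>gauss) \<partial>lborel)" by simp
        with lg.integral_fst'[OF i3] lg.integral_fst'[OF i2] show ?thesis by simp
      qed
      \<comment> \<open>Minus the integrand of w'' - x w' - b w after the integration by parts. For
        fixed y, -G is the t-derivative of sin^b t times F at the rotated point, which runs from 0
        at t = 0 to F x at t = pi/2.\<close>
      define G where "G t y = k2 t * (y * F1 (rot x (t, y))) - x * (k1 t * F1 (rot x (t, y))) - b * (k t * F (rot x (t, y)))" for t y
      have Gi: "integrable lgm (case_prod G)"
        using Bochner_Integration.integrable_diff[OF Bochner_Integration.integrable_diff[OF i2 integrable_mult_right[OF i1, of x]] integrable_mult_right[OF i0, of b]]
        unfolding G_def[abs_def] by (simp add: case_prod_unfold)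
      have inner: "(\<integral>t. G t y \<partial>lborel) = - F x" if Gy: "integrable lborel (\<lambda>t. G t y)" for y
      proof -
        define H where "H t = sin t powr b * F (rot x (t, y))" for t
        define h where "h t = b * (sin t powr (b - 1) * cos t) * F (rot x (t, y)) +
            sin t powr b * (F1 (rot x (t, y)) * (x * cos t - y * sin t))" for t
        have dH: "(H has_real_derivative h t) (at t)" if "t \<in> J" for t
        proof -
          have 1: "((\<lambda>t. rot x (t, y)) has_real_derivative (x * cos t - y * sin t)) (at t)"
            unfolding rot_def by (auto intro!: derivative_eq_intros)
          have 2: "((\<lambda>t. sin t powr b) has_real_derivative b * (sin t powr (b - 1) * cos t)) (at t)"
            using pos(1)[OF that] by (auto intro!: derivative_eq_intros simp: powr_diff field_simps)
          from DERIV_mult[OF 2 DERIV_chain2[OF F 1]] show ?thesis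
            unfolding H_def[abs_def] h_def by (simp add: mult_ac)
        qed
        have cH: "continuous_on {0..pi/2} H"
          unfolding H_def
        proof (intro continuous_on_mult continuous_on_powr' continuous_intros)
          have "continuous_on {0..pi/2} (\<lambda>t. rot x (t, y))"
            unfolding rot_def by (auto intro!: continuous_intros)
          then show "continuous_on {0..pi/2} (\<lambda>t. F (rot x (t, y)))"
            by (rule continuous_on_compose2[OF DERIV_continuous[OF F, of UNIV]]) auto
        qed (use b in \<open>auto intro!: sin_ge_zero\<close>)
        \<comment> \<open>sin^b need not be differentiable at 0, so at the end points only
          continuity is used.\<close>
        have "(h has_integral H (pi/2) - H 0) {0..pi/2}"
          by (rule fundamental_theorem_of_calculus_interior[OF _ cH])
            (use dH in \<open>auto simp: J_def simp flip: has_real_derivative_iff_has_vector_derivative\<close>)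
        then have "(h has_integral F x) {0..pi/2}"
          using b by (simp add: H_def rot_def)
        then have "((\<lambda>t. - G t y) has_integral F x) {0..pi/2}"
        proof (rule has_integral_spike_finite[of "{0, pi/2}", rotated 2])
          fix t assume "t \<in> {0..pi/2} - {0, pi/2}"
          then have t: "t \<in> J" by (auto simp: J_def)
          have "sin t powr (b + 1) = sin t powr b * sin t"
            using pos(1)[OF t] by (simp add: powr_add)
          then show "- G t y = h t"
            using t unfolding G_def h_def k_def k1_def k2_def by (simp add: algebra_simps)
        qed simp
        then have "((\<lambda>t. if t \<in> {0..pi/2} then - G t y else 0) has_integral F x) UNIV"
          by (subst has_integral_restrict_UNIV)
        moreover have "(\<lambda>t. if t \<in> {0..pi/2} then - G t y else 0) = (\<lambda>t. - G t y)"
          by (auto simp: G_def k_def k1_def k2_def J_def indicator_def)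
        ultimately have "((\<lambda>t. - G t y) has_integral F x) UNIV" by simp
        moreover have "((\<lambda>t. - G t y) has_integral (\<integral>t. - G t y \<partial>lborel)) UNIV"
          by (rule has_integral_integral_lborel) (use Gy in simp)
        ultimately have "(\<integral>t. - G t y \<partial>lborel) = F x"
          by (rule has_integral_unique[symmetric])
        then show ?thesis by simp
      qed
      \<comment> \<open>The order of integration is exchanged: the t-integral is now the inner one,
        and Fubini's theorem grants its integrability for almost every y.\<close>
      have "(\<integral>y. (\<integral>t. G t y \<partial>lborel) \<partial>gauss) = (\<integral>y. - F x \<partial>gauss)"
      proof (rule integral_cong_AE)
        show "(\<lambda>y. \<integral>t. G t y \<partial>lborel) \<in> borel_measurable gauss"
          using lg.integrable_snd[OF Gi] by (rule borel_measurable_integrable)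
        show "AE y in gauss. (\<integral>t. G t y \<partial>lborel) = - F x"
          using lg.AE_integrable_snd[OF Gi] by eventually_elim (rule inner)
      qed simp
      then have "(\<integral>v. case_prod G v \<partial>lgm) = - F x"
        unfolding lg.integral_snd[OF Gi] using gauss.prob_space by simp
      moreover have "(\<integral>v. case_prod G v \<partial>lgm) = (\<integral>v. k2 (fst v) * (snd v * F1 (rot x v)) \<partial>lgm)
          - x * (\<integral>v. k1 (fst v) * F1 (rot x v) \<partial>lgm) - b * (\<integral>v. k (fst v) * F (rot x v) \<partial>lgm)"
        using i0 i1 i2 unfolding G_def by (simp add: case_prod_unfold)
      ultimately show ?thesis
        unfolding w_def w1_def w2_def ibp by simp
    qed
    have bw: "\<bar>w x\<bar> \<le> ?K * B * (1 + \<bar>x\<bar>) ^ s" for x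
    proof -
      have "\<bar>w x\<bar> \<le> ((\<integral>t. \<bar>k t\<bar> \<partial>lborel) * bmoment s) * B * (1 + \<bar>x\<bar>) ^ s"
        unfolding w_def abs_minus_cancel by (rule rot_integrable[OF ki _ FB]) measurable
      also have "\<dots> \<le> ?K * B * (1 + \<bar>x\<bar>) ^ s"
        using B0 K0 by (intro mult_right_mono) auto
      finally show ?thesis .
    qed
    have bw1: "\<bar>w1 x\<bar> \<le> ?K * B * (1 + \<bar>x\<bar>) ^ s" for x
    proof -
      have "\<bar>w1 x\<bar> \<le> ((\<integral>t. \<bar>k1 t\<bar> \<partial>lborel) * bmoment s) * B * (1 + \<bar>x\<bar>) ^ s"
        unfolding w1_def abs_minus_cancel by (rule rot_integrable[OF k1i _ F1B]) measurable
      also have "\<dots> \<le> ?K * B * (1 + \<bar>x\<bar>) ^ s"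
        using B0 K0 by (intro mult_right_mono) auto
      finally show ?thesis .
    qed
    have "(w1 has_real_derivative F x + x * w1 x + b * w x) (at x)" for x
      using dw1[of x] unfolding ode .
    with dw bw bw1
    show "\<exists>w w1. (\<forall>x. (w has_real_derivative w1 x) (at x)) \<and>
        (\<forall>x. (w1 has_real_derivative F x + x * w1 x + b * w x) (at x)) \<and>
        (\<forall>x. \<bar>w x\<bar> \<le> ?K * B * (1 + \<bar>x\<bar>) ^ s) \<and> (\<forall>x. \<bar>w1 x\<bar> \<le> ?K * B * (1 + \<bar>x\<bar>) ^ s)"
      by blast
  qed
qed

section \<open>Orthogonality to polynomials and Hermite remainders\<close>

text \<open>Monomials are used instead of Hermite polynomials because integration by parts acts on
  them as a simple recursion.\<close>

definition gauss_orth :: "nat \<Rightarrow> (real \<Rightarrow> real) \<Rightarrow> bool" where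
  "gauss_orth n g \<longleftrightarrow> (\<forall>k<n. (\<integral>x. g x * x ^ k \<partial>gauss) = 0)"

lemma integrable_gauss_power:
  assumes "continuous_on UNIV g" "polynomial_growth g"
  shows "integrable gauss (\<lambda>x. g x * x ^ k)"
proof (rule integrable_gauss_growth)
  note [measurable] = continuous_borel[OF assms(1)]
  show "(\<lambda>x. g x * x ^ k) \<in> borel_measurable borel" by measurable
qed (intro polynomial_growth_intros assms)

text \<open>At k = 0 the truncated exponent \<open>k - 1\<close> is harmless because of the factor
  k.\<close>

lemma gauss_ibp_power:
  assumes "\<And>x. (u has_real_derivative u' x) (at x)" "continuous_on UNIV u'"
    and "polynomial_growth u" "polynomial_growth u'"
  shows "(\<integral>x. u' x * x ^ k \<partial>gauss) = (\<integral>x. u x * x ^ (k + 1) \<partial>gauss) - real k * (\<integral>x. u x * x ^ (k - 1) \<partial>gauss)"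
proof -
  have cu: "continuous_on UNIV u" by (rule DERIV_continuous[OF assms(1)])
  have d: "((\<lambda>x. u x * x ^ k) has_real_derivative u' x * x ^ k + real k * (u x * x ^ (k - 1))) (at x)" for x
    using DERIV_mult[OF assms(1) DERIV_pow[of k x]] by (simp add: mult_ac)
  have "(\<integral>x. u' x * x ^ k + real k * (u x * x ^ (k - 1)) \<partial>gauss) = (\<integral>x. x * (u x * x ^ k) \<partial>gauss)"
    by (rule gauss_integration_by_parts[OF d])
      (intro continuous_intros polynomial_growth_intros assms cu)+
  moreover have "(\<integral>x. u' x * x ^ k + real k * (u x * x ^ (k - 1)) \<partial>gauss) =
      (\<integral>x. u' x * x ^ k \<partial>gauss) + real k * (\<integral>x. u x * x ^ (k - 1) \<partial>gauss)"
    using integrable_gauss_power[OF assms(2,4), of k] integrable_gauss_power[OF cu assms(3), of "k - 1"]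
    by simp
  moreover have "(\<lambda>x. x * (u x * x ^ k)) = (\<lambda>x. u x * x ^ (k + 1))"
    by (auto simp: mult_ac)
  ultimately show ?thesis by simp
qed

lemma growth_le:
  assumes "\<bar>a\<bar> \<le> C * (1 + \<bar>x\<bar>) ^ s" "C \<le> C'" "s \<le> s'" "0 \<le> C"
  shows "\<bar>a\<bar> \<le> C' * (1 + \<bar>x::real\<bar>) ^ s'"
proof -
  have "C * (1 + \<bar>x\<bar>) ^ s \<le> C' * (1 + \<bar>x\<bar>) ^ s'"
    using assms by (intro mult_mono power_increasing) auto
  with assms(1) show ?thesis by linarith
qed

lemma growth_times_ident:
  assumes "\<bar>a\<bar> \<le> C * (1 + \<bar>x::real\<bar>) ^ s"
  shows "\<bar>x * a\<bar> \<le> C * (1 + \<bar>x\<bar>) ^ (s + 1)"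
proof -
  have "\<bar>x\<bar> * \<bar>a\<bar> \<le> (1 + \<bar>x\<bar>) * (C * (1 + \<bar>x\<bar>) ^ s)"
    using assms by (intro mult_mono) auto
  then show ?thesis by (simp add: abs_mult mult_ac)
qed

text \<open>If \<open>f\<close> is the Stein antiderivative of \<open>g\<close> and \<open>u\<close> solves \<open>u'' - x u' + (c - 1) u = f\<close>,
  then \<open>\<psi> = x u - u'\<close> solves \<open>\<psi>'' - x \<psi>' + c \<psi> = g\<close>; moreover \<open>\<psi>' = c u - f\<close>, so that no further
  derivative of \<open>u\<close> has to be estimated.\<close>

lemma ou_step:
  assumes f: "\<And>x. (f has_real_derivative (x * f x - g x)) (at x)"
    and u: "\<And>x. (u has_real_derivative u1 x) (at x)"
    and u1: "\<And>x. (u1 has_real_derivative (f x + x * u1 x - (c - 1) * u x)) (at x)"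
    and fB: "\<And>x. \<bar>f x\<bar> \<le> K * (1 + \<bar>x\<bar>) ^ s"
    and uB: "\<And>x. \<bar>u x\<bar> \<le> C * (1 + \<bar>x\<bar>) ^ s'" and u1B: "\<And>x. \<bar>u1 x\<bar> \<le> C * (1 + \<bar>x\<bar>) ^ s'"
    and o: "gauss_orth n u"
  defines "\<psi> \<equiv> \<lambda>x. x * u x - u1 x" and "\<psi>1 \<equiv> \<lambda>x. c * u x - f x"
  shows "(\<psi> has_real_derivative \<psi>1 x) (at x)"
    and "(\<psi>1 has_real_derivative (g x + x * \<psi>1 x - c * \<psi> x)) (at x)"
    and "\<bar>\<psi> x\<bar> \<le> (2 * C + \<bar>c\<bar> * C + K) * (1 + \<bar>x\<bar>) ^ (s + s' + 1)"
    and "\<bar>\<psi>1 x\<bar> \<le> (2 * C + \<bar>c\<bar> * C + K) * (1 + \<bar>x\<bar>) ^ (s + s' + 1)"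
    and "gauss_orth (Suc n) \<psi>"
proof -
  have C0: "C \<ge> 0" using uB[of 0] by simp
  have K0: "K \<ge> 0" using fB[of 0] by simp
  have cC0: "0 \<le> \<bar>c\<bar> * C" using C0 by simp
  have cu1: "continuous_on UNIV u1" by (rule DERIV_continuous[OF u1])
  have cu: "continuous_on UNIV u" by (rule DERIV_continuous[OF u])
  have pu: "polynomial_growth u" "polynomial_growth u1"
    using uB u1B by (auto intro: polynomial_growthI)
  have "((\<lambda>x. x * u x - u1 x) has_real_derivative (1 * u x + u1 x * x - (f x + x * u1 x - (c - 1) * u x))) (at x)"
    by (intro DERIV_diff DERIV_mult DERIV_ident u u1)
  then show "(\<psi> has_real_derivative \<psi>1 x) (at x)"
    unfolding \<psi>_def \<psi>1_def by (rule DERIV_cong) (simp add: algebra_simps)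
  have "((\<lambda>x. c * u x - f x) has_real_derivative (c * u1 x - (x * f x - g x))) (at x)"
    by (intro DERIV_diff DERIV_cmult u f)
  then show "(\<psi>1 has_real_derivative (g x + x * \<psi>1 x - c * \<psi> x)) (at x)"
    unfolding \<psi>_def \<psi>1_def by (rule DERIV_cong) (simp add: algebra_simps)
  let ?w = "(1 + \<bar>x\<bar>) ^ (s + s' + 1)"
  have w0: "0 \<le> ?w" by simp
  have a1: "\<bar>x * u x\<bar> \<le> C * ?w"
    by (rule growth_le[OF growth_times_ident[OF uB]]) (use C0 in auto)
  have a2: "\<bar>u1 x\<bar> \<le> C * ?w"
    by (rule growth_le[OF u1B]) (use C0 in auto)
  have a3: "\<bar>u x\<bar> \<le> C * ?w"
    by (rule growth_le[OF uB]) (use C0 in auto)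
  have a4: "\<bar>f x\<bar> \<le> K * ?w"
    by (rule growth_le[OF fB]) (use K0 in auto)
  note a = a1 a2 a3 a4
  have KC: "0 \<le> K * ?w" "0 \<le> (\<bar>c\<bar> * C) * ?w" "0 \<le> C * ?w"
    using w0 C0 K0 cC0 by (auto simp del: power_Suc intro!: mult_nonneg_nonneg)
  have e: "(2 * C + \<bar>c\<bar> * C + K) * ?w = 2 * (C * ?w) + (\<bar>c\<bar> * C) * ?w + K * ?w"
    by (simp only: distrib_right mult.assoc)
  have "\<bar>\<psi> x\<bar> \<le> \<bar>x * u x\<bar> + \<bar>u1 x\<bar>" unfolding \<psi>_def by (rule abs_triangle_ineq4)
  then show "\<bar>\<psi> x\<bar> \<le> (2 * C + \<bar>c\<bar> * C + K) * ?w"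
    unfolding e using a KC by linarith
  have "\<bar>\<psi>1 x\<bar> \<le> \<bar>c * u x\<bar> + \<bar>f x\<bar>" unfolding \<psi>1_def by (rule abs_triangle_ineq4)
  moreover have "\<bar>c * u x\<bar> \<le> (\<bar>c\<bar> * C) * ?w"
    using mult_left_mono[OF a(3), of "\<bar>c\<bar>"] by (simp add: abs_mult mult_ac)
  ultimately show "\<bar>\<psi>1 x\<bar> \<le> (2 * C + \<bar>c\<bar> * C + K) * ?w"
    unfolding e using a KC by linarith
  show "gauss_orth (Suc n) \<psi>"
    unfolding gauss_orth_def
  proof (intro allI impI)
    fix k assume k: "k < Suc n"
    \<comment> \<open>The map from u to x u - u' is the adjoint of differentiation: the k-th moment
      of \<psi> is k times the moment of u of degree k - 1, so one order of orthogonality is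
      gained.\<close>
    have "(\<integral>x. \<psi> x * x ^ k \<partial>gauss) = (\<integral>x. u x * x ^ (k + 1) - u1 x * x ^ k \<partial>gauss)"
      unfolding \<psi>_def by (intro Bochner_Integration.integral_cong) (auto simp: algebra_simps)
    also have "\<dots> = (\<integral>x. u x * x ^ (k + 1) \<partial>gauss) - (\<integral>x. u1 x * x ^ k \<partial>gauss)"
      by (intro Bochner_Integration.integral_diff integrable_gauss_power cu cu1 pu)
    also have "\<dots> = real k * (\<integral>x. u x * x ^ (k - 1) \<partial>gauss)"
      unfolding gauss_ibp_power[OF u cu1 pu] by simp
    also have "\<dots> = 0"
      using o k unfolding gauss_orth_def by (cases k) auto
    finally show "(\<integral>x. \<psi> x * x ^ k \<partial>gauss) = 0" .
  qed
qed

text \<open>Since g = x f - f', the moment of g of degree k + 1 is k + 1 times the moment of f of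
  degree k: one order is lost.\<close>

lemma stein_orth:
  assumes f: "\<And>x. (f has_real_derivative (x * f x - g x)) (at x)"
    and g: "continuous_on UNIV g" "polynomial_growth g" and pf: "polynomial_growth f"
    and o: "gauss_orth (Suc n) g"
  shows "gauss_orth n f"
  unfolding gauss_orth_def
proof (intro allI impI)
  fix k assume k: "k < n"
  have cf: "continuous_on UNIV f" by (rule DERIV_continuous[OF f])
  have cf': "continuous_on UNIV (\<lambda>x. x * f x - g x)" by (intro continuous_intros cf g)
  have pf': "polynomial_growth (\<lambda>x. x * f x - g x)" by (intro polynomial_growth_intros pf g)
  have "(\<integral>x. (x * f x - g x) * x ^ (k + 1) \<partial>gauss) =
      (\<integral>x. f x * x ^ (k + 1 + 1) \<partial>gauss) - real (k + 1) * (\<integral>x. f x * x ^ (k + 1 - 1) \<partial>gauss)"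
    by (rule gauss_ibp_power[OF f cf' pf pf'])
  moreover have "(\<integral>x. (x * f x - g x) * x ^ (k + 1) \<partial>gauss) =
      (\<integral>x. f x * x ^ (k + 1 + 1) - g x * x ^ (k + 1) \<partial>gauss)"
    by (intro Bochner_Integration.integral_cong) (auto simp: algebra_simps)
  moreover have "(\<integral>x. f x * x ^ (k + 1 + 1) - g x * x ^ (k + 1) \<partial>gauss) =
      (\<integral>x. f x * x ^ (k + 1 + 1) \<partial>gauss) - (\<integral>x. g x * x ^ (k + 1) \<partial>gauss)"
    by (intro Bochner_Integration.integral_diff integrable_gauss_power cf g pf)
  moreover have "(\<integral>x. g x * x ^ (k + 1) \<partial>gauss) = 0"
    using o k unfolding gauss_orth_def by auto
  ultimately have "real (k + 1) * (\<integral>x. f x * x ^ k \<partial>gauss) = 0" by simp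
  then show "(\<integral>x. f x * x ^ k \<partial>gauss) = 0" by simp
qed

text \<open>Induction on the order of orthogonality. For c < 1 the equation for u in
  \<open>ou_step\<close> has the coefficient c - 1 < 0, and Mehler's integral solves it. In the
  induction step the Stein antiderivative lowers both c and the order by one, the induction
  hypothesis yields u, and \<open>ou_step\<close> restores the order. \<open>C\<close> and
  \<open>s'\<close> do not depend on g.\<close>

lemma ou_solve_aux:
  assumes "c < real (Suc n)"
  shows "\<exists>C\<ge>0. \<exists>s'. \<forall>g g' B. (\<forall>x. (g has_real_derivative g' x) (at x)) \<longrightarrow> continuous_on UNIV g' \<longrightarrow>
    polynomial_growth g' \<longrightarrow> (\<forall>x. \<bar>g x\<bar> \<le> B * (1 + \<bar>x\<bar>) ^ s) \<longrightarrow> gauss_orth (Suc n) g \<longrightarrow>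
    (\<exists>\<psi> \<psi>1. (\<forall>x. (\<psi> has_real_derivative \<psi>1 x) (at x)) \<and>
      (\<forall>x. (\<psi>1 has_real_derivative (g x + x * \<psi>1 x - c * \<psi> x)) (at x)) \<and>
      (\<forall>x. \<bar>\<psi> x\<bar> \<le> C * B * (1 + \<bar>x\<bar>) ^ s') \<and> (\<forall>x. \<bar>\<psi>1 x\<bar> \<le> C * B * (1 + \<bar>x\<bar>) ^ s') \<and>
      gauss_orth (Suc n) \<psi>)"
  using assms
proof (induction n arbitrary: c)
  case 0
  obtain K where K: "K \<ge> 0"
    "\<forall>g B. continuous_on UNIV g \<longrightarrow> (\<forall>x. \<bar>g x\<bar> \<le> B * (1 + \<bar>x\<bar>) ^ s) \<longrightarrow> (\<integral>x. g x \<partial>gauss) = 0 \<longrightarrow>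
      (\<exists>f. (\<forall>x. (f has_real_derivative (x * f x - g x)) (at x)) \<and> (\<forall>x. \<bar>f x\<bar> \<le> K * B * (1 + \<bar>x\<bar>) ^ s))"
    using stein_antiderivative[of s] by (elim exE conjE)
  have b: "1 - c > 0" using 0 by simp
  obtain C where C: "C \<ge> 0"
    "\<forall>F F1 F2 B. (\<forall>x. (F has_real_derivative F1 x) (at x)) \<longrightarrow> (\<forall>x. (F1 has_real_derivative F2 x) (at x)) \<longrightarrow>
      continuous_on UNIV F2 \<longrightarrow> polynomial_growth F2 \<longrightarrow>
      (\<forall>x. \<bar>F x\<bar> \<le> B * (1 + \<bar>x\<bar>) ^ (s + 1)) \<longrightarrow> (\<forall>x. \<bar>F1 x\<bar> \<le> B * (1 + \<bar>x\<bar>) ^ (s + 1)) \<longrightarrow>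
      (\<exists>w w1. (\<forall>x. (w has_real_derivative w1 x) (at x)) \<and>
        (\<forall>x. (w1 has_real_derivative F x + x * w1 x + (1 - c) * w x) (at x)) \<and>
        (\<forall>x. \<bar>w x\<bar> \<le> C * B * (1 + \<bar>x\<bar>) ^ (s + 1)) \<and> (\<forall>x. \<bar>w1 x\<bar> \<le> C * B * (1 + \<bar>x\<bar>) ^ (s + 1)))"
    using mehler_resolvent[OF b, of "s + 1"] by (elim exE conjE)
  let ?C = "2 * (C * (K + 1)) + \<bar>c\<bar> * (C * (K + 1)) + K"
  show ?case
  proof (intro exI[of _ ?C] conjI exI[of _ "s + (s + 1) + 1"] allI impI)
    show "0 \<le> ?C" using C K by simp
    fix g g' :: "real \<Rightarrow> real" and B
    assume g: "\<forall>x. (g has_real_derivative g' x) (at x)" "continuous_on UNIV g'" "polynomial_growth g'"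
      and gB: "\<forall>x. \<bar>g x\<bar> \<le> B * (1 + \<bar>x\<bar>) ^ s" and o: "gauss_orth (Suc 0) g"
    have B0: "B \<ge> 0" using gB[THEN spec, of 0] by simp
    have cg: "continuous_on UNIV g" using g(1) DERIV_continuous by blast
    have pg: "polynomial_growth g" using gB by (auto intro: polynomial_growthI)
    have g0: "(\<integral>x. g x \<partial>gauss) = 0" using o by (simp add: gauss_orth_def)
    obtain f where ff: "\<forall>x. (f has_real_derivative (x * f x - g x)) (at x)" "\<forall>x. \<bar>f x\<bar> \<le> K * B * (1 + \<bar>x\<bar>) ^ s"
      using K(2)[rule_format, OF cg gB[rule_format] g0] by (elim exE conjE)
    note f = ff(1)[rule_format] ff(2)[rule_format]
    have pf: "polynomial_growth f" using f(2) by (rule polynomial_growthI)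
    have cf: "continuous_on UNIV f" by (rule DERIV_continuous[OF f(1)])
    have F2: "((\<lambda>x. x * f x - g x) has_real_derivative (1 * f x + (x * f x - g x) * x - g' x)) (at x)" for x
      by (intro DERIV_diff DERIV_mult DERIV_ident f g(1)[rule_format])
    \<comment> \<open>The resolvent asks for one common bound on f and on f' = x f - g; the factor x
      accounts for the exponent \<open>s + 1\<close>.\<close>
    have fB: "\<bar>f x\<bar> \<le> ((K + 1) * B) * (1 + \<bar>x\<bar>) ^ (s + 1)" for x
      by (rule growth_le[OF f(2)]) (use K(1) B0 in \<open>auto simp: algebra_simps\<close>)
    have f1B: "\<bar>x * f x - g x\<bar> \<le> ((K + 1) * B) * (1 + \<bar>x\<bar>) ^ (s + 1)" for x
    proof -
      have "\<bar>x * f x\<bar> \<le> K * B * (1 + \<bar>x\<bar>) ^ (s + 1)"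
        by (rule growth_times_ident[OF f(2)])
      moreover have "\<bar>g x\<bar> \<le> B * (1 + \<bar>x\<bar>) ^ (s + 1)"
        by (rule growth_le[OF gB[rule_format]]) (use B0 in auto)
      moreover have "((K + 1) * B) * (1 + \<bar>x\<bar>) ^ (s + 1) = K * B * (1 + \<bar>x\<bar>) ^ (s + 1) + B * (1 + \<bar>x\<bar>) ^ (s + 1)"
        by (simp only: distrib_right mult_1_left)
      ultimately show ?thesis using abs_triangle_ineq4[of "x * f x" "g x"] by linarith
    qed
    have F2c: "continuous_on UNIV (\<lambda>x. 1 * f x + (x * f x - g x) * x - g' x)"
      by (intro continuous_intros cf cg g)
    have F2p: "polynomial_growth (\<lambda>x. 1 * f x + (x * f x - g x) * x - g' x)"
      by (intro polynomial_growth_intros pf pg g)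
    obtain u u1 where uu: "\<forall>x. (u has_real_derivative u1 x) (at x)"
      "\<forall>x. (u1 has_real_derivative f x + x * u1 x + (1 - c) * u x) (at x)"
      "\<forall>x. \<bar>u x\<bar> \<le> C * ((K + 1) * B) * (1 + \<bar>x\<bar>) ^ (s + 1)"
      "\<forall>x. \<bar>u1 x\<bar> \<le> C * ((K + 1) * B) * (1 + \<bar>x\<bar>) ^ (s + 1)"
      using C(2)[rule_format, OF f(1) F2 F2c F2p fB f1B] by (elim exE conjE)
    note u = uu(1)[rule_format] and u1 = uu(2)[rule_format] and uB = uu(3)[rule_format] uu(4)[rule_format]
    have u1': "(u1 has_real_derivative (f x + x * u1 x - (c - 1) * u x)) (at x)" for x
      by (rule DERIV_cong[OF u1]) (simp add: algebra_simps)
    have o0: "gauss_orth 0 u" by (simp add: gauss_orth_def)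
    note st = ou_step[OF f(1) u u1' f(2) uB o0]
    have e: "2 * (C * ((K + 1) * B)) + \<bar>c\<bar> * (C * ((K + 1) * B)) + K * B = ?C * B"
      by (simp add: algebra_simps)
    show "\<exists>\<psi> \<psi>1. (\<forall>x. (\<psi> has_real_derivative \<psi>1 x) (at x)) \<and>
      (\<forall>x. (\<psi>1 has_real_derivative (g x + x * \<psi>1 x - c * \<psi> x)) (at x)) \<and>
      (\<forall>x. \<bar>\<psi> x\<bar> \<le> ?C * B * (1 + \<bar>x\<bar>) ^ (s + (s + 1) + 1)) \<and> (\<forall>x. \<bar>\<psi>1 x\<bar> \<le> ?C * B * (1 + \<bar>x\<bar>) ^ (s + (s + 1) + 1)) \<and>
      gauss_orth (Suc 0) \<psi>"
      by (rule exI[of _ "\<lambda>x. x * u x - u1 x"], rule exI[of _ "\<lambda>x. c * u x - f x"], intro conjI allI)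
        (rule st(1), rule st(2), rule st(3)[unfolded e], rule st(4)[unfolded e], rule st(5))
  qed
next
  case (Suc n)
  obtain K where K: "K \<ge> 0"
    "\<forall>g B. continuous_on UNIV g \<longrightarrow> (\<forall>x. \<bar>g x\<bar> \<le> B * (1 + \<bar>x\<bar>) ^ s) \<longrightarrow> (\<integral>x. g x \<partial>gauss) = 0 \<longrightarrow>
      (\<exists>f. (\<forall>x. (f has_real_derivative (x * f x - g x)) (at x)) \<and> (\<forall>x. \<bar>f x\<bar> \<le> K * B * (1 + \<bar>x\<bar>) ^ s))"
    using stein_antiderivative[of s] by (elim exE conjE)
  have "c - 1 < real (Suc n)" using Suc.prems by simp
  from Suc.IH[OF this] obtain C s' where C: "C \<ge> 0"
    "\<forall>g g' B. (\<forall>x. (g has_real_derivative g' x) (at x)) \<longrightarrow> continuous_on UNIV g' \<longrightarrow>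
    polynomial_growth g' \<longrightarrow> (\<forall>x. \<bar>g x\<bar> \<le> B * (1 + \<bar>x\<bar>) ^ s) \<longrightarrow> gauss_orth (Suc n) g \<longrightarrow>
    (\<exists>\<psi> \<psi>1. (\<forall>x. (\<psi> has_real_derivative \<psi>1 x) (at x)) \<and>
      (\<forall>x. (\<psi>1 has_real_derivative (g x + x * \<psi>1 x - (c - 1) * \<psi> x)) (at x)) \<and>
      (\<forall>x. \<bar>\<psi> x\<bar> \<le> C * B * (1 + \<bar>x\<bar>) ^ s') \<and> (\<forall>x. \<bar>\<psi>1 x\<bar> \<le> C * B * (1 + \<bar>x\<bar>) ^ s') \<and>
      gauss_orth (Suc n) \<psi>)"
    by (elim exE conjE)
  let ?C = "2 * (C * K) + \<bar>c\<bar> * (C * K) + K"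
  show ?case
  proof (intro exI[of _ ?C] conjI exI[of _ "s + s' + 1"] allI impI)
    show "0 \<le> ?C" using C K by simp
    fix g g' :: "real \<Rightarrow> real" and B
    assume g: "\<forall>x. (g has_real_derivative g' x) (at x)" "continuous_on UNIV g'" "polynomial_growth g'"
      and gB: "\<forall>x. \<bar>g x\<bar> \<le> B * (1 + \<bar>x\<bar>) ^ s" and o: "gauss_orth (Suc (Suc n)) g"
    have cg: "continuous_on UNIV g" using g(1) DERIV_continuous by blast
    have pg: "polynomial_growth g" using gB by (auto intro: polynomial_growthI)
    have g0: "(\<integral>x. g x \<partial>gauss) = 0" using o unfolding gauss_orth_def by force
    obtain f where ff: "\<forall>x. (f has_real_derivative (x * f x - g x)) (at x)" "\<forall>x. \<bar>f x\<bar> \<le> K * B * (1 + \<bar>x\<bar>) ^ s"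
      using K(2)[rule_format, OF cg gB[rule_format] g0] by (elim exE conjE)
    note f = ff(1)[rule_format] ff(2)[rule_format]
    have pf: "polynomial_growth f" using f(2) by (rule polynomial_growthI)
    have cf: "continuous_on UNIV f" by (rule DERIV_continuous[OF f(1)])
    have of: "gauss_orth (Suc n) f" by (rule stein_orth[OF f(1) cg pg pf o])
    have F1: "continuous_on UNIV (\<lambda>x. x * f x - g x)" "polynomial_growth (\<lambda>x. x * f x - g x)"
      by (intro continuous_intros polynomial_growth_intros pf pg cf cg)+
    obtain u u1 where uu: "\<forall>x. (u has_real_derivative u1 x) (at x)"
      "\<forall>x. (u1 has_real_derivative (f x + x * u1 x - (c - 1) * u x)) (at x)"
      "\<forall>x. \<bar>u x\<bar> \<le> C * (K * B) * (1 + \<bar>x\<bar>) ^ s'" "\<forall>x. \<bar>u1 x\<bar> \<le> C * (K * B) * (1 + \<bar>x\<bar>) ^ s'"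
      and ou: "gauss_orth (Suc n) u"
      using C(2)[rule_format, OF f(1) F1 f(2) of] by (elim exE conjE)
    note u = uu(1)[rule_format] and u1 = uu(2)[rule_format] and uB = uu(3)[rule_format] uu(4)[rule_format]
    note st = ou_step[OF f(1) u u1 f(2) uB ou]
    have e: "2 * (C * (K * B)) + \<bar>c\<bar> * (C * (K * B)) + K * B = ?C * B"
      by (simp add: algebra_simps)
    show "\<exists>\<psi> \<psi>1. (\<forall>x. (\<psi> has_real_derivative \<psi>1 x) (at x)) \<and>
      (\<forall>x. (\<psi>1 has_real_derivative (g x + x * \<psi>1 x - c * \<psi> x)) (at x)) \<and>
      (\<forall>x. \<bar>\<psi> x\<bar> \<le> ?C * B * (1 + \<bar>x\<bar>) ^ (s + s' + 1)) \<and> (\<forall>x. \<bar>\<psi>1 x\<bar> \<le> ?C * B * (1 + \<bar>x\<bar>) ^ (s + s' + 1)) \<and>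
      gauss_orth (Suc (Suc n)) \<psi>"
      by (rule exI[of _ "\<lambda>x. x * u x - u1 x"], rule exI[of _ "\<lambda>x. c * u x - f x"], intro conjI allI)
        (rule st(1), rule st(2), rule st(3)[unfolded e], rule st(4)[unfolded e], rule st(5))
  qed
qed

text \<open>The bound on g has explicit constants, which must be uniform over the test functions. Of
  the derivative only continuity and some polynomial growth are recorded, so it may vary with the
  test function.\<close>

definition smooth_growth :: "real \<Rightarrow> nat \<Rightarrow> (real \<Rightarrow> real) \<Rightarrow> bool" where
  "smooth_growth B s g \<longleftrightarrow> (\<exists>g'. (\<forall>x. (g has_real_derivative g' x) (at x)) \<and> continuous_on UNIV g' \<and>
    polynomial_growth g') \<and> (\<forall>x. \<bar>g x\<bar> \<le> B * (1 + \<bar>x\<bar>) ^ s)"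

lemma smooth_growthI:
  assumes "\<And>x. (g has_real_derivative g' x) (at x)" "continuous_on UNIV g'" "polynomial_growth g'"
    "\<And>x. \<bar>g x\<bar> \<le> B * (1 + \<bar>x\<bar>) ^ s"
  shows "smooth_growth B s g"
  unfolding smooth_growth_def using assms by blast

text \<open>The form that can be iterated: \<psi>'' is of the same class as g, with its constant
  multiplied by \<open>C\<close>. Its orthogonality follows by integrating by parts twice; for n < 2
  the truncated \<open>n - 2\<close> makes that claim void.\<close>

lemma ou_solve:
  assumes "c < real n" "n \<ge> 1"
  obtains C s' where "C \<ge> 0"
    "\<And>g B. smooth_growth B s g \<Longrightarrow> gauss_orth n g \<Longrightarrow>
      \<exists>\<psi>. \<psi> \<in> C2_pol \<and> (\<forall>x. deriv (deriv \<psi>) x - x * deriv \<psi> x + c * \<psi> x = g x) \<and>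
        smooth_growth (C * B) s' (deriv (deriv \<psi>)) \<and> gauss_orth (n - 2) (deriv (deriv \<psi>))"
proof -
  obtain n' where n: "n = Suc n'" using assms(2) by (cases n) auto
  obtain C s' where C: "C \<ge> 0"
    "\<forall>g g' B. (\<forall>x. (g has_real_derivative g' x) (at x)) \<longrightarrow> continuous_on UNIV g' \<longrightarrow>
    polynomial_growth g' \<longrightarrow> (\<forall>x. \<bar>g x\<bar> \<le> B * (1 + \<bar>x\<bar>) ^ s) \<longrightarrow> gauss_orth n g \<longrightarrow>
    (\<exists>\<psi> \<psi>1. (\<forall>x. (\<psi> has_real_derivative \<psi>1 x) (at x)) \<and>
      (\<forall>x. (\<psi>1 has_real_derivative (g x + x * \<psi>1 x - c * \<psi> x)) (at x)) \<and>
      (\<forall>x. \<bar>\<psi> x\<bar> \<le> C * B * (1 + \<bar>x\<bar>) ^ s') \<and> (\<forall>x. \<bar>\<psi>1 x\<bar> \<le> C * B * (1 + \<bar>x\<bar>) ^ s') \<and>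
      gauss_orth n \<psi>)"
    using ou_solve_aux[OF assms(1)[unfolded n], of s, folded n] by (elim exE conjE)
  \<comment> \<open>One summand for each term of \<psi>'' = g + x \<psi>' - c \<psi>.\<close>
  let ?C = "1 + C + \<bar>c\<bar> * C"
  show ?thesis
  proof (rule that[of ?C "s + s' + 1"])
    show "0 \<le> ?C" using C by simp
    fix g B assume gs: "smooth_growth B s g" and o: "gauss_orth n g"
    obtain g' where g: "\<And>x. (g has_real_derivative g' x) (at x)" "continuous_on UNIV g'" "polynomial_growth g'"
      and gB: "\<And>x. \<bar>g x\<bar> \<le> B * (1 + \<bar>x\<bar>) ^ s"
      using gs unfolding smooth_growth_def by blast
    have B0: "B \<ge> 0" using gB[of 0] by simp
    have cg: "continuous_on UNIV g" by (rule DERIV_continuous[OF g(1)])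
    have pg: "polynomial_growth g" using gB by (rule polynomial_growthI)
    obtain \<psi> \<psi>1 where pp: "\<forall>x. (\<psi> has_real_derivative \<psi>1 x) (at x)"
      "\<forall>x. (\<psi>1 has_real_derivative (g x + x * \<psi>1 x - c * \<psi> x)) (at x)"
      "\<forall>x. \<bar>\<psi> x\<bar> \<le> C * B * (1 + \<bar>x\<bar>) ^ s'" "\<forall>x. \<bar>\<psi>1 x\<bar> \<le> C * B * (1 + \<bar>x\<bar>) ^ s'"
      and \<psi>o: "gauss_orth n \<psi>"
      using C(2)[rule_format, OF g gB o] by (elim exE conjE)
    note \<psi> = pp(1)[rule_format] and \<psi>1 = pp(2)[rule_format] and \<psi>B = pp(3)[rule_format] pp(4)[rule_format]
    define \<psi>2 where "\<psi>2 = (\<lambda>x. g x + x * \<psi>1 x - c * \<psi> x)"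
    have \<psi>1': "\<And>x. (\<psi>1 has_real_derivative \<psi>2 x) (at x)" using \<psi>1 by (simp add: \<psi>2_def)
    have c: "continuous_on UNIV \<psi>" "continuous_on UNIV \<psi>1"
      using DERIV_continuous[OF \<psi>] DERIV_continuous[OF \<psi>1] by auto
    have p: "polynomial_growth \<psi>" "polynomial_growth \<psi>1"
      using \<psi>B by (auto intro: polynomial_growthI)
    have c2: "continuous_on UNIV \<psi>2" unfolding \<psi>2_def by (intro continuous_intros c cg)
    have p2: "polynomial_growth \<psi>2" unfolding \<psi>2_def by (intro polynomial_growth_intros p pg)
    note C2 = C2_polI[OF \<psi> \<psi>1' c2 p p2]
    have d3: "(\<psi>2 has_real_derivative (g' x + (1 * \<psi>1 x + \<psi>2 x * x) - c * \<psi>1 x)) (at x)" for x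
      unfolding \<psi>2_def[abs_def]
      using DERIV_diff[OF DERIV_add[OF g(1) DERIV_mult[OF DERIV_ident \<psi>1'[unfolded \<psi>2_def]]] DERIV_cmult[OF \<psi>]] by simp
    have c3: "continuous_on UNIV (\<lambda>x. g' x + (1 * \<psi>1 x + \<psi>2 x * x) - c * \<psi>1 x)"
      by (intro continuous_intros g c c2)
    have p3: "polynomial_growth (\<lambda>x. g' x + (1 * \<psi>1 x + \<psi>2 x * x) - c * \<psi>1 x)"
      by (intro polynomial_growth_intros g p p2)
    have B2: "\<bar>\<psi>2 x\<bar> \<le> ?C * B * (1 + \<bar>x\<bar>) ^ (s + s' + 1)" for x
    proof -
      let ?w = "(1 + \<bar>x\<bar>) ^ (s + s' + 1)"
      have "\<bar>g x\<bar> \<le> B * ?w" by (rule growth_le[OF gB]) (use B0 in auto)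
      moreover have "\<bar>x * \<psi>1 x\<bar> \<le> C * B * ?w"
        by (rule growth_le[OF growth_times_ident[OF \<psi>B(2)]]) (use B0 C(1) in auto)
      moreover have "\<bar>c * \<psi> x\<bar> \<le> \<bar>c\<bar> * (C * B * ?w)"
        unfolding abs_mult by (rule mult_left_mono, rule growth_le[OF \<psi>B(1)]) (use B0 C(1) in auto)
      moreover have "?C * B * ?w = B * ?w + C * B * ?w + \<bar>c\<bar> * (C * B * ?w)"
        by (simp only: distrib_right mult_1_left mult.assoc)
      moreover have "\<bar>\<psi>2 x\<bar> \<le> \<bar>g x\<bar> + \<bar>x * \<psi>1 x\<bar> + \<bar>c * \<psi> x\<bar>" unfolding \<psi>2_def by linarith
      ultimately show ?thesis by linarith
    qed
    have o2: "gauss_orth (n - 2) \<psi>2"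
      unfolding gauss_orth_def
    proof (intro allI impI)
      fix k assume k: "k < n - 2"
      have z: "(\<integral>x. \<psi> x * x ^ i \<partial>gauss) = 0" if "i < n" for i
        using \<psi>o that by (simp add: gauss_orth_def)
      have z1: "(\<integral>x. \<psi>1 x * x ^ i \<partial>gauss) = 0" if "i + 1 < n" for i
        unfolding gauss_ibp_power[OF \<psi> c(2) p] using that by (simp add: z del: power_Suc)
      show "(\<integral>x. \<psi>2 x * x ^ k \<partial>gauss) = 0"
        unfolding gauss_ibp_power[OF \<psi>1' c2 p(2) p2] using k by (simp add: z1 del: power_Suc)
    qed
    show "\<exists>\<psi>. \<psi> \<in> C2_pol \<and> (\<forall>x. deriv (deriv \<psi>) x - x * deriv \<psi> x + c * \<psi> x = g x) \<and>
        smooth_growth (?C * B) (s + s' + 1) (deriv (deriv \<psi>)) \<and> gauss_orth (n - 2) (deriv (deriv \<psi>))"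
    proof (intro exI[of _ \<psi>] conjI)
      show "smooth_growth (?C * B) (s + s' + 1) (deriv (deriv \<psi>))"
        unfolding C2(3) by (rule smooth_growthI[OF d3 c3 p3 B2])
    qed (use C2 o2 in \<open>auto simp: \<psi>2_def\<close>)
  qed
qed

section \<open>Hermite polynomials and remainders\<close>

fun herm :: "nat \<Rightarrow> real poly" where
  "herm 0 = 1"
| "herm (Suc k) = [:0, 1:] * herm k - pderiv (herm k)"

lemma hermite_poly: "hermite k x = poly (herm k) x"
proof -
  have *: "(deriv ^^ k) (\<lambda>t. exp (- t\<^sup>2 / 2)) = (\<lambda>x. (-1) ^ k * poly (herm k) x * exp (- x\<^sup>2 / 2))" for k
  proof (induction k)
    case (Suc k)
    have "((\<lambda>x. (-1) ^ k * poly (herm k) x * exp (- x\<^sup>2 / 2)) has_real_derivative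
        (-1) ^ k * poly (pderiv (herm k)) x * exp (- x\<^sup>2 / 2) +
        exp (- x\<^sup>2 / 2) * (- x) * ((-1) ^ k * poly (herm k) x)) (at x)" for x :: real
    proof (rule DERIV_mult)
      show "((\<lambda>x. (-1) ^ k * poly (herm k) x) has_real_derivative (-1) ^ k * poly (pderiv (herm k)) x) (at x)"
        by (rule DERIV_cmult[OF poly_DERIV])
      show "((\<lambda>x. exp (- x\<^sup>2 / 2)) has_real_derivative exp (- x\<^sup>2 / 2) * (- x)) (at x)"
        by (rule derivative_eq_intros refl | simp)+
    qed
    then have "((\<lambda>x. (-1) ^ k * poly (herm k) x * exp (- x\<^sup>2 / 2)) has_real_derivative
        (-1) ^ Suc k * poly (herm (Suc k)) x * exp (- x\<^sup>2 / 2)) (at x)" for x :: real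
      by (rule DERIV_cong) (simp add: algebra_simps)
    then have "deriv (\<lambda>x. (-1) ^ k * poly (herm k) x * exp (- x\<^sup>2 / 2)) =
        (\<lambda>x. (-1) ^ Suc k * poly (herm (Suc k)) x * exp (- x\<^sup>2 / 2))"
      by (intro ext DERIV_imp_deriv)
    then show ?case using Suc by simp
  qed simp
  have "(-1::real) ^ k * (-1) ^ k = 1"
    by (simp flip: power_mult_distrib)
  moreover have "exp (x\<^sup>2 / 2) * exp (- x\<^sup>2 / 2) = 1"
    by (simp flip: exp_add)
  ultimately have "((-1) ^ k * (-1) ^ k) * (exp (x\<^sup>2 / 2) * exp (- x\<^sup>2 / 2)) * poly (herm k) x = poly (herm k) x"
    by simp
  then show ?thesis unfolding hermite_def * by (simp only: mult_ac)
qed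

lemma polynomial_growth_poly: "polynomial_growth (poly p)"
proof -
  have "poly p = (\<lambda>x. \<Sum>i\<le>degree p. coeff p i * x ^ i)"
    by (auto simp: poly_altdef)
  then show ?thesis by (simp only:) (intro polynomial_growth_intros)
qed

lemma integrable_gauss_poly: "integrable gauss (poly p)"
  by (intro integrable_gauss_growth polynomial_growth_poly continuous_borel continuous_on_poly continuous_on_id)

lemma gauss_poly_ibp: "(\<integral>x. poly (pderiv p) x \<partial>gauss) = (\<integral>x. x * poly p x \<partial>gauss)"
  by (rule gauss_integration_by_parts[OF poly_DERIV])
    (intro polynomial_growth_poly continuous_intros)+

text \<open>Integration by parts: multiplication by x minus differentiation is the adjoint of
  differentiation for the Gaussian measure.\<close>

lemma herm_Suc_integral: "(\<integral>x. poly (herm (Suc k) * q) x \<partial>gauss) = (\<integral>x. poly (herm k * pderiv q) x \<partial>gauss)"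
proof -
  have "(\<integral>x. poly (pderiv (herm k * q)) x \<partial>gauss) = (\<integral>x. poly ([:0, 1:] * (herm k * q)) x \<partial>gauss)"
    using gauss_poly_ibp[of "herm k * q"] by simp
  then have "0 = (\<integral>x. poly ([:0, 1:] * (herm k * q)) x \<partial>gauss) - (\<integral>x. poly (pderiv (herm k * q)) x \<partial>gauss)"
    by simp
  also have "\<dots> = (\<integral>x. poly ([:0, 1:] * (herm k * q)) x - poly (pderiv (herm k * q)) x \<partial>gauss)"
    by (intro Bochner_Integration.integral_diff[symmetric] integrable_gauss_poly)
  also have "\<dots> = (\<integral>x. poly (herm (Suc k) * q) x - poly (herm k * pderiv q) x \<partial>gauss)"
    by (intro Bochner_Integration.integral_cong) (auto simp: pderiv_mult algebra_simps)
  also have "\<dots> = (\<integral>x. poly (herm (Suc k) * q) x \<partial>gauss) - (\<integral>x. poly (herm k * pderiv q) x \<partial>gauss)"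
    by (intro Bochner_Integration.integral_diff integrable_gauss_poly)
  finally show ?thesis by simp
qed

lemma pderiv_herm: "pderiv (herm (Suc k)) = smult (real (Suc k)) (herm k)"
proof (induction k)
  case (Suc k)
  have "pderiv (herm (Suc (Suc k))) = herm (Suc k) + ([:0, 1:] * pderiv (herm (Suc k)) - pderiv (pderiv (herm (Suc k))))"
    by (simp only: herm.simps(2)[of "Suc k"] pderiv_diff pderiv_mult) (simp add: pderiv_pCons)
  also have "[:0, 1:] * pderiv (herm (Suc k)) - pderiv (pderiv (herm (Suc k))) = smult (real (Suc k)) (herm (Suc k))"
    unfolding Suc by (simp only: herm.simps(2) pderiv_smult smult_diff_right mult_smult_right)
  also have "herm (Suc k) + smult (real (Suc k)) (herm (Suc k)) = smult (real (Suc (Suc k))) (herm (Suc k))"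
    by (metis of_nat_Suc smult_1_left smult_add_left)
  finally show ?case .
qed (simp add: pderiv_pCons)

lemma poly_zero_fun: "poly (0::real poly) = (\<lambda>x. 0)"
  by auto

lemma herm_orthogonal: "(\<integral>x. poly (herm j * herm k) x \<partial>gauss) = (if j = k then fact k else 0)"
proof (induction j arbitrary: k)
  case 0
  show ?case
  proof (cases k)
    case (Suc k')
    have "(\<integral>x. poly (herm (Suc k') * 1) x \<partial>gauss) = 0"
      unfolding herm_Suc_integral by (simp add: poly_zero_fun)
    then show ?thesis using Suc by simp
  qed (use gauss.prob_space in simp)
next
  case (Suc j)
  show ?case
  proof (cases k)
    case 0
    then show ?thesis by (simp only: herm_Suc_integral) (simp add: poly_zero_fun)
  next
    case (Suc k')
    have "(\<integral>x. poly (herm j * pderiv (herm (Suc k'))) x \<partial>gauss) = (\<integral>x. real (Suc k') * poly (herm j * herm k') x \<partial>gauss)"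
      unfolding pderiv_herm by (simp add: mult_ac)
    also have "\<dots> = real (Suc k') * (if j = k' then fact k' else 0)"
      using Suc.IH[of k'] by (simp del: poly_mult)
    finally have h: "(\<integral>x. poly (herm j * pderiv (herm (Suc k'))) x \<partial>gauss) = real (Suc k') * (if j = k' then fact k' else 0)" .
    show ?thesis unfolding Suc herm_Suc_integral h by simp
  qed
qed

lemma herm_degree: "degree (herm k) \<le> k" and herm_monic: "coeff (herm k) k = 1"
proof -
  have "degree (herm k) \<le> k \<and> coeff (herm k) k = 1"
  proof (induction k)
    case (Suc k)
    have "degree (pCons 0 (herm k)) \<le> Suc k" using Suc degree_pCons_le[of 0 "herm k"] by linarith
    moreover have "degree (pderiv (herm k)) \<le> Suc k" unfolding degree_pderiv using Suc by linarith
    ultimately have "degree (herm (Suc k)) \<le> Suc k" by (auto intro: degree_diff_le)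
    moreover have "coeff (herm (Suc k)) (Suc k) = 1"
      using Suc by (simp add: coeff_pderiv coeff_eq_0)
    ultimately show ?case ..
  qed simp
  then show "degree (herm k) \<le> k" "coeff (herm k) k = 1" by auto
qed

text \<open>\<open>herm m\<close> is monic of degree m, so subtracting a suitable multiple of it
  lowers the degree of a polynomial.\<close>

lemma orth_poly_if_orth_herm:
  assumes g: "g \<in> borel_measurable borel" "polynomial_growth g"
    and o: "\<And>k. k < n \<Longrightarrow> (\<integral>x. g x * poly (herm k) x \<partial>gauss) = 0"
  shows "gauss_orth n g"
proof -
  have int: "integrable gauss (\<lambda>x. g x * poly q x)" for q
  proof (rule integrable_gauss_growth)
    have [measurable]: "poly q \<in> borel_measurable borel"
      by (intro continuous_borel continuous_on_poly continuous_on_id)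
    note [measurable] = g(1)
    show "(\<lambda>x. g x * poly q x) \<in> borel_measurable borel" by measurable
  qed (intro polynomial_growth_intros polynomial_growth_poly g)
  have "(\<integral>x. g x * poly q x \<partial>gauss) = 0" if "m \<le> n" "q = 0 \<or> degree q < m" for m q
    using that
  proof (induction m arbitrary: q)
    case (Suc m)
    let ?r = "q - smult (coeff q m) (herm m)"
    have "degree ?r \<le> m" "coeff ?r m = 0"
      using Suc.prems herm_degree[of m] herm_monic[of m]
      by (auto intro!: degree_diff_le order_trans[OF degree_smult_le])
    then have "?r = 0 \<or> degree ?r < m"
      by (metis leading_coeff_0_iff le_neq_implies_less)
    then have "(\<integral>x. g x * poly ?r x \<partial>gauss) = 0"
      using Suc.prems by (intro Suc.IH) auto
    moreover have "(\<integral>x. g x * poly ?r x \<partial>gauss) = (\<integral>x. g x * poly q x - coeff q m * (g x * poly (herm m) x) \<partial>gauss)"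
      by (intro Bochner_Integration.integral_cong) (auto simp: algebra_simps)
    moreover have "\<dots> = (\<integral>x. g x * poly q x \<partial>gauss) - coeff q m * (\<integral>x. g x * poly (herm m) x \<partial>gauss)"
      by (subst Bochner_Integration.integral_diff) (use int in auto)
    ultimately show ?case using o[of m] Suc.prems by simp
  qed simp
  from this[of n "monom 1 _"] show ?thesis
    unfolding gauss_orth_def by (auto simp: poly_monom degree_monom_eq)
qed

text \<open>For \<open>R = r_tilde lam p m + 1\<close> its expectation at X is exactly the
  difference between the integrals of \<open>h\<close> against the law of X and against the
  Edgeworth measure.\<close>

definition hermite_rest :: "nat \<Rightarrow> (real \<Rightarrow> real) \<Rightarrow> real \<Rightarrow> real" where
  "hermite_rest R h x = h x - (\<Sum>k\<le>R. (\<integral>y. h y * poly (herm k) y \<partial>gauss) / fact k * poly (herm k) x)"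

text \<open>Uniform over all \<open>h\<close> bounded by 1: the Hermite coefficients are at most the
  Gaussian L1 norms of \<open>herm k\<close> over k!, and \<open>h'\<close> enters no
  constant.\<close>

lemma hermite_rest:
  "\<exists>C\<ge>0. \<exists>s. \<forall>h h'. (\<forall>x. (h has_real_derivative h' x) (at x)) \<longrightarrow> continuous_on UNIV h' \<longrightarrow> polynomial_growth h' \<longrightarrow>
    (\<forall>x. \<bar>h x\<bar> \<le> 1) \<longrightarrow> smooth_growth C s (hermite_rest R h) \<and> gauss_orth (Suc R) (hermite_rest R h)"
proof -
  have pm [measurable]: "poly q \<in> borel_measurable borel" for q :: "real poly"
    by (intro continuous_borel continuous_on_poly continuous_on_id)
  define bd where "bd x = 1 + (\<Sum>k\<le>R. (\<integral>y. \<bar>poly (herm k) y\<bar> \<partial>gauss) / fact k * \<bar>poly (herm k) x\<bar>)" for x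
  have "polynomial_growth (\<lambda>x. \<bar>poly (herm k) x\<bar>)" for k
    by (rule polynomial_growth_bound[OF polynomial_growth_poly[of "herm k"]]) simp
  then have "polynomial_growth bd" unfolding bd_def by (intro polynomial_growth_intros)
  then obtain C s where C: "\<And>x. \<bar>bd x\<bar> \<le> C * (1 + \<bar>x\<bar>) ^ s"
    unfolding polynomial_growth_def by blast
  show ?thesis
  proof (intro exI[of _ C] exI[of _ s] conjI[of "C \<ge> 0"] allI impI)
    show "C \<ge> 0" using C[of 0] by simp
    fix h h' :: "real \<Rightarrow> real"
    assume hh: "\<forall>x. (h has_real_derivative h' x) (at x)" "continuous_on UNIV h'" "polynomial_growth h'"
      and hh1: "\<forall>x. \<bar>h x\<bar> \<le> 1"
    note h = hh(1)[rule_format] hh(2,3) and h1 = hh1[rule_format]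
    have ch: "continuous_on UNIV h" by (rule DERIV_continuous[OF h(1)])
    have [measurable]: "h \<in> borel_measurable borel" by (rule continuous_borel[OF ch])
    have ph: "polynomial_growth h" by (rule polynomial_growth_bound[OF polynomial_growth_const[of 1]]) (use h1 in auto)
    have hi: "integrable gauss (\<lambda>x. h x * poly q x)" for q
      by (rule integrable_gauss_growth) (measurable, intro polynomial_growth_intros ph polynomial_growth_poly)
    define a where "a k = (\<integral>y. h y * poly (herm k) y \<partial>gauss) / fact k" for k
    have rest: "hermite_rest R h = (\<lambda>x. h x - (\<Sum>k\<le>R. a k * poly (herm k) x))"
      unfolding hermite_rest_def a_def ..
    have ab: "\<bar>a k\<bar> \<le> (\<integral>y. \<bar>poly (herm k) y\<bar> \<partial>gauss) / fact k" for k
    proof -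
      have "\<bar>\<integral>y. h y * poly (herm k) y \<partial>gauss\<bar> \<le> (\<integral>y. \<bar>h y * poly (herm k) y\<bar> \<partial>gauss)"
        by (rule integral_abs_bound)
      also have "\<dots> \<le> (\<integral>y. \<bar>poly (herm k) y\<bar> \<partial>gauss)"
      proof (rule integral_mono)
        show "\<bar>h y * poly (herm k) y\<bar> \<le> \<bar>poly (herm k) y\<bar>" for y
          using h1[of y] by (simp add: abs_mult mult_left_le_one_le)
      qed (intro integrable_abs hi integrable_gauss_poly)+
      finally show ?thesis unfolding a_def by (simp add: abs_div divide_right_mono)
    qed
    have "\<bar>hermite_rest R h x\<bar> \<le> C * (1 + \<bar>x\<bar>) ^ s" for x
    proof -
      have "\<bar>hermite_rest R h x\<bar> \<le> \<bar>h x\<bar> + \<bar>\<Sum>k\<le>R. a k * poly (herm k) x\<bar>"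
        unfolding rest by (rule abs_triangle_ineq4)
      also have "\<bar>\<Sum>k\<le>R. a k * poly (herm k) x\<bar> \<le> (\<Sum>k\<le>R. \<bar>a k * poly (herm k) x\<bar>)"
        by (rule sum_abs)
      also have "\<dots> \<le> (\<Sum>k\<le>R. (\<integral>y. \<bar>poly (herm k) y\<bar> \<partial>gauss) / fact k * \<bar>poly (herm k) x\<bar>)"
        unfolding abs_mult by (intro sum_mono mult_right_mono ab) auto
      finally have "\<bar>hermite_rest R h x\<bar> \<le> bd x"
        using h1[of x] unfolding bd_def by linarith
      then show ?thesis using C[of x] by linarith
    qed
    moreover have "(hermite_rest R h has_real_derivative (h' x - (\<Sum>k\<le>R. a k * poly (pderiv (herm k)) x))) (at x)" for x
      unfolding rest by (intro DERIV_diff h DERIV_sum DERIV_cmult poly_DERIV)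
    moreover have "continuous_on UNIV (\<lambda>x. h' x - (\<Sum>k\<le>R. a k * poly (pderiv (herm k)) x))"
      by (intro continuous_intros h)
    moreover have "polynomial_growth (\<lambda>x. h' x - (\<Sum>k\<le>R. a k * poly (pderiv (herm k)) x))"
      by (intro polynomial_growth_intros h polynomial_growth_poly)
    ultimately have 1: "smooth_growth C s (hermite_rest R h)"
      by (intro smooth_growthI)
    have 2: "gauss_orth (Suc R) (hermite_rest R h)"
    proof (rule orth_poly_if_orth_herm)
      show "hermite_rest R h \<in> borel_measurable borel" unfolding rest by measurable
      show "polynomial_growth (hermite_rest R h)" unfolding rest
        by (intro polynomial_growth_intros ph polynomial_growth_poly)
      fix j assume j: "j < Suc R"
      have "(\<integral>x. hermite_rest R h x * poly (herm j) x \<partial>gauss) =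
          (\<integral>x. h x * poly (herm j) x - (\<Sum>k\<le>R. a k * poly (herm k * herm j) x) \<partial>gauss)"
        unfolding rest by (intro Bochner_Integration.integral_cong) (auto simp: left_diff_distrib sum_distrib_right mult.assoc)
      also have "\<dots> = (\<integral>x. h x * poly (herm j) x \<partial>gauss) - (\<integral>x. (\<Sum>k\<le>R. a k * poly (herm k * herm j) x) \<partial>gauss)"
        by (intro Bochner_Integration.integral_diff hi Bochner_Integration.integrable_sum integrable_mult_right integrable_gauss_poly)
      also have "(\<integral>x. (\<Sum>k\<le>R. a k * poly (herm k * herm j) x) \<partial>gauss) = (\<Sum>k\<le>R. \<integral>x. a k * poly (herm k * herm j) x \<partial>gauss)"
        by (intro Bochner_Integration.integral_sum integrable_mult_right integrable_gauss_poly)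
      also have "\<dots> = (\<Sum>k\<le>R. if k = j then a k * fact j else 0)"
        by (intro sum.cong refl) (simp only: integral_mult_right_zero herm_orthogonal, simp)
      also have "\<dots> = a j * fact j" using j by simp
      finally show "(\<integral>x. hermite_rest R h x * poly (herm j) x \<partial>gauss) = 0"
        by (simp add: a_def)
    qed
    from 1 2 show "smooth_growth C s (hermite_rest R h) \<and> gauss_orth (Suc R) (hermite_rest R h)" ..
  qed
qed

section \<open>Transfer from the eigenfunction to the Gaussian\<close>

context markov_diffusion
begin

definition W :: "nat \<Rightarrow> ('a \<Rightarrow> real) \<Rightarrow> 'a \<Rightarrow> real" where
  "W p X = (\<lambda>x. \<Gamma> X X x / lam p - 1)"

lemma W_A: "X \<in> E p \<Longrightarrow> W p X \<in> A (2 * p)"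
  using A_diff[OF A_cmult[OF A_\<Gamma>[OF E_A[of X p p] E_A[of X p p]], of "1 / lam p"] A_const[of 1 "p + p"]]
  by (simp add: W_def mult_2)

text \<open>Hypercontractivity bounds the moments of X uniformly over all normalised
  eigenfunctions.\<close>

lemma growth_L2_bound: "\<exists>C\<ge>0. \<forall>X\<in>E p. l2 M X = 1 \<longrightarrow> (\<forall>(g :: real \<Rightarrow> real) B. g \<in> borel_measurable borel \<longrightarrow> (\<forall>x. \<bar>g x\<bar> \<le> B * (1 + \<bar>x\<bar>) ^ s) \<longrightarrow>
    l2 M (\<lambda>x. g (X x)) \<le> C * B)"
proof -
  obtain C where C: "C \<ge> 0" "\<And>X. X \<in> A p \<Longrightarrow> l2 M (\<lambda>x. X x ^ (2 * s)) \<le> C * (l2 M X) ^ (2 * s)"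
    using hypercontractive_power by meson
  show ?thesis
  proof (intro exI[of _ "2 ^ s * (1 + C)"] conjI ballI impI allI)
    show "0 \<le> 2 ^ s * (1 + C)" using C by simp
    fix X and g :: "real \<Rightarrow> real" and B assume X: "X \<in> E p" "l2 M X = 1" and g: "g \<in> borel_measurable borel"
      and B: "\<forall>x. \<bar>g x\<bar> \<le> B * (1 + \<bar>x\<bar>) ^ s"
    have B0: "B \<ge> 0" using B[rule_format, of 0] by simp
    have am: "X \<in> all_moments M" using X by (intro D_all_moments E_D)
    have bd: "(1 + \<bar>x\<bar>) ^ s \<le> 2 ^ s * (1 + x ^ (2 * s))" for x :: real
    proof -
      have "(1 + \<bar>x\<bar>) ^ s \<le> (2 * max 1 \<bar>x\<bar>) ^ s" by (intro power_mono) auto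
      also have "\<dots> = 2 ^ s * (max 1 \<bar>x\<bar>) ^ s" by (rule power_mult_distrib)
      also have "(max 1 \<bar>x\<bar>) ^ s \<le> 1 + x ^ (2 * s)"
      proof (cases "\<bar>x\<bar> \<le> 1")
        case False
        then have "\<bar>x\<bar> ^ s \<le> \<bar>x\<bar> ^ (2 * s)" by (intro power_increasing) auto
        also have "\<dots> = x ^ (2 * s)" by (simp add: power_mult)
        finally show ?thesis using False by (simp add: max_def)
      qed (simp add: power_mult max_def)
      finally show ?thesis by simp
    qed
    have L: "(\<lambda>x. X x ^ (2 * s)) \<in> L2 M" "(\<lambda>x. 1) \<in> L2 M"
      using am by (auto intro!: all_moments_L2 all_moments_intros)
    have "l2 M (\<lambda>x. g (X x)) \<le> l2 M (\<lambda>x. (B * 2 ^ s) * (1 + X x ^ (2 * s)))"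
      unfolding l2_def
    proof (intro real_sqrt_le_mono integral_mono)
      have gm: "(\<lambda>x. g (X x)) \<in> all_moments M"
        by (rule all_moments_growth[OF am g]) (use B in \<open>auto intro: polynomial_growthI\<close>)
      show "integrable M (\<lambda>x. (g (X x))\<^sup>2)" "integrable M (\<lambda>x. ((B * 2 ^ s) * (1 + X x ^ (2 * s)))\<^sup>2)"
        using am gm by (auto intro!: all_moments_integrable all_moments_intros)
      fix x
      have "\<bar>g (X x)\<bar> \<le> B * (2 ^ s * (1 + X x ^ (2 * s)))"
        using B[rule_format, of "X x"] mult_left_mono[OF bd[of "X x"] B0] by linarith
      then have "\<bar>g (X x)\<bar>\<^sup>2 \<le> (B * (2 ^ s * (1 + X x ^ (2 * s))))\<^sup>2"
        by (rule power_mono) simp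
      then show "(g (X x))\<^sup>2 \<le> ((B * 2 ^ s) * (1 + X x ^ (2 * s)))\<^sup>2"
        by (simp add: mult.assoc)
    qed
    also have "\<dots> = (B * 2 ^ s) * l2 M (\<lambda>x. 1 + X x ^ (2 * s))"
      unfolding l2_cmult using B0 by simp
    also have "\<dots> \<le> (B * 2 ^ s) * (1 + C)"
    proof (rule mult_left_mono)
      show "l2 M (\<lambda>x. 1 + X x ^ (2 * s)) \<le> 1 + C"
        using l2_triangle[OF L(2,1)] C(2)[OF E_A[OF X(1) order_refl]] X(2) by (simp add: l2_const)
    qed (use B0 in simp)
    finally show "l2 M (\<lambda>x. g (X x)) \<le> 2 ^ s * (1 + C) * B" by (simp add: mult_ac)
  qed
qed

lemma smooth_growth_measurable:
  assumes "smooth_growth B s g"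
  shows "g \<in> borel_measurable borel" "polynomial_growth g"
  using assms unfolding smooth_growth_def
  by (auto intro: continuous_borel DERIV_continuous polynomial_growthI)

lemma eigen_transfer:
  assumes p: "p \<ge> 1" and X: "X \<in> E p" and Z: "Z \<in> E k"
    and \<psi>: "\<psi> \<in> C2_pol" "\<And>x. deriv (deriv \<psi>) x - x * deriv \<psi> x + lam k / lam p * \<psi> x = g x"
    and g: "smooth_growth B s g" and \<psi>2: "smooth_growth B' s' (deriv (deriv \<psi>))"
  shows "(\<integral>x. g (X x) * Z x \<partial>M) = - (\<integral>x. deriv (deriv \<psi>) (X x) * (W p X x * Z x) \<partial>M)"
proof -
  have lp: "lam p > 0" by (rule lam_pos[OF p])
  have XD: "X \<in> D" and ZD: "Z \<in> D" using X Z E_D by auto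
  have \<psi>D: "(\<lambda>x. \<psi> (X x)) \<in> D" by (rule D_compose[OF \<psi>(1) XD])
  have am: "(\<lambda>x. g (X x)) \<in> all_moments M" "(\<lambda>x. deriv (deriv \<psi>) (X x)) \<in> all_moments M"
    "(\<lambda>x. \<psi> (X x)) \<in> all_moments M" "Z \<in> all_moments M" "W p X \<in> all_moments M"
    using all_moments_growth[OF D_all_moments[OF XD] smooth_growth_measurable[OF g]]
      all_moments_growth[OF D_all_moments[OF XD] smooth_growth_measurable[OF \<psi>2]]
      D_all_moments[OF \<psi>D] D_all_moments[OF ZD] A_all_moments[OF W_A[OF X]] by auto
  \<comment> \<open>The equation for \<psi> and \<Gamma>(X, X) = lam p (1 + W) together eliminate
    the first derivative of \<psi>.\<close>
  have LpX: "AE x in M. L (\<lambda>x. \<psi> (X x)) x =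
      lam p * (g (X x) + deriv (deriv \<psi>) (X x) * W p X x) - lam k * \<psi> (X x)"
    using L_compose[OF \<psi>(1) XD] E_eigen[OF X]
  proof eventually_elim
    case (elim x)
    have "g (X x) = deriv (deriv \<psi>) (X x) - X x * deriv \<psi> (X x) + lam k / lam p * \<psi> (X x)"
      using \<psi>(2)[of "X x"] by simp
    then have "lam p * g (X x) = lam p * deriv (deriv \<psi>) (X x) - lam p * (X x * deriv \<psi> (X x)) + lam k * \<psi> (X x)"
      using lp by (simp add: field_simps)
    moreover have "lam p * (deriv (deriv \<psi>) (X x) * W p X x) = deriv (deriv \<psi>) (X x) * \<Gamma> X X x - lam p * deriv (deriv \<psi>) (X x)"
      using lp by (simp add: W_def field_simps)
    ultimately show ?case unfolding elim distrib_left by (simp add: elim(2) algebra_simps)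
  qed
  \<comment> \<open>Moving \<open>L\<close> from Z to \<psi>(X) produces the term in lam k on both
    sides, where it cancels.\<close>
  have "- lam k * (\<integral>x. \<psi> (X x) * Z x \<partial>M) = (\<integral>x. \<psi> (X x) * L Z x \<partial>M)"
    unfolding integral_mult_right_zero[symmetric]
    by (rule integral_cong_AE) (use \<psi>D ZD E_eigen[OF Z] in auto)
  also have "\<dots> = (\<integral>x. L (\<lambda>x. \<psi> (X x)) x * Z x \<partial>M)"
    by (rule L_symmetric[OF \<psi>D ZD])
  also have "\<dots> = (\<integral>x. lam p * (g (X x) * Z x + deriv (deriv \<psi>) (X x) * (W p X x * Z x)) - lam k * (\<psi> (X x) * Z x) \<partial>M)"
  proof (rule integral_cong_AE)
    show "(\<lambda>x. L (\<lambda>x. \<psi> (X x)) x * Z x) \<in> borel_measurable M"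
      using L_measurable[OF \<psi>D] D_measurable[OF ZD] by measurable
    show "(\<lambda>x. lam p * (g (X x) * Z x + deriv (deriv \<psi>) (X x) * (W p X x * Z x)) - lam k * (\<psi> (X x) * Z x)) \<in> borel_measurable M"
      using am by (intro all_moments_measurable all_moments_intros)
    show "AE x in M. L (\<lambda>x. \<psi> (X x)) x * Z x =
        lam p * (g (X x) * Z x + deriv (deriv \<psi>) (X x) * (W p X x * Z x)) - lam k * (\<psi> (X x) * Z x)"
      using LpX
    proof eventually_elim
      case (elim x)
      show ?case unfolding elim by (simp add: algebra_simps)
    qed
  qed
  also have "\<dots> = lam p * ((\<integral>x. g (X x) * Z x \<partial>M) + (\<integral>x. deriv (deriv \<psi>) (X x) * (W p X x * Z x) \<partial>M))
      - lam k * (\<integral>x. \<psi> (X x) * Z x \<partial>M)"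
  proof -
    have "integrable M (\<lambda>x. g (X x) * Z x)" "integrable M (\<lambda>x. deriv (deriv \<psi>) (X x) * (W p X x * Z x))"
      "integrable M (\<lambda>x. \<psi> (X x) * Z x)"
      using am by (auto intro!: all_moments_integrable all_moments_mult)
    then show ?thesis by simp
  qed
  finally have "lam p * ((\<integral>x. g (X x) * Z x \<partial>M) + (\<integral>x. deriv (deriv \<psi>) (X x) * (W p X x * Z x) \<partial>M)) = 0"
    by simp
  then show ?thesis using lp by simp
qed

text \<open>Every application of the previous identity replaces \<open>Z\<close> by \<open>W Z\<close>, which gains a factor \<open>\<parallel>W\<parallel>\<close>
  and costs two orders of orthogonality to polynomials.\<close>

lemma transfer_iterated:
  assumes p: "p \<ge> 1" and WK: "\<And>X. X \<in> E p \<Longrightarrow> l2 M X = 1 \<Longrightarrow> W p X \<in> A K"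
    and J: "\<And>j. j < n \<Longrightarrow> lam (K * (i + j)) / lam p + 2 * real j < real J"
  shows "\<exists>C\<ge>0. \<forall>X\<in>E p. l2 M X = 1 \<longrightarrow> (\<forall>Z\<in>A (K * i). \<forall>g B. smooth_growth B s g \<longrightarrow> gauss_orth J g \<longrightarrow>
    \<bar>\<integral>x. g (X x) * Z x \<partial>M\<bar> \<le> C * B * l2 M Z * (l2 M (W p X)) ^ n)"
  using J
proof (induction n arbitrary: i J s)
  case 0
  obtain C where C: "C \<ge> 0" "\<forall>X\<in>E p. l2 M X = 1 \<longrightarrow> (\<forall>(g :: real \<Rightarrow> real) B. g \<in> borel_measurable borel \<longrightarrow> (\<forall>x. \<bar>g x\<bar> \<le> B * (1 + \<bar>x\<bar>) ^ s) \<longrightarrow>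
    l2 M (\<lambda>x. g (X x)) \<le> C * B)"
    using growth_L2_bound[of p s] by blast
  show ?case
  proof (intro exI[of _ C] conjI ballI impI allI)
    fix X Z g B assume X: "X \<in> E p" "l2 M X = 1" and Z: "Z \<in> A (K * i)" and g: "smooth_growth B s g"
    have gX: "(\<lambda>x. g (X x)) \<in> L2 M"
      using all_moments_growth[OF D_all_moments[OF E_D[OF X(1)]] smooth_growth_measurable[OF g]] by (rule all_moments_L2)
    have "\<bar>\<integral>x. g (X x) * Z x \<partial>M\<bar> \<le> l2 M (\<lambda>x. g (X x)) * l2 M Z"
      by (rule Cauchy_Schwarz_L2[OF gX D_L2'[OF A_D[OF Z]]])
    also have "\<dots> \<le> C * B * l2 M Z"
      using C(2)[rule_format, OF X smooth_growth_measurable(1)[OF g], of B] g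
      by (intro mult_right_mono) (auto simp: smooth_growth_def)
    finally show "\<bar>\<integral>x. g (X x) * Z x \<partial>M\<bar> \<le> C * B * l2 M Z * (l2 M (W p X)) ^ 0" by simp
  qed (rule C(1))
next
  case (Suc n)
  have lp: "lam p > 0" by (rule lam_pos[OF p])
  obtain H where H: "H \<ge> 0" "\<forall>F\<in>A K. \<forall>G\<in>A (K * i). l2 M (\<lambda>x. F x * G x) \<le> H * l2 M F * l2 M G"
    using hypercontractive_mult[of K "K * i"] by blast
  \<comment> \<open>The equation contains the eigenvalue of Z, so Z is first a single
    eigenfunction.\<close>
  have ex: "\<exists>C\<ge>0. \<forall>X\<in>E p. l2 M X = 1 \<longrightarrow> (\<forall>Z\<in>E k. \<forall>g B. smooth_growth B s g \<longrightarrow> gauss_orth J g \<longrightarrow>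
    \<bar>\<integral>x. g (X x) * Z x \<partial>M\<bar> \<le> C * B * l2 M Z * (l2 M (W p X)) ^ Suc n)" if k: "k \<le> K * i" for k
  proof -
    have c: "lam k / lam p < real J"
      using Suc.prems[of 0] lam_mono[OF k] lp divide_right_mono[of "lam k" "lam (K * i)" "lam p"] by simp
    moreover have "0 \<le> lam k / lam p" using lp lam_nonneg[of k] by simp
    ultimately have J1: "J \<ge> 1" by linarith
    obtain C s' where C: "C \<ge> 0"
      "\<And>g B. smooth_growth B s g \<Longrightarrow> gauss_orth J g \<Longrightarrow>
      \<exists>\<psi>. \<psi> \<in> C2_pol \<and> (\<forall>x. deriv (deriv \<psi>) x - x * deriv \<psi> x + lam k / lam p * \<psi> x = g x) \<and>
        smooth_growth (C * B) s' (deriv (deriv \<psi>)) \<and> gauss_orth (J - 2) (deriv (deriv \<psi>))"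
      using ou_solve[OF c J1, of s] by blast
    \<comment> \<open>The budget passes on: step \<open>Suc j\<close> at level i with order J is
      step j at level \<open>Suc i\<close> with order \<open>J - 2\<close>.\<close>
    have "lam (K * (Suc i + j)) / lam p + 2 * real j < real (J - 2)" if "j < n" for j
      using Suc.prems[of "Suc j"] that by simp
    from Suc.IH[of "Suc i" "J - 2" s', OF this] obtain D' where D': "D' \<ge> 0"
      "\<forall>X\<in>E p. l2 M X = 1 \<longrightarrow> (\<forall>Z\<in>A (K * Suc i). \<forall>g B. smooth_growth B s' g \<longrightarrow> gauss_orth (J - 2) g \<longrightarrow>
        \<bar>\<integral>x. g (X x) * Z x \<partial>M\<bar> \<le> D' * B * l2 M Z * (l2 M (W p X)) ^ n)"
      by blast
    show ?thesis
    proof (intro exI[of _ "D' * C * H"] conjI ballI impI allI)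
      show "0 \<le> D' * C * H" using D' C H by simp
      fix X Z g B assume X: "X \<in> E p" "l2 M X = 1" and Z: "Z \<in> E k"
        and g: "smooth_growth B s g" "gauss_orth J g"
      obtain \<psi> where \<psi>: "\<psi> \<in> C2_pol" "\<forall>x. deriv (deriv \<psi>) x - x * deriv \<psi> x + lam k / lam p * \<psi> x = g x"
        "smooth_growth (C * B) s' (deriv (deriv \<psi>))" "gauss_orth (J - 2) (deriv (deriv \<psi>))"
        using C(2)[OF g] by blast
      have B0: "B \<ge> 0"
      proof -
        have "\<bar>g 0\<bar> \<le> B * (1 + \<bar>0\<bar>) ^ s" using g(1) unfolding smooth_growth_def by blast
        then show ?thesis by simp
      qed
      have ZA: "Z \<in> A (K * i)" by (rule E_A[OF Z k])
      have WZ: "(\<lambda>x. W p X x * Z x) \<in> A (K * Suc i)"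
        using A_mult[OF WK[OF X] ZA] by simp
      have "\<bar>\<integral>x. g (X x) * Z x \<partial>M\<bar> = \<bar>\<integral>x. deriv (deriv \<psi>) (X x) * (W p X x * Z x) \<partial>M\<bar>"
        using eigen_transfer[OF p X(1) Z \<psi>(1) \<psi>(2)[rule_format] g(1) \<psi>(3)] by simp
      also have "\<dots> \<le> D' * (C * B) * l2 M (\<lambda>x. W p X x * Z x) * (l2 M (W p X)) ^ n"
        using D'(2)[rule_format, OF X WZ \<psi>(3,4)] .
      also have "\<dots> \<le> D' * (C * B) * (H * l2 M (W p X) * l2 M Z) * (l2 M (W p X)) ^ n"
        using D' C B0 H(2)[rule_format, OF WK[OF X] ZA] by (intro mult_right_mono mult_left_mono) auto
      finally show "\<bar>\<integral>x. g (X x) * Z x \<partial>M\<bar> \<le> D' * C * H * B * l2 M Z * (l2 M (W p X)) ^ Suc n"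
        by (simp add: mult_ac)
    qed
  qed
  then have "\<forall>k\<in>{..K * i}. \<exists>C. C \<ge> 0 \<and> (\<forall>X\<in>E p. l2 M X = 1 \<longrightarrow> (\<forall>Z\<in>E k. \<forall>g B. smooth_growth B s g \<longrightarrow> gauss_orth J g \<longrightarrow>
    \<bar>\<integral>x. g (X x) * Z x \<partial>M\<bar> \<le> C * B * l2 M Z * (l2 M (W p X)) ^ Suc n))"
    by blast
  \<comment> \<open>Z has finitely many components, none larger in norm than Z itself, so the
    constants are simply added.\<close>
  from bchoice[OF this] obtain Cf where Cf: "\<forall>k\<in>{..K * i}. Cf k \<ge> 0 \<and> (\<forall>X\<in>E p. l2 M X = 1 \<longrightarrow> (\<forall>Z\<in>E k. \<forall>g B. smooth_growth B s g \<longrightarrow> gauss_orth J g \<longrightarrow>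
    \<bar>\<integral>x. g (X x) * Z x \<partial>M\<bar> \<le> Cf k * B * l2 M Z * (l2 M (W p X)) ^ Suc n))"
    by (elim exE)
  show ?case
  proof (intro exI[of _ "\<Sum>k\<le>K * i. Cf k"] conjI ballI impI allI)
    show "0 \<le> (\<Sum>k\<le>K * i. Cf k)" using Cf by (intro sum_nonneg) auto
    fix X Z g B assume X: "X \<in> E p" "l2 M X = 1" and Z: "Z \<in> A (K * i)"
      and g: "smooth_growth B s g" "gauss_orth J g"
    have B0: "B \<ge> 0"
    proof -
      have "\<bar>g 0\<bar> \<le> B * (1 + \<bar>0\<bar>) ^ s" using g(1) unfolding smooth_growth_def by blast
      then show ?thesis by simp
    qed
    obtain z where z: "\<And>k. z k \<in> E k" "AE x in M. Z x = (\<Sum>k\<le>K * i. z k x)"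
      using A_E[OF Z] by blast
    have gX: "(\<lambda>x. g (X x)) \<in> all_moments M"
      by (rule all_moments_growth[OF D_all_moments[OF E_D[OF X(1)]] smooth_growth_measurable[OF g(1)]])
    have zm: "z k \<in> all_moments M" for k using z(1) by (intro D_all_moments E_D)
    have "(\<integral>x. g (X x) * Z x \<partial>M) = (\<integral>x. (\<Sum>k\<le>K * i. g (X x) * z k x) \<partial>M)"
    proof (rule integral_cong_AE)
      show "(\<lambda>x. g (X x) * Z x) \<in> borel_measurable M"
        using gX A_all_moments[OF Z] by (intro all_moments_measurable all_moments_mult)
      show "(\<lambda>x. \<Sum>k\<le>K * i. g (X x) * z k x) \<in> borel_measurable M"
        using gX zm by (intro all_moments_measurable all_moments_intros)
      show "AE x in M. g (X x) * Z x = (\<Sum>k\<le>K * i. g (X x) * z k x)"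
        using z(2) by eventually_elim (simp add: sum_distrib_left)
    qed
    also have "\<dots> = (\<Sum>k\<le>K * i. \<integral>x. g (X x) * z k x \<partial>M)"
      using gX zm by (intro Bochner_Integration.integral_sum all_moments_integrable all_moments_mult)
    finally have "\<bar>\<integral>x. g (X x) * Z x \<partial>M\<bar> \<le> (\<Sum>k\<le>K * i. \<bar>\<integral>x. g (X x) * z k x \<partial>M\<bar>)"
      by (simp only: sum_abs)
    also have "\<dots> \<le> (\<Sum>k\<le>K * i. Cf k * (B * l2 M Z * (l2 M (W p X)) ^ Suc n))"
    proof (rule sum_mono)
      fix k assume k: "k \<in> {..K * i}"
      have "\<bar>\<integral>x. g (X x) * z k x \<partial>M\<bar> \<le> Cf k * B * l2 M (z k) * (l2 M (W p X)) ^ Suc n"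
        using Cf k X z(1) g by blast
      also have "\<dots> \<le> Cf k * B * l2 M Z * (l2 M (W p X)) ^ Suc n"
        using Cf k B0 l2_component_le[OF A_D[OF Z] z(1) z(2), of k]
        by (intro mult_right_mono mult_left_mono) auto
      finally show "\<bar>\<integral>x. g (X x) * z k x \<partial>M\<bar> \<le> Cf k * (B * l2 M Z * (l2 M (W p X)) ^ Suc n)"
        by (simp only: mult.assoc)
    qed
    also have "\<dots> = (\<Sum>k\<le>K * i. Cf k) * (B * l2 M Z * (l2 M (W p X)) ^ Suc n)"
      by (simp only: sum_distrib_right)
    finally show "\<bar>\<integral>x. g (X x) * Z x \<partial>M\<bar> \<le> (\<Sum>k\<le>K * i. Cf k) * B * l2 M Z * (l2 M (W p X)) ^ Suc n"
      by (simp only: mult.assoc)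
  qed
qed

lemma \<Gamma>_mean:
  assumes X: "X \<in> E p" "l2 M X = 1"
  shows "(\<integral>x. \<Gamma> X X x \<partial>M) = lam p"
proof -
  have XD: "X \<in> D" by (rule E_D[OF X(1)])
  have X2: "(\<integral>x. (X x)\<^sup>2 \<partial>M) = 1" using l2_sq[of M X] X(2) by simp
  have i: "integrable M (L (\<lambda>y. X y * X y))"
    using A_L[OF E_mult[OF X(1) X(1)]] by (intro all_moments_integrable A_all_moments)
  have i2: "integrable M (\<lambda>x. (X x)\<^sup>2)"
    by (intro L2_integrable_sq D_L2' XD)
  have "(\<integral>x. \<Gamma> X X x \<partial>M) = (\<integral>x. (1/2) * L (\<lambda>y. X y * X y) x + lam p * (X x)\<^sup>2 \<partial>M)"
  proof (rule integral_cong_AE)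
    show "AE x in M. \<Gamma> X X x = (1/2) * L (\<lambda>y. X y * X y) x + lam p * (X x)\<^sup>2"
      using E_eigen[OF X(1)] by eventually_elim (simp add: carre_du_champ_def power2_eq_square)
  qed (use \<Gamma>_measurable[OF XD XD] L_measurable[OF D_mult[OF XD XD]] D_measurable[OF XD] in measurable)
  also have "\<dots> = lam p"
    using i i2 L_integral[OF D_mult[OF XD XD]] X2 by simp
  finally show ?thesis .
qed

lemma variance_\<Gamma>:
  assumes X: "X \<in> E p" "l2 M X = 1" and p: "p \<ge> 1"
  shows "variance (\<Gamma> X X) = (lam p * l2 M (W p X))\<^sup>2"
proof -
  have "variance (\<Gamma> X X) = (\<integral>x. (lam p)\<^sup>2 * (W p X x)\<^sup>2 \<partial>M)"
    unfolding \<Gamma>_mean[OF X] W_def using lam_pos[OF p]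
    by (intro Bochner_Integration.integral_cong) (simp_all add: right_diff_distrib flip: power_mult_distrib)
  then show ?thesis by (simp add: l2_sq power_mult_distrib)
qed

text \<open>\<open>K\<close> and \<open>n\<close> are free because the dichotomy leads to two uses:
  \<open>2 * p - 1\<close> with \<open>m + 1\<close> iterations, and \<open>2 * p\<close> with none,
  where the condition on \<open>R\<close> is void.\<close>

lemma hermite_rest_bound:
  assumes p: "p \<ge> 1" and WK: "\<And>X. X \<in> E p \<Longrightarrow> l2 M X = 1 \<Longrightarrow> W p X \<in> A K"
    and R: "\<And>j. j < n \<Longrightarrow> lam (K * j) / lam p + 2 * real j < real (Suc R)"
  shows "\<exists>C\<ge>0. \<forall>X\<in>E p. l2 M X = 1 \<longrightarrow> (\<forall>h h'. (\<forall>x. (h has_real_derivative h' x) (at x)) \<longrightarrow> continuous_on UNIV h' \<longrightarrow>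
    polynomial_growth h' \<longrightarrow> (\<forall>x. \<bar>h x\<bar> \<le> 1) \<longrightarrow>
    \<bar>\<integral>x. hermite_rest R h (X x) \<partial>M\<bar> \<le> C * (l2 M (W p X)) ^ n)"
proof -
  obtain B s where B: "B \<ge> 0"
    "\<forall>h h'. (\<forall>x. (h has_real_derivative h' x) (at x)) \<longrightarrow> continuous_on UNIV h' \<longrightarrow> polynomial_growth h' \<longrightarrow>
      (\<forall>x. \<bar>h x\<bar> \<le> 1) \<longrightarrow> smooth_growth B s (hermite_rest R h) \<and> gauss_orth (Suc R) (hermite_rest R h)"
    using hermite_rest[of R] by (elim exE conjE)
  have tr: "\<exists>C\<ge>0. \<forall>X\<in>E p. l2 M X = 1 \<longrightarrow> (\<forall>Z\<in>A (K * 0). \<forall>g B. smooth_growth B s g \<longrightarrow> gauss_orth (Suc R) g \<longrightarrow>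
    \<bar>\<integral>x. g (X x) * Z x \<partial>M\<bar> \<le> C * B * l2 M Z * (l2 M (W p X)) ^ n)"
  proof (rule transfer_iterated[OF p])
    show "W p X \<in> A K" if "X \<in> E p" "l2 M X = 1" for X using WK that .
    show "lam (K * (0 + j)) / lam p + 2 * real j < real (Suc R)" if "j < n" for j
      using R[OF that] by simp
  qed
  obtain C where C: "C \<ge> 0"
    "\<forall>X\<in>E p. l2 M X = 1 \<longrightarrow> (\<forall>Z\<in>A (K * 0). \<forall>g B. smooth_growth B s g \<longrightarrow> gauss_orth (Suc R) g \<longrightarrow>
    \<bar>\<integral>x. g (X x) * Z x \<partial>M\<bar> \<le> C * B * l2 M Z * (l2 M (W p X)) ^ n)"
    using tr by (elim exE conjE)
  show ?thesis
  proof (intro exI[of _ "C * B"] conjI ballI impI allI)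
    show "0 \<le> C * B" using C B by simp
    fix X h h' assume X: "X \<in> E p" "l2 M X = 1" and h: "\<forall>x. (h has_real_derivative h' x) (at x)"
      "continuous_on UNIV h'" "polynomial_growth h'" "\<forall>x. \<bar>h x\<bar> \<le> 1"
    have "smooth_growth B s (hermite_rest R h) \<and> gauss_orth (Suc R) (hermite_rest R h)"
      by (rule B(2)[rule_format, OF h(1)[rule_format] h(2,3) h(4)[rule_format]])
    from C(2)[rule_format, OF X A_const[of 1] conjunct1[OF this] conjunct2[OF this]]
    show "\<bar>\<integral>x. hermite_rest R h (X x) \<partial>M\<bar> \<le> C * B * (l2 M (W p X)) ^ n"
      by (simp add: l2_const)
  qed
qed

end

section \<open>Asymptotically Gaussian eigenfunctions\<close>

text \<open>The product of the first j odd numbers, which is the Gaussian moment of order 2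
  j.\<close>

definition mdf :: "nat \<Rightarrow> real" where "mdf j = (\<Prod>i<j. 2 * real i + 1)"

lemma mdf_0 [simp]: "mdf 0 = 1" and mdf_Suc: "mdf (Suc j) = (2 * real j + 1) * mdf j"
  by (simp_all add: mdf_def)

lemma mdf_pos: "mdf j > 0"
  unfolding mdf_def by (intro prod_pos) auto

lemma poly_nat_bound:
  assumes "degree (Q :: real poly) \<le> e"
  obtains C where "C \<ge> 0" "\<And>j. \<bar>poly Q (real j)\<bar> \<le> C * (1 + real j) ^ e"
proof (rule that)
  show "0 \<le> (\<Sum>i\<le>degree Q. \<bar>coeff Q i\<bar>)" by (intro sum_nonneg) auto
  fix j
  have "\<bar>poly Q (real j)\<bar> \<le> (\<Sum>i\<le>degree Q. \<bar>coeff Q i * real j ^ i\<bar>)"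
    unfolding poly_altdef by (rule sum_abs)
  also have "\<dots> \<le> (\<Sum>i\<le>degree Q. \<bar>coeff Q i\<bar> * (1 + real j) ^ e)"
  proof (rule sum_mono)
    fix i assume i: "i \<in> {..degree Q}"
    have "real j ^ i \<le> (1 + real j) ^ i" by (intro power_mono) auto
    also have "\<dots> \<le> (1 + real j) ^ e" using i assms by (intro power_increasing) auto
    finally show "\<bar>coeff Q i * real j ^ i\<bar> \<le> \<bar>coeff Q i\<bar> * (1 + real j) ^ e"
      unfolding abs_mult by (intro mult_left_mono) auto
  qed
  finally show "\<bar>poly Q (real j)\<bar> \<le> (\<Sum>i\<le>degree Q. \<bar>coeff Q i\<bar>) * (1 + real j) ^ e"
    by (simp only: sum_distrib_right)
qed

text \<open>The difference lowers the degree by one and the factor x restores it. Up to the factor 2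
  lam p this is how \<open>L\<close> acts on limiting moments regarded as polynomials in j.\<close>

lemma degree_backward_difference:
  "degree ([:0, 1:] * (pcompose P [:-1, 1:] - P)) \<le> degree (P :: real poly)"
proof (cases "pcompose P [:-1, 1:] - P = 0")
  case False
  let ?Q = "pcompose P [:-1, 1:] - P"
  have d: "degree (pcompose P [:-1, 1:]) = degree P" by (simp add: degree_pcompose)
  have "coeff (pcompose P [:-1, 1:]) (degree P) = lead_coeff (pcompose P [:-1, 1:])"
    by (simp only: d)
  also have "\<dots> = lead_coeff P" by (subst lead_coeff_comp) auto
  finally have "coeff ?Q (degree P) = 0" by simp
  moreover have "degree ?Q \<le> degree P" by (rule degree_diff_le) (simp_all add: d)
  ultimately have "degree ?Q < degree P"
    using False by (metis leading_coeff_0_iff le_neq_implies_less)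
  then show ?thesis
    using degree_mult_le[of "[:0, 1:]" ?Q] by simp
qed simp

text \<open>The left-hand side of the last assumption has order \<open>degree P + 1\<close> in j,
  the right-hand side only \<open>degree P\<close>.\<close>

lemma poly_growth_contradiction:
  assumes "P \<noteq> (0 :: real poly)" "\<And>j. 0 \<le> poly P (real j)"
    "\<And>j. (2 * real j + 1) * poly P (real (Suc j)) \<le> C * (1 + real j) ^ degree P"
  shows False
proof -
  have C0: "C \<ge> 0" using assms(3)[of 0] assms(2)[of 1] by simp
  have "filterlim (\<lambda>j. real (Suc j)) at_top sequentially"
    by (rule filterlim_compose[OF filterlim_real_sequentially filterlim_Suc])
  from filterlim_compose[OF tendsto_mono[OF at_top_le_at_infinity poly_divide_tendsto_aux[of P]] this]
  have lim: "(\<lambda>j. poly P (real (Suc j)) / real (Suc j) ^ degree P) \<longlonglongrightarrow> lead_coeff P" .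
  have "(\<lambda>j. poly P (real (Suc j)) / real (Suc j) ^ degree P) \<longlonglongrightarrow> 0"
  proof (rule Lim_null_comparison)
    show "(\<lambda>j. C / real (Suc j)) \<longlonglongrightarrow> 0"
      using tendsto_mult_right_zero[OF LIMSEQ_inverse_real_of_nat, of C] by (simp add: divide_inverse)
    show "\<forall>\<^sub>F j in sequentially. norm (poly P (real (Suc j)) / real (Suc j) ^ degree P) \<le> C / real (Suc j)"
    proof (intro always_eventually allI)
      fix j
      have p: "0 < real (Suc j) ^ degree P" by simp
      have "real (Suc j) * poly P (real (Suc j)) \<le> (2 * real j + 1) * poly P (real (Suc j))"
        using assms(2)[of "Suc j"] by (intro mult_right_mono) auto
      also have "\<dots> \<le> C * real (Suc j) ^ degree P" using assms(3)[of j] by simp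
      finally have "poly P (real (Suc j)) * real (Suc j) \<le> C * real (Suc j) ^ degree P"
        by (simp only: mult.commute)
      then have "poly P (real (Suc j)) / real (Suc j) ^ degree P \<le> C / real (Suc j)"
        using p by (subst pos_divide_le_eq[OF p]) (simp add: pos_le_divide_eq)
      then show "norm (poly P (real (Suc j)) / real (Suc j) ^ degree P) \<le> C / real (Suc j)"
        using assms(2)[of "Suc j"] p by (simp add: abs_div)
    qed
  qed
  with lim have "lead_coeff P = 0" by (rule LIMSEQ_unique)
  then show False using assms(1) by simp
qed

definition binom_poly :: "nat \<Rightarrow> real poly" where
  "binom_poly i = smult (1 / fact i) (\<Prod>l<i. [:- real l, 1:])"

lemma poly_binom_poly: "poly (binom_poly i) (real j) = real (j choose i)"
  by (simp add: binom_poly_def binomial_gbinomial gbinomial_prod_rev poly_prod atLeast0LessThan)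

lemma simultaneous_convergent_subsequence:
  fixes f :: "'b \<Rightarrow> nat \<Rightarrow> real"
  assumes "finite I" "\<And>k. k \<in> I \<Longrightarrow> Bseq (f k)"
  shows "\<exists>r. strict_mono r \<and> (\<forall>k\<in>I. convergent (\<lambda>n. f k (r n)))"
  using assms
proof (induction I rule: finite_induct)
  case empty
  show ?case by (intro exI[of _ id]) (auto simp: strict_mono_def)
next
  case (insert a I)
  then obtain r where r: "strict_mono r" "\<forall>k\<in>I. convergent (\<lambda>n. f k (r n))" by blast
  have "bounded (range (\<lambda>n. f a (r n)))"
  proof -
    have "Bseq (f a)" using insert by auto
    then obtain K where "\<And>n. norm (f a n) \<le> K" unfolding Bseq_def by blast
    then show ?thesis by (intro boundedI[of _ K]) auto
  qed
  then obtain l s where s: "strict_mono s" "((\<lambda>n. f a (r n)) \<circ> s) \<longlonglongrightarrow> l"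
    using bounded_imp_convergent_subsequence[of "\<lambda>n. f a (r n)"] by blast
  show ?case
  proof (intro exI[of _ "r \<circ> s"] conjI ballI)
    show "strict_mono (r \<circ> s)" using r(1) s(1) by (rule strict_mono_o)
    fix k assume "k \<in> insert a I"
    then show "convergent (\<lambda>n. f k ((r \<circ> s) n))"
    proof
      assume "k = a" then show ?thesis using s(2) by (auto simp: convergent_def comp_def)
    next
      assume "k \<in> I"
      then have "convergent ((\<lambda>n. f k (r n)) \<circ> s)" using r(2) s(1) convergent_subseq_convergent by blast
      then show ?thesis by (simp add: comp_def)
    qed
  qed
qed

section \<open>Moments against even powers of the eigenfunction\<close>

context markov_diffusion
begin

text \<open>Division by the Gaussian moment makes this the mean of F, for every j, if X is standard
  Gaussian and independent of F. A dependence of F on X shows up as a dependence on j.\<close>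

definition mom :: "('a \<Rightarrow> real) \<Rightarrow> ('a \<Rightarrow> real) \<Rightarrow> nat \<Rightarrow> real" where
  "mom X F j = (\<integral>x. F x * X x ^ (2 * j) \<partial>M) / mdf j"

lemma mom_integrable: "X \<in> D \<Longrightarrow> F \<in> D \<Longrightarrow> integrable M (\<lambda>x. F x * X x ^ (2 * j))"
  by (intro D_integrable D_mult D_power)

lemma mom_mono:
  assumes "X \<in> D" "F \<in> D" "G \<in> D" "AE x in M. F x \<le> G x"
  shows "mom X F j \<le> mom X G j"
proof -
  have "(\<integral>x. F x * X x ^ (2 * j) \<partial>M) \<le> (\<integral>x. G x * X x ^ (2 * j) \<partial>M)"
  proof (rule integral_mono_AE)
    show "AE x in M. F x * X x ^ (2 * j) \<le> G x * X x ^ (2 * j)"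
      using assms(4) by eventually_elim (simp add: mult_right_mono)
  qed (intro mom_integrable assms)+
  then show ?thesis
    unfolding mom_def using mdf_pos[of j] by (simp add: divide_right_mono)
qed

lemma mom_cong_AE:
  assumes "X \<in> D" "F \<in> D" "G \<in> D" "AE x in M. F x = G x"
  shows "mom X F j = mom X G j"
  by (rule antisym; rule mom_mono) (use assms in \<open>auto elim: eventually_mono\<close>)

lemma mom_lincomb:
  assumes "X \<in> D" "F \<in> D" "G \<in> D"
  shows "mom X (\<lambda>x. a * F x + b * G x) j = a * mom X F j + b * mom X G j"
proof -
  have "(\<integral>x. (a * F x + b * G x) * X x ^ (2 * j) \<partial>M) = (\<integral>x. a * (F x * X x ^ (2 * j)) + b * (G x * X x ^ (2 * j)) \<partial>M)"
    by (simp add: algebra_simps)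
  also have "\<dots> = a * (\<integral>x. F x * X x ^ (2 * j) \<partial>M) + b * (\<integral>x. G x * X x ^ (2 * j) \<partial>M)"
    using mom_integrable[OF assms(1,2)] mom_integrable[OF assms(1,3)] by simp
  finally show ?thesis unfolding mom_def by (simp add: add_divide_distrib)
qed

lemma mom_nonneg:
  assumes "AE x in M. 0 \<le> F x"
  shows "0 \<le> mom X F j"
proof -
  have "0 \<le> (\<integral>x. F x * X x ^ (2 * j) \<partial>M)"
    by (rule integral_nonneg_AE) (use assms in eventually_elim, simp)
  then show ?thesis unfolding mom_def using mdf_pos[of j] by simp
qed

lemma mom_0: "mom X F 0 = (\<integral>x. F x \<partial>M)"
  by (simp add: mom_def)

lemma mom_sum:
  assumes "X \<in> D" "\<And>k. k \<in> I \<Longrightarrow> F k \<in> D"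
  shows "mom X (\<lambda>x. \<Sum>k\<in>I. F k x) j = (\<Sum>k\<in>I. mom X (F k) j)"
proof -
  have "(\<integral>x. (\<Sum>k\<in>I. F k x) * X x ^ (2 * j) \<partial>M) = (\<Sum>k\<in>I. \<integral>x. F k x * X x ^ (2 * j) \<partial>M)"
    unfolding sum_distrib_right by (intro Bochner_Integration.integral_sum mom_integrable assms)
  then show ?thesis unfolding mom_def by (simp add: sum_divide_distrib)
qed

text \<open>Symmetry moves \<open>L\<close> onto X^(2i+2), where the diffusion property evaluates
  it. The normalisation by \<open>mdf\<close> turns the result into a difference of consecutive
  moments, and the last term is an error that is small with W.\<close>

lemma mom_generator:
  assumes p: "p \<ge> 1" and X: "X \<in> E p" and U: "U \<in> D"
  shows "mom X (L U) (Suc i) = lam p * (2 * real i + 2) * (mom X U i - mom X U (Suc i))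
    + lam p * (2 * real i + 2) * mom X (\<lambda>x. U x * W p X x) i"
proof -
  have lp: "lam p > 0" by (rule lam_pos[OF p])
  have XD: "X \<in> D" by (rule E_D[OF X])
  have WD: "W p X \<in> D" by (rule A_D[OF W_A[OF X]])
  let ?a = "2 * real i + 2" and ?b = "2 * real i + 1"
  have LX: "AE x in M. L (\<lambda>y. X y ^ (2 * Suc i)) x =
      lam p * ?a * (?b * (X x ^ (2 * i) + W p X x * X x ^ (2 * i)) - X x ^ (2 * Suc i))"
    using L_compose[OF C2_pol_power XD, of "2 * Suc i"] E_eigen[OF X]
  proof eventually_elim
    case (elim x)
    have G: "\<Gamma> X X x = lam p * (1 + W p X x)" using lp by (simp add: W_def)
    show ?case
      unfolding elim(1) deriv2_power unfolding deriv_power G elim(2)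
      by (simp add: algebra_simps)
  qed
  have "(\<integral>x. L U x * X x ^ (2 * Suc i) \<partial>M) = (\<integral>x. U x * L (\<lambda>y. X y ^ (2 * Suc i)) x \<partial>M)"
    by (rule L_symmetric[OF U D_power[OF XD], symmetric])
  also have "\<dots> = (\<integral>x. (lam p * ?a) * (?b * (U x * X x ^ (2 * i) + (U x * W p X x) * X x ^ (2 * i)) - U x * X x ^ (2 * Suc i)) \<partial>M)"
  proof (rule integral_cong_AE)
    show "(\<lambda>x. U x * L (\<lambda>y. X y ^ (2 * Suc i)) x) \<in> borel_measurable M"
      using D_measurable[OF U] L_measurable[OF D_power[OF XD]] by measurable
    show "(\<lambda>x. (lam p * ?a) * (?b * (U x * X x ^ (2 * i) + (U x * W p X x) * X x ^ (2 * i)) - U x * X x ^ (2 * Suc i))) \<in> borel_measurable M"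
      using D_measurable[OF U] D_measurable[OF XD] D_measurable[OF WD] by measurable
    show "AE x in M. U x * L (\<lambda>y. X y ^ (2 * Suc i)) x =
      (lam p * ?a) * (?b * (U x * X x ^ (2 * i) + (U x * W p X x) * X x ^ (2 * i)) - U x * X x ^ (2 * Suc i))"
      using LX
    proof eventually_elim
      case (elim x)
      show ?case unfolding elim by (simp add: algebra_simps)
    qed
  qed
  also have "\<dots> = (lam p * ?a) * (?b * ((\<integral>x. U x * X x ^ (2 * i) \<partial>M) + (\<integral>x. (U x * W p X x) * X x ^ (2 * i) \<partial>M))
      - (\<integral>x. U x * X x ^ (2 * Suc i) \<partial>M))"
    using mom_integrable[OF XD U, of i] mom_integrable[OF XD U, of "Suc i"] mom_integrable[OF XD D_mult[OF U WD], of i]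
    by (simp del: power_Suc mult_Suc_right)
  finally have *: "(\<integral>x. L U x * X x ^ (2 * Suc i) \<partial>M) = \<dots>" .
  have alg: "c * (b * (u + w) - v) / (b * m) = c * (u / m - v / (b * m)) + c * (w / m)"
    if "m > 0" "b > 0" for u v w m b c :: real
    using that by (simp add: field_simps)
  show ?thesis
    unfolding mom_def * mdf_Suc by (rule alg[OF mdf_pos]) simp
qed

text \<open>In the second bound the integrand is regrouped as U X^(2i) times W, so that
  Cauchy-Schwarz isolates the norm of W.\<close>

lemma mom_bound:
  "\<exists>C\<ge>0. \<forall>X\<in>E p. l2 M X = 1 \<longrightarrow> (\<forall>U\<in>A N. \<bar>mom X U i\<bar> \<le> C * l2 M U \<and> \<bar>mom X (\<lambda>x. U x * W p X x) i\<bar> \<le> C * l2 M U * l2 M (W p X))"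
proof -
  obtain C where C: "C \<ge> 0" "\<forall>X\<in>A p. l2 M (\<lambda>x. X x ^ (2 * i)) \<le> C * (l2 M X) ^ (2 * i)"
    using hypercontractive_power[of p "2 * i"] by blast
  obtain H where H: "H \<ge> 0" "\<forall>F\<in>A N. \<forall>G\<in>A (2 * i * p). l2 M (\<lambda>x. F x * G x) \<le> H * l2 M F * l2 M G"
    using hypercontractive_mult[of N "2 * i * p"] by blast
  let ?C = "(C + H * C) / mdf i"
  show ?thesis
  proof (intro exI[of _ ?C] conjI ballI impI)
    show "0 \<le> ?C" using C H mdf_pos[of i] by simp
    fix X U assume X: "X \<in> E p" "l2 M X = 1" and U: "U \<in> A N"
    have XA: "X \<in> A p" by (rule E_A[OF X(1) order_refl])
    have XP: "(\<lambda>x. X x ^ (2 * i)) \<in> A (2 * i * p)" by (rule A_power[OF XA])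
    have XB: "l2 M (\<lambda>x. X x ^ (2 * i)) \<le> C" using C(2) XA X(2) by fastforce
    have HC: "0 \<le> H * C" using H C by simp
    have "\<bar>\<integral>x. U x * X x ^ (2 * i) \<partial>M\<bar> \<le> l2 M U * l2 M (\<lambda>x. X x ^ (2 * i))"
      by (rule Cauchy_Schwarz_L2[OF D_L2'[OF A_D[OF U]] D_L2'[OF A_D[OF XP]]])
    also have "\<dots> \<le> l2 M U * (C + H * C)"
      using XB HC by (intro mult_left_mono) auto
    finally have 1: "\<bar>\<integral>x. U x * X x ^ (2 * i) \<partial>M\<bar> \<le> (C + H * C) * l2 M U" by (simp add: mult.commute)
    show "\<bar>mom X U i\<bar> \<le> ?C * l2 M U"
      unfolding mom_def abs_div using divide_right_mono[OF 1, of "mdf i"] mdf_pos[of i] by simp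
    have UX: "l2 M (\<lambda>x. U x * X x ^ (2 * i)) \<le> H * l2 M U * C"
      using H(2)[rule_format, OF U XP] mult_left_mono[OF XB, of "H * l2 M U"] H(1) by simp
    have "\<bar>\<integral>x. (U x * W p X x) * X x ^ (2 * i) \<partial>M\<bar> = \<bar>\<integral>x. (U x * X x ^ (2 * i)) * W p X x \<partial>M\<bar>"
      by (simp add: mult_ac)
    also have "\<dots> \<le> l2 M (\<lambda>x. U x * X x ^ (2 * i)) * l2 M (W p X)"
      by (rule Cauchy_Schwarz_L2[OF D_L2'[OF A_D[OF A_mult[OF U XP]]] D_L2'[OF A_D[OF W_A[OF X(1)]]]])
    also have "\<dots> \<le> (H * l2 M U * C) * l2 M (W p X)"
      using UX by (intro mult_right_mono) auto
    also have "\<dots> \<le> (C + H * C) * l2 M U * l2 M (W p X)"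
      using mult_nonneg_nonneg[OF mult_nonneg_nonneg[OF C(1) l2_nonneg[of M U]] l2_nonneg[of M "W p X"]]
      by (simp add: algebra_simps)
    finally have 2: "\<bar>\<integral>x. (U x * W p X x) * X x ^ (2 * i) \<partial>M\<bar> \<le> (C + H * C) * l2 M U * l2 M (W p X)" .
    show "\<bar>mom X (\<lambda>x. U x * W p X x) i\<bar> \<le> ?C * l2 M U * l2 M (W p X)"
      unfolding mom_def abs_div using divide_right_mono[OF 2, of "mdf i"] mdf_pos[of i] by simp
  qed
qed

text \<open>For such a sequence \<open>mom_generator\<close> with U = 1 shows that the even moments
  of X_n tend to the Gaussian ones.\<close>

definition asymp_gauss :: "nat \<Rightarrow> (nat \<Rightarrow> 'a \<Rightarrow> real) \<Rightarrow> bool" where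
  "asymp_gauss p Xs \<longleftrightarrow> (\<forall>n. Xs n \<in> E p \<and> l2 M (Xs n) = 1) \<and> (\<lambda>n. l2 M (W p (Xs n))) \<longlonglongrightarrow> 0"

lemma asymp_gauss_subseq: "asymp_gauss p Xs \<Longrightarrow> strict_mono r \<Longrightarrow> asymp_gauss p (Xs \<circ> r)"
  unfolding asymp_gauss_def using LIMSEQ_subseq_LIMSEQ by (auto simp: comp_def)

lemma mom_W_null:
  assumes "asymp_gauss p Xs" "\<And>n. U n \<in> A N" "\<And>n. l2 M (U n) \<le> B"
  shows "(\<lambda>n. mom (Xs n) (\<lambda>x. U n x * W p (Xs n) x) i) \<longlonglongrightarrow> 0"
proof -
  obtain C where C: "C \<ge> 0"
    "\<forall>X\<in>E p. l2 M X = 1 \<longrightarrow> (\<forall>U\<in>A N. \<bar>mom X U i\<bar> \<le> C * l2 M U \<and> \<bar>mom X (\<lambda>x. U x * W p X x) i\<bar> \<le> C * l2 M U * l2 M (W p X))"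
    using mom_bound[of p N i] by blast
  have X: "\<And>n. Xs n \<in> E p" "\<And>n. l2 M (Xs n) = 1" and W0: "(\<lambda>n. l2 M (W p (Xs n))) \<longlonglongrightarrow> 0"
    using assms(1) unfolding asymp_gauss_def by auto
  show ?thesis
  proof (rule Lim_null_comparison)
    show "(\<lambda>n. C * B * l2 M (W p (Xs n))) \<longlonglongrightarrow> 0"
      using tendsto_mult_right_zero[OF W0, of "C * B"] by simp
    show "\<forall>\<^sub>F n in sequentially. norm (mom (Xs n) (\<lambda>x. U n x * W p (Xs n) x) i) \<le> C * B * l2 M (W p (Xs n))"
    proof (intro always_eventually allI)
      fix n
      have "norm (mom (Xs n) (\<lambda>x. U n x * W p (Xs n) x) i) \<le> C * l2 M (U n) * l2 M (W p (Xs n))"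
        using C(2)[rule_format, OF X(1)[of n] X(2)[of n] assms(2)[of n]] by simp
      also have "\<dots> \<le> C * B * l2 M (W p (Xs n))"
        using C(1) assms(3)[of n] by (intro mult_right_mono mult_left_mono) auto
      finally show "norm (mom (Xs n) (\<lambda>x. U n x * W p (Xs n) x) i) \<le> C * B * l2 M (W p (Xs n))" .
    qed
  qed
qed

lemma mom_generator_limit:
  assumes p: "p \<ge> 1" and a: "asymp_gauss p Xs" "\<And>n. U n \<in> A N" "\<And>n. l2 M (U n) \<le> B"
  shows "(\<lambda>n. mom (Xs n) (L (U n)) (Suc i) - lam p * (2 * real i + 2) * (mom (Xs n) (U n) i - mom (Xs n) (U n) (Suc i))) \<longlonglongrightarrow> 0"
proof -
  have X: "\<And>n. Xs n \<in> E p" using a(1) unfolding asymp_gauss_def by auto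
  have "mom (Xs n) (L (U n)) (Suc i) - lam p * (2 * real i + 2) * (mom (Xs n) (U n) i - mom (Xs n) (U n) (Suc i)) =
    (lam p * (2 * real i + 2)) * mom (Xs n) (\<lambda>x. U n x * W p (Xs n) x) i" for n
    using mom_generator[OF p X[of n] A_D[OF a(2)[of n]], of i] by simp
  then show ?thesis
    using tendsto_mult_right_zero[OF mom_W_null[OF a, where i = i], of "lam p * (2 * real i + 2)"] by simp
qed

text \<open>The moments of a component of \<open>Y\<^sup>2\<close> against powers of \<open>X\<^sub>n\<close> satisfy a first order recursion in the
  limit, whose solutions are multiples of a binomial coefficient.\<close>

lemma component_moments:
  assumes p: "p \<ge> 1" and a: "asymp_gauss p Xs" and U: "U \<in> E k"
    and conv: "\<And>i. lam k / lam p = 2 * real i \<Longrightarrow> convergent (\<lambda>n. mom (Xs n) U i)"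
  shows "\<exists>h i0. \<forall>j. (\<lambda>n. mom (Xs n) U j) \<longlonglongrightarrow> h * real (j choose i0)"
proof -
  have lp: "lam p > 0" by (rule lam_pos[OF p])
  define \<tau> where "\<tau> = lam k / lam p"
  have UD: "U \<in> D" by (rule E_D[OF U])
  have XD: "Xs n \<in> D" for n using a E_D unfolding asymp_gauss_def by blast
  have UA: "U \<in> A k" by (rule E_A[OF U order_refl])
  have m0: "mom (Xs n) U 0 = 0" if "\<tau> \<noteq> 0" for n
  proof -
    have "(\<integral>x. L U x \<partial>M) = (\<integral>x. - lam k * U x \<partial>M)"
      by (rule integral_cong_AE) (use UD E_eigen[OF U] in auto)
    then have "lam k * (\<integral>x. U x \<partial>M) = 0" using L_integral[OF UD] by simp
    then show ?thesis using that unfolding mom_0 \<tau>_def by auto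
  qed
  have rec: "(\<lambda>n. (2 * real j + 2 - \<tau>) * mom (Xs n) U (Suc j) - (2 * real j + 2) * mom (Xs n) U j) \<longlonglongrightarrow> 0" for j
  proof -
    have "(\<lambda>n. mom (Xs n) (L U) (Suc j) - lam p * (2 * real j + 2) * (mom (Xs n) U j - mom (Xs n) U (Suc j))) \<longlonglongrightarrow> 0"
      by (rule mom_generator_limit[OF p a UA order_refl])
    moreover have "mom (Xs n) (L U) (Suc j) = - lam k * mom (Xs n) U (Suc j)" for n
    proof -
      have "mom (Xs n) (L U) (Suc j) = mom (Xs n) (\<lambda>x. (- lam k) * U x + 0 * U x) (Suc j)"
        by (rule mom_cong_AE[OF XD A_D[OF A_L[OF UA]] D_lincomb[OF UD UD]]) (use E_eigen[OF U] in simp)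
      then show ?thesis unfolding mom_lincomb[OF XD UD UD] by simp
    qed
    ultimately have "(\<lambda>n. (1 / lam p) * (- lam k * mom (Xs n) U (Suc j) - lam p * (2 * real j + 2) * (mom (Xs n) U j - mom (Xs n) U (Suc j)))) \<longlonglongrightarrow> (1 / lam p) * 0"
      by (intro tendsto_mult tendsto_const) simp
    moreover have "(1 / lam p) * (- lam k * y - lam p * c * (z - y)) = (c - \<tau>) * y - c * z" for c y z
      using lp unfolding \<tau>_def by (simp add: field_simps)
    ultimately show ?thesis by simp
  qed
  have step: "(\<lambda>n. mom (Xs n) U (Suc j)) \<longlonglongrightarrow> (2 * real j + 2) * l / (2 * real j + 2 - \<tau>)"
    if "(\<lambda>n. mom (Xs n) U j) \<longlonglongrightarrow> l" "2 * real j + 2 \<noteq> \<tau>" for j l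
  proof -
    have "(\<lambda>n. ((2 * real j + 2 - \<tau>) * mom (Xs n) U (Suc j) - (2 * real j + 2) * mom (Xs n) U j + (2 * real j + 2) * mom (Xs n) U j) / (2 * real j + 2 - \<tau>))
      \<longlonglongrightarrow> (0 + (2 * real j + 2) * l) / (2 * real j + 2 - \<tau>)"
      using that by (intro tendsto_intros rec) auto
    then show ?thesis using that(2) by simp
  qed
  show ?thesis
  \<comment> \<open>If \<tau> = 2 i0 with i0 > 0, the coefficient of the moment at i0 vanishes in
    the recursion: the limit h there is free, its existence has to be assumed, and the limits below
    i0 are 0. If \<tau> is not an even natural number, there is no free value and all limits are
    0.\<close>
  proof (cases "\<exists>i. \<tau> = 2 * real i")
    case True
    then obtain i0 where i0: "\<tau> = 2 * real i0" by blast
    then obtain h where h: "(\<lambda>n. mom (Xs n) U i0) \<longlonglongrightarrow> h"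
      using conv[of i0] unfolding \<tau>_def convergent_def by blast
    have "(\<lambda>n. mom (Xs n) U j) \<longlonglongrightarrow> h * real (j choose i0)" for j
    proof (induction j)
      case 0
      show ?case
      proof (cases "i0 = 0")
        case True then show ?thesis using h by simp
      next
        case False
        then have "\<tau> \<noteq> 0" using i0 by simp
        then show ?thesis using m0 False by (simp add: binomial_eq_0)
      qed
    next
      case (Suc j)
      show ?case
      proof (cases "Suc j = i0")
        case True then show ?thesis using h by simp
      next
        case False
        then have ne: "2 * real j + 2 \<noteq> \<tau>" using i0 by (auto simp: field_simps)
        have "(2 * real j + 2) * (h * real (j choose i0)) / (2 * real j + 2 - \<tau>) = h * real (Suc j choose i0)"
        proof -
          have "(real (Suc j) - real i0) * real (Suc j choose i0) = real (Suc j) * real (j choose i0)"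
          proof (cases "i0 \<le> Suc j")
            case True
            have "(Suc j - i0) * (Suc j choose i0) = Suc j * (j choose i0)"
              using binomial_absorb_comp[of "Suc j" i0] by simp
            then have "real ((Suc j - i0) * (Suc j choose i0)) = real (Suc j * (j choose i0))" by (rule arg_cong)
            then show ?thesis using True by (simp only: of_nat_mult of_nat_diff)
          qed (simp add: binomial_eq_0)
          then have "(2 * real j + 2) * real (j choose i0) = (2 * real j + 2 - \<tau>) * real (Suc j choose i0)"
            unfolding i0 by (simp add: algebra_simps)
          then have "h * ((2 * real j + 2) * real (j choose i0)) = h * ((2 * real j + 2 - \<tau>) * real (Suc j choose i0))" by simp
          then show ?thesis using ne by (simp only: mult_ac) (simp add: divide_eq_eq mult_ac)
        qed
        then show ?thesis using step[OF Suc ne] by simp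
      qed
    qed
    then show ?thesis by blast
  next
    case False
    have "(\<lambda>n. mom (Xs n) U j) \<longlonglongrightarrow> 0" for j
    proof (induction j)
      case 0
      have "\<tau> \<noteq> 0" using False by (metis mult_zero_right of_nat_0)
      then show ?case using m0 by simp
    next
      case (Suc j)
      have "2 * real j + 2 \<noteq> \<tau>" using False by (metis distrib_left mult.right_neutral of_nat_Suc add.commute)
      from step[OF Suc this] show ?case by simp
    qed
    then show ?thesis by (intro exI[of _ 0] exI) simp
  qed
qed

text \<open>Y^2 has finitely many components with bounded moments, so along a subsequence the free
  moment of each component converges. By \<open>component_moments\<close> all other moments then
  converge too, with limits polynomial in j.\<close>

lemma square_moments:
  assumes p: "p \<ge> 1" and a: "asymp_gauss p Xs" and Y: "Y \<in> E q"
  shows "\<exists>r P. strict_mono r \<and> (\<forall>j. (\<lambda>n. mom (Xs (r n)) (\<lambda>x. (Y x)\<^sup>2) j) \<longlonglongrightarrow> poly P (real j))"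
proof -
  have Y2: "(\<lambda>x. (Y x)\<^sup>2) \<in> A (q + q)"
    using E_mult[OF Y Y] by (simp add: power2_eq_square)
  obtain u where u: "\<And>k. u k \<in> E k" "AE x in M. (Y x)\<^sup>2 = (\<Sum>k\<le>q + q. u k x)"
    using A_E[OF Y2] by blast
  have X: "\<And>n. Xs n \<in> E p" "\<And>n. l2 M (Xs n) = 1" using a unfolding asymp_gauss_def by auto
  \<comment> \<open>The index of the free moment if there is one, otherwise arbitrary; boundedness
    holds at any index.\<close>
  define ix where "ix k = (SOME i. lam k / lam p = 2 * real i)" for k
  have "Bseq (\<lambda>n. mom (Xs n) (u k) (ix k))" for k
  proof -
    obtain C where C: "\<forall>X\<in>E p. l2 M X = 1 \<longrightarrow> (\<forall>U\<in>A k. \<bar>mom X U (ix k)\<bar> \<le> C * l2 M U \<and> \<bar>mom X (\<lambda>x. U x * W p X x) (ix k)\<bar> \<le> C * l2 M U * l2 M (W p X))"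
      using mom_bound[of p k "ix k"] by blast
    have "norm (mom (Xs n) (u k) (ix k)) \<le> C * l2 M (u k)" for n
      using C[rule_format, OF X(1)[of n] X(2)[of n] E_A[OF u(1)[of k] order_refl]] by simp
    then show ?thesis by (intro BseqI') auto
  qed
  then obtain r where r: "strict_mono r" "\<forall>k\<in>{..q+q}. convergent (\<lambda>n. mom (Xs (r n)) (u k) (ix k))"
    using simultaneous_convergent_subsequence[of "{..q+q}" "\<lambda>k n. mom (Xs n) (u k) (ix k)"] by auto
  have ar: "asymp_gauss p (Xs \<circ> r)" by (rule asymp_gauss_subseq[OF a r(1)])
  have "\<exists>h i0. \<forall>j. (\<lambda>n. mom (Xs (r n)) (u k) j) \<longlonglongrightarrow> h * real (j choose i0)" if k: "k \<le> q + q" for k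
  proof -
    have "convergent (\<lambda>n. mom ((Xs \<circ> r) n) (u k) i)" if i: "lam k / lam p = 2 * real i" for i
    proof -
      have "lam k / lam p = 2 * real (ix k)"
        unfolding ix_def by (rule someI[of "\<lambda>i. lam k / lam p = 2 * real i", OF i])
      then have "ix k = i" using i by simp
      then show ?thesis using r(2) k by auto
    qed
    from component_moments[OF p ar u(1) this] show ?thesis by simp
  qed
  then have "\<forall>k\<in>{..q+q}. \<exists>hi. \<forall>j. (\<lambda>n. mom (Xs (r n)) (u k) j) \<longlonglongrightarrow> fst hi * real (j choose snd hi)"
    by (metis atMost_iff fst_conv snd_conv)
  from bchoice[OF this] obtain hi where hi: "\<forall>k\<in>{..q+q}. \<forall>j. (\<lambda>n. mom (Xs (r n)) (u k) j) \<longlonglongrightarrow> fst (hi k) * real (j choose snd (hi k))"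
    by blast
  define P where "P = (\<Sum>k\<le>q+q. smult (fst (hi k)) (binom_poly (snd (hi k))))"
  have "(\<lambda>n. mom (Xs (r n)) (\<lambda>x. (Y x)\<^sup>2) j) \<longlonglongrightarrow> poly P (real j)" for j
  proof -
    have "mom (Xs (r n)) (\<lambda>x. (Y x)\<^sup>2) j = (\<Sum>k\<le>q+q. mom (Xs (r n)) (u k) j)" for n
    proof -
      have "mom (Xs (r n)) (\<lambda>x. (Y x)\<^sup>2) j = mom (Xs (r n)) (\<lambda>x. \<Sum>k\<le>q+q. u k x) j"
        by (rule mom_cong_AE[OF E_D[OF X(1)] A_D[OF Y2] _ u(2)]) (rule D_sum, rule E_D, rule u(1))
      also have "\<dots> = (\<Sum>k\<le>q+q. mom (Xs (r n)) (u k) j)"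
        using E_D[OF u(1)] by (intro mom_sum[OF E_D[OF X(1)]])
      finally show ?thesis .
    qed
    moreover have "poly P (real j) = (\<Sum>k\<le>q+q. fst (hi k) * real (j choose snd (hi k)))"
      by (simp add: P_def poly_sum poly_binom_poly)
    moreover have "(\<lambda>n. \<Sum>k\<le>q+q. mom (Xs (r n)) (u k) j) \<longlonglongrightarrow> (\<Sum>k\<le>q+q. fst (hi k) * real (j choose snd (hi k)))"
      by (intro tendsto_sum) (use hi in auto)
    ultimately show ?thesis by simp
  qed
  with r(1) show ?thesis by blast
qed

text \<open>In the limit \<open>F\<^sub>n\<close> grows at most like a polynomial of degree \<open>e / 2\<close> in the Gaussian variable.\<close>

definition moment_growth :: "(nat \<Rightarrow> 'a \<Rightarrow> real) \<Rightarrow> nat \<Rightarrow> (nat \<Rightarrow> 'a \<Rightarrow> real) \<Rightarrow> bool" where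
  "moment_growth Xs e F \<longleftrightarrow>
    (\<exists>C\<ge>0. \<forall>j. \<forall>\<^sub>F n in sequentially. mom (Xs n) (\<lambda>x. (F n x)\<^sup>2) j \<le> C * (1 + real j) ^ e)"

text \<open>(a F + b G)^2 \<le> 2 a^2 F^2 + 2 b^2 G^2. The index from which the bounds hold may
  depend on j, the constants may not.\<close>

lemma moment_growth_lincomb:
  assumes X: "\<And>n. Xs n \<in> D" and F: "\<And>n. F n \<in> D" "\<And>n. G n \<in> D"
    and g: "moment_growth Xs e F" "moment_growth Xs e G"
  shows "moment_growth Xs e (\<lambda>n x. a * F n x + b * G n x)"
proof -
  obtain C where C: "C \<ge> 0" "\<And>j. \<forall>\<^sub>F n in sequentially. mom (Xs n) (\<lambda>x. (F n x)\<^sup>2) j \<le> C * (1 + real j) ^ e"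
    using g(1) unfolding moment_growth_def by blast
  obtain C' where C': "C' \<ge> 0" "\<And>j. \<forall>\<^sub>F n in sequentially. mom (Xs n) (\<lambda>x. (G n x)\<^sup>2) j \<le> C' * (1 + real j) ^ e"
    using g(2) unfolding moment_growth_def by blast
  have le: "mom (Xs n) (\<lambda>x. (a * F n x + b * G n x)\<^sup>2) j \<le>
      (2 * a\<^sup>2) * mom (Xs n) (\<lambda>x. (F n x)\<^sup>2) j + (2 * b\<^sup>2) * mom (Xs n) (\<lambda>x. (G n x)\<^sup>2) j" for n j
  proof -
    have "mom (Xs n) (\<lambda>x. (a * F n x + b * G n x)\<^sup>2) j \<le>
        mom (Xs n) (\<lambda>x. (2 * a\<^sup>2) * (F n x)\<^sup>2 + (2 * b\<^sup>2) * (G n x)\<^sup>2) j"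
    proof (rule mom_mono[OF X])
      show "AE x in M. (a * F n x + b * G n x)\<^sup>2 \<le> (2 * a\<^sup>2) * (F n x)\<^sup>2 + (2 * b\<^sup>2) * (G n x)\<^sup>2"
      proof (rule AE_I2)
        fix x
        have "0 \<le> (a * F n x - b * G n x)\<^sup>2" by simp
        then show "(a * F n x + b * G n x)\<^sup>2 \<le> (2 * a\<^sup>2) * (F n x)\<^sup>2 + (2 * b\<^sup>2) * (G n x)\<^sup>2"
          unfolding power2_sum power2_diff power_mult_distrib by linarith
      qed
    qed (intro D_power D_lincomb F)+
    also have "\<dots> = (2 * a\<^sup>2) * mom (Xs n) (\<lambda>x. (F n x)\<^sup>2) j + (2 * b\<^sup>2) * mom (Xs n) (\<lambda>x. (G n x)\<^sup>2) j"
      by (rule mom_lincomb[OF X D_power[OF F(1)] D_power[OF F(2)]])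
    finally show ?thesis .
  qed
  show ?thesis
    unfolding moment_growth_def
  proof (intro exI[of _ "(2 * a\<^sup>2) * C + (2 * b\<^sup>2) * C'"] conjI allI)
    show "0 \<le> (2 * a\<^sup>2) * C + (2 * b\<^sup>2) * C'" using C(1) C'(1) by simp
    fix j
    show "\<forall>\<^sub>F n in sequentially. mom (Xs n) (\<lambda>x. (a * F n x + b * G n x)\<^sup>2) j \<le> ((2 * a\<^sup>2) * C + (2 * b\<^sup>2) * C') * (1 + real j) ^ e"
      using C(2)[of j] C'(2)[of j]
    proof eventually_elim
      case (elim n)
      have "(2 * a\<^sup>2) * mom (Xs n) (\<lambda>x. (F n x)\<^sup>2) j \<le> (2 * a\<^sup>2) * (C * (1 + real j) ^ e)"
        by (rule mult_left_mono[OF elim(1)]) simp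
      moreover have "(2 * b\<^sup>2) * mom (Xs n) (\<lambda>x. (G n x)\<^sup>2) j \<le> (2 * b\<^sup>2) * (C' * (1 + real j) ^ e)"
        by (rule mult_left_mono[OF elim(2)]) simp
      moreover have "((2 * a\<^sup>2) * C + (2 * b\<^sup>2) * C') * (1 + real j) ^ e =
          (2 * a\<^sup>2) * (C * (1 + real j) ^ e) + (2 * b\<^sup>2) * (C' * (1 + real j) ^ e)"
        by (simp only: distrib_right mult.assoc)
      ultimately show ?case using le[of n j] by linarith
    qed
  qed
qed

lemma moment_growth_cmult:
  "(\<And>n. Xs n \<in> D) \<Longrightarrow> (\<And>n. F n \<in> D) \<Longrightarrow> moment_growth Xs e F \<Longrightarrow> moment_growth Xs e (\<lambda>n x. a * F n x)"
  using moment_growth_lincomb[of Xs F F e a 0] by simp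

lemma moment_growth_zero: "moment_growth Xs e (\<lambda>n x. 0)"
  unfolding moment_growth_def by (intro exI[of _ 0]) (simp add: mom_def)

lemma moment_growth_sum:
  assumes "\<And>n. Xs n \<in> D" "\<And>k n. k \<in> I \<Longrightarrow> f n k \<in> D" "\<And>k. k \<in> I \<Longrightarrow> moment_growth Xs e (\<lambda>n. f n k)"
  shows "moment_growth Xs e (\<lambda>n x. \<Sum>k\<in>I. f n k x)"
  using assms(2,3)
proof (induction I rule: infinite_finite_induct)
  case (insert a I)
  have IH: "moment_growth Xs e (\<lambda>n x. \<Sum>k\<in>I. f n k x)"
    by (rule insert.IH) (use insert.prems in auto)
  have D: "\<And>n. f n a \<in> D" "\<And>n. (\<lambda>x. \<Sum>k\<in>I. f n k x) \<in> D"
    using insert.prems(1) by (auto intro!: D_sum)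
  have "moment_growth Xs e (\<lambda>n x. 1 * f n a x + 1 * (\<Sum>k\<in>I. f n k x))"
    by (rule moment_growth_lincomb[OF assms(1) D insert.prems(2) IH]) simp
  then show ?case using insert.hyps by simp
qed (simp_all add: moment_growth_zero)

lemma moment_growth_cong_AE:
  assumes "\<And>n. Xs n \<in> D" "\<And>n. F n \<in> D" "\<And>n. G n \<in> D" "\<And>n. AE x in M. F n x = G n x" "moment_growth Xs e F"
  shows "moment_growth Xs e G"
proof -
  have "mom (Xs n) (\<lambda>x. (F n x)\<^sup>2) j = mom (Xs n) (\<lambda>x. (G n x)\<^sup>2) j" for n j
    by (rule mom_cong_AE[OF assms(1) D_power[OF assms(2)] D_power[OF assms(3)]])
      (use assms(4)[of n] in eventually_elim, simp)
  then show ?thesis using assms(5) unfolding moment_growth_def by simp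
qed

text \<open>G is lam p times the resolvent of \<open>L\<close> at lam p applied to F, so lam p F =
  lam p G - L G. The claim combines L(G^2) \<ge> 2 G L G with 2 F G \<le> F^2 + G^2.\<close>

lemma resolvent_square:
  assumes p: "p \<ge> 1" and I: "finite I" and f: "\<And>k. k \<in> I \<Longrightarrow> f k \<in> E k"
  defines "F \<equiv> \<lambda>x. \<Sum>k\<in>I. f k x" and "G \<equiv> \<lambda>x. \<Sum>k\<in>I. lam p / (lam p + lam k) * f k x"
  shows "AE x in M. lam p * (G x)\<^sup>2 - lam p * (F x)\<^sup>2 \<le> L (\<lambda>x. (G x)\<^sup>2) x"
proof -
  have lp: "lam p > 0" by (rule lam_pos[OF p])
  have GD: "G \<in> D" unfolding G_def by (rule D_sum, rule D_cmult, rule E_D, rule f)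
  have "AE x in M. \<forall>k\<in>I. L (\<lambda>x. lam p / (lam p + lam k) * f k x) x = - lam k * (lam p / (lam p + lam k) * f k x)"
  proof (subst AE_ball_countable)
    show "\<forall>k\<in>I. AE x in M. L (\<lambda>x. lam p / (lam p + lam k) * f k x) x = - lam k * (lam p / (lam p + lam k) * f k x)"
      using E_eigen[OF E_cmult[OF f]] by blast
  qed (simp add: I countable_finite)
  moreover have "AE x in M. L G x = (\<Sum>k\<in>I. L (\<lambda>x. lam p / (lam p + lam k) * f k x) x)"
    unfolding G_def by (rule L_sum, rule D_cmult, rule E_D, rule f)
  ultimately have LG: "AE x in M. lam p * F x = lam p * G x - L G x"
  proof eventually_elim
    case (elim x)
    have "lam p * G x - L G x = (\<Sum>k\<in>I. lam p * (lam p / (lam p + lam k) * f k x) + lam k * (lam p / (lam p + lam k) * f k x))"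
      unfolding elim(2) using elim(1) by (simp add: G_def sum_distrib_left sum.distrib flip: sum_negf)
    also have "\<dots> = (\<Sum>k\<in>I. lam p * f k x)"
    proof (rule sum.cong[OF refl])
      fix k
      have "lam p + lam k > 0" using lp lam_nonneg[of k] by linarith
      then show "lam p * (lam p / (lam p + lam k) * f k x) + lam k * (lam p / (lam p + lam k) * f k x) = lam p * f k x"
        unfolding distrib_right[symmetric] by simp
    qed
    finally show ?case by (simp add: F_def sum_distrib_left)
  qed
  show ?thesis
    using L_square[OF GD D_power[OF GD]] LG
  proof eventually_elim
    case (elim x)
    have "2 * G x * L G x = 2 * lam p * (G x)\<^sup>2 - 2 * lam p * (F x * G x)"
    proof -
      have e: "L G x = lam p * G x - lam p * F x" using elim(2) by linarith
      show ?thesis unfolding e by (simp add: power2_eq_square algebra_simps)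
    qed
    moreover have "lam p * (2 * (F x * G x)) \<le> lam p * ((F x)\<^sup>2 + (G x)\<^sup>2)"
      using sum_squares_bound[of "F x" "G x"] lp by (intro mult_left_mono) (auto simp: mult.assoc)
    ultimately show ?case using elim(1) by (simp add: algebra_simps)
  qed
qed

text \<open>A discrete maximum principle. If \<gamma> and b are the moments of G^2 and F^2, then up
  to a vanishing error (2 i + 3) \<gamma>(i + 1) \<le> (2 i + 2) \<gamma>(i) + b(i + 1), so \<gamma>
  inherits the growth of b by induction.\<close>

lemma moment_growth_resolvent:
  assumes p: "p \<ge> 1" and a: "asymp_gauss p Xs" and I: "finite I" "I \<subseteq> {..N}"
    and f: "\<And>n k. k \<in> I \<Longrightarrow> f n k \<in> E k" "\<And>n k. k \<in> I \<Longrightarrow> l2 M (f n k) \<le> B"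
    and g: "moment_growth Xs e (\<lambda>n x. \<Sum>k\<in>I. f n k x)"
  shows "moment_growth Xs e (\<lambda>n x. \<Sum>k\<in>I. lam p / (lam p + lam k) * f n k x)"
proof -
  have lp: "lam p > 0" by (rule lam_pos[OF p])
  have XD: "Xs n \<in> D" for n using a E_D unfolding asymp_gauss_def by blast
  define F where "F n x = (\<Sum>k\<in>I. f n k x)" for n x
  define G where "G n x = (\<Sum>k\<in>I. lam p / (lam p + lam k) * f n k x)" for n x
  have FD: "F n \<in> D" for n unfolding F_def[abs_def] by (rule D_sum, rule E_D, rule f(1))
  have GA: "G n \<in> A N" for n
    unfolding G_def[abs_def] by (rule A_sum, rule A_cmult, rule E_A[OF f(1)]) (use I in auto)
  have GD: "G n \<in> D" for n by (rule A_D[OF GA])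
  have GB: "l2 M (G n) \<le> (\<Sum>k\<in>I. B)" for n
  proof -
    have "l2 M (G n) \<le> (\<Sum>k\<in>I. l2 M (\<lambda>x. lam p / (lam p + lam k) * f n k x))"
      unfolding G_def[abs_def] by (rule l2_sum, rule D_L2', rule D_cmult, rule E_D, rule f(1))
    also have "\<dots> \<le> (\<Sum>k\<in>I. B)"
    proof (rule sum_mono)
      fix k assume k: "k \<in> I"
      have "\<bar>lam p / (lam p + lam k)\<bar> \<le> 1" using lp lam_nonneg[of k] by simp
      then have "l2 M (\<lambda>x. lam p / (lam p + lam k) * f n k x) \<le> 1 * l2 M (f n k)"
        unfolding l2_cmult by (intro mult_right_mono) auto
      then show "l2 M (\<lambda>x. lam p / (lam p + lam k) * f n k x) \<le> B" using f(2)[OF k, of n] by linarith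
    qed
    finally show ?thesis .
  qed
  obtain H where H: "H \<ge> 0" "\<forall>F\<in>A N. \<forall>G\<in>A N. l2 M (\<lambda>x. F x * G x) \<le> H * l2 M F * l2 M G"
    using hypercontractive_mult[of N N] by blast
  have G2A: "(\<lambda>x. (G n x)\<^sup>2) \<in> A (2 * N)" for n by (rule A_power[OF GA])
  have G2B: "l2 M (\<lambda>x. (G n x)\<^sup>2) \<le> H * (\<Sum>k\<in>I. B) * (\<Sum>k\<in>I. B)" for n
  proof -
    have "l2 M (\<lambda>x. G n x * G n x) \<le> H * l2 M (G n) * l2 M (G n)" using H(2) GA by blast
    also have "\<dots> \<le> H * (\<Sum>k\<in>I. B) * (\<Sum>k\<in>I. B)"
      using GB[of n] H(1) order_trans[OF l2_nonneg GB[of n]] by (intro mult_mono) auto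
    finally show ?thesis by (simp add: power2_eq_square)
  qed
  define \<gamma> where "\<gamma> n j = mom (Xs n) (\<lambda>x. (G n x)\<^sup>2) j" for n j
  define b where "b n j = mom (Xs n) (\<lambda>x. (F n x)\<^sup>2) j" for n j
  obtain C where C: "C \<ge> 0" "\<And>j. \<forall>\<^sub>F n in sequentially. b n j \<le> C * (1 + real j) ^ e"
    using g unfolding moment_growth_def b_def F_def by blast
  have en: "lam p * \<gamma> n j - lam p * b n j \<le> mom (Xs n) (L (\<lambda>x. (G n x)\<^sup>2)) j" for n j
  proof -
    have "mom (Xs n) (\<lambda>x. lam p * (G n x)\<^sup>2 + (- lam p) * (F n x)\<^sup>2) j \<le> mom (Xs n) (L (\<lambda>x. (G n x)\<^sup>2)) j"
    proof (rule mom_mono[OF XD])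
      show "AE x in M. lam p * (G n x)\<^sup>2 + (- lam p) * (F n x)\<^sup>2 \<le> L (\<lambda>x. (G n x)\<^sup>2) x"
        using resolvent_square[of p I "f n", OF p I(1) f(1)] unfolding F_def G_def by simp
    qed (intro D_lincomb D_power FD GD A_D[OF A_L[OF G2A]])+
    then show ?thesis
      unfolding mom_lincomb[OF XD D_power[OF GD] D_power[OF FD]] \<gamma>_def b_def by simp
  qed
  have "\<forall>\<^sub>F n in sequentially. \<gamma> n j \<le> (C + 1) * (1 + real j) ^ e" for j
  proof (induction j)
    case 0
    show ?case using C(2)[of 0]
    proof eventually_elim
      case (elim n)
      have "mom (Xs n) (L (\<lambda>x. (G n x)\<^sup>2)) 0 = 0"
        unfolding mom_0 by (rule L_integral[OF D_power[OF GD]])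
      then have "lam p * \<gamma> n 0 \<le> lam p * b n 0" using en[of n 0] by simp
      then show ?case using elim lp by simp
    qed
  next
    case (Suc i)
    \<comment> \<open>It tends to 0 and is eventually below lam p; the summand 1 in
      \<open>C + 1\<close> pays for that.\<close>
    define err where "err n = mom (Xs n) (L (\<lambda>x. (G n x)\<^sup>2)) (Suc i) - lam p * (2 * real i + 2) * (\<gamma> n i - \<gamma> n (Suc i))" for n
    have "err \<longlonglongrightarrow> 0"
      unfolding err_def[abs_def] \<gamma>_def by (rule mom_generator_limit[OF p a G2A G2B])
    then have "\<forall>\<^sub>F n in sequentially. err n < lam p"
      using lp order_tendstoD(2) by blast
    with Suc.IH C(2)[of "Suc i"] show ?case
    proof eventually_elim
      case (elim n)
      let ?w = "(1 + real (Suc i)) ^ e" and ?v = "(1 + real i) ^ e"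
      have w1: "1 \<le> ?w" by (intro one_le_power) auto
      have vw: "?v \<le> ?w" by (intro power_mono) auto
      have "lam p * (\<gamma> n (Suc i) - b n (Suc i)) \<le> lam p * ((2 * real i + 2) * (\<gamma> n i - \<gamma> n (Suc i)) + 1)"
        using en[of n "Suc i"] elim(3) unfolding err_def by (simp add: algebra_simps)
      then have 1: "\<gamma> n (Suc i) - b n (Suc i) \<le> (2 * real i + 2) * (\<gamma> n i - \<gamma> n (Suc i)) + 1"
        using lp by simp
      have "(2 * real i + 2) * \<gamma> n i \<le> (2 * real i + 2) * ((C + 1) * ?v)"
        using elim(1) by (intro mult_left_mono) auto
      also have "\<dots> \<le> (2 * real i + 2) * ((C + 1) * ?w)"
        using vw C(1) by (intro mult_left_mono) auto
      finally have 2: "(2 * real i + 2) * \<gamma> n i \<le> (2 * real i + 2) * ((C + 1) * ?w)" .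
      have 3: "b n (Suc i) + 1 \<le> (C + 1) * ?w"
        using elim(2) w1 unfolding distrib_right by linarith
      have "(2 * real i + 3) * \<gamma> n (Suc i) \<le> (2 * real i + 3) * z" if z: "z = (C + 1) * ?w" for z
      proof -
        have "(2 * real i + 3) * y = y + (2 * real i + 2) * y" for y :: real
          by (simp add: algebra_simps)
        from this[of "\<gamma> n (Suc i)"] this[of z] show ?thesis
          using 1 2 3 unfolding z[symmetric] right_diff_distrib by linarith
      qed
      from this[OF refl] have "(2 * real i + 3) * \<gamma> n (Suc i) \<le> (2 * real i + 3) * ((C + 1) * ?w)" .
      then show ?case by (rule mult_left_le_imp_le) simp
    qed
  qed
  then show ?thesis
    unfolding moment_growth_def using C(1)
    by (intro exI[of _ "C + 1"]) (auto simp: \<gamma>_def G_def)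
qed

text \<open>The resolvent multiplies the components by distinct numbers \<open>r k\<close>.
  Subtracting \<open>r c\<close> times the original sum removes component c, and the induction
  hypothesis applies to the rest; |r k - r c| \<le> 1 keeps the bound \<open>B\<close>.\<close>

lemma moment_growth_components:
  assumes p: "p \<ge> 1" and a: "asymp_gauss p Xs" and I: "finite I" "I \<subseteq> {..N}"
    and f: "\<And>n k. k \<in> I \<Longrightarrow> f n k \<in> E k" "\<And>n k. k \<in> I \<Longrightarrow> l2 M (f n k) \<le> B"
    and g: "moment_growth Xs e (\<lambda>n x. \<Sum>k\<in>I. f n k x)"
  shows "\<forall>k\<in>I. moment_growth Xs e (\<lambda>n. f n k)"
  using I f g
proof (induction I arbitrary: f rule: finite_induct)
  case (insert c I)
  have lp: "lam p > 0" by (rule lam_pos[OF p])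
  have XD: "Xs n \<in> D" for n using a E_D unfolding asymp_gauss_def by blast
  define r where "r k = lam p / (lam p + lam k)" for k
  have r01: "0 < r k" "r k \<le> 1" for k
    using lp lam_nonneg[of k] by (auto simp: r_def)
  have fD: "f n k \<in> D" if "k \<in> insert c I" for n k
    using insert.prems(2) that E_D by blast
  have SD: "(\<lambda>x. \<Sum>k\<in>insert c I. f n k x) \<in> D" "(\<lambda>x. \<Sum>k\<in>insert c I. r k * f n k x) \<in> D" for n
    by (auto intro!: D_sum D_cmult fD)
  have R: "moment_growth Xs e (\<lambda>n x. \<Sum>k\<in>insert c I. r k * f n k x)"
    unfolding r_def
    by (rule moment_growth_resolvent[OF p a _ insert.prems(1) insert.prems(2) insert.prems(3) insert.prems(4)])
      (use insert.hyps in auto)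
  have "moment_growth Xs e (\<lambda>n x. 1 * (\<Sum>k\<in>insert c I. r k * f n k x) + (- r c) * (\<Sum>k\<in>insert c I. f n k x))"
    by (rule moment_growth_lincomb[OF XD SD(2) SD(1) R insert.prems(4)])
  moreover have "1 * (\<Sum>k\<in>insert c I. r k * f n k x) + (- r c) * (\<Sum>k\<in>insert c I. f n k x) = (\<Sum>k\<in>I. (r k - r c) * f n k x)" for n x
    using insert.hyps by (simp add: left_diff_distrib sum_subtractf sum_distrib_left algebra_simps sum_negf)
  ultimately have g': "moment_growth Xs e (\<lambda>n x. \<Sum>k\<in>I. (r k - r c) * f n k x)" by simp
  have comp: "\<forall>k\<in>I. moment_growth Xs e (\<lambda>n x. (r k - r c) * f n k x)"
  proof (rule insert.IH)
    show "I \<subseteq> {..N}" using insert.prems(1) by auto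
    show "(\<lambda>x. (r k - r c) * f n k x) \<in> E k" if "k \<in> I" for n k
      using insert.prems(2) that by (intro E_cmult) auto
    show "l2 M (\<lambda>x. (r k - r c) * f n k x) \<le> B" if "k \<in> I" for n k
    proof -
      have "\<bar>r k - r c\<bar> \<le> 1" using r01[of k] r01[of c] by linarith
      then have "l2 M (\<lambda>x. (r k - r c) * f n k x) \<le> 1 * l2 M (f n k)"
        unfolding l2_cmult by (intro mult_right_mono) auto
      then show ?thesis using insert.prems(3)[of k n] that by simp
    qed
  qed (rule g')
  have gI: "moment_growth Xs e (\<lambda>n. f n k)" if k: "k \<in> I" for k
  proof -
    have "lam k \<noteq> lam c" using k insert.hyps(2) strict_mono_eq[OF lam_strict_mono] by auto
    moreover have "lam p + lam k > 0" "lam p + lam c > 0" using lp lam_nonneg[of k] lam_nonneg[of c] by auto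
    ultimately have ne: "r k - r c \<noteq> 0" using lp by (simp add: r_def)
    have "moment_growth Xs e (\<lambda>n x. (1 / (r k - r c)) * ((r k - r c) * f n k x))"
      by (rule moment_growth_cmult[OF XD D_cmult[OF fD] bspec[OF comp k]]) (use k in auto)
    then show ?thesis using ne by simp
  qed
  have gs: "moment_growth Xs e (\<lambda>n x. \<Sum>k\<in>I. f n k x)"
    by (rule moment_growth_sum[OF XD]) (use fD gI in auto)
  have SI: "(\<lambda>x. \<Sum>k\<in>I. f n k x) \<in> D" for n
    by (auto intro!: D_sum fD)
  have "moment_growth Xs e (\<lambda>n x. 1 * (\<Sum>k\<in>insert c I. f n k x) + (-1) * (\<Sum>k\<in>I. f n k x))"
    by (rule moment_growth_lincomb[OF XD SD(1) SI insert.prems(4) gs])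
  then have "moment_growth Xs e (\<lambda>n. f n c)" using insert.hyps by simp
  with gI show ?case by blast
qed simp

text \<open>If \<open>lam p + lam q\<close> were missing from the eigenvalues that occur in \<open>X\<^sub>n Y\<close>, the resolvent of \<open>L\<close>
  would keep the components of \<open>X\<^sub>n Y\<close> at the growth order of \<open>Y\<close>. But
  \<open>mom X\<^sub>n ((X\<^sub>n Y)\<^sup>2) j = (2 j + 1) * mom X\<^sub>n (Y\<^sup>2) (j + 1)\<close> is of one order more.\<close>

lemma sum_in_spectrum:
  assumes p: "p \<ge> 1" and a0: "asymp_gauss p Xs0"
  shows "\<exists>k\<le>p + q. lam k = lam p + lam q"
proof (rule ccontr)
  assume notin: "\<not> ?thesis"
  have lp: "lam p > 0" by (rule lam_pos[OF p])
  obtain Y where Y: "Y \<in> E q" "l2 M Y > 0" using E_nontrivial by blast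
  obtain r P where r: "strict_mono r" and lim0: "\<forall>j. (\<lambda>n. mom (Xs0 (r n)) (\<lambda>x. (Y x)\<^sup>2) j) \<longlonglongrightarrow> poly P (real j)"
    using square_moments[OF p a0 Y(1)] by blast
  define Xs where "Xs n = Xs0 (r n)" for n
  have a: "asymp_gauss p Xs"
    using asymp_gauss_subseq[OF a0 r] unfolding Xs_def by (simp add: comp_def)
  have lim: "(\<lambda>n. mom (Xs n) (\<lambda>x. (Y x)\<^sup>2) j) \<longlonglongrightarrow> poly P (real j)" for j
    using lim0 unfolding Xs_def by blast
  have X: "Xs n \<in> E p" "l2 M (Xs n) = 1" for n using a unfolding asymp_gauss_def by auto
  have XD: "Xs n \<in> D" for n by (rule E_D[OF X(1)])
  have YD: "Y \<in> D" by (rule E_D[OF Y(1)])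
  have XA: "Xs n \<in> A p" for n by (rule E_A[OF X(1) order_refl])
  have YA: "Y \<in> A q" by (rule E_A[OF Y(1) order_refl])
  have Y2A: "(\<lambda>x. (Y x)\<^sup>2) \<in> A (2 * q)" by (rule A_power[OF YA])
  define \<kappa> where "\<kappa> = lam p + lam q"
  have \<kappa>: "\<kappa> \<noteq> lam k" if "k \<le> p + q" for k
    using notin that unfolding \<kappa>_def by metis
  \<comment> \<open>The moment of order 0 is the squared norm of Y for every n, so P does not
    vanish.\<close>
  have P0: "poly P 0 = (l2 M Y)\<^sup>2"
    using LIMSEQ_unique[OF lim[of 0]] by (simp add: mom_0 l2_sq)
  have Pne: "P \<noteq> 0" using P0 Y(2) by auto
  have Pnn: "0 \<le> poly P (real j)" for j
    by (rule LIMSEQ_le_const[OF lim]) (auto intro!: mom_nonneg)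
  define e where "e = degree P"
  \<comment> \<open>Describes the limiting moments of \<Gamma>(Y, Y) = L(Y^2) / 2 + lam q Y^2, since
    \<open>L\<close> acts on limits as 2 lam p j (P(j - 1) - P(j)). Its degree is at most that of
    P.\<close>
  define Q where "Q = smult (lam p) ([:0, 1:] * (pcompose P [:-1, 1:] - P)) + smult (lam q) P"
  have "degree Q \<le> e"
    unfolding Q_def e_def
    by (intro degree_add_le order_trans[OF degree_smult_le] degree_backward_difference order_refl)
  then obtain CQ where CQ: "CQ \<ge> 0" "\<And>j. \<bar>poly Q (real j)\<bar> \<le> CQ * (1 + real j) ^ e"
    using poly_nat_bound by blast
  have \<Gamma>YA: "\<Gamma> Y Y \<in> A (q + q)" by (rule A_\<Gamma>[OF YA YA])
  have LY2: "L (\<lambda>x. (Y x)\<^sup>2) \<in> D" by (rule A_D[OF A_L[OF Y2A]])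
  have \<Gamma>Yeq: "mom (Xs n) (\<Gamma> Y Y) j = (1/2) * mom (Xs n) (L (\<lambda>x. (Y x)\<^sup>2)) j + lam q * mom (Xs n) (\<lambda>x. (Y x)\<^sup>2) j" for n j
  proof -
    have "mom (Xs n) (\<Gamma> Y Y) j = mom (Xs n) (\<lambda>x. (1/2) * L (\<lambda>x. (Y x)\<^sup>2) x + lam q * (Y x)\<^sup>2) j"
    proof (rule mom_cong_AE[OF XD A_D[OF \<Gamma>YA] D_lincomb[OF LY2 D_power[OF YD]]])
      show "AE x in M. \<Gamma> Y Y x = (1/2) * L (\<lambda>x. (Y x)\<^sup>2) x + lam q * (Y x)\<^sup>2"
        using E_eigen[OF Y(1)] by eventually_elim (simp add: carre_du_champ_def power2_eq_square)
    qed
    then show ?thesis unfolding mom_lincomb[OF XD LY2 D_power[OF YD]] .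
  qed
  have \<Gamma>Ylim: "(\<lambda>n. mom (Xs n) (\<Gamma> Y Y) j) \<longlonglongrightarrow> poly Q (real j)" for j
  proof (cases j)
    case 0
    have "mom (Xs n) (L (\<lambda>x. (Y x)\<^sup>2)) 0 = 0" for n
      unfolding mom_0 by (rule L_integral[OF D_power[OF YD]])
    then have "(\<lambda>n. mom (Xs n) (\<Gamma> Y Y) 0) \<longlonglongrightarrow> lam q * poly P (real 0)"
      unfolding \<Gamma>Yeq by (simp only: mult_zero_right add_0_left) (intro tendsto_intros lim)
    then show ?thesis unfolding 0 by (simp add: Q_def)
  next
    case (Suc i)
    have 1: "(\<lambda>n. mom (Xs n) (L (\<lambda>x. (Y x)\<^sup>2)) (Suc i) - lam p * (2 * real i + 2) * (mom (Xs n) (\<lambda>x. (Y x)\<^sup>2) i - mom (Xs n) (\<lambda>x. (Y x)\<^sup>2) (Suc i))) \<longlonglongrightarrow> 0"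
      by (rule mom_generator_limit[OF p a Y2A order_refl])
    have 2: "(\<lambda>n. lam p * (2 * real i + 2) * (mom (Xs n) (\<lambda>x. (Y x)\<^sup>2) i - mom (Xs n) (\<lambda>x. (Y x)\<^sup>2) (Suc i)))
      \<longlonglongrightarrow> lam p * (2 * real i + 2) * (poly P (real i) - poly P (real (Suc i)))"
      by (intro tendsto_intros lim)
    have 3: "(\<lambda>n. mom (Xs n) (L (\<lambda>x. (Y x)\<^sup>2)) (Suc i)) \<longlonglongrightarrow> lam p * (2 * real i + 2) * (poly P (real i) - poly P (real (Suc i)))"
      using tendsto_add[OF 1 2] by simp
    have "(\<lambda>n. mom (Xs n) (\<Gamma> Y Y) (Suc i)) \<longlonglongrightarrow>
      (1/2) * (lam p * (2 * real i + 2) * (poly P (real i) - poly P (real (Suc i)))) + lam q * poly P (real (Suc i))"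
      unfolding \<Gamma>Yeq by (intro tendsto_intros 3 lim)
    moreover have "(1/2) * (lam p * (2 * real i + 2) * (poly P (real i) - poly P (real (Suc i)))) + lam q * poly P (real (Suc i)) = poly Q (real (Suc i))"
      by (simp add: Q_def poly_pcompose algebra_simps)
    ultimately show ?thesis unfolding Suc by simp
  qed
  obtain H where H: "H \<ge> 0" "\<forall>F\<in>A p. \<forall>G\<in>A q. l2 M (\<lambda>x. F x * G x) \<le> H * l2 M F * l2 M G"
    using hypercontractive_mult[of p q] by blast
  have XYA: "(\<lambda>x. Xs n x * Y x) \<in> A (p + q)" for n by (rule A_mult[OF XA YA])
  have "\<forall>n. \<exists>z. (\<forall>k. z k \<in> E k) \<and> (AE x in M. Xs n x * Y x = (\<Sum>k\<le>p + q. z k x))"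
    using A_E[OF XYA] by metis
  from choice[OF this] obtain Z where Zex: "\<forall>n. (\<forall>k. Z n k \<in> E k) \<and> (AE x in M. Xs n x * Y x = (\<Sum>k\<le>p + q. Z n k x))"
    by blast
  then have Z: "\<And>n k. Z n k \<in> E k" "\<And>n. AE x in M. Xs n x * Y x = (\<Sum>k\<le>p + q. Z n k x)" by auto
  have ZB: "l2 M (Z n k) \<le> H * l2 M Y" if "k \<le> p + q" for n k
  proof -
    have "l2 M (Z n k) \<le> l2 M (\<lambda>x. Xs n x * Y x)"
      by (rule l2_component_le[OF A_D[OF XYA] Z(1) Z(2) that])
    also have "\<dots> \<le> H * l2 M (Xs n) * l2 M Y" using H(2) XA YA by blast
    finally show ?thesis using X(2) by simp
  qed
  \<comment> \<open>The components of (\<kappa> + L)(X_n Y), whose sum is 2 \<Gamma>(X_n,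
    Y).\<close>
  define f where "f n k x = (\<kappa> - lam k) * Z n k x" for n k x
  have fE: "f n k \<in> E k" for n k
    unfolding f_def[abs_def] by (rule E_cmult[OF Z(1)])
  have fB: "l2 M (f n k) \<le> (\<kappa> + lam (p + q)) * (H * l2 M Y)" if "k \<le> p + q" for n k
  proof -
    have "\<bar>\<kappa> - lam k\<bar> \<le> \<kappa> + lam (p + q)"
      using lam_nonneg[of k] lam_mono[OF that] lam_nonneg[of p] lam_nonneg[of q] unfolding \<kappa>_def by linarith
    then show ?thesis
      unfolding f_def[abs_def] l2_cmult using ZB[OF that, of n] by (intro mult_mono) auto
  qed
  have feq: "AE x in M. (\<Sum>k\<le>p + q. f n k x) = 2 * \<Gamma> (Xs n) Y x" for n
    using L_eigen_sum[OF A_D[OF XYA[of n]] Z(1)[of n] Z(2)[of n]] Z(2)[of n] E_eigen[OF X(1)[of n]] E_eigen[OF Y(1)]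
  proof eventually_elim
    case (elim x)
    have "(\<Sum>k\<le>p + q. f n k x) = \<kappa> * (\<Sum>k\<le>p + q. Z n k x) - (\<Sum>k\<le>p + q. lam k * Z n k x)"
      by (simp add: f_def left_diff_distrib sum_subtractf sum_distrib_left)
    also have "\<dots> = \<kappa> * (Xs n x * Y x) + L (\<lambda>x. Xs n x * Y x) x"
      using elim(1,2) by simp
    also have "\<dots> = 2 * \<Gamma> (Xs n) Y x"
      unfolding carre_du_champ_def elim(3,4) \<kappa>_def by (simp add: algebra_simps)
    finally show ?case .
  qed
  \<comment> \<open>4 \<Gamma>(X, Y)^2 \<le> 4 \<Gamma>(X, X) \<Gamma>(Y, Y) = 4 lam p (1 + W)
    \<Gamma>(Y, Y). In \<open>CQ + 2\<close> one unit covers the distance of the moments of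
    \<Gamma>(Y, Y) from their limits, the other the term with W.\<close>
  have vgrow: "moment_growth Xs e (\<lambda>n x. \<Sum>k\<in>{..p + q}. f n k x)"
    unfolding moment_growth_def
  proof (intro exI[of _ "4 * lam p * (CQ + 2)"] conjI allI)
    show "0 \<le> 4 * lam p * (CQ + 2)" using lp CQ(1) by simp
    fix j
    let ?w = "(1 + real j) ^ e"
    have w1: "1 \<le> ?w" by (intro one_le_power) auto
    have e1: "\<forall>\<^sub>F n in sequentially. mom (Xs n) (\<Gamma> Y Y) j < CQ * ?w + 1"
      by (rule order_tendstoD(2)[OF \<Gamma>Ylim]) (use CQ(2)[of j] in linarith)
    have e2: "\<forall>\<^sub>F n in sequentially. mom (Xs n) (\<lambda>x. \<Gamma> Y Y x * W p (Xs n) x) j < 1"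
      by (rule order_tendstoD(2)[OF mom_W_null[OF a \<Gamma>YA order_refl]]) simp
    show "\<forall>\<^sub>F n in sequentially. mom (Xs n) (\<lambda>x. (\<Sum>k\<in>{..p + q}. f n k x)\<^sup>2) j \<le> 4 * lam p * (CQ + 2) * ?w"
      using e1 e2
    proof eventually_elim
      case (elim n)
      have WD: "W p (Xs n) \<in> D" by (rule A_D[OF W_A[OF X(1)]])
      have \<Gamma>D: "\<Gamma> Y Y \<in> D" by (rule A_D[OF \<Gamma>YA])
      have "mom (Xs n) (\<lambda>x. (\<Sum>k\<in>{..p + q}. f n k x)\<^sup>2) j \<le>
        mom (Xs n) (\<lambda>x. (4 * lam p) * \<Gamma> Y Y x + (4 * lam p) * (\<Gamma> Y Y x * W p (Xs n) x)) j"
      proof (rule mom_mono[OF XD])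
        show "(\<lambda>x. (\<Sum>k\<in>{..p + q}. f n k x)\<^sup>2) \<in> D" by (rule D_power, rule D_sum, rule E_D, rule fE)
        show "(\<lambda>x. (4 * lam p) * \<Gamma> Y Y x + (4 * lam p) * (\<Gamma> Y Y x * W p (Xs n) x)) \<in> D"
          by (intro D_lincomb \<Gamma>D D_mult WD)
        show "AE x in M. (\<Sum>k\<in>{..p + q}. f n k x)\<^sup>2 \<le> (4 * lam p) * \<Gamma> Y Y x + (4 * lam p) * (\<Gamma> Y Y x * W p (Xs n) x)"
          using feq[of n] \<Gamma>_Cauchy_Schwarz[OF XD[of n] YD]
        proof eventually_elim
          case (elim x)
          have "\<Gamma> (Xs n) (Xs n) x = lam p * (1 + W p (Xs n) x)" using lp by (simp add: W_def)
          then have "(\<Gamma> (Xs n) Y x)\<^sup>2 \<le> lam p * (1 + W p (Xs n) x) * \<Gamma> Y Y x" using elim(2) by simp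
          then show ?case unfolding elim(1) power_mult_distrib by (simp add: algebra_simps)
        qed
      qed
      also have "\<dots> = (4 * lam p) * mom (Xs n) (\<Gamma> Y Y) j + (4 * lam p) * mom (Xs n) (\<lambda>x. \<Gamma> Y Y x * W p (Xs n) x) j"
        by (rule mom_lincomb[OF XD \<Gamma>D D_mult[OF \<Gamma>D WD]])
      also have "\<dots> = (4 * lam p) * (mom (Xs n) (\<Gamma> Y Y) j + mom (Xs n) (\<lambda>x. \<Gamma> Y Y x * W p (Xs n) x) j)"
        by (simp only: distrib_left)
      also have "\<dots> \<le> (4 * lam p) * ((CQ + 2) * ?w)"
      proof (rule mult_left_mono)
        show "mom (Xs n) (\<Gamma> Y Y) j + mom (Xs n) (\<lambda>x. \<Gamma> Y Y x * W p (Xs n) x) j \<le> (CQ + 2) * ?w"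
          using elim w1 unfolding distrib_right by linarith
      qed (use lp in simp)
      finally show ?case by (simp only: mult.assoc)
    qed
  qed
  have "\<forall>k\<in>{..p + q}. moment_growth Xs e (\<lambda>n. f n k)"
  proof (rule moment_growth_components[OF p a])
    show "moment_growth Xs e (\<lambda>n x. \<Sum>k\<in>{..p + q}. f n k x)" by (rule vgrow)
  qed (use fE fB in auto)
  \<comment> \<open>The assumption that \<kappa> is no eigenvalue of index at most p + q allows the
    division that recovers the components of X_n Y.\<close>
  then have Zgrow: "moment_growth Xs e (\<lambda>n. Z n k)" if "k \<in> {..p + q}" for k
  proof -
    have "moment_growth Xs e (\<lambda>n x. (1 / (\<kappa> - lam k)) * f n k x)"
      using \<open>\<forall>k\<in>{..p + q}. moment_growth Xs e (\<lambda>n. f n k)\<close> that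
      by (intro moment_growth_cmult XD E_D[OF fE]) auto
    then show ?thesis using \<kappa>[of k] that by (simp add: f_def)
  qed
  have "moment_growth Xs e (\<lambda>n x. \<Sum>k\<in>{..p + q}. Z n k x)"
    by (rule moment_growth_sum[OF XD E_D[OF Z(1)] Zgrow])
  then have "moment_growth Xs e (\<lambda>n x. Xs n x * Y x)"
  proof (rule moment_growth_cong_AE[rotated -1])
    show "(\<lambda>x. \<Sum>k\<in>{..p + q}. Z n k x) \<in> D" for n
      by (rule D_sum, rule E_D, rule Z(1))
    show "AE x in M. (\<Sum>k\<in>{..p + q}. Z n k x) = Xs n x * Y x" for n
      using Z(2)[of n] by eventually_elim simp
  qed (rule XD, rule A_D[OF XYA])
  then obtain C where C: "\<forall>j. \<forall>\<^sub>F n in sequentially. mom (Xs n) (\<lambda>x. (Xs n x * Y x)\<^sup>2) j \<le> C * (1 + real j) ^ e"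
    unfolding moment_growth_def by blast
  have "(2 * real j + 1) * poly P (real (Suc j)) \<le> C * (1 + real j) ^ degree P" for j
  proof -
    have eq: "mom (Xs n) (\<lambda>x. (Xs n x * Y x)\<^sup>2) j = (2 * real j + 1) * mom (Xs n) (\<lambda>x. (Y x)\<^sup>2) (Suc j)" for n
    proof -
      have "(\<lambda>x. (Xs n x * Y x)\<^sup>2 * Xs n x ^ (2 * j)) = (\<lambda>x. (Y x)\<^sup>2 * Xs n x ^ (2 * Suc j))"
        by (simp add: power_mult_distrib mult_ac power2_eq_square)
      moreover have "(2 * real j + 1) * (c / ((2 * real j + 1) * mdf j)) = c / mdf j" for c
        by (simp add: add_nonneg_eq_0_iff)
      ultimately show ?thesis unfolding mom_def mdf_Suc by (simp only:)
    qed
    have "\<forall>\<^sub>F n in sequentially. (2 * real j + 1) * mom (Xs n) (\<lambda>x. (Y x)\<^sup>2) (Suc j) \<le> C * (1 + real j) ^ e"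
      using C[rule_format, of j] unfolding eq .
    moreover have "(\<lambda>n. (2 * real j + 1) * mom (Xs n) (\<lambda>x. (Y x)\<^sup>2) (Suc j)) \<longlonglongrightarrow> (2 * real j + 1) * poly P (real (Suc j))"
      by (intro tendsto_intros lim)
    ultimately show ?thesis unfolding e_def[symmetric]
      by (intro tendsto_upperbound[where F = sequentially]) auto
  qed
  from poly_growth_contradiction[OF Pne Pnn this] show False .
qed

text \<open>The index of lam p + lam q is strictly increasing in q and equals p at q = 0, so it is
  at least p + q; \<open>sum_in_spectrum\<close> gives the reverse inequality.\<close>

lemma double_eigenvalue:
  assumes p: "p \<ge> 1" and a: "asymp_gauss p Xs"
  shows "lam (2 * p) = 2 * lam p"
proof -
  have "\<forall>q. \<exists>k. k \<le> p + q \<and> lam k = lam p + lam q" using sum_in_spectrum[OF p a] by blast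
  from choice[OF this] obtain k where k: "\<And>q. k q \<le> p + q" "\<And>q. lam (k q) = lam p + lam q" by blast
  have "k q \<ge> p + q" for q
  proof (induction q)
    case 0
    have "lam (k 0) = lam p" using k(2)[of 0] lam_0 by simp
    then show ?case using strict_mono_eq[OF lam_strict_mono] by auto
  next
    case (Suc q)
    have "lam (k q) < lam (k (Suc q))"
      unfolding k(2) using strict_monoD[OF lam_strict_mono, of q "Suc q"] by simp
    then have "k q < k (Suc q)" using strict_mono_less[OF lam_strict_mono] by blast
    then show ?case using Suc by simp
  qed
  then have "k p = 2 * p" using k(1)[of p] by (metis le_antisym mult_2)
  then show ?thesis using k(2)[of p] by simp
qed

lemma W_A_sharp:
  assumes p: "p \<ge> 1" and d: "lam (2 * p) = 2 * lam p" and X: "X \<in> E p"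
  shows "W p X \<in> A (2 * p - 1)"
proof -
  have lp: "lam p > 0" by (rule lam_pos[OF p])
  have XX: "(\<lambda>x. X x * X x) \<in> A (p + p)" by (rule E_mult[OF X X])
  obtain g where g: "\<And>k. g k \<in> E k" "AE x in M. X x * X x = (\<Sum>k\<le>p + p. g k x)"
    using A_E[OF XX] by blast
  \<comment> \<open>From \<Gamma>(X, X) = L(X^2) / 2 + lam p X^2: division by lam p leaves this
    factor on the component of X^2 of index k, and it vanishes at k = 2 p.\<close>
  let ?c = "\<lambda>k. 1 - lam k / (2 * lam p)"
  have "(\<lambda>x. (\<Sum>k\<le>2 * p - 1. ?c k * g k x) - 1) \<in> A (2 * p - 1)"
    by (intro A_diff A_const A_sum A_cmult E_A[OF g(1)]) auto
  then show ?thesis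
  proof (rule A_cong_AE)
    show "W p X \<in> borel_measurable M" by (rule A_measurable[OF W_A[OF X]])
    show "AE x in M. W p X x = (\<Sum>k\<le>2 * p - 1. ?c k * g k x) - 1"
      using L_eigen_sum[OF A_D[OF XX] g] g(2) E_eigen[OF X]
    proof eventually_elim
      case (elim x)
      have "\<Gamma> X X x / lam p = (L (\<lambda>y. X y * X y) x) / (2 * lam p) + X x * X x"
        unfolding carre_du_champ_def elim(3) using lp by (simp add: field_simps)
      also have "\<dots> = (\<Sum>k\<le>p + p. ?c k * g k x)"
        unfolding elim(1,2) by (simp add: left_diff_distrib sum_subtractf sum_divide_distrib)
      also have "{..p + p} = insert (2 * p) {..2 * p - 1}" using p by auto
      also have "(\<Sum>k\<in>insert (2 * p) {..2 * p - 1}. ?c k * g k x) = ?c (2 * p) * g (2 * p) x + (\<Sum>k\<le>2 * p - 1. ?c k * g k x)"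
        using p by (intro sum.insert) auto
      finally show ?case using d lp by (simp add: W_def)
    qed
  qed
qed

lemma spectral_dichotomy:
  assumes p: "p \<ge> 1"
  shows "lam (2 * p) = 2 * lam p \<or> (\<exists>\<epsilon>>0. \<forall>X\<in>E p. l2 M X = 1 \<longrightarrow> \<epsilon> \<le> l2 M (W p X))"
proof (rule ccontr)
  assume c: "\<not> ?thesis"
  then have "\<forall>n. \<exists>X. X \<in> E p \<and> l2 M X = 1 \<and> l2 M (W p X) < inverse (real (Suc n))"
    by (metis not_le inverse_positive_iff_positive of_nat_0_less_iff zero_less_Suc)
  from choice[OF this] obtain Xs where Xs: "\<And>n. Xs n \<in> E p" "\<And>n. l2 M (Xs n) = 1"
    "\<And>n. l2 M (W p (Xs n)) < inverse (real (Suc n))" by blast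
  have "(\<lambda>n. l2 M (W p (Xs n))) \<longlonglongrightarrow> 0"
    by (rule Lim_null_comparison[OF _ LIMSEQ_inverse_real_of_nat])
      (use Xs(3) in \<open>auto intro!: always_eventually less_imp_le\<close>)
  then have "asymp_gauss p Xs" unfolding asymp_gauss_def using Xs by auto
  from double_eigenvalue[OF p this] c show False by blast
qed

end

section \<open>The total variation bound\<close>

text \<open>The approximants are averages of h over [x, x + 1 / (n + 1)], written as difference
  quotients of an antiderivative. Their derivatives are bounded for each n, though not uniformly in
  n.\<close>

lemma C1_approximation:
  fixes h :: "real \<Rightarrow> real"
  assumes h: "continuous_on UNIV h" "\<And>x. \<bar>h x\<bar> \<le> 1"
  shows "\<exists>f f'. (\<forall>n x. (f n has_real_derivative f' n x) (at x)) \<and> (\<forall>n. continuous_on UNIV (f' n)) \<and>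
    (\<forall>n. polynomial_growth (f' n)) \<and> (\<forall>n x. \<bar>f n x\<bar> \<le> 1) \<and> (\<forall>x. (\<lambda>n. f n x) \<longlonglongrightarrow> h x)"
proof -
  have hc: "isCont h x" for x
    using h(1) by (simp add: continuous_on_eq_continuous_at)
  have "\<exists>F. \<forall>x::real. -\<infinity> < ereal x \<longrightarrow> ereal x < \<infinity> \<longrightarrow> (F has_vector_derivative h x) (at x)"
    by (rule einterval_antiderivative) (auto intro: hc)
  then obtain F where F: "\<And>x. (F has_real_derivative h x) (at x)"
    by (auto simp: has_real_derivative_iff_has_vector_derivative)
  define d where "d n = inverse (real (Suc n))" for n
  have d0: "d n > 0" for n by (simp add: d_def)
  have dl: "d \<longlonglongrightarrow> 0" unfolding d_def[abs_def] by (rule LIMSEQ_inverse_real_of_nat)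
  define f where "f n x = (F (x + d n) - F x) / d n" for n x
  define f' where "f' n x = (h (x + d n) - h x) / d n" for n x
  \<comment> \<open>By the mean value theorem an average is a value of h at a nearby point, which
    yields both the bound 1 and the convergence.\<close>
  have "\<exists>z. x \<le> z \<and> z \<le> x + d n \<and> f n x = h z" for n x
  proof -
    obtain z where "x < z" "z < x + d n" "F (x + d n) - F x = (x + d n - x) * h z"
      using MVT2[of x "x + d n" F h] F d0[of n] by auto
    then show ?thesis using d0[of n] by (intro exI[of _ z]) (auto simp: f_def)
  qed
  then have "\<forall>n x. \<exists>z. x \<le> z \<and> z \<le> x + d n \<and> f n x = h z" by blast
  then obtain z where z: "\<And>n x. x \<le> z n x" "\<And>n x. z n x \<le> x + d n" "\<And>n x. f n x = h (z n x)"
    by (metis (no_types, lifting))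
  have 1: "(f n has_real_derivative f' n x) (at x)" for n x
    unfolding f_def[abs_def] f'_def
    by (intro DERIV_cdivide DERIV_diff F) (use DERIV_shift[of F "h (x + d n)" x "d n"] F in simp)
  have 2: "continuous_on UNIV (f' n)" for n
    unfolding f'_def[abs_def] using d0[of n]
    by (intro continuous_intros continuous_on_compose2[OF h(1)]) auto
  have "\<bar>f' n x\<bar> \<le> (2 / d n) * (1 + \<bar>x\<bar>) ^ 0" for n x
  proof -
    have "\<bar>h (x + d n) - h x\<bar> \<le> 2" using h(2)[of x] h(2)[of "x + d n"] by linarith
    then show ?thesis using d0[of n] by (simp add: f'_def abs_divide divide_right_mono)
  qed
  then have 3: "polynomial_growth (f' n)" for n by (rule polynomial_growthI)
  have 4: "(\<lambda>n. f n x) \<longlonglongrightarrow> h x" for x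
  proof -
    have "(\<lambda>n. x + d n) \<longlonglongrightarrow> x + 0" by (intro tendsto_intros dl)
    then have "(\<lambda>n. z n x) \<longlonglongrightarrow> x"
      by (intro tendsto_sandwich[OF _ _ tendsto_const[of x] , of "\<lambda>n. z n x" _ "\<lambda>n. x + d n"]) (auto intro: z always_eventually)
    from isCont_tendsto_compose[OF hc this] show ?thesis unfolding z(3) .
  qed
  have 5: "\<bar>f n x\<bar> \<le> 1" for n x unfolding z(3) by (rule h(2))
  from 1 2 3 4 5 show ?thesis by blast
qed

lemma signed_integral_density:
  assumes [measurable]: "g \<in> borel_measurable borel" "h \<in> borel_measurable borel"
    and i: "integrable lborel (\<lambda>x. g x * h x)"
  shows "signed_integral (signed_density g) h = (\<integral>x. g x * h x \<partial>lborel)"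
proof -
  have part: "(\<integral>x. h x \<partial>density lborel (\<lambda>x. ennreal (f x))) = (\<integral>x. max 0 (f x) * h x \<partial>lborel)"
    if [measurable]: "f \<in> borel_measurable borel" for f :: "real \<Rightarrow> real"
  proof -
    have "(\<integral>x. h x \<partial>density lborel (\<lambda>x. ennreal (max 0 (f x)))) = (\<integral>x. max 0 (f x) *\<^sub>R h x \<partial>lborel)"
      by (intro integral_density) auto
    then show ?thesis by (simp add: ennreal_max_0)
  qed
  have i1: "integrable lborel (\<lambda>x. max 0 (g x) * h x)" "integrable lborel (\<lambda>x. max 0 (- g x) * h x)"
    by (rule Bochner_Integration.integrable_bound[OF i]; auto simp: abs_mult intro!: mult_right_mono)+
  have "signed_integral (signed_density g) h = (\<integral>x. max 0 (g x) * h x - max 0 (- g x) * h x \<partial>lborel)"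
    unfolding signed_integral_def signed_density_def fst_conv snd_conv
    using i1 by (simp add: part)
  also have "\<dots> = (\<integral>x. g x * h x \<partial>lborel)"
    by (intro Bochner_Integration.integral_cong) (auto simp: max_def)
  finally show ?thesis .
qed

lemma signed_integral_distr:
  "X \<in> borel_measurable M \<Longrightarrow> h \<in> borel_measurable borel \<Longrightarrow>
    signed_integral (signed_of_measure (distr M borel X)) h = (\<integral>x. h (X x) \<partial>M)"
  by (simp add: signed_integral_def signed_of_measure_def integral_distr)

lemma integrable_gauss_bounded_poly:
  assumes "continuous_on UNIV h" "\<And>x. \<bar>h x\<bar> \<le> 1"
  shows "integrable gauss (\<lambda>x. h x * poly q x)"
proof (rule Bochner_Integration.integrable_bound[OF integrable_gauss_poly[of q]])
  show "(\<lambda>x. h x * poly q x) \<in> borel_measurable gauss"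
    using continuous_borel[OF continuous_on_mult[OF assms(1) continuous_on_poly[OF continuous_on_id, of UNIV q]]] by simp
  show "AE x in gauss. norm (h x * poly q x) \<le> norm (poly q x)"
    using assms(2) by (auto simp: abs_mult intro!: mult_left_le_one_le always_eventually)
qed

context prob_space
begin

lemma integral_hermite_rest:
  assumes X: "X \<in> all_moments M" and h: "continuous_on UNIV h" "\<And>x. \<bar>h x\<bar> \<le> 1"
  shows "(\<integral>x. hermite_rest R h (X x) \<partial>M) = (\<integral>x. h (X x) \<partial>M) -
    (\<Sum>k\<le>R. (\<integral>y. h y * poly (herm k) y \<partial>gauss) / fact k * (\<integral>x. poly (herm k) (X x) \<partial>M))"
proof -
  have "polynomial_growth h" by (rule polynomial_growth_bound[OF polynomial_growth_const[of 1]]) (simp add: h)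
  then have 1: "integrable M (\<lambda>x. h (X x))"
    by (intro all_moments_integrable all_moments_growth[OF X] continuous_borel h(1))
  have 2: "integrable M (\<lambda>x. poly (herm k) (X x))" for k
    by (intro all_moments_integrable all_moments_growth[OF X] continuous_borel polynomial_growth_poly continuous_on_poly continuous_on_id)
  show ?thesis unfolding hermite_rest_def using 1 2 by simp
qed

text \<open>\<open>B\<close> does not depend on the derivative of the test function, so by dominated
  convergence the bound survives pointwise limits of bounded C1 functions.\<close>

lemma hermite_rest_bound_continuous:
  assumes X: "X \<in> all_moments M" and h: "continuous_on UNIV h" "\<And>x. \<bar>h x\<bar> \<le> 1"
    and B: "\<forall>h h'. (\<forall>x. (h has_real_derivative h' x) (at x)) \<longrightarrow> continuous_on UNIV h' \<longrightarrow> polynomial_growth h' \<longrightarrow>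
      (\<forall>x. \<bar>h x\<bar> \<le> 1) \<longrightarrow> \<bar>\<integral>x. hermite_rest R h (X x) \<partial>M\<bar> \<le> B"
  shows "\<bar>\<integral>x. hermite_rest R h (X x) \<partial>M\<bar> \<le> B"
proof -
  obtain f f' where f: "\<forall>n x. (f n has_real_derivative f' n x) (at x)" "\<forall>n. continuous_on UNIV (f' n)"
    "\<forall>n. polynomial_growth (f' n)" "\<forall>n x. \<bar>f n x\<bar> \<le> 1" "\<forall>x. (\<lambda>n. f n x) \<longlonglongrightarrow> h x"
    using C1_approximation[OF h] by (elim exE conjE)
  have fc: "continuous_on UNIV (f n)" for n by (rule DERIV_continuous) (rule f(1)[rule_format])
  have [measurable]: "X \<in> borel_measurable M" "h \<in> borel_measurable borel" "f n \<in> borel_measurable borel"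
    "poly q \<in> borel_measurable borel" for n and q :: "real poly"
    by (auto intro!: continuous_borel continuous_intros h fc all_moments_measurable[OF X])
  have "(\<lambda>n. \<integral>x. f n (X x) \<partial>M) \<longlonglongrightarrow> (\<integral>x. h (X x) \<partial>M)"
    by (rule integral_dominated_convergence[where w = "\<lambda>_. 1"]) (use f(4,5) in auto)
  moreover have "(\<lambda>n. \<integral>y. f n y * poly q y \<partial>gauss) \<longlonglongrightarrow> (\<integral>y. h y * poly q y \<partial>gauss)" for q
  proof (rule integral_dominated_convergence[where w = "\<lambda>y. \<bar>poly q y\<bar>"])
    show "AE x in gauss. (\<lambda>n. f n x * poly q x) \<longlonglongrightarrow> h x * poly q x"
      using f(5) by (intro always_eventually allI tendsto_mult tendsto_const) auto
    show "AE x in gauss. norm (f n x * poly q x) \<le> \<bar>poly q x\<bar>" for n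
      using f(4) by (auto simp: abs_mult intro!: mult_left_le_one_le always_eventually)
  qed (use integrable_gauss_poly[of q] in auto)
  ultimately have "(\<lambda>n. \<integral>x. hermite_rest R (f n) (X x) \<partial>M) \<longlonglongrightarrow> (\<integral>x. hermite_rest R h (X x) \<partial>M)"
    unfolding integral_hermite_rest[OF X h] integral_hermite_rest[OF X fc f(4)[rule_format]]
    by (intro tendsto_intros) auto
  then have "(\<lambda>n. \<bar>\<integral>x. hermite_rest R (f n) (X x) \<partial>M\<bar>) \<longlonglongrightarrow> \<bar>\<integral>x. hermite_rest R h (X x) \<partial>M\<bar>"
    by (rule tendsto_rabs)
  moreover have "\<bar>\<integral>x. hermite_rest R (f n) (X x) \<partial>M\<bar> \<le> B" for n
    by (rule B[rule_format, of "f n" "f' n"]) (use f in auto)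
  ultimately show ?thesis
    by (intro tendsto_upperbound[where F = sequentially]) auto
qed

end

section \<open>The Edgeworth measure and the conclusion\<close>

context markov_diffusion
begin

text \<open>The reason why the sum in the density starts at k = 3: mean 0 and variance 1 of X cancel
  the terms k = 1 and k = 2, and the term k = 0 is the constant 1.\<close>

lemma low_hermite_means:
  assumes X: "X \<in> E p" "l2 M X = 1" and p: "p \<ge> 1"
  shows "(\<integral>x. poly (herm 0) (X x) \<partial>M) = 1" "(\<integral>x. poly (herm 1) (X x) \<partial>M) = 0"
    "(\<integral>x. poly (herm 2) (X x) \<partial>M) = 0"
proof -
  have XD: "X \<in> D" using X(1) by (rule E_D)
  show "(\<integral>x. poly (herm 0) (X x) \<partial>M) = 1" by (simp add: prob_space)
  have "0 = (\<integral>x. L X x \<partial>M)" using L_integral[OF XD] by simp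
  also have "\<dots> = (\<integral>x. - lam p * X x \<partial>M)"
    by (rule integral_cong_AE) (use E_eigen[OF X(1)] L_measurable[OF XD] D_measurable[OF XD] in auto)
  finally have "(\<integral>x. X x \<partial>M) = 0" using lam_pos[OF p] by simp
  then show "(\<integral>x. poly (herm 1) (X x) \<partial>M) = 0" by simp
  have X2: "(\<integral>x. (X x)\<^sup>2 \<partial>M) = 1" using l2_sq[of M X] X(2) by simp
  have i2: "integrable M (\<lambda>x. (X x)\<^sup>2)" by (intro L2_integrable_sq D_L2' XD)
  have "(\<integral>x. poly (herm 2) (X x) \<partial>M) = (\<integral>x. (X x)\<^sup>2 - 1 \<partial>M)"
    by (intro Bochner_Integration.integral_cong) (simp_all add: numeral_2_eq_2 power2_eq_square pderiv_pCons)
  also have "\<dots> = 0" using i2 X2 by (simp add: prob_space)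
  finally show "(\<integral>x. poly (herm 2) (X x) \<partial>M) = 0" .
qed

text \<open>The Hermite coefficient of h and the Hermite mean of X enter each term symmetrically, so
  the integral of h against the density is the expectation at X of the truncated Hermite expansion
  of h.\<close>

lemma signed_integral_edgeworth:
  assumes X: "X \<in> E p" "l2 M X = 1" and p: "p \<ge> 1" and m: "m \<ge> 1"
    and h: "continuous_on UNIV h" "\<And>x. \<bar>h x\<bar> \<le> 1"
  shows "signed_integral (signed_of_measure (distr M borel X)) h - signed_integral (edgeworth_measure M lam p m X) h =
    (\<integral>x. hermite_rest (r_tilde lam p m + 1) h (X x) \<partial>M)"
proof -
  define R where "R = r_tilde lam p m + 1"
  have R2: "R \<ge> 2" using m by (simp add: R_def r_tilde_def)
  let ?e = "\<lambda>k. \<integral>x. poly (herm k) (X x) \<partial>M"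
  let ?a = "\<lambda>k. \<integral>y. h y * poly (herm k) y \<partial>gauss"
  have [measurable]: "h \<in> borel_measurable borel" "poly q \<in> borel_measurable borel" for q :: "real poly"
    by (intro continuous_borel continuous_intros h)+
  have g: "exp (- x\<^sup>2 / 2) / sqrt (2 * pi) * (1 + (\<Sum>k = 3..R. (\<integral>y. hermite k (X y) \<partial>M) / fact k * hermite k x)) =
      std_normal_density x * poly (1 + (\<Sum>k = 3..R. smult (?e k / fact k) (herm k))) x" for x
    by (simp add: std_normal_density_def hermite_poly poly_sum)
  let ?q = "1 + (\<Sum>k = 3..R. smult (?e k / fact k) (herm k))"
  have i: "integrable lborel (\<lambda>x. std_normal_density x * (h x * poly ?q x))"
    using integrable_gauss_bounded_poly[OF h, of ?q] by (subst (asm) integrable_gauss) auto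
  have "signed_integral (edgeworth_measure M lam p m X) h =
      (\<integral>x. std_normal_density x * poly ?q x * h x \<partial>lborel)"
    unfolding edgeworth_measure_def R_def[symmetric] g
    by (rule signed_integral_density) (use i in \<open>auto simp: mult_ac\<close>)
  also have "\<dots> = (\<integral>x. h x * poly ?q x \<partial>gauss)"
    by (subst integral_gauss) (auto simp: mult_ac)
  also have "\<dots> = (\<integral>x. h x * poly (herm 0) x + (\<Sum>k = 3..R. ?e k / fact k * (h x * poly (herm k) x)) \<partial>gauss)"
    by (intro Bochner_Integration.integral_cong) (auto simp: poly_sum distrib_left sum_distrib_left mult_ac)
  also have "\<dots> = ?a 0 + (\<Sum>k = 3..R. ?e k / fact k * ?a k)"
  proof -
    have "integrable gauss (\<lambda>x. \<Sum>k = 3..R. ?e k / fact k * (h x * poly (herm k) x))"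
      by (intro Bochner_Integration.integrable_sum integrable_mult_right integrable_gauss_bounded_poly h)
    then show ?thesis
      using integrable_gauss_bounded_poly[OF h]
      by (simp del: herm.simps add: Bochner_Integration.integral_add)
  qed
  also have "\<dots> = (\<Sum>k\<le>R. ?a k / fact k * ?e k)"
  proof -
    have "{..R} = {0, 1, 2} \<union> {3..R}" using R2 by auto
    then have "(\<Sum>k\<le>R. ?a k / fact k * ?e k) = (\<Sum>k\<in>{0, 1, 2}. ?a k / fact k * ?e k) + (\<Sum>k = 3..R. ?a k / fact k * ?e k)"
      by (simp only:) (rule sum.union_disjoint, auto)
    also have "(\<Sum>k\<in>{0, 1, 2}. ?a k / fact k * ?e k) = ?a 0"
      using low_hermite_means[OF X p] by (simp del: herm.simps One_nat_def)
    finally show ?thesis by (simp add: mult_ac)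
  qed
  finally show ?thesis
    unfolding R_def[symmetric]
    using signed_integral_distr[of X M h] D_measurable[OF E_D[OF X(1)]]
      integral_hermite_rest[OF D_all_moments[OF E_D[OF X(1)]] h, of R] by simp
qed

lemma hermite_rest_bound_W:
  assumes p: "p \<ge> 1" and m: "m \<ge> 1"
  shows "\<exists>C\<ge>0. \<forall>X\<in>E p. l2 M X = 1 \<longrightarrow> (\<forall>h h'. (\<forall>x. (h has_real_derivative h' x) (at x)) \<longrightarrow> continuous_on UNIV h' \<longrightarrow>
    polynomial_growth h' \<longrightarrow> (\<forall>x. \<bar>h x\<bar> \<le> 1) \<longrightarrow>
    \<bar>\<integral>x. hermite_rest (r_tilde lam p m + 1) h (X x) \<partial>M\<bar> \<le> C * (l2 M (W p X)) ^ (m + 1))"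
  using spectral_dichotomy[OF p]
proof
  assume d: "lam (2 * p) = 2 * lam p"
  show ?thesis
  proof (rule hermite_rest_bound[OF p])
    show "W p X \<in> A (2 * p - 1)" if "X \<in> E p" for X by (rule W_A_sharp[OF p d that])
    fix j assume j: "j < m + 1"
    \<comment> \<open>The worst step is j = m. The remainder is orthogonal to degrees below
      floor(?x) + 2 m + 1, which exceeds ?x + 2 j because ?x < floor(?x) + 1.\<close>
    let ?x = "lam ((2 * p - 1) * m) / lam p"
    have "lam ((2 * p - 1) * j) / lam p \<le> ?x"
      using j lam_pos[OF p] by (intro divide_right_mono lam_mono mult_le_mono) auto
    moreover have "?x < real (nat \<lfloor>?x\<rfloor>) + 1"
      using lam_nonneg lam_pos[OF p] by (simp add: of_nat_nat)
    moreover have "real (Suc (r_tilde lam p m + 1)) = real (nat \<lfloor>?x\<rfloor>) + 2 * real m + 1"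
      using m by (simp add: r_tilde_def of_nat_diff)
    ultimately show "lam ((2 * p - 1) * j) / lam p + 2 * real j < real (Suc (r_tilde lam p m + 1))"
      using j by simp
  qed
next
  assume "\<exists>\<epsilon>>0. \<forall>X\<in>E p. l2 M X = 1 \<longrightarrow> \<epsilon> \<le> l2 M (W p X)"
  then obtain \<epsilon> where \<epsilon>: "\<epsilon> > 0" "\<forall>X\<in>E p. l2 M X = 1 \<longrightarrow> \<epsilon> \<le> l2 M (W p X)" by blast
  have "\<exists>C\<ge>0. \<forall>X\<in>E p. l2 M X = 1 \<longrightarrow> (\<forall>h h'. (\<forall>x. (h has_real_derivative h' x) (at x)) \<longrightarrow> continuous_on UNIV h' \<longrightarrow>
    polynomial_growth h' \<longrightarrow> (\<forall>x. \<bar>h x\<bar> \<le> 1) \<longrightarrow>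
    \<bar>\<integral>x. hermite_rest (r_tilde lam p m + 1) h (X x) \<partial>M\<bar> \<le> C * (l2 M (W p X)) ^ 0)"
    by (rule hermite_rest_bound[OF p W_A]; simp)
  then obtain C where C: "C \<ge> 0" "\<forall>X\<in>E p. l2 M X = 1 \<longrightarrow> (\<forall>h h'. (\<forall>x. (h has_real_derivative h' x) (at x)) \<longrightarrow> continuous_on UNIV h' \<longrightarrow>
    polynomial_growth h' \<longrightarrow> (\<forall>x. \<bar>h x\<bar> \<le> 1) \<longrightarrow>
    \<bar>\<integral>x. hermite_rest (r_tilde lam p m + 1) h (X x) \<partial>M\<bar> \<le> C * (l2 M (W p X)) ^ 0)" by (elim exE conjE)
  \<comment> \<open>The lower bound \<epsilon> for the norm of W turns the bare constant into the
    required power of that norm.\<close>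
  have le: "C * (l2 M (W p X)) ^ 0 \<le> C / \<epsilon> ^ (m + 1) * (l2 M (W p X)) ^ (m + 1)" if "X \<in> E p" "l2 M X = 1" for X
  proof -
    have "\<epsilon> ^ (m + 1) \<le> (l2 M (W p X)) ^ (m + 1)"
      using \<epsilon> that by (intro power_mono) auto
    then have "1 \<le> (l2 M (W p X)) ^ (m + 1) / \<epsilon> ^ (m + 1)"
      using \<epsilon>(1) by (simp add: le_divide_eq_1_pos del: power_Suc)
    from mult_left_mono[OF this C(1)] show ?thesis by simp
  qed
  show ?thesis
  proof (intro exI[of _ "C / \<epsilon> ^ (m + 1)"] conjI ballI impI allI)
    show "0 \<le> C / \<epsilon> ^ (m + 1)" using C(1) \<epsilon>(1) by simp
  qed (rule order_trans[OF C(2)[rule_format] le], auto)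
qed

lemma d_TV_edgeworth:
  assumes p: "p \<ge> 1" and m: "m \<ge> 1"
  shows "\<exists>C>0. \<forall>X\<in>E p. (\<integral>x. (X x)\<^sup>2 \<partial>M) = 1 \<longrightarrow>
    d_TV (signed_of_measure (distr M borel X)) (edgeworth_measure M lam p m X) \<le> C * (variance (\<Gamma> X X)) powr ((real m + 1) / 2)"
proof -
  obtain C where C: "C \<ge> 0" "\<forall>X\<in>E p. l2 M X = 1 \<longrightarrow> (\<forall>h h'. (\<forall>x. (h has_real_derivative h' x) (at x)) \<longrightarrow> continuous_on UNIV h' \<longrightarrow>
    polynomial_growth h' \<longrightarrow> (\<forall>x. \<bar>h x\<bar> \<le> 1) \<longrightarrow>
    \<bar>\<integral>x. hermite_rest (r_tilde lam p m + 1) h (X x) \<partial>M\<bar> \<le> C * (l2 M (W p X)) ^ (m + 1))"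
    using hermite_rest_bound_W[OF p m] by (elim exE conjE)
  have lp: "lam p > 0" by (rule lam_pos[OF p])
  \<comment> \<open>lam p times the norm of W is the standard deviation of \<Gamma>(X, X), hence the
    division; the summand 1 makes the constant positive even if \<open>C = 0\<close>.\<close>
  let ?C = "C / lam p ^ (m + 1) + 1"
  have "d_TV (signed_of_measure (distr M borel X)) (edgeworth_measure M lam p m X) \<le> ?C * (variance (\<Gamma> X X)) powr ((real m + 1) / 2)"
    if X: "X \<in> E p" and X2: "(\<integral>x. (X x)\<^sup>2 \<partial>M) = 1" for X
  proof -
    have l: "l2 M X = 1" using X2 l2_sq[of M X] l2_nonneg[of M X] by (simp add: power2_eq_1_iff)
    let ?w = "l2 M (W p X)"
    \<comment> \<open>The exponent (m + 1) / 2 need not be an integer, hence \<open>powr\<close>; at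
      variance 0 both sides are 0.\<close>
    have v: "(variance (\<Gamma> X X)) powr ((real m + 1) / 2) = (lam p * ?w) ^ (m + 1)"
    proof -
      have "(y\<^sup>2) powr ((real m + 1) / 2) = y ^ (m + 1)" if "y \<ge> 0" for y :: real
      proof (cases "y = 0")
        case False
        then have "y > 0" using that by simp
        then have "y\<^sup>2 = y powr 2" "y ^ (m + 1) = y powr (real m + 1)"
          using powr_realpow[of y "m + 1"] by (simp_all add: add.commute)
        moreover have "2 * ((real m + 1) / 2) = real m + 1" by simp
        ultimately show ?thesis by (simp only: powr_powr)
      qed simp
      then show ?thesis using lp unfolding variance_\<Gamma>[OF X l p] by simp
    qed
    have "(SUP h \<in> {h :: real \<Rightarrow> real. continuous_on UNIV h \<and> (\<forall>x. \<bar>h x\<bar> \<le> 1)}.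
        \<bar>signed_integral (signed_of_measure (distr M borel X)) h - signed_integral (edgeworth_measure M lam p m X) h\<bar>) \<le> C * ?w ^ (m + 1)"
    proof (rule cSUP_least)
      have "(\<lambda>x. 0) \<in> {h :: real \<Rightarrow> real. continuous_on UNIV h \<and> (\<forall>x. \<bar>h x\<bar> \<le> 1)}" by simp
      then show "{h :: real \<Rightarrow> real. continuous_on UNIV h \<and> (\<forall>x. \<bar>h x\<bar> \<le> 1)} \<noteq> {}" by blast
      fix h :: "real \<Rightarrow> real" assume "h \<in> {h. continuous_on UNIV h \<and> (\<forall>x. \<bar>h x\<bar> \<le> 1)}"
      then have h: "continuous_on UNIV h" "\<And>x. \<bar>h x\<bar> \<le> 1" by auto
      show "\<bar>signed_integral (signed_of_measure (distr M borel X)) h - signed_integral (edgeworth_measure M lam p m X) h\<bar> \<le> C * ?w ^ (m + 1)"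
        unfolding signed_integral_edgeworth[OF X l p m h]
        by (rule hermite_rest_bound_continuous[OF D_all_moments[OF E_D[OF X]] h C(2)[THEN bspec, OF X, THEN mp, OF l]])
    qed
    then have "d_TV (signed_of_measure (distr M borel X)) (edgeworth_measure M lam p m X) \<le> 1 / 2 * (C * ?w ^ (m + 1))"
      unfolding d_TV_def by (rule mult_left_mono) simp
    also have "\<dots> \<le> C * ?w ^ (m + 1)" using C(1) by simp
    also have "\<dots> = C / lam p ^ (m + 1) * (lam p * ?w) ^ (m + 1)"
      using lp by (simp only: power_mult_distrib) simp
    also have "\<dots> \<le> ?C * (lam p * ?w) ^ (m + 1)"
      using lp by (intro mult_right_mono) auto
    finally show ?thesis unfolding v .
  qed
  moreover have "?C > 0" using C(1) lp by (intro add_nonneg_pos divide_nonneg_pos) auto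
  ultimately show ?thesis by blast
qed

end

theorem theorem7p2:
  fixes M :: "'a measure" and D :: "('a \<Rightarrow> real) set" and L :: "('a \<Rightarrow> real) \<Rightarrow> 'a \<Rightarrow> real"
    and lam :: "nat \<Rightarrow> real" and p m :: nat
  assumes "symmetric_markov_operator M D L"
    and "diffusion_property M D L"
    and "diagonalisable M D L lam"
    and "product_stable M D L lam"
    and "p \<ge> 1" and "m \<ge> 1"
  shows "\<exists>C>0. \<forall>X \<in> ker_shift M D L (lam p). (\<integral>x. (X x)\<^sup>2 \<partial>M) = 1 \<longrightarrow>
    d_TV (signed_of_measure (distr M borel X)) (edgeworth_measure M lam p m X)
      \<le> C * (prob_space.variance M (carre_du_champ L X X)) powr ((real m + 1) / 2)"
  by (rule markov_diffusion.d_TV_edgeworth[OF markov_diffusionI[OF assms(1-4)] assms(5,6)])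

end
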